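(* Let $k$ be a commutative ring, and let $(A,1,\overline\mu_A+h_A+\mu_{\mathrm{su}})$ and $(B,1,\overline\mu_B+h_B+\mu_{\mathrm{su}})$ be $A_\infty$-algebras with split units. Let $g+g_{\mathrm{su}}\in CC^\bullet(A,B)_0$ be a strictly unital element (strictly unital elements between modules with split elements being assumed to preserve the fixed splittings), with $$g=\overline g+a\in CC^\bullet(\overline A,\overline B)\oplus CC^\bullet(\overline A,k)=CC^\bullet(\overline A,B).$$ Then $g+g_{\mathrm{su}}$ is a morphism of $A_\infty$-algebras if and only if $$(\Psi^{-1}(\overline g),\,-s^{-1}a):\ \mathrm{Bar}\,\overline A\to\mathrm{Bar}\,\overline B$$ is a morphism of the corresponding curved dg-coalgebras. This is equivalent to the following two equations holding for all $n\geq 1$ on $(\Pi\overline A)^{\otimes n}$: $$(\overline\mu_B*\overline g)^n-(\overline g\circ\overline\mu_A)^n+\sum_{p+q=n}\mu^2_{\mathrm{su}}(\overline g^{\,p}\otimes a^q)+\sum_{p+q=n}\mu^2_{\mathrm{su}}(a^p\otimes\overline g^{\,q})=0,$$ $$(h_B*\overline g)^n-(a\circ\overline\mu_A)^n-h_A^n+\sum_{p+q=n}\mu^2_{\mathrm{su}}(a^p\otimes a^q)=0,$$ where $p,q\ge1$ in the sums.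
   Context: Conventions: modules, maps, tensor products are over $k$; graded means $\mathbb Z$-graded. $\mathrm{Hom}(M,N)_n=\prod_i\mathrm{Hom}(M_i,N_{i+n})$. $(\Pi M)_n=M_{n-1}$, $s:M\to\Pi M$ is the degree $1$ identity map, $[x]=s(x)$, $[x_1|\dots|x_n]=[x_1]\otimes\dots\otimes[x_n]$. Sign rule: $(f\otimes g)(x\otimes y)=(-1)^{|g||x|}f(x)\otimes g(y)$. $CC^n(A,B)=\mathrm{Hom}((\Pi A)^{\otimes n},\Pi B)$, $CC^\bullet(A,B)=\prod_{n\ge1}CC^n(A,B)$, $f=(f^n)$; $CC^\bullet(A,B)_i$ is the degree $i$ part. Gerstenhaber product of $g\in CC^\bullet(A,B)$ and $f\in CC^\bullet(A,A)$: $(g\circ f)^n=\sum_{i=1}^n\sum_{j=0}^{i-1}g^i(1^{\otimes j}\otimes f^{n-i+1}\otimes1^{\otimes i-j-1})$. For $f\in CC^\bullet(B,B')$, $g\in CC^\bullet(A,B)_0$: $(f*g)^n=\sum_{i_1+\dots+i_m=n}f^m(g^{i_1}\otimes\dots\otimes g^{i_m})$ (all $m\ge1$, $i_j\ge1$). An $A_\infty$-algebra structure on $A$ is $\nu\in CC^\bullet(A,A)_{-1}$ with $\nu\circ\nu=0$; an $A_\infty$-morphism $(A,\nu_A)\to(B,\nu_B)$ is $g\in CC^\bullet(A,B)_0$ with $\nu_B*g=g\circ\nu_A$. A graded module with split element is a pair $(A,1)$, where $1\in A_0$ generates a free rank one submodule, together with a fixed splitting $A\to k$ of the inclusion $k\to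 A$, $1\mapsto 1$. Put $\overline A=A/(k\cdot1)$, considered as a submodule of $A$ via the splitting, so $A=\overline A\oplus k$. $CC^\bullet(\overline A,B)$ is a submodule of $CC^\bullet(A,B)$ via $A\to\overline A$ (extension by zero to tensors with an entry $[1]$). $\mu_{\mathrm{su}}\in CC^\bullet(A,A)_{-1}$ (and likewise for $B$) has $\mu_{\mathrm{su}}^n=0$ for $n\ne2$, $\mu_{\mathrm{su}}^2[1|a]=[a]$, $\mu_{\mathrm{su}}^2[a|1]=(-1)^{|a|}[a]$ for $a\in A$, $\mu_{\mathrm{su}}^2=0$ on $\Pi\overline A\otimes\Pi\overline A$. $\nu\in CC^\bullet(A,A)_{-1}$ is strictly unital if $\nu^2[1|a]=[a]=(-1)^{|a|}\nu^2[a|1]$ and $\nu^n$, $n\ne2$, vanishes whenever an entry is $1$; such elements are exactly $\overline\mu+h+\mu_{\mathrm{su}}$ with $\overline\mu\in CC^\bullet(\overline A,\overline A)_{-1}$, $h\in CC^\bullet(\overline A,k)_{-1}$. An $A_\infty$-algebra with split unit $(A,1,\nu)$ is a module with split element with a strictly unital $A_\infty$-structure $\nu$. $f\in CC^\bullet(A,B)_0$ is strictly unital if $f^1[1]=[1]$ and $f^n$, $n\ge2$, vanishes whenever an entry is $1$; when $(A,1)$ and $(B,1)$ are modules with split elements, strictly unital elements of $CC^\bullet(A,B)_0$ are assumed to preserve the fixed splittings. Every strictly unital element is of the form $g+g_{\mathrm{su}}$ for a unique $g\in CC^\bullet(\overline A,B)_0$, where $g_{\mathrm{su}}^1$ is the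 composite $\Pi A\to\Pi k\to\Pi B$ (splitting, then $[1]\mapsto[1]$) and $g_{\mathrm{su}}^n=0$ for $n\ge2$. $T_{\mathsf{co}}(V)=\bigoplus_{n\ge1}V^{\otimes n}$ has comultiplication $\Delta(v_1\otimes\dots\otimes v_n)=\sum_{i=1}^{n-1}(v_1\otimes\dots\otimes v_i)\otimes(v_{i+1}\otimes\dots\otimes v_n)$. For $f\in CC^\bullet(\overline A,\overline A)$, $\Phi^{-1}(f)$ is the coderivation of $T_{\mathsf{co}}(\Pi\overline A)$ given on $(\Pi\overline A)^{\otimes n}$ by $\sum_{i,j}1^{\otimes j}\otimes f^i\otimes1^{\otimes n-i-j}$. For $\overline g\in CC^\bullet(\overline A,\overline B)_0$, $\Psi^{-1}(\overline g):T_{\mathsf{co}}(\Pi\overline A)\to T_{\mathsf{co}}(\Pi\overline B)$ is the graded coalgebra morphism whose component $(\Pi\overline A)^{\otimes n}\to(\Pi\overline B)^{\otimes m}$ is $\sum_{i_1+\dots+i_m=n}\overline g^{\,i_1}\otimes\dots\otimes\overline g^{\,i_m}$. The map $-s^{-1}a:T_{\mathsf{co}}(\Pi\overline A)\to k$ is $a$ followed by $-s^{-1}:\Pi k\to k$ (degree $-1$). For homogeneous $\xi:C\to k$, $\mathrm{ad}(\xi)=(\xi\otimes1)\Delta-(1\otimes\xi)\Delta:C\to C$ (identifying $k\otimes C\cong C\cong C\otimes k$). A curved dg-coalgebra is $(C,d,\xi)$ with $d$ a degree $-1$ coderivation and $\xi:C\to k$ of degree $-2$ such that $d^2=\mathrm{ad}(\xi)$,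 $\xi d=0$. The curved bar construction of $(A,1,\overline\mu+h+\mu_{\mathrm{su}})$ is the curved dg-coalgebra $\mathrm{Bar}\,\overline A=(T_{\mathsf{co}}(\Pi\overline A),\Phi^{-1}(\overline\mu),-s^{-1}h)$. A morphism of curved dg-coalgebras $(C,d_C,\xi_C)\to(D,d_D,\xi_D)$ is a pair $(\gamma,\alpha)$ with $\gamma:C\to D$ a graded coalgebra morphism and $\alpha:C\to k$ a degree $-1$ linear map with $d_D\gamma=\gamma d_C+\gamma\,\mathrm{ad}(\alpha)$ and $\xi_D\gamma-\alpha^2=\alpha d_C+\xi_C$, where $\alpha^2$ is the composite $C\xrightarrow{\Delta}C\otimes C\xrightarrow{\alpha\otimes\alpha}k\otimes k\cong k$.
   Formalization: In the definition of a morphism of curved dg-coalgebras, α² is taken without the Koszul sign, as the sum of α(c′)α(c″) over Δc; with the stated sign rule applied to α⊗α, α² would change sign and the claimed equivalence would fail. *)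

theory Defs
  imports "HOL-Algebra.Module" "HOL-Algebra.AbelCoset"
begin

section \<open>Graded modules\<close>

text \<open>
  A graded module is rendered internally, as a module with a family of submodules of which it is
  the direct sum.  A homogeneous map of degree \<open>d\<close> is then a linear map shifting the grading by
  \<open>d\<close>, that is, an element of the product over \<open>i\<close> of \<open>Hom(M\<^sub>i, N\<^sub>i\<^sub>+\<^sub>d)\<close>.  The ring
  multiplication and unit that every module record carries are never used.
\<close>

record ('k, 'a) gmodule = "('k, 'a) module" +
  grade :: "int \<Rightarrow> 'a set"

definition decomposition :: "('k, 'a, 'z) gmodule_scheme \<Rightarrow> (int \<Rightarrow> 'a) \<Rightarrow> 'a \<Rightarrow> bool" where
  "decomposition M c x \<longleftrightarrow>
     (\<forall>i. c i \<in> grade M i) \<and> finite {i. c i \<noteq> \<zero>\<^bsub>M\<^esub>} \<and>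
     x = (\<Oplus>\<^bsub>M\<^esub> i \<in> {i. c i \<noteq> \<zero>\<^bsub>M\<^esub>}. c i)"

definition graded_module :: "'k ring \<Rightarrow> ('k, 'a, 'z) gmodule_scheme \<Rightarrow> bool" where
  "graded_module R M \<longleftrightarrow>
     module R M \<and> (\<forall>i. submodule (grade M i) R M) \<and>
     (\<forall>x \<in> carrier M. \<exists>!c. decomposition M c x)"

definition linear_maps ::
  "'k ring \<Rightarrow> ('k, 'a, 'y) module_scheme \<Rightarrow> ('k, 'b, 'z) module_scheme \<Rightarrow> ('a \<Rightarrow> 'b) set" where
  "linear_maps R M N = {f. f \<in> carrier M \<rightarrow> carrier N \<and>
     (\<forall>x \<in> carrier M. \<forall>y \<in> carrier M. f (x \<oplus>\<^bsub>M\<^esub> y) = f x \<oplus>\<^bsub>N\<^esub> f y) \<and>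
     (\<forall>r \<in> carrier R. \<forall>x \<in> carrier M. f (r \<odot>\<^bsub>M\<^esub> x) = r \<odot>\<^bsub>N\<^esub> f x)}"

definition graded_hom ::
  "'k ring \<Rightarrow> ('k, 'a, 'y) gmodule_scheme \<Rightarrow> ('k, 'b, 'z) gmodule_scheme \<Rightarrow> int \<Rightarrow> ('a \<Rightarrow> 'b) set"
  where
  "graded_hom R M N d = {f \<in> linear_maps R M N. \<forall>i. f ` grade M i \<subseteq> grade N (i + d)}"

definition ground :: "'k ring \<Rightarrow> ('k, 'k) gmodule" where
  "ground R = \<lparr>carrier = carrier R, mult = mult R, one = one R, zero = zero R, add = add R,
     smult = mult R, grade = (\<lambda>i. if i = 0 then carrier R else {\<zero>\<^bsub>R\<^esub>})\<rparr>"

text \<open>The suspension has the same elements as \<open>M\<close>, so \<open>s\<close> is the identity and \<open>[x]\<close> is \<open>x\<close>.\<close>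

definition susp :: "('k, 'a, 'z) gmodule_scheme \<Rightarrow> ('k, 'a, 'z) gmodule_scheme" where
  "susp M = M\<lparr>grade := (\<lambda>n. grade M (n - 1))\<rparr>"

text \<open>
  The Koszul sign: for homogeneous \<open>x\<close> of degree \<open>i\<close>, \<open>koszul M d x\<close> is \<open>(-1)\<^sup>d\<^sup>i x\<close>,
  extended additively to all of \<open>M\<close>.
\<close>

definition koszul :: "('k, 'a, 'z) gmodule_scheme \<Rightarrow> int \<Rightarrow> 'a \<Rightarrow> 'a" where
  "koszul M d x = (THE y. \<exists>c. decomposition M c x \<and>
     y = (\<Oplus>\<^bsub>M\<^esub> i \<in> {i. c i \<noteq> \<zero>\<^bsub>M\<^esub>}. if even (d * i) then c i else \<ominus>\<^bsub>M\<^esub> c i))"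


section \<open>Tensor powers\<close>

text \<open>
  The \<open>n\<close>-th tensor power of \<open>V\<close> is the free module on the lists of length \<open>n\<close> over \<open>V\<close>, modulo
  the submodule generated by the multilinearity relations.  Its elements are cosets of finitely
  supported coefficient functions.
\<close>

definition generated_submodule ::
  "'k ring \<Rightarrow> ('k, 'a, 'z) module_scheme \<Rightarrow> 'a set \<Rightarrow> 'a set" where
  "generated_submodule R M S = \<Inter> {H. submodule H R M \<and> S \<subseteq> H}"

definition free_power ::
  "'k ring \<Rightarrow> ('k, 'a, 'z) module_scheme \<Rightarrow> nat \<Rightarrow> ('k, 'a list \<Rightarrow> 'k) module" where
  "free_power R V n =
     \<lparr>carrier = {c. (\<forall>l. c l \<in> carrier R) \<and> finite {l. c l \<noteq> \<zero>\<^bsub>R\<^esub>} \<and>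
        (\<forall>l. c l \<noteq> \<zero>\<^bsub>R\<^esub> \<longrightarrow> length l = n \<and> set l \<subseteq> carrier V)},
      mult = undefined, one = undefined,
      zero = (\<lambda>l. \<zero>\<^bsub>R\<^esub>), add = (\<lambda>c c' l. c l \<oplus>\<^bsub>R\<^esub> c' l), smult = (\<lambda>r c l. r \<otimes>\<^bsub>R\<^esub> c l)\<rparr>"

definition single :: "'k ring \<Rightarrow> 'a list \<Rightarrow> 'a list \<Rightarrow> 'k" where
  "single R xs = (\<lambda>l. if l = xs then \<one>\<^bsub>R\<^esub> else \<zero>\<^bsub>R\<^esub>)"

definition tensor_relations ::
  "'k ring \<Rightarrow> ('k, 'a, 'z) module_scheme \<Rightarrow> nat \<Rightarrow> ('a list \<Rightarrow> 'k) set" where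
  "tensor_relations R V n = generated_submodule R (free_power R V n)
     ({single R (us @ [x \<oplus>\<^bsub>V\<^esub> y] @ vs)
         \<ominus>\<^bsub>free_power R V n\<^esub> single R (us @ [x] @ vs)
         \<ominus>\<^bsub>free_power R V n\<^esub> single R (us @ [y] @ vs) | us x y vs.
         length us + 1 + length vs = n \<and>
         set us \<subseteq> carrier V \<and> set vs \<subseteq> carrier V \<and> x \<in> carrier V \<and> y \<in> carrier V}
      \<union> {single R (us @ [r \<odot>\<^bsub>V\<^esub> x] @ vs)
         \<ominus>\<^bsub>free_power R V n\<^esub> r \<odot>\<^bsub>free_power R V n\<^esub> single R (us @ [x] @ vs) | us r x vs.
         length us + 1 + length vs = n \<and>
         set us \<subseteq> carrier V \<and> set vs \<subseteq> carrier V \<and> r \<in> carrier R \<and> x \<in> carrier V})"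

definition quotient_module ::
  "('k, 'c) module \<Rightarrow> 'c set \<Rightarrow> ('k, 'c set) module" where
  "quotient_module F N =
     \<lparr>carrier = a_rcosets\<^bsub>F\<^esub> N, mult = undefined, one = undefined, zero = N,
      add = (\<lambda>X Y. X <+>\<^bsub>F\<^esub> Y),
      smult = (\<lambda>r X. {r \<odot>\<^bsub>F\<^esub> x \<oplus>\<^bsub>F\<^esub> n | x n. x \<in> X \<and> n \<in> N})\<rparr>"

text \<open>The pure tensor of the entries of a list.\<close>

definition tensor ::
  "'k ring \<Rightarrow> ('k, 'a, 'z) module_scheme \<Rightarrow> 'a list \<Rightarrow> ('a list \<Rightarrow> 'k) set" where
  "tensor R V xs =
     tensor_relations R V (length xs) +>\<^bsub>free_power R V (length xs)\<^esub> single R xs"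

definition tensor_power ::
  "'k ring \<Rightarrow> ('k, 'a, 'z) gmodule_scheme \<Rightarrow> nat \<Rightarrow> ('k, ('a list \<Rightarrow> 'k) set) gmodule" where
  "tensor_power R V n =
     (let Q = quotient_module (free_power R V n) (tensor_relations R V n) in
      \<lparr>carrier = carrier Q, mult = mult Q, one = one Q, zero = zero Q, add = add Q,
       smult = smult Q,
       grade = (\<lambda>d. generated_submodule R Q
         {tensor R V xs | xs ds. length xs = n \<and> list_all2 (\<lambda>x i. x \<in> grade V i) xs ds \<and>
            sum_list ds = d})\<rparr>)"

text \<open>
  The linear map on the \<open>n\<close>-th tensor power induced by a multilinear \<open>\<phi>\<close> (given on lists of
  length \<open>n\<close>), computed on an arbitrary representative.
\<close>

definition tensor_lift ::
  "'k ring \<Rightarrow> ('k, 'b, 'z) module_scheme \<Rightarrow> ('a list \<Rightarrow> 'b) \<Rightarrow> ('a list \<Rightarrow> 'k) set \<Rightarrow> 'b" where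
  "tensor_lift R M \<phi> X =
     (let c = (SOME c. c \<in> X) in \<Oplus>\<^bsub>M\<^esub> l \<in> {l. c l \<noteq> \<zero>\<^bsub>R\<^esub>}. c l \<odot>\<^bsub>M\<^esub> \<phi> l)"

text \<open>The identification of the first tensor power with \<open>V\<close>.\<close>

definition untensor ::
  "'k ring \<Rightarrow> ('k, 'a, 'z) module_scheme \<Rightarrow> ('a list \<Rightarrow> 'k) set \<Rightarrow> 'a" where
  "untensor R V = tensor_lift R V hd"

text \<open>The identification of the product of the \<open>p\<close>-th and \<open>q\<close>-th tensor power with the
  \<open>(p + q)\<close>-th one, as a bilinear operation.\<close>

definition tensor_append ::
  "'k ring \<Rightarrow> ('k, 'a, 'z) gmodule_scheme \<Rightarrow> nat \<Rightarrow> nat \<Rightarrow>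
   ('a list \<Rightarrow> 'k) set \<Rightarrow> ('a list \<Rightarrow> 'k) set \<Rightarrow> ('a list \<Rightarrow> 'k) set" where
  "tensor_append R V p q X Y =
     tensor_lift R (tensor_power R V (p + q))
       (\<lambda>xs. tensor_lift R (tensor_power R V (p + q)) (\<lambda>ys. tensor R V (xs @ ys)) Y) X"

text \<open>
  Tensor products of homogeneous maps.  A factor \<open>(e, i, f)\<close> is a linear map \<open>f\<close> of degree \<open>e\<close>
  from the \<open>i\<close>-th tensor power of \<open>V\<close> to \<open>W\<close>.  Following the sign rule
  \<open>(f \<otimes> g) (x \<otimes> y) = (-1)\<^bsup>|g||x|\<^esup> f x \<otimes> g y\<close>, the arguments of each factor are
  multiplied by the sign for moving all later factors past them.
\<close>

type_synonym ('k, 'a, 'b) factor = "int \<times> nat \<times> (('a list \<Rightarrow> 'k) set \<Rightarrow> 'b)"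

fun apply_factors ::
  "'k ring \<Rightarrow> ('k, 'a, 'z) gmodule_scheme \<Rightarrow> ('k, 'a, 'b) factor list \<Rightarrow> 'a list \<Rightarrow> 'b list" where
  "apply_factors R V [] xs = []"
| "apply_factors R V ((e, i, f) # fs) xs =
     f (tensor R V (map (koszul V (sum_list (map fst fs))) (take i xs)))
       # apply_factors R V fs (drop i xs)"

definition tensor_maps ::
  "'k ring \<Rightarrow> ('k, 'a, 'y) gmodule_scheme \<Rightarrow> ('k, 'b, 'z) gmodule_scheme \<Rightarrow>
   ('k, 'a, 'b) factor list \<Rightarrow> ('a list \<Rightarrow> 'k) set \<Rightarrow> ('b list \<Rightarrow> 'k) set" where
  "tensor_maps R V W fs =
     tensor_lift R (tensor_power R W (length fs)) (\<lambda>xs. tensor R W (apply_factors R V fs xs))"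

definition id_factor :: "'k ring \<Rightarrow> ('k, 'a, 'z) gmodule_scheme \<Rightarrow> ('k, 'a, 'a) factor" where
  "id_factor R V = (0, 1, untensor R V)"


section \<open>Hochschild cochains and A-infinity structures\<close>

text \<open>A cochain is a family of maps of which only the members with index at least 1 matter.\<close>

type_synonym ('k, 'a, 'b) cochain = "nat \<Rightarrow> ('a list \<Rightarrow> 'k) set \<Rightarrow> 'b"

definition CC ::
  "'k ring \<Rightarrow> ('k, 'a, 'y) gmodule_scheme \<Rightarrow> ('k, 'b, 'z) gmodule_scheme \<Rightarrow> int \<Rightarrow>
   ('k, 'a, 'b) cochain set" where
  "CC R A B d = {f. \<forall>n \<ge> 1. f n \<in> graded_hom R (tensor_power R (susp A) n) (susp B) d}"

definition cochain_add ::
  "('k, 'b, 'z) gmodule_scheme \<Rightarrow> ('k, 'a, 'b) cochain \<Rightarrow> ('k, 'a, 'b) cochain \<Rightarrow>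
   ('k, 'a, 'b) cochain" where
  "cochain_add B f g = (\<lambda>n X. f n X \<oplus>\<^bsub>B\<^esub> g n X)"

text \<open>The Gerstenhaber product of \<open>g\<close> and \<open>f\<close>, where \<open>e\<close> is the degree of \<open>f\<close>.\<close>

definition gerstenhaber ::
  "'k ring \<Rightarrow> ('k, 'a, 'y) gmodule_scheme \<Rightarrow> ('k, 'b, 'z) gmodule_scheme \<Rightarrow> int \<Rightarrow>
   ('k, 'a, 'b) cochain \<Rightarrow> ('k, 'a, 'a) cochain \<Rightarrow> ('k, 'a, 'b) cochain" where
  "gerstenhaber R A B e g f = (\<lambda>n X.
     \<Oplus>\<^bsub>B\<^esub> i \<in> {1..n}. \<Oplus>\<^bsub>B\<^esub> j \<in> {0..i - 1}.
       g i (tensor_maps R (susp A) (susp A)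
         (replicate j (id_factor R (susp A)) @ [(e, n - i + 1, f (n - i + 1))] @
          replicate (i - j - 1) (id_factor R (susp A))) X))"

definition compositions :: "nat \<Rightarrow> nat list set" where
  "compositions n = {ks. ks \<noteq> [] \<and> (\<forall>k \<in> set ks. 1 \<le> k) \<and> sum_list ks = n}"

text \<open>\<open>f * g\<close> for \<open>g\<close> of degree 0.\<close>

definition star ::
  "'k ring \<Rightarrow> ('k, 'a, 'x) gmodule_scheme \<Rightarrow> ('k, 'b, 'y) gmodule_scheme \<Rightarrow>
   ('k, 'c, 'z) gmodule_scheme \<Rightarrow>
   ('k, 'b, 'c) cochain \<Rightarrow> ('k, 'a, 'b) cochain \<Rightarrow> ('k, 'a, 'c) cochain" where
  "star R A B B' f g = (\<lambda>n X.
     \<Oplus>\<^bsub>B'\<^esub> ks \<in> compositions n.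
       f (length ks) (tensor_maps R (susp A) (susp B) (map (\<lambda>k. (0, k, g k)) ks) X))"

definition A_infinity_algebra ::
  "'k ring \<Rightarrow> ('k, 'a, 'z) gmodule_scheme \<Rightarrow> ('k, 'a, 'a) cochain \<Rightarrow> bool" where
  "A_infinity_algebra R A \<nu> \<longleftrightarrow>
     graded_module R A \<and> \<nu> \<in> CC R A A (-1) \<and>
     (\<forall>n \<ge> 1. \<forall>X \<in> carrier (tensor_power R (susp A) n).
        gerstenhaber R A A (-1) \<nu> \<nu> n X = \<zero>\<^bsub>A\<^esub>)"

definition A_infinity_morphism ::
  "'k ring \<Rightarrow> ('k, 'a, 'y) gmodule_scheme \<Rightarrow> ('k, 'a, 'a) cochain \<Rightarrow>
   ('k, 'b, 'z) gmodule_scheme \<Rightarrow> ('k, 'b, 'b) cochain \<Rightarrow> ('k, 'a, 'b) cochain \<Rightarrow> bool" where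
  "A_infinity_morphism R A \<nu>\<^sub>A B \<nu>\<^sub>B f \<longleftrightarrow>
     A_infinity_algebra R A \<nu>\<^sub>A \<and> A_infinity_algebra R B \<nu>\<^sub>B \<and> f \<in> CC R A B 0 \<and>
     (\<forall>n \<ge> 1. \<forall>X \<in> carrier (tensor_power R (susp A) n).
        star R A B B \<nu>\<^sub>B f n X = gerstenhaber R A B (-1) f \<nu>\<^sub>A n X)"


section \<open>Split units\<close>

record ('k, 'a) split_gmodule = "('k, 'a) gmodule" +
  unt :: 'a
  splitting :: "'a \<Rightarrow> 'k"

definition split_element :: "'k ring \<Rightarrow> ('k, 'a, 'z) split_gmodule_scheme \<Rightarrow> bool" where
  "split_element R A \<longleftrightarrow>
     graded_module R A \<and> unt A \<in> grade A 0 \<and>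
     (\<forall>r \<in> carrier R. r \<odot>\<^bsub>A\<^esub> unt A = \<zero>\<^bsub>A\<^esub> \<longrightarrow> r = \<zero>\<^bsub>R\<^esub>) \<and>
     splitting A \<in> graded_hom R A (ground R) 0 \<and> splitting A (unt A) = \<one>\<^bsub>R\<^esub>"

text \<open>\<open>A / (k \<cdot> 1)\<close> is identified with its image in \<open>A\<close>, the kernel of the splitting.\<close>

definition reduced :: "'k ring \<Rightarrow> ('k, 'a, 'z) split_gmodule_scheme \<Rightarrow> ('k, 'a) gmodule" where
  "reduced R A =
     \<lparr>carrier = {x \<in> carrier A. splitting A x = \<zero>\<^bsub>R\<^esub>},
      mult = mult A, one = one A, zero = zero A, add = add A, smult = smult A,
      grade = (\<lambda>i. {x \<in> grade A i. splitting A x = \<zero>\<^bsub>R\<^esub>})\<rparr>"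

definition reduction :: "('k, 'a, 'z) split_gmodule_scheme \<Rightarrow> 'a \<Rightarrow> 'a" where
  "reduction A x = x \<ominus>\<^bsub>A\<^esub> splitting A x \<odot>\<^bsub>A\<^esub> unt A"

definition unit_map :: "('k, 'a, 'z) split_gmodule_scheme \<Rightarrow> 'k \<Rightarrow> 'a" where
  "unit_map A r = r \<odot>\<^bsub>A\<^esub> unt A"

text \<open>Scalar-valued cochains, regarded as cochains with values in \<open>k \<cdot> 1\<close>.\<close>

definition unital_cochain ::
  "('k, 'b, 'z) split_gmodule_scheme \<Rightarrow> ('k, 'a, 'k) cochain \<Rightarrow> ('k, 'a, 'b) cochain" where
  "unital_cochain B f = (\<lambda>n X. unit_map B (f n X))"

text \<open>The inclusion of the cochains on \<open>reduced R A\<close> into the cochains on \<open>A\<close>.\<close>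

definition extend_cochain ::
  "'k ring \<Rightarrow> ('k, 'a, 'z) split_gmodule_scheme \<Rightarrow> ('k, 'a, 'b) cochain \<Rightarrow> ('k, 'a, 'b) cochain"
  where
  "extend_cochain R A f = (\<lambda>n X.
     f n (tensor_maps R (susp A) (susp (reduced R A))
       (replicate n (0, 1, \<lambda>Y. reduction A (untensor R (susp A) Y))) X))"

text \<open>
  With \<open>x = x' + p(x) 1\<close> and \<open>y = y' + p(y) 1\<close>, where \<open>p\<close> is the splitting and \<open>x'\<close>, \<open>y'\<close> are
  reduced, bilinearity and the defining values \<open>[1|y] \<mapsto> [y]\<close>, \<open>[x|1] \<mapsto> (-1)\<^bsup>|x|\<^esup> [x]\<close> and
  \<open>[x'|y'] \<mapsto> 0\<close> force \<open>[x|y] \<mapsto> p(x) [y] + p(y) (-1)\<^bsup>|x'|\<^esup> [x']\<close>.  The degree in the sign is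
  the one in \<open>A\<close>, not in its suspension.
\<close>

definition mu_su ::
  "'k ring \<Rightarrow> ('k, 'a, 'z) split_gmodule_scheme \<Rightarrow> ('k, 'a, 'a) cochain" where
  "mu_su R A = (\<lambda>n X.
     if n = 2 then
       tensor_lift R A
         (\<lambda>xs. splitting A (xs ! 0) \<odot>\<^bsub>A\<^esub> (xs ! 1) \<oplus>\<^bsub>A\<^esub>
               splitting A (xs ! 1) \<odot>\<^bsub>A\<^esub> koszul A 1 (reduction A (xs ! 0))) X
     else \<zero>\<^bsub>A\<^esub>)"

definition g_su ::
  "'k ring \<Rightarrow> ('k, 'a, 'y) split_gmodule_scheme \<Rightarrow> ('k, 'b, 'z) split_gmodule_scheme \<Rightarrow>
   ('k, 'a, 'b) cochain" where
  "g_su R A B = (\<lambda>n X.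
     if n = 1 then unit_map B (splitting A (untensor R (susp A) X)) else \<zero>\<^bsub>B\<^esub>)"

definition strictly_unital_structure ::
  "'k ring \<Rightarrow> ('k, 'a, 'z) split_gmodule_scheme \<Rightarrow> ('k, 'a, 'a) cochain \<Rightarrow> bool" where
  "strictly_unital_structure R A \<nu> \<longleftrightarrow>
     \<nu> \<in> CC R A A (-1) \<and>
     (\<forall>i. \<forall>x \<in> grade A i.
        \<nu> 2 (tensor R (susp A) [unt A, x]) = x \<and>
        x = (if even i then \<nu> 2 (tensor R (susp A) [x, unt A])
             else \<ominus>\<^bsub>A\<^esub> \<nu> 2 (tensor R (susp A) [x, unt A]))) \<and>
     (\<forall>n \<ge> 1. n \<noteq> 2 \<longrightarrow> (\<forall>xs. length xs = n \<and> set xs \<subseteq> carrier A \<and> unt A \<in> set xs \<longrightarrow>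
        \<nu> n (tensor R (susp A) xs) = \<zero>\<^bsub>A\<^esub>))"

definition A_infinity_split_unit ::
  "'k ring \<Rightarrow> ('k, 'a, 'z) split_gmodule_scheme \<Rightarrow> ('k, 'a, 'a) cochain \<Rightarrow> bool" where
  "A_infinity_split_unit R A \<nu> \<longleftrightarrow>
     split_element R A \<and> strictly_unital_structure R A \<nu> \<and> A_infinity_algebra R A \<nu>"

text \<open>The last clause is the standing assumption that the fixed splittings are preserved.\<close>

definition strictly_unital_element ::
  "'k ring \<Rightarrow> ('k, 'a, 'y) split_gmodule_scheme \<Rightarrow> ('k, 'b, 'z) split_gmodule_scheme \<Rightarrow>
   ('k, 'a, 'b) cochain \<Rightarrow> bool" where
  "strictly_unital_element R A B f \<longleftrightarrow>
     f \<in> CC R A B 0 \<and>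
     f 1 (tensor R (susp A) [unt A]) = unt B \<and>
     (\<forall>n \<ge> 2. \<forall>xs. length xs = n \<and> set xs \<subseteq> carrier A \<and> unt A \<in> set xs \<longrightarrow>
        f n (tensor R (susp A) xs) = \<zero>\<^bsub>B\<^esub>) \<and>
     (\<forall>x \<in> carrier A. splitting B (f 1 (tensor R (susp A) [x])) = splitting A x)"

text \<open>\<open>\<mu> + h + \<mu>\<^sub>s\<^sub>u\<close> and \<open>g + a + g\<^sub>s\<^sub>u\<close>.\<close>

definition su_structure ::
  "'k ring \<Rightarrow> ('k, 'a, 'z) split_gmodule_scheme \<Rightarrow> ('k, 'a, 'a) cochain \<Rightarrow> ('k, 'a, 'k) cochain \<Rightarrow>
   ('k, 'a, 'a) cochain" where
  "su_structure R A \<mu> h =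
     cochain_add A
       (cochain_add A (extend_cochain R A \<mu>) (extend_cochain R A (unital_cochain A h)))
       (mu_su R A)"

definition su_element ::
  "'k ring \<Rightarrow> ('k, 'a, 'y) split_gmodule_scheme \<Rightarrow> ('k, 'b, 'z) split_gmodule_scheme \<Rightarrow>
   ('k, 'a, 'b) cochain \<Rightarrow> ('k, 'a, 'k) cochain \<Rightarrow> ('k, 'a, 'b) cochain" where
  "su_element R A B g a =
     cochain_add B (extend_cochain R A (cochain_add B g (unital_cochain B a))) (g_su R A B)"


section \<open>Curved dg-coalgebras\<close>

text \<open>The tensor square \<open>C \<otimes> C\<close> is \<open>tensor_power R C 2\<close>.\<close>

record ('k, 'c) curved_coalgebra =
  space :: "('k, 'c) gmodule"
  comult :: "'c \<Rightarrow> ('c list \<Rightarrow> 'k) set"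
  codiff :: "'c \<Rightarrow> 'c"
  curv :: "'c \<Rightarrow> 'k"

definition graded_coalgebra ::
  "'k ring \<Rightarrow> ('k, 'c) gmodule \<Rightarrow> ('c \<Rightarrow> ('c list \<Rightarrow> 'k) set) \<Rightarrow> bool" where
  "graded_coalgebra R C \<Delta> \<longleftrightarrow>
     graded_module R C \<and> \<Delta> \<in> graded_hom R C (tensor_power R C 2) 0 \<and>
     (\<forall>c \<in> carrier C.
        tensor_lift R (tensor_power R C 3)
          (\<lambda>xs. tensor_append R C 2 1 (\<Delta> (xs ! 0)) (tensor R C [xs ! 1])) (\<Delta> c) =
        tensor_lift R (tensor_power R C 3)
          (\<lambda>xs. tensor_append R C 1 2 (tensor R C [xs ! 0]) (\<Delta> (xs ! 1))) (\<Delta> c))"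

definition unary_factor ::
  "'k ring \<Rightarrow> ('k, 'c) gmodule \<Rightarrow> int \<Rightarrow> ('c \<Rightarrow> 'd) \<Rightarrow> ('k, 'c, 'd) factor" where
  "unary_factor R C e f = (e, 1, \<lambda>X. f (untensor R C X))"

definition coderivation ::
  "'k ring \<Rightarrow> ('k, 'c) gmodule \<Rightarrow> ('c \<Rightarrow> ('c list \<Rightarrow> 'k) set) \<Rightarrow> int \<Rightarrow> ('c \<Rightarrow> 'c) \<Rightarrow> bool" where
  "coderivation R C \<Delta> e d \<longleftrightarrow>
     d \<in> graded_hom R C C e \<and>
     (\<forall>c \<in> carrier C. \<Delta> (d c) =
        tensor_maps R C C [unary_factor R C e d, id_factor R C] (\<Delta> c)
        \<oplus>\<^bsub>tensor_power R C 2\<^esub> tensor_maps R C C [id_factor R C, unary_factor R C e d] (\<Delta> c))"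

definition coalgebra_morphism ::
  "'k ring \<Rightarrow> ('k, 'c) gmodule \<Rightarrow> ('c \<Rightarrow> ('c list \<Rightarrow> 'k) set) \<Rightarrow>
   ('k, 'd) gmodule \<Rightarrow> ('d \<Rightarrow> ('d list \<Rightarrow> 'k) set) \<Rightarrow> ('c \<Rightarrow> 'd) \<Rightarrow> bool" where
  "coalgebra_morphism R C \<Delta>\<^sub>C D \<Delta>\<^sub>D \<gamma> \<longleftrightarrow>
     \<gamma> \<in> graded_hom R C D 0 \<and>
     (\<forall>c \<in> carrier C. \<Delta>\<^sub>D (\<gamma> c) =
        tensor_maps R C D [unary_factor R C 0 \<gamma>, unary_factor R C 0 \<gamma>] (\<Delta>\<^sub>C c))"

text \<open>\<open>ad(\<xi>) = (\<xi> \<otimes> 1) \<Delta> - (1 \<otimes> \<xi>) \<Delta>\<close> for \<open>\<xi>\<close> of degree \<open>e\<close>; by the sign rule,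
  \<open>1 \<otimes> \<xi>\<close> maps \<open>x \<otimes> y\<close> to \<open>(-1)\<^bsup>e|x|\<^esup> \<xi>(y) x\<close>.\<close>

definition ad ::
  "'k ring \<Rightarrow> ('k, 'c) gmodule \<Rightarrow> ('c \<Rightarrow> ('c list \<Rightarrow> 'k) set) \<Rightarrow> int \<Rightarrow> ('c \<Rightarrow> 'k) \<Rightarrow> 'c \<Rightarrow> 'c" where
  "ad R C \<Delta> e \<xi> c =
     tensor_lift R C (\<lambda>xs. \<xi> (xs ! 0) \<odot>\<^bsub>C\<^esub> (xs ! 1)) (\<Delta> c)
     \<ominus>\<^bsub>C\<^esub> tensor_lift R C (\<lambda>xs. \<xi> (xs ! 1) \<odot>\<^bsub>C\<^esub> koszul C e (xs ! 0)) (\<Delta> c)"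

text \<open>
  \<open>\<alpha>\<^sup>2(c)\<close> is the sum of the products \<open>\<alpha>(c') \<alpha>(c'')\<close> over \<open>\<Delta> c\<close>: the map
  \<open>\<alpha> \<otimes> \<alpha>\<close> to \<open>k \<otimes> k = k\<close> is taken without a Koszul sign.  For \<open>\<alpha>\<close> of degree \<open>-1\<close> this is
  the sign with which \<open>ad(\<alpha>)\<close> composed with itself equals \<open>ad(\<alpha>\<^sup>2)\<close>, so that, together with
  \<open>d\<^sub>D \<gamma> = \<gamma> d\<^sub>C + \<gamma> ad(\<alpha>)\<close>, the equation \<open>\<xi>\<^sub>D \<gamma> - \<alpha>\<^sup>2 = \<alpha> d\<^sub>C + \<xi>\<^sub>C\<close> is
  compatible with \<open>d\<^sup>2 = ad(\<xi>)\<close> on both sides; with the Koszul sign \<open>\<alpha>\<^sup>2\<close> would change sign.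
\<close>

definition square ::
  "'k ring \<Rightarrow> ('c \<Rightarrow> ('c list \<Rightarrow> 'k) set) \<Rightarrow> ('c \<Rightarrow> 'k) \<Rightarrow> 'c \<Rightarrow> 'k" where
  "square R \<Delta> \<alpha> c = tensor_lift R (ground R) (\<lambda>xs. \<alpha> (xs ! 0) \<otimes>\<^bsub>R\<^esub> \<alpha> (xs ! 1)) (\<Delta> c)"

definition curved_dg_coalgebra :: "'k ring \<Rightarrow> ('k, 'c) curved_coalgebra \<Rightarrow> bool" where
  "curved_dg_coalgebra R C \<longleftrightarrow>
     graded_coalgebra R (space C) (comult C) \<and>
     coderivation R (space C) (comult C) (-1) (codiff C) \<and>
     curv C \<in> graded_hom R (space C) (ground R) (-2) \<and>
     (\<forall>c \<in> carrier (space C).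
        codiff C (codiff C c) = ad R (space C) (comult C) (-2) (curv C) c \<and>
        curv C (codiff C c) = \<zero>\<^bsub>R\<^esub>)"

definition curved_dg_morphism ::
  "'k ring \<Rightarrow> ('k, 'c) curved_coalgebra \<Rightarrow> ('k, 'd) curved_coalgebra \<Rightarrow>
   ('c \<Rightarrow> 'd) \<Rightarrow> ('c \<Rightarrow> 'k) \<Rightarrow> bool" where
  "curved_dg_morphism R C D \<gamma> \<alpha> \<longleftrightarrow>
     curved_dg_coalgebra R C \<and> curved_dg_coalgebra R D \<and>
     coalgebra_morphism R (space C) (comult C) (space D) (comult D) \<gamma> \<and>
     \<alpha> \<in> graded_hom R (space C) (ground R) (-1) \<and>
     (\<forall>c \<in> carrier (space C).
        codiff D (\<gamma> c) =
          \<gamma> (codiff C c) \<oplus>\<^bsub>space D\<^esub> \<gamma> (ad R (space C) (comult C) (-1) \<alpha> c)) \<and>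
     (\<forall>c \<in> carrier (space C).
        curv D (\<gamma> c) \<ominus>\<^bsub>R\<^esub> square R (comult C) \<alpha> c = \<alpha> (codiff C c) \<oplus>\<^bsub>R\<^esub> curv C c)"


section \<open>The tensor coalgebra and the curved bar construction\<close>

text \<open>Direct sum of the tensor powers of exponent at least 1: finitely supported sequences of
  tensors, indexed by the positive naturals.\<close>

type_synonym ('k, 'a) tco = "nat \<Rightarrow> ('a list \<Rightarrow> 'k) set"

definition tensor_module ::
  "'k ring \<Rightarrow> ('k, 'a, 'z) gmodule_scheme \<Rightarrow> ('k, ('k, 'a) tco) gmodule" where
  "tensor_module R V =
     \<lparr>carrier = {t \<in> (\<Pi>\<^sub>E n \<in> {1..}. carrier (tensor_power R V n)).
        finite {n. 1 \<le> n \<and> t n \<noteq> \<zero>\<^bsub>tensor_power R V n\<^esub>}},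
      mult = undefined, one = undefined,
      zero = (\<lambda>n \<in> {1..}. \<zero>\<^bsub>tensor_power R V n\<^esub>),
      add = (\<lambda>s t. \<lambda>n \<in> {1..}. s n \<oplus>\<^bsub>tensor_power R V n\<^esub> t n),
      smult = (\<lambda>r t. \<lambda>n \<in> {1..}. r \<odot>\<^bsub>tensor_power R V n\<^esub> t n),
      grade = (\<lambda>d. {t \<in> (\<Pi>\<^sub>E n \<in> {1..}. grade (tensor_power R V n) d).
        finite {n. 1 \<le> n \<and> t n \<noteq> \<zero>\<^bsub>tensor_power R V n\<^esub>}})\<rparr>"

definition tco_incl ::
  "'k ring \<Rightarrow> ('k, 'a, 'z) gmodule_scheme \<Rightarrow> nat \<Rightarrow> ('a list \<Rightarrow> 'k) set \<Rightarrow> ('k, 'a) tco" where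
  "tco_incl R V n X = (\<lambda>m \<in> {1..}. if m = n then X else \<zero>\<^bsub>tensor_power R V m\<^esub>)"

text \<open>The map on the direct sum with components \<open>\<phi> n\<close>.\<close>

definition tco_lift ::
  "'k ring \<Rightarrow> ('k, 'a, 'y) gmodule_scheme \<Rightarrow> ('k, 'b, 'z) module_scheme \<Rightarrow>
   (nat \<Rightarrow> ('a list \<Rightarrow> 'k) set \<Rightarrow> 'b) \<Rightarrow> ('k, 'a) tco \<Rightarrow> 'b" where
  "tco_lift R V M \<phi> t =
     (\<Oplus>\<^bsub>M\<^esub> n \<in> {n. 1 \<le> n \<and> t n \<noteq> \<zero>\<^bsub>tensor_power R V n\<^esub>}. \<phi> n (t n))"

definition tco_comult ::
  "'k ring \<Rightarrow> ('k, 'a, 'z) gmodule_scheme \<Rightarrow> ('k, 'a) tco \<Rightarrow> (('k, 'a) tco list \<Rightarrow> 'k) set" where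
  "tco_comult R V =
     (let T = tensor_module R V; TT = tensor_power R T 2 in
      tco_lift R V TT (\<lambda>n. tensor_lift R TT (\<lambda>xs.
        \<Oplus>\<^bsub>TT\<^esub> i \<in> {1..n - 1}.
          tensor R T [tco_incl R V i (tensor R V (take i xs)),
                      tco_incl R V (n - i) (tensor R V (drop i xs))])))"

text \<open>The coderivation \<open>\<Phi>\<^sup>-\<^sup>1(f)\<close>, where \<open>e\<close> is the degree of \<open>f\<close>.\<close>

definition Phi_inv ::
  "'k ring \<Rightarrow> ('k, 'a, 'z) gmodule_scheme \<Rightarrow> int \<Rightarrow> ('k, 'a, 'a) cochain \<Rightarrow>
   ('k, 'a) tco \<Rightarrow> ('k, 'a) tco" where
  "Phi_inv R A e f =
     (let V = susp A; T = tensor_module R V in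
      tco_lift R V T (\<lambda>n X.
        \<Oplus>\<^bsub>T\<^esub> i \<in> {1..n}. \<Oplus>\<^bsub>T\<^esub> j \<in> {0..n - i}.
          tco_incl R V (n - i + 1) (tensor_maps R V V
            (replicate j (id_factor R V) @ [(e, i, f i)] @
             replicate (n - i - j) (id_factor R V)) X)))"

definition Psi_inv ::
  "'k ring \<Rightarrow> ('k, 'a, 'y) gmodule_scheme \<Rightarrow> ('k, 'b, 'z) gmodule_scheme \<Rightarrow>
   ('k, 'a, 'b) cochain \<Rightarrow> ('k, 'a) tco \<Rightarrow> ('k, 'b) tco" where
  "Psi_inv R A B g =
     tco_lift R (susp A) (tensor_module R (susp B)) (\<lambda>n X.
       \<Oplus>\<^bsub>tensor_module R (susp B)\<^esub> ks \<in> compositions n.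
         tco_incl R (susp B) (length ks)
           (tensor_maps R (susp A) (susp B) (map (\<lambda>k. (0, k, g k)) ks) X))"

text \<open>The functional \<open>-s\<^sup>-\<^sup>1a\<close>.\<close>

definition neg_desusp ::
  "'k ring \<Rightarrow> ('k, 'a, 'z) gmodule_scheme \<Rightarrow> ('k, 'a, 'k) cochain \<Rightarrow> ('k, 'a) tco \<Rightarrow> 'k" where
  "neg_desusp R A a = tco_lift R (susp A) (ground R) (\<lambda>n X. \<ominus>\<^bsub>R\<^esub> a n X)"

definition bar ::
  "'k ring \<Rightarrow> ('k, 'a, 'z) split_gmodule_scheme \<Rightarrow> ('k, 'a, 'a) cochain \<Rightarrow> ('k, 'a, 'k) cochain \<Rightarrow>
   ('k, ('k, 'a) tco) curved_coalgebra" where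
  "bar R A \<mu> h =
     \<lparr>space = tensor_module R (susp (reduced R A)),
      comult = tco_comult R (susp (reduced R A)),
      codiff = Phi_inv R (reduced R A) (-1) \<mu>,
      curv = neg_desusp R (reduced R A) h\<rparr>"

end

theory Submission imports Defs begin

text \<open>
  Evaluated on pure tensors, all products of cochains become sums over ways of cutting a word into
  pieces.  On words with entries in the reduced modules, the difference of the two sides of the
  morphism equation splits along \<open>B = reduced B \<oplus> k \<cdot> 1\<close> into the two displayed equations; on words with
  an entry \<open>1\<close> both sides agree by strict unitality.  On the other side, both terms of the compatibility
  of \<open>\<Psi>\<^sup>-\<^sup>1(g)\<close> with the differentials are coderivations along \<open>\<Psi>\<^sup>-\<^sup>1(g)\<close>, so that it can be checked after
  projection to tensors of length 1, where it is the first equation; the curvature condition is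
  minus the second one.
\<close>

text \<open>A morphism of curved dg-coalgebras presupposes that both bar constructions are curved
  dg-coalgebras, so \<open>d\<^sup>2 = ad(\<xi>)\<close> and \<open>\<xi> d = 0\<close> have to be
  derived as well. They are the reduced part and the unit part of the A-infinity relation: when the
  inner operation yields h times 1, the outer one can use the unit only through
  \<open>mu_su\<close>, and the two boundary terms that survive are those of ad(-s^-1 h). Comparing
  coderivations in length 1 requires that they obey the same signed rule. The sign rule is therefore
  expressed by the linear operator \<open>koszul\<close>, which also acts on inhomogeneous elements.
  The price is that the gradings of tensor powers, which are given by generators, must be shown to
  be direct. The signs in the two equations have three sources: the minus in -s^-1 a, the product
  \<alpha>^2 taken without Koszul sign, and the shift between the degree in \<open>B\<close>, used
  by \<open>mu_su\<close>, and the degree in the suspension, used by the sign rule.\<close>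

abbreviation (input) "lin \<equiv> linear_maps"
abbreviation (input) "tpow \<equiv> tensor_power"
abbreviation (input) "tlin R V n \<equiv> linear_maps R (tensor_power R V n)"
abbreviation (input) "Tco \<equiv> tensor_module"
abbreviation (input) "gerst \<equiv> gerstenhaber"
abbreviation (input) "over V xs \<equiv> set xs \<subseteq> carrier V"
abbreviation (input) "homogeneous V \<equiv> list_all2 (\<lambda>x i. x \<in> grade V i)"

section \<open>Sums and linear maps\<close>

context abelian_monoid
begin
lemma finsum_Sigma:
  assumes "finite A" "\<And>x. x \<in> A \<Longrightarrow> finite (B x)"
    and "\<And>x y. x \<in> A \<Longrightarrow> y \<in> B x \<Longrightarrow> f x y \<in> carrier G"
  shows "(\<Oplus>x\<in>A. \<Oplus>y\<in>B x. f x y) = finsum G (\<lambda>(x, y). f x y) (Sigma A B)"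
  using assms
proof (induction A rule: finite_induct)
  case empty
  then show ?case by simp
next
  case (insert a A)
  have eq: "Sigma (insert a A) B = Pair a ` B a \<union> Sigma A B" by auto
  have cl: "(\<lambda>x. \<Oplus>y\<in>B x. f x y) \<in> A \<rightarrow> carrier G" "(\<Oplus>y\<in>B a. f a y) \<in> carrier G"
    using insert.prems by (auto intro!: finsum_closed)
  have "finsum G (\<lambda>(x, y). f x y) (Sigma (insert a A) B) =
      finsum G (\<lambda>(x, y). f x y) (Pair a ` B a) \<oplus> finsum G (\<lambda>(x, y). f x y) (Sigma A B)"
    unfolding eq using insert by (intro finsum_Un_disjoint) auto
  also have "finsum G (\<lambda>(x, y). f x y) (Pair a ` B a) = (\<Oplus>y\<in>B a. f a y)"
    using insert.prems by (subst finsum_reindex) (auto simp: inj_on_def)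
  finally show ?case
    using insert cl by (simp add: finsum_insert)
qed

text \<open>Reindexing with an explicit inverse, so that no image or injectivity has to be computed
  in the later sums over cuts of words.\<close>

lemma finsum_bij_witness:
  assumes ij: "\<And>x. x \<in> S \<Longrightarrow> i x \<in> T" "\<And>x. x \<in> S \<Longrightarrow> j (i x) = x"
    and ji: "\<And>y. y \<in> T \<Longrightarrow> j y \<in> S" "\<And>y. y \<in> T \<Longrightarrow> i (j y) = y"
    and eq: "\<And>x. x \<in> S \<Longrightarrow> b (i x) = a x"
    and cl: "\<And>y. y \<in> T \<Longrightarrow> b y \<in> carrier G"
  shows "finsum G a S = finsum G b T"
proof -
  have T: "T = i ` S" using ij ji by (auto simp: image_iff) metis
  have inj: "inj_on i S" using ij(2) by (metis inj_onI)
  have "finsum G b T = (\<Oplus>x\<in>S. b (i x))"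
    unfolding T by (rule finsum_reindex) (use cl ij inj in auto)
  also have "... = finsum G a S"
    by (rule finsum_cong') (use eq cl ij in "force simp: Pi_def")+
  finally show ?thesis by simp
qed

lemma finsum_subset:
  assumes "finite S" "T \<subseteq> S" "\<And>x. x \<in> S - T \<Longrightarrow> f x = \<zero>" "\<And>x. x \<in> T \<Longrightarrow> f x \<in> carrier G"
  shows "finsum G f S = finsum G f T"
  by (rule add.finprod_mono_neutral_cong_right) (use assms in \<open>auto intro!: Pi_I\<close>, metis DiffI assms(3,4) zero_closed)

end

lemma (in abelian_group) finsum_neg:
  assumes "\<And>x. x \<in> A \<Longrightarrow> f x \<in> carrier G"
  shows "\<ominus> (finsum G f A) = (\<Oplus>x\<in>A. \<ominus> f x)"
  using assms
proof (induction A rule: infinite_finite_induct)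
  case (insert x F)
  then have "finsum G f F \<in> carrier G" "(\<lambda>x. \<ominus> f x) \<in> F \<rightarrow> carrier G"
    by (auto intro!: finsum_closed)
  with insert show ?case by (simp add: finsum_insert minus_add Pi_def)
qed (auto simp: finsum_infinite)

lemma (in abelian_group) minus_eq_zero_iff:
  "x \<in> carrier G \<Longrightarrow> y \<in> carrier G \<Longrightarrow> x \<ominus> y = \<zero> \<longleftrightarrow> x = y"
  unfolding a_minus_def by (simp add: add.inv_solve_right' add.inv_solve_right)

lemma lin_mapsI:
  assumes "\<And>x. x \<in> carrier M \<Longrightarrow> f x \<in> carrier N"
    and "\<And>x y. x \<in> carrier M \<Longrightarrow> y \<in> carrier M \<Longrightarrow> f (x \<oplus>\<^bsub>M\<^esub> y) = f x \<oplus>\<^bsub>N\<^esub> f y"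
    and "\<And>r x. r \<in> carrier R \<Longrightarrow> x \<in> carrier M \<Longrightarrow> f (r \<odot>\<^bsub>M\<^esub> x) = r \<odot>\<^bsub>N\<^esub> f x"
  shows "f \<in> lin R M N"
  using assms by (auto simp: linear_maps_def)

lemma lin_closed: "f \<in> lin R M N \<Longrightarrow> x \<in> carrier M \<Longrightarrow> f x \<in> carrier N"
  and lin_add: "f \<in> lin R M N \<Longrightarrow> x \<in> carrier M \<Longrightarrow> y \<in> carrier M \<Longrightarrow>
    f (x \<oplus>\<^bsub>M\<^esub> y) = f x \<oplus>\<^bsub>N\<^esub> f y"
  and lin_smult: "f \<in> lin R M N \<Longrightarrow> r \<in> carrier R \<Longrightarrow> x \<in> carrier M \<Longrightarrow>
    f (r \<odot>\<^bsub>M\<^esub> x) = r \<odot>\<^bsub>N\<^esub> f x"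
  by (auto simp: linear_maps_def)

lemma lin_cong:
  assumes "f \<in> lin R M N" "module R M" "\<And>x. x \<in> carrier M \<Longrightarrow> g x = f x"
  shows "g \<in> lin R M N"
proof -
  interpret module R M by fact
  show ?thesis
    by (rule lin_mapsI) (use assms in "auto simp: lin_closed lin_add lin_smult")
qed

context
  fixes R :: "'k ring" and M :: "('k, 'a, 'y) module_scheme" and N :: "('k, 'b, 'z) module_scheme"
  assumes M: "module R M" and N: "module R N"
begin
interpretation M: module R M by (rule M)
interpretation N: module R N by (rule N)

lemma lin_zero: "f \<in> lin R M N \<Longrightarrow> f \<zero>\<^bsub>M\<^esub> = \<zero>\<^bsub>N\<^esub>"
  by (metis M.M.zero_closed M.R.zero_closed M.smult_l_null N.smult_l_null lin_closed lin_smult)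

lemma lin_neg: "f \<in> lin R M N \<Longrightarrow> x \<in> carrier M \<Longrightarrow> f (\<ominus>\<^bsub>M\<^esub> x) = \<ominus>\<^bsub>N\<^esub> f x"
proof -
  assume f: "f \<in> lin R M N" and x: "x \<in> carrier M"
  have "f (\<ominus>\<^bsub>M\<^esub> x) \<oplus>\<^bsub>N\<^esub> f x = \<zero>\<^bsub>N\<^esub>"
    using lin_add[OF f, of "\<ominus>\<^bsub>M\<^esub> x" x] x by (simp add: M.M.l_neg lin_zero[OF f])
  then show ?thesis
    using N.M.minus_equality lin_closed[OF f] x by simp
qed

lemma lin_minus: "f \<in> lin R M N \<Longrightarrow> x \<in> carrier M \<Longrightarrow> y \<in> carrier M \<Longrightarrow>
    f (x \<ominus>\<^bsub>M\<^esub> y) = f x \<ominus>\<^bsub>N\<^esub> f y"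
  unfolding a_minus_def by (simp add: lin_add lin_neg)

lemma lin_finsum:
  assumes f: "f \<in> lin R M N" and "\<And>i. i \<in> I \<Longrightarrow> g i \<in> carrier M"
  shows "f (\<Oplus>\<^bsub>M\<^esub>i\<in>I. g i) = (\<Oplus>\<^bsub>N\<^esub>i\<in>I. f (g i))"
  using assms(2)
proof (induction I rule: infinite_finite_induct)
  case (insert x F)
  then have "finsum M g F \<in> carrier M" "(\<lambda>i. f (g i)) \<in> F \<rightarrow> carrier N" "f (g x) \<in> carrier N"
    using lin_closed[OF f] by (auto intro!: M.M.finsum_closed)
  with insert f show ?case by (simp add: lin_add Pi_def)
qed (auto simp: lin_zero[OF f] M.M.finsum_infinite N.M.finsum_infinite)

lemma lin_zero_map: "(\<lambda>x. \<zero>\<^bsub>N\<^esub>) \<in> lin R M N"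
  by (rule lin_mapsI) auto

lemma lin_add_map:
  assumes "f \<in> lin R M N" "g \<in> lin R M N"
  shows "(\<lambda>x. f x \<oplus>\<^bsub>N\<^esub> g x) \<in> lin R M N"
  using assms
  by (intro lin_mapsI)
    (auto simp: lin_closed lin_add lin_smult N.smult_r_distr N.a_ac)

lemma lin_neg_map:
  assumes "f \<in> lin R M N"
  shows "(\<lambda>x. \<ominus>\<^bsub>N\<^esub> f x) \<in> lin R M N"
  using assms
  by (intro lin_mapsI)
    (auto simp: lin_closed lin_add lin_smult N.smult_r_minus N.minus_add)

lemma lin_minus_map:
  assumes "f \<in> lin R M N" "g \<in> lin R M N"
  shows "(\<lambda>x. f x \<ominus>\<^bsub>N\<^esub> g x) \<in> lin R M N"
  unfolding a_minus_def by (intro lin_add_map lin_neg_map assms)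

lemma lin_smult_map:
  assumes "f \<in> lin R M N" "r \<in> carrier R"
  shows "(\<lambda>x. r \<odot>\<^bsub>N\<^esub> f x) \<in> lin R M N"
  using assms
  by (intro lin_mapsI)
    (auto simp: lin_closed lin_add lin_smult N.smult_r_distr M.R.m_comm
      simp flip: N.smult_assoc1)

lemma lin_finsum_map:
  assumes "\<And>i. i \<in> I \<Longrightarrow> f i \<in> lin R M N"
  shows "(\<lambda>x. \<Oplus>\<^bsub>N\<^esub>i\<in>I. f i x) \<in> lin R M N"
  using assms
proof (induction I rule: infinite_finite_induct)
  case (insert x F)
  then have "(\<lambda>y. f x y \<oplus>\<^bsub>N\<^esub> (\<Oplus>\<^bsub>N\<^esub>i\<in>F. f i y)) \<in> lin R M N"
    by (intro lin_add_map) auto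
  then show ?case
    by (rule lin_cong[OF _ M]) (use insert lin_closed in "fastforce intro!: N.M.finsum_insert")
qed (auto simp: N.M.finsum_infinite intro: lin_zero_map)

lemma lin_scalar_map:
  assumes "f \<in> lin R M (ground R)" "y \<in> carrier N"
  shows "(\<lambda>x. f x \<odot>\<^bsub>N\<^esub> y) \<in> lin R M N"
  using assms
  by (intro lin_mapsI)
    (auto simp: linear_maps_def ground_def N.smult_l_distr N.smult_assoc1 Pi_def)

end

lemma lin_id: "module R M \<Longrightarrow> (\<lambda>x. x) \<in> lin R M M"
  by (rule lin_mapsI) auto

lemma lin_comp:
  "g \<in> lin R N P \<Longrightarrow> f \<in> lin R M N \<Longrightarrow> (\<lambda>x. g (f x)) \<in> lin R M P"
  by (rule lin_mapsI) (auto simp: lin_closed lin_add lin_smult)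

lemma module_ground: "cring R \<Longrightarrow> module R (ground R)"
proof -
  assume "cring R"
  then interpret cring R .
  show ?thesis
  proof (rule moduleI)
    show "abelian_group (ground R)"
      by (rule abelian_groupI)
        (auto simp: ground_def a_ac l_neg intro!: bexI[of _ "\<ominus>\<^bsub>R\<^esub> _"])
  qed (auto simp: ground_def l_distr r_distr m_assoc is_cring)
qed

lemma submodule_closed:
  assumes "module R M" "submodule H R M"
  shows "H \<subseteq> carrier M" "\<zero>\<^bsub>M\<^esub> \<in> H" "x \<in> H \<Longrightarrow> y \<in> H \<Longrightarrow> x \<oplus>\<^bsub>M\<^esub> y \<in> H"
    "r \<in> carrier R \<Longrightarrow> x \<in> H \<Longrightarrow> r \<odot>\<^bsub>M\<^esub> x \<in> H" "x \<in> H \<Longrightarrow> \<ominus>\<^bsub>M\<^esub> x \<in> H"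
proof -
  interpret module R M by fact
  show "H \<subseteq> carrier M" "x \<in> H \<Longrightarrow> y \<in> H \<Longrightarrow> x \<oplus>\<^bsub>M\<^esub> y \<in> H"
    "r \<in> carrier R \<Longrightarrow> x \<in> H \<Longrightarrow> r \<odot>\<^bsub>M\<^esub> x \<in> H" "x \<in> H \<Longrightarrow> \<ominus>\<^bsub>M\<^esub> x \<in> H"
    using submoduleE[OF assms(2)] by auto
  show "\<zero>\<^bsub>M\<^esub> \<in> H"
    using assms(2) subgroup.one_closed[of H "add_monoid M"] by (auto simp: submodule_def)
qed

lemma submodule_finsum:
  assumes "module R M" "submodule H R M" "\<And>i. i \<in> I \<Longrightarrow> f i \<in> H"
  shows "(\<Oplus>\<^bsub>M\<^esub>i\<in>I. f i) \<in> H"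
proof -
  interpret module R M by fact
  note H = submodule_closed[OF assms(1,2)]
  show ?thesis using assms(3)
  proof (induction I rule: infinite_finite_induct)
    case (insert x F)
    then have "finsum M f (insert x F) = f x \<oplus>\<^bsub>M\<^esub> finsum M f F"
      using H(1) by (intro M.finsum_insert) auto
    with insert H show ?case by auto
  qed (auto simp: M.finsum_infinite H)
qed

text \<open>Closure under negation is automatic, as \<open>- x = (-1) x\<close>.\<close>

lemma submoduleI':
  assumes "module R M" "H \<subseteq> carrier M" "\<zero>\<^bsub>M\<^esub> \<in> H"
    "\<And>x y. x \<in> H \<Longrightarrow> y \<in> H \<Longrightarrow> x \<oplus>\<^bsub>M\<^esub> y \<in> H"
    "\<And>r x. r \<in> carrier R \<Longrightarrow> x \<in> H \<Longrightarrow> r \<odot>\<^bsub>M\<^esub> x \<in> H"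
  shows "submodule H R M"
proof -
  interpret module R M by fact
  have "\<ominus>\<^bsub>M\<^esub> x \<in> H" if "x \<in> H" for x
  proof -
    have "\<ominus>\<^bsub>M\<^esub> x = (\<ominus>\<^bsub>R\<^esub> \<one>\<^bsub>R\<^esub>) \<odot>\<^bsub>M\<^esub> x"
      using that assms(2) by (auto simp: smult_l_minus)
    then show ?thesis using assms(5) that by simp
  qed
  then show ?thesis using assms by (intro submoduleI) auto
qed

lemma submodule_preimage:
  assumes "module R M" "module R N" "f \<in> lin R M N" "submodule H R N"
  shows "submodule {x \<in> carrier M. f x \<in> H} R M"
proof -
  interpret M: module R M by fact
  note H = submodule_closed[OF assms(2,4)]
  show ?thesis
    by (rule submoduleI'[OF assms(1)])
      (use H assms(3) lin_zero[OF assms(1,2,3)] in "auto simp: lin_add lin_smult")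
qed

text \<open>Equality of two linear maps is a submodule condition, so it can be tested on any
  generating set. The extensionality principles for graded modules, tensor powers, multilinear maps
  and the tensor coalgebra all rest on this.\<close>

lemma submodule_equalizer:
  assumes "module R M" "module R N" "f \<in> lin R M N" "g \<in> lin R M N"
  shows "submodule {x \<in> carrier M. f x = g x} R M"
proof -
  interpret M: module R M by fact
  show ?thesis
    by (rule submoduleI'[OF assms(1)])
      (use assms in "auto simp: lin_add lin_smult lin_zero[OF assms(1,2)]")
qed

lemma generated_submodule_least:
  "submodule H R M \<Longrightarrow> S \<subseteq> H \<Longrightarrow> generated_submodule R M S \<subseteq> H"
  by (auto simp: generated_submodule_def)

lemma generated_submodule_incl: "S \<subseteq> generated_submodule R M S"
  by (auto simp: generated_submodule_def)

lemma generated_submodule: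
  assumes "module R M" "S \<subseteq> carrier M"
  shows "submodule (generated_submodule R M S) R M"
proof -
  interpret module R M by fact
  have "generated_submodule R M S \<subseteq> carrier M"
    by (rule generated_submodule_least) (use assms carrier_is_submodule in auto)
  then show ?thesis
    by (rule submoduleI'[OF assms(1)])
      (auto simp: generated_submodule_def submodule_closed[OF assms(1)])
qed

section \<open>Graded modules\<close>

lemma graded_moduleD:
  assumes "graded_module R M"
  shows "module R M" "submodule (grade M i) R M"
  using assms by (auto simp: graded_module_def)

lemma grade_closed: "graded_module R M \<Longrightarrow> x \<in> grade M i \<Longrightarrow> x \<in> carrier M"
  using graded_moduleD[of R M] submodule_closed(1) by blast

context
  fixes R :: "'k ring" and M :: "('k, 'a, 'y) gmodule_scheme"
  assumes M: "module R M" and sub: "\<And>i. submodule (grade M i) R M"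
begin
interpretation module R M by (rule M)

lemmas sub_closed = submodule_closed[OF M sub]

lemma decompositionI:
  assumes "\<And>i. c i \<in> grade M i" "finite S" "\<And>i. i \<notin> S \<Longrightarrow> c i = \<zero>\<^bsub>M\<^esub>" "x = (\<Oplus>\<^bsub>M\<^esub>i\<in>S. c i)"
  shows "decomposition M c x"
proof -
  have "{i. c i \<noteq> \<zero>\<^bsub>M\<^esub>} \<subseteq> S" using assms(3) by auto
  moreover have "(\<Oplus>\<^bsub>M\<^esub>i\<in>S. c i) = (\<Oplus>\<^bsub>M\<^esub> i \<in> {i. c i \<noteq> \<zero>\<^bsub>M\<^esub>}. c i)"
    by (rule M.finsum_subset) (use assms sub_closed(1) in auto)
  ultimately show ?thesis
    using assms finite_subset by (auto simp: decomposition_def)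
qed

lemma decomposition_finsum:
  assumes "decomposition M c x" "finite S" "\<And>i. i \<notin> S \<Longrightarrow> c i = \<zero>\<^bsub>M\<^esub>"
  shows "x = (\<Oplus>\<^bsub>M\<^esub>i\<in>S. c i)"
proof -
  have "(\<Oplus>\<^bsub>M\<^esub>i\<in>S. c i) = (\<Oplus>\<^bsub>M\<^esub> i \<in> {i. c i \<noteq> \<zero>\<^bsub>M\<^esub>}. c i)"
    by (rule M.finsum_subset) (use assms sub_closed(1) in "auto simp: decomposition_def")
  then show ?thesis using assms(1) by (simp add: decomposition_def)
qed

text \<open>The support of a sum can be smaller than the union of the supports, so decompositions
  are compared over a common finite superset.\<close>

lemma decomposition_common_support:
  assumes "decomposition M c x" "decomposition M c' y"
  obtains S where "finite S" "\<And>i. i \<notin> S \<Longrightarrow> c i = \<zero>\<^bsub>M\<^esub>" "\<And>i. i \<notin> S \<Longrightarrow> c' i = \<zero>\<^bsub>M\<^esub>"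
    "x = (\<Oplus>\<^bsub>M\<^esub>i\<in>S. c i)" "y = (\<Oplus>\<^bsub>M\<^esub>i\<in>S. c' i)"
proof -
  let ?S = "{i. c i \<noteq> \<zero>\<^bsub>M\<^esub>} \<union> {i. c' i \<noteq> \<zero>\<^bsub>M\<^esub>}"
  have "finite ?S" using assms by (auto simp: decomposition_def)
  moreover have "x = (\<Oplus>\<^bsub>M\<^esub>i\<in>?S. c i)"
    by (rule decomposition_finsum[OF assms(1) calculation]) auto
  moreover have "y = (\<Oplus>\<^bsub>M\<^esub>i\<in>?S. c' i)"
    by (rule decomposition_finsum[OF assms(2) \<open>finite ?S\<close>]) auto
  ultimately show ?thesis by (intro that[of ?S]) auto
qed

lemma decomposition_closed:
  assumes "decomposition M c x"
  shows "c i \<in> grade M i" "c i \<in> carrier M" "x \<in> carrier M"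
  using assms sub_closed(1)[of i] sub_closed(1) by (auto simp: decomposition_def intro!: M.finsum_closed)

lemma decomposition_add:
  assumes "decomposition M c x" "decomposition M c' y"
  shows "decomposition M (\<lambda>i. c i \<oplus>\<^bsub>M\<^esub> c' i) (x \<oplus>\<^bsub>M\<^esub> y)"
proof -
  obtain S where S: "finite S" "\<And>i. i \<notin> S \<Longrightarrow> c i = \<zero>\<^bsub>M\<^esub>" "\<And>i. i \<notin> S \<Longrightarrow> c' i = \<zero>\<^bsub>M\<^esub>"
    "x = (\<Oplus>\<^bsub>M\<^esub>i\<in>S. c i)" "y = (\<Oplus>\<^bsub>M\<^esub>i\<in>S. c' i)"
    using decomposition_common_support[OF assms] by metis
  note cl = decomposition_closed[OF assms(1)] decomposition_closed[OF assms(2)]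
  show ?thesis
    by (rule decompositionI[of _ S])
      (use S cl in "auto intro: sub_closed(3) simp: M.finsum_addf")
qed

lemma decomposition_smult:
  assumes "decomposition M c x" "r \<in> carrier R"
  shows "decomposition M (\<lambda>i. r \<odot>\<^bsub>M\<^esub> c i) (r \<odot>\<^bsub>M\<^esub> x)"
proof -
  note cl = decomposition_closed[OF assms(1)]
  show ?thesis
    by (rule decompositionI[of _ "{i. c i \<noteq> \<zero>\<^bsub>M\<^esub>}"])
      (use assms cl in "auto intro: sub_closed(4) simp: decomposition_def finsum_smult_ldistr")
qed

lemma decomposition_homogeneous:
  assumes "x \<in> grade M i"
  shows "decomposition M (\<lambda>j. if j = i then x else \<zero>\<^bsub>M\<^esub>) x"
proof (rule decompositionI[of _ "{i}"])
  have "x \<in> carrier M" using assms sub_closed(1) by blast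
  then show "x = (\<Oplus>\<^bsub>M\<^esub>j\<in>{i}. if j = i then x else \<zero>\<^bsub>M\<^esub>)"
    by (simp add: M.finsum_insert)
qed (use assms sub_closed(2) in auto)

text \<open>The elements with some decomposition form a submodule containing every grade, so
  existence needs only the span condition. Two decompositions of one element differ by a
  decomposition of zero, so uniqueness needs to be known only there.\<close>

lemma graded_moduleI:
  assumes span: "\<And>H. submodule H R M \<Longrightarrow> (\<And>i. grade M i \<subseteq> H) \<Longrightarrow> carrier M \<subseteq> H"
    and zero: "\<And>c i. decomposition M c \<zero>\<^bsub>M\<^esub> \<Longrightarrow> c i = \<zero>\<^bsub>M\<^esub>"
  shows "graded_module R M"
proof -
  let ?H = "{x \<in> carrier M. \<exists>c. decomposition M c x}"
  have "carrier M \<subseteq> ?H"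
  proof (rule span)
    show "submodule ?H R M"
    proof (rule submoduleI'[OF M])
      show "\<zero>\<^bsub>M\<^esub> \<in> ?H" using decomposition_homogeneous[OF sub_closed(2)] by auto
    qed (auto intro: decomposition_add decomposition_smult)
    show "grade M i \<subseteq> ?H" for i
      using decomposition_homogeneous sub_closed(1)[of i] by blast
  qed
  moreover have "c = c'" if "decomposition M c x" "decomposition M c' x" for c c' x
  proof
    fix i
    note cl = decomposition_closed[OF that(1)] decomposition_closed[OF that(2)]
    \<comment> \<open>Subtraction is written as adding the multiple by -1, since decompositions are
      already known to be stable under sums and scalars.\<close>
    have "decomposition M (\<lambda>i. c i \<oplus>\<^bsub>M\<^esub> (\<ominus>\<^bsub>R\<^esub> \<one>\<^bsub>R\<^esub>) \<odot>\<^bsub>M\<^esub> c' i) (x \<oplus>\<^bsub>M\<^esub> (\<ominus>\<^bsub>R\<^esub> \<one>\<^bsub>R\<^esub>) \<odot>\<^bsub>M\<^esub> x)"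
      using that by (intro decomposition_add decomposition_smult) auto
    also have "x \<oplus>\<^bsub>M\<^esub> (\<ominus>\<^bsub>R\<^esub> \<one>\<^bsub>R\<^esub>) \<odot>\<^bsub>M\<^esub> x = \<zero>\<^bsub>M\<^esub>"
      using cl by (simp add: smult_l_minus M.r_neg)
    finally have "c i \<oplus>\<^bsub>M\<^esub> (\<ominus>\<^bsub>R\<^esub> \<one>\<^bsub>R\<^esub>) \<odot>\<^bsub>M\<^esub> c' i = \<zero>\<^bsub>M\<^esub>" by (rule zero)
    then have "c i \<ominus>\<^bsub>M\<^esub> c' i = \<zero>\<^bsub>M\<^esub>"
      using cl by (simp add: smult_l_minus a_minus_def)
    then show "c i = c' i"
      using cl by (simp add: M.minus_eq_zero_iff)
  qed
  ultimately show ?thesis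
    unfolding graded_module_def using M sub by blast
qed

end

context
  fixes R :: "'k ring" and M :: "('k, 'a, 'y) gmodule_scheme"
  assumes M: "graded_module R M"
begin
interpretation module R M by (rule graded_moduleD(1)[OF M])

lemmas M_sub = graded_moduleD[OF M]
lemmas M_closed = submodule_closed[OF M_sub]

lemma decomposition_ex:
  assumes "x \<in> carrier M" obtains c where "decomposition M c x"
  using assms M by (auto simp: graded_module_def)

lemma decomposition_unique:
  "decomposition M c x \<Longrightarrow> decomposition M c' x \<Longrightarrow> c = c'"
  using decomposition_closed(3)[OF M_sub, of c x] M unfolding graded_module_def by blast

lemma graded_span:
  assumes "submodule H R M" "\<And>i. grade M i \<subseteq> H" "x \<in> carrier M"
  shows "x \<in> H"
proof -
  obtain c where c: "decomposition M c x" using decomposition_ex assms(3) by blast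
  then have "x = (\<Oplus>\<^bsub>M\<^esub> i \<in> {i. c i \<noteq> \<zero>\<^bsub>M\<^esub>}. c i)" "\<And>i. c i \<in> H"
    using assms(2) by (auto simp: decomposition_def)
  then show ?thesis
    using submodule_finsum[OF M_sub(1) assms(1), of "{i. c i \<noteq> \<zero>\<^bsub>M\<^esub>}" c] by simp
qed

lemma graded_ext:
  assumes "module R N" "f \<in> lin R M N" "g \<in> lin R M N"
    and "\<And>i x. x \<in> grade M i \<Longrightarrow> f x = g x" "x \<in> carrier M"
  shows "f x = g x"
  using graded_span[OF submodule_equalizer[OF M_sub(1) assms(1-3)] _ assms(5)] assms(4) M_closed(1)
  by blast

text \<open>Uniqueness of decompositions removes the \<open>THE\<close> of the definition, and the
  sum may run over any finite set containing the support.\<close>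

lemma koszul_eq:
  assumes c: "decomposition M c x" and S: "finite S" "\<And>i. i \<notin> S \<Longrightarrow> c i = \<zero>\<^bsub>M\<^esub>"
  shows "koszul M d x = (\<Oplus>\<^bsub>M\<^esub>i\<in>S. if even (d * i) then c i else \<ominus>\<^bsub>M\<^esub> c i)"
proof -
  let ?k = "\<lambda>i. if even (d * i) then c i else \<ominus>\<^bsub>M\<^esub> c i"
  note cl = decomposition_closed[OF M_sub c]
  have "koszul M d x = (\<Oplus>\<^bsub>M\<^esub>i\<in>{i. c i \<noteq> \<zero>\<^bsub>M\<^esub>}. ?k i)"
    unfolding koszul_def
  proof (rule the_equality)
    fix y assume "\<exists>c. decomposition M c x \<and> y =
      (\<Oplus>\<^bsub>M\<^esub>i\<in>{i. c i \<noteq> \<zero>\<^bsub>M\<^esub>}. if even (d * i) then c i else \<ominus>\<^bsub>M\<^esub> c i)"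
    then show "y = (\<Oplus>\<^bsub>M\<^esub>i\<in>{i. c i \<noteq> \<zero>\<^bsub>M\<^esub>}. ?k i)"
      using decomposition_unique[OF c] by blast
  qed (use c in blast)
  also have "... = (\<Oplus>\<^bsub>M\<^esub>i\<in>S. ?k i)"
    by (rule M.finsum_subset[symmetric]) (use S cl in auto)
  finally show ?thesis .
qed

lemma koszul_homogeneous:
  assumes "x \<in> grade M i"
  shows "koszul M d x = (if even (d * i) then x else \<ominus>\<^bsub>M\<^esub> x)"
proof -
  have "x \<in> carrier M" using assms M_closed(1) by blast
  then show ?thesis
    by (subst koszul_eq[OF decomposition_homogeneous[OF M_sub assms], of "{i}"])
      (auto simp: M.finsum_insert)
qed

lemma koszul_linear: "koszul M d \<in> lin R M M"
proof (rule lin_mapsI)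
  fix x assume "x \<in> carrier M"
  then obtain c where c: "decomposition M c x" using decomposition_ex by blast
  note cl = decomposition_closed[OF M_sub c]
  have fin: "finite {i. c i \<noteq> \<zero>\<^bsub>M\<^esub>}" using c by (auto simp: decomposition_def)
  have k: "koszul M d x = (\<Oplus>\<^bsub>M\<^esub>i\<in>{i. c i \<noteq> \<zero>\<^bsub>M\<^esub>}. if even (d * i) then c i else \<ominus>\<^bsub>M\<^esub> c i)"
    by (rule koszul_eq[OF c fin]) auto
  show "koszul M d x \<in> carrier M"
    unfolding k using cl by (auto intro!: M.finsum_closed)
  show "koszul M d (r \<odot>\<^bsub>M\<^esub> x) = r \<odot>\<^bsub>M\<^esub> koszul M d x" if r: "r \<in> carrier R" for r
  proof -
    \<comment> \<open>The support of r x may be smaller than that of x; the sum is kept over the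
      larger one.\<close>
    have "koszul M d (r \<odot>\<^bsub>M\<^esub> x) = (\<Oplus>\<^bsub>M\<^esub>i\<in>{i. c i \<noteq> \<zero>\<^bsub>M\<^esub>}.
        if even (d * i) then r \<odot>\<^bsub>M\<^esub> c i else \<ominus>\<^bsub>M\<^esub> (r \<odot>\<^bsub>M\<^esub> c i))"
      by (rule koszul_eq[OF decomposition_smult[OF M_sub c r] fin]) (use r in auto)
    also have "... = r \<odot>\<^bsub>M\<^esub> koszul M d x"
      unfolding k using r cl fin
      by (subst finsum_smult_ldistr) (auto intro!: M.finsum_cong' simp: smult_r_minus)
    finally show ?thesis .
  qed
  show "koszul M d (x \<oplus>\<^bsub>M\<^esub> y) = koszul M d x \<oplus>\<^bsub>M\<^esub> koszul M d y" if y: "y \<in> carrier M" for y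
  proof -
    obtain c' where c': "decomposition M c' y" using decomposition_ex[OF y] by blast
    note cl' = decomposition_closed[OF M_sub c']
    obtain S where S: "finite S" "\<And>i. i \<notin> S \<Longrightarrow> c i = \<zero>\<^bsub>M\<^esub>" "\<And>i. i \<notin> S \<Longrightarrow> c' i = \<zero>\<^bsub>M\<^esub>"
      by (rule decomposition_common_support[OF M_sub c c']) (rule that)
    show ?thesis
    proof -
      have "koszul M d (x \<oplus>\<^bsub>M\<^esub> y) = (\<Oplus>\<^bsub>M\<^esub>i\<in>S. if even (d * i) then c i \<oplus>\<^bsub>M\<^esub> c' i
          else \<ominus>\<^bsub>M\<^esub> (c i \<oplus>\<^bsub>M\<^esub> c' i))"
        by (rule koszul_eq[OF decomposition_add[OF M_sub c c'] S(1)]) (use S in auto)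
      also have "... = koszul M d x \<oplus>\<^bsub>M\<^esub> koszul M d y"
      proof -
        have k: "koszul M d x = (\<Oplus>\<^bsub>M\<^esub>i\<in>S. if even (d * i) then c i else \<ominus>\<^bsub>M\<^esub> c i)"
          "koszul M d y = (\<Oplus>\<^bsub>M\<^esub>i\<in>S. if even (d * i) then c' i else \<ominus>\<^bsub>M\<^esub> c' i)"
          by (rule koszul_eq[OF c S(1)] koszul_eq[OF c' S(1)]; use S in auto)+
        show ?thesis
          unfolding k using cl cl'
          by (intro trans[OF M.finsum_cong' M.finsum_addf]) (auto simp: M.minus_add)
      qed
      finally show ?thesis .
    qed
  qed
qed

lemma koszul_closed: "x \<in> carrier M \<Longrightarrow> koszul M d x \<in> carrier M"
  by (rule lin_closed[OF koszul_linear])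

lemma koszul_graded: "koszul M d \<in> graded_hom R M M 0"
  using koszul_linear koszul_homogeneous M_closed(5) by (auto simp: graded_hom_def)

lemma koszul_even: "even d \<Longrightarrow> x \<in> carrier M \<Longrightarrow> koszul M d x = x"
  by (rule graded_ext[OF M_sub(1) koszul_linear lin_id[OF M_sub(1)]])
    (auto simp: koszul_homogeneous)

lemma koszul_koszul: "x \<in> carrier M \<Longrightarrow> koszul M d (koszul M d x) = x"
proof (rule graded_ext[OF M_sub(1) lin_comp[OF koszul_linear koszul_linear] lin_id[OF M_sub(1)]])
  fix i x assume x: "x \<in> grade M i"
  then have "\<ominus>\<^bsub>M\<^esub> x \<in> grade M i" "x \<in> carrier M" using M_closed by auto
  with x show "koszul M d (koszul M d x) = x"
    using koszul_homogeneous[OF x] koszul_homogeneous[of "\<ominus>\<^bsub>M\<^esub> x" i] by auto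
qed

end

lemma graded_homD:
  assumes "f \<in> graded_hom R M N d"
  shows "f \<in> lin R M N" "x \<in> grade M i \<Longrightarrow> f x \<in> grade N (i + d)"
  using assms by (auto simp: graded_hom_def)

text \<open>\<open>f\<close> moves degree i to degree i + e, and (-1)^(d (i + e)) = (-1)^(d i)
  (-1)^(d e).\<close>

lemma koszul_commute:
  assumes M: "graded_module R M" and N: "graded_module R N" and f: "f \<in> graded_hom R M N e"
    and x: "x \<in> carrier M"
  shows "f (koszul M d x) =
    (if even (d * e) then koszul N d (f x) else \<ominus>\<^bsub>N\<^esub> koszul N d (f x))"
proof -
  interpret N: module R N using graded_moduleD(1)[OF N] .
  note f' = graded_homD[OF f]
  note mods = graded_moduleD(1)[OF M] graded_moduleD(1)[OF N]
  show ?thesis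
  proof (cases "even (d * e)")
    case True
    have "f (koszul M d x) = koszul N d (f x)"
      by (rule graded_ext[OF M mods(2) lin_comp[OF f'(1) koszul_linear[OF M]]
            lin_comp[OF koszul_linear[OF N] f'(1)] _ x])
        (use True f' mods in \<open>auto simp: koszul_homogeneous[OF M] koszul_homogeneous[OF N f'(2)]
          lin_neg grade_closed[OF M] distrib_left\<close>)
    with True show ?thesis by simp
  next
    case False
    have "f (koszul M d x) = \<ominus>\<^bsub>N\<^esub> koszul N d (f x)"
      by (rule graded_ext[OF M mods(2) lin_comp[OF f'(1) koszul_linear[OF M]]
            lin_neg_map[OF mods lin_comp[OF koszul_linear[OF N] f'(1)]] _ x])
        (use False f' mods in \<open>auto simp: koszul_homogeneous[OF M] koszul_homogeneous[OF N f'(2)]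
          lin_neg lin_closed grade_closed[OF M] distrib_left\<close>)
    with False show ?thesis by simp
  qed
qed

section \<open>Tensor powers\<close>

lemma (in abelian_group) add_minus_cancel:
  "x \<in> carrier G \<Longrightarrow> y \<in> carrier G \<Longrightarrow> (x \<oplus> y) \<ominus> x = y"
  by (simp add: a_minus_def a_comm[of x y] a_assoc r_neg)

text \<open>For \<open>n \<ge> 1\<close> the closure clause follows from the second one.\<close>

definition multilinear ::
  "'k ring \<Rightarrow> ('k, 'a, 'y) module_scheme \<Rightarrow> nat \<Rightarrow> ('k, 'b, 'z) module_scheme \<Rightarrow> ('a list \<Rightarrow> 'b) \<Rightarrow> bool"
  where
  "multilinear R V n M \<phi> \<longleftrightarrow>
     (\<forall>xs. length xs = n \<longrightarrow> over V xs \<longrightarrow> \<phi> xs \<in> carrier M) \<and>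
     (\<forall>us vs. n = Suc (length us + length vs) \<longrightarrow> over V us \<longrightarrow> over V vs \<longrightarrow>
        (\<lambda>x. \<phi> (us @ x # vs)) \<in> lin R V M)"

lemma multilinear_closed:
  "multilinear R V n M \<phi> \<Longrightarrow> length xs = n \<Longrightarrow> over V xs \<Longrightarrow> \<phi> xs \<in> carrier M"
  by (auto simp: multilinear_def)

lemma multilinear_slot:
  "multilinear R V n M \<phi> \<Longrightarrow> n = Suc (length us + length vs) \<Longrightarrow> over V us \<Longrightarrow>
    over V vs \<Longrightarrow> (\<lambda>x. \<phi> (us @ x # vs)) \<in> lin R V M"
  by (auto simp: multilinear_def)

lemma multilinearI:
  assumes "\<And>xs. length xs = n \<Longrightarrow> over V xs \<Longrightarrow> \<phi> xs \<in> carrier M"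
    and "\<And>us vs. n = Suc (length us + length vs) \<Longrightarrow> over V us \<Longrightarrow> over V vs \<Longrightarrow>
        (\<lambda>x. \<phi> (us @ x # vs)) \<in> lin R V M"
  shows "multilinear R V n M \<phi>"
  using assms by (auto simp: multilinear_def)

lemma multilinear_comp:
  assumes "multilinear R V n M \<phi>" "f \<in> lin R M N"
  shows "multilinear R V n N (\<lambda>xs. f (\<phi> xs))"
  by (intro multilinearI lin_comp[OF assms(2)] lin_closed[OF assms(2)]
      multilinear_slot[OF assms(1)] multilinear_closed[OF assms(1)])

lemma multilinear_cong:
  assumes "multilinear R V n M \<phi>" "module R V"
    and "\<And>xs. length xs = n \<Longrightarrow> over V xs \<Longrightarrow> \<psi> xs = \<phi> xs"
  shows "multilinear R V n M \<psi>"
proof (rule multilinearI)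
  fix us vs
  assume *: "n = Suc (length us + length vs)" "over V us" "over V vs"
  show "(\<lambda>x. \<psi> (us @ x # vs)) \<in> lin R V M"
    by (rule lin_cong[OF multilinear_slot[OF assms(1) *] assms(2)]) (use * assms(3) in auto)
qed (use assms multilinear_closed in fastforce)

lemma multilinear_finsum:
  assumes "module R V" "module R M" "\<And>i. i \<in> I \<Longrightarrow> multilinear R V n M (\<phi> i)"
  shows "multilinear R V n M (\<lambda>xs. \<Oplus>\<^bsub>M\<^esub>i\<in>I. \<phi> i xs)"
proof -
  interpret M: module R M by fact
  show ?thesis
    by (intro multilinearI lin_finsum_map assms M.M.finsum_closed)
      (auto intro: multilinear_closed[OF assms(3)] multilinear_slot[OF assms(3)])
qed

lemma multilinear_map:
  assumes "multilinear R W n M \<phi>" "f \<in> lin R V W"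
  shows "multilinear R V n M (\<lambda>xs. \<phi> (map f xs))"
proof (rule multilinearI)
  have cl: "over V xs \<Longrightarrow> over W (map f xs)" for xs
    using lin_closed[OF assms(2)] by auto
  show "\<phi> (map f xs) \<in> carrier M" if "length xs = n" "over V xs" for xs
    using that cl by (intro multilinear_closed[OF assms(1)]) auto
  show "(\<lambda>x. \<phi> (map f (us @ x # vs))) \<in> lin R V M"
    if "n = Suc (length us + length vs)" "over V us" "over V vs" for us vs
    using lin_comp[OF multilinear_slot[OF assms(1), of "map f us" "map f vs"] assms(2)] that cl
    by simp
qed

text \<open>Stated with \<open>xs ! 0\<close> and \<open>xs ! 1\<close>, the form in which
  \<open>mu_su\<close>, \<open>ad\<close>, \<open>square\<close> and \<open>tensor2\<close> hand
  bilinear maps to \<open>tensor_lift\<close>.\<close>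

lemma multilinear_pair:
  assumes "\<And>y. y \<in> carrier V \<Longrightarrow> (\<lambda>x. \<beta> x y) \<in> lin R V M"
    and "\<And>x. x \<in> carrier V \<Longrightarrow> \<beta> x \<in> lin R V M"
  shows "multilinear R V 2 M (\<lambda>xs. \<beta> (xs ! 0) (xs ! 1))"
proof (rule multilinearI)
  fix xs assume "length xs = 2" "over V xs"
  then show "\<beta> (xs ! 0) (xs ! 1) \<in> carrier M"
    using lin_closed[OF assms(2)] by (auto simp: numeral_2_eq_2 length_Suc_conv)
next
  fix us vs assume *: "2 = Suc (length us + length vs)" "over V us" "over V vs"
  then consider (1) v where "us = []" "vs = [v]" | (2) u where "us = [u]" "vs = []"
    by (cases us; cases vs) auto
  then show "(\<lambda>x. \<beta> ((us @ x # vs) ! 0) ((us @ x # vs) ! 1)) \<in> lin R V M"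
    by cases (use * assms in auto)
qed

section \<open>Free modules on lists and the multilinearity relations\<close>

lemma free_power_simps:
  "carrier (free_power R V n) = {c. (\<forall>l. c l \<in> carrier R) \<and> finite {l. c l \<noteq> \<zero>\<^bsub>R\<^esub>} \<and>
        (\<forall>l. c l \<noteq> \<zero>\<^bsub>R\<^esub> \<longrightarrow> length l = n \<and> over V l)}"
  "zero (free_power R V n) = (\<lambda>l. \<zero>\<^bsub>R\<^esub>)"
  "add (free_power R V n) = (\<lambda>c c' l. c l \<oplus>\<^bsub>R\<^esub> c' l)"
  "smult (free_power R V n) = (\<lambda>r c l. r \<otimes>\<^bsub>R\<^esub> c l)"
  by (auto simp: free_power_def)

context
  fixes R :: "'k ring" and V :: "('k, 'a, 'y) module_scheme" and n :: nat
  assumes V: "module R V"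
begin
interpretation V: module R V by (rule V)

private abbreviation (input) "F \<equiv> free_power R V n"
private abbreviation (input) "L \<equiv> {xs. length xs = n \<and> over V xs}"

lemma module_free_power: "module R F"
proof (rule moduleI)
  show "abelian_group F"
  proof (rule abelian_groupI)
    fix c assume c: "c \<in> carrier F"
    have "{l. \<ominus>\<^bsub>R\<^esub> c l \<noteq> \<zero>\<^bsub>R\<^esub>} \<subseteq> {l. c l \<noteq> \<zero>\<^bsub>R\<^esub>}" by auto
    then have "(\<lambda>l. \<ominus>\<^bsub>R\<^esub> c l) \<in> carrier F"
      using c finite_subset by (fastforce simp: free_power_simps)
    then show "\<exists>d \<in> carrier F. d \<oplus>\<^bsub>F\<^esub> c = \<zero>\<^bsub>F\<^esub>"
      using c by (intro bexI[of _ "\<lambda>l. \<ominus>\<^bsub>R\<^esub> c l"]) (auto simp: free_power_simps V.R.l_neg)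
  next
    fix c d assume c: "c \<in> carrier F" and d: "d \<in> carrier F"
    have "finite {l. c l \<oplus>\<^bsub>R\<^esub> d l \<noteq> \<zero>\<^bsub>R\<^esub>}"
      by (rule finite_subset[of _ "{l. c l \<noteq> \<zero>\<^bsub>R\<^esub>} \<union> {l. d l \<noteq> \<zero>\<^bsub>R\<^esub>}"])
        (use c d in "auto simp: free_power_simps")
    then show "c \<oplus>\<^bsub>F\<^esub> d \<in> carrier F"
      using c d by (simp add: free_power_simps) (metis V.R.l_zero V.R.zero_closed)
  qed (auto simp: free_power_simps V.R.a_ac)
next
  fix r c assume r: "r \<in> carrier R" and c: "c \<in> carrier F"
  have "finite {l. r \<otimes>\<^bsub>R\<^esub> c l \<noteq> \<zero>\<^bsub>R\<^esub>}"
    by (rule finite_subset[of _ "{l. c l \<noteq> \<zero>\<^bsub>R\<^esub>}"]) (use r c in "auto simp: free_power_simps")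
  then show "r \<odot>\<^bsub>F\<^esub> c \<in> carrier F"
    using r c by (simp add: free_power_simps) (metis V.R.r_null)
qed (auto simp: free_power_simps V.R.l_distr V.R.r_distr V.R.m_assoc V.R.is_cring)

interpretation F: module R F by (rule module_free_power)

lemma single_closed: "xs \<in> L \<Longrightarrow> single R xs \<in> carrier F"
proof -
  assume "xs \<in> L"
  moreover have "finite {l. single R xs l \<noteq> \<zero>\<^bsub>R\<^esub>}"
    by (rule finite_subset[of _ "{xs}"]) (auto simp: single_def)
  ultimately show ?thesis by (auto simp: free_power_simps single_def)
qed

text \<open>The induction runs over a finite set containing the support, not over the support
  itself: clearing the coefficient at \<open>l\<close> then leaves a function supported in the
  smaller set, whether or not that coefficient was zero.\<close>

lemma free_power_span:
  assumes H: "submodule H R F" "\<And>xs. xs \<in> L \<Longrightarrow> single R xs \<in> H"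
  shows "carrier F \<subseteq> H"
proof
  fix c assume c: "c \<in> carrier F"
  have "\<forall>c \<in> carrier F. {l. c l \<noteq> \<zero>\<^bsub>R\<^esub>} \<subseteq> S \<longrightarrow> c \<in> H" if "finite S" for S
    using that
  proof (induction S)
    case empty
    then show ?case
      using submodule_closed(2)[OF F.module_axioms H(1)] by (auto simp: free_power_simps)
  next
    case (insert l S)
    show ?case
    proof (intro ballI impI)
      fix c assume c: "c \<in> carrier F" "{l. c l \<noteq> \<zero>\<^bsub>R\<^esub>} \<subseteq> insert l S"
      let ?c = "c(l := \<zero>\<^bsub>R\<^esub>)"
      have "finite {k. ?c k \<noteq> \<zero>\<^bsub>R\<^esub>}"
        by (rule finite_subset[of _ "{l. c l \<noteq> \<zero>\<^bsub>R\<^esub>}"]) (use c in "auto simp: free_power_simps")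
      then have "?c \<in> carrier F" using c(1) by (auto simp: free_power_simps)
      moreover have "{k. ?c k \<noteq> \<zero>\<^bsub>R\<^esub>} \<subseteq> S" using c(2) by auto
      ultimately have 1: "?c \<in> H" using insert.IH by blast
      show "c \<in> H"
      proof (cases "c l = \<zero>\<^bsub>R\<^esub>")
        case True
        then have "?c = c" by auto
        then show ?thesis using 1 by simp
      next
        case False
        then have "single R l \<in> H" using c(1) by (intro H(2)) (auto simp: free_power_simps)
        moreover have "c l \<in> carrier R" using c(1) by (auto simp: free_power_simps)
        moreover have "c = ?c \<oplus>\<^bsub>F\<^esub> c l \<odot>\<^bsub>F\<^esub> single R l"
          using c(1) by (auto simp: free_power_simps single_def fun_eq_iff)
        ultimately show ?thesis
          using 1 submodule_closed[OF F.module_axioms H(1)] by metis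
      qed
    qed
  qed
  then show "c \<in> H" using c by (auto simp: free_power_simps)
qed

text \<open>The sum inside \<open>tensor_lift\<close> for a given representative, so that linearity
  and independence of the representative can be treated separately.\<close>

definition free_lift :: "('k, 'b, 'z) module_scheme \<Rightarrow> ('a list \<Rightarrow> 'b) \<Rightarrow> ('a list \<Rightarrow> 'k) \<Rightarrow> 'b" where
  "free_lift M \<phi> c = (\<Oplus>\<^bsub>M\<^esub> l \<in> {l. c l \<noteq> \<zero>\<^bsub>R\<^esub>}. c l \<odot>\<^bsub>M\<^esub> \<phi> l)"

context
  fixes M :: "('k, 'b, 'z) module_scheme" and \<phi> :: "'a list \<Rightarrow> 'b"
  assumes M: "module R M" and \<phi>: "multilinear R V n M \<phi>"
begin
interpretation M: module R M by (rule M)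

lemma free_lift_eq:
  assumes "c \<in> carrier F" "finite S" "{l. c l \<noteq> \<zero>\<^bsub>R\<^esub>} \<subseteq> S" "S \<subseteq> L"
  shows "free_lift M \<phi> c = (\<Oplus>\<^bsub>M\<^esub> l \<in> S. c l \<odot>\<^bsub>M\<^esub> \<phi> l)"
  unfolding free_lift_def
  by (rule M.M.finsum_subset[symmetric])
    (use assms multilinear_closed[OF \<phi>] in "auto simp: free_power_simps intro!: M.smult_l_null M.smult_closed")

lemma free_lift_linear: "free_lift M \<phi> \<in> lin R F M"
proof (rule lin_mapsI)
  have cl: "c l \<odot>\<^bsub>M\<^esub> \<phi> l \<in> carrier M" "c l \<in> carrier R" if "c \<in> carrier F" "l \<in> L" for c l
    using that multilinear_closed[OF \<phi>] by (auto simp: free_power_simps)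
  fix c assume c: "c \<in> carrier F"
  let ?S = "{l. c l \<noteq> \<zero>\<^bsub>R\<^esub>}"
  have S: "finite ?S" "?S \<subseteq> L" using c by (auto simp: free_power_simps)
  show "free_lift M \<phi> c \<in> carrier M"
    unfolding free_lift_def using S cl[OF c] by (auto intro!: M.M.finsum_closed)
  show "free_lift M \<phi> (r \<odot>\<^bsub>F\<^esub> c) = r \<odot>\<^bsub>M\<^esub> free_lift M \<phi> c" if r: "r \<in> carrier R" for r
  proof -
    have "free_lift M \<phi> (r \<odot>\<^bsub>F\<^esub> c) = (\<Oplus>\<^bsub>M\<^esub> l \<in> ?S. (r \<odot>\<^bsub>F\<^esub> c) l \<odot>\<^bsub>M\<^esub> \<phi> l)"
      by (rule free_lift_eq) (use S r c F.smult_closed in "auto simp: free_power_simps(4)")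
    also have "... = (\<Oplus>\<^bsub>M\<^esub> l \<in> ?S. r \<odot>\<^bsub>M\<^esub> (c l \<odot>\<^bsub>M\<^esub> \<phi> l))"
      by (rule M.M.finsum_cong')
        (use S r cl[OF c] multilinear_closed[OF \<phi>] in "auto simp: free_power_simps(4) M.smult_assoc1")
    also have "... = r \<odot>\<^bsub>M\<^esub> free_lift M \<phi> c"
      unfolding free_lift_def
      by (rule M.finsum_smult_ldistr[symmetric]) (use S r cl[OF c] in auto)
    finally show ?thesis .
  qed
  show "free_lift M \<phi> (c \<oplus>\<^bsub>F\<^esub> d) = free_lift M \<phi> c \<oplus>\<^bsub>M\<^esub> free_lift M \<phi> d" if d: "d \<in> carrier F" for d
  proof -
    let ?T = "?S \<union> {l. d l \<noteq> \<zero>\<^bsub>R\<^esub>}"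
    have T: "finite ?T" "?T \<subseteq> L" using c d by (auto simp: free_power_simps)
    have "free_lift M \<phi> (c \<oplus>\<^bsub>F\<^esub> d) = (\<Oplus>\<^bsub>M\<^esub> l \<in> ?T. (c \<oplus>\<^bsub>F\<^esub> d) l \<odot>\<^bsub>M\<^esub> \<phi> l)"
      by (rule free_lift_eq) (use T c d F.M.add.m_closed in "auto simp: free_power_simps(3)")
    also have "... = (\<Oplus>\<^bsub>M\<^esub> l \<in> ?T. c l \<odot>\<^bsub>M\<^esub> \<phi> l \<oplus>\<^bsub>M\<^esub> d l \<odot>\<^bsub>M\<^esub> \<phi> l)"
    proof (rule M.M.finsum_cong')
      fix l assume "l \<in> ?T"
      then have "l \<in> L" using T by blast
      then show "(c \<oplus>\<^bsub>F\<^esub> d) l \<odot>\<^bsub>M\<^esub> \<phi> l = c l \<odot>\<^bsub>M\<^esub> \<phi> l \<oplus>\<^bsub>M\<^esub> d l \<odot>\<^bsub>M\<^esub> \<phi> l"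
        using cl(2)[OF c] cl(2)[OF d] multilinear_closed[OF \<phi>]
        by (simp add: free_power_simps(3) M.smult_l_distr)
    qed (use T cl[OF c] cl[OF d] in blast)+
    also have "... = (\<Oplus>\<^bsub>M\<^esub> l \<in> ?T. c l \<odot>\<^bsub>M\<^esub> \<phi> l) \<oplus>\<^bsub>M\<^esub> (\<Oplus>\<^bsub>M\<^esub> l \<in> ?T. d l \<odot>\<^bsub>M\<^esub> \<phi> l)"
      by (rule M.M.finsum_addf) (use T cl[OF c] cl[OF d] in blast)+
    also have "... = free_lift M \<phi> c \<oplus>\<^bsub>M\<^esub> free_lift M \<phi> d"
      by (intro arg_cong2[where f = "add M"] free_lift_eq[symmetric]) (use T c d in auto)
    finally show ?thesis .
  qed
qed

lemma free_lift_single: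
  assumes "xs \<in> L"
  shows "free_lift M \<phi> (single R xs) = \<phi> xs"
proof -
  have "\<phi> xs \<in> carrier M" using assms multilinear_closed[OF \<phi>] by auto
  then show ?thesis
    by (subst free_lift_eq[of _ "{xs}"])
      (use assms single_closed in "auto simp: M.M.finsum_insert single_def")
qed

end

private abbreviation (input) "N \<equiv> tensor_relations R V n"

lemma relations_submodule: "submodule N R F"
  unfolding tensor_relations_def
proof (rule generated_submodule[OF module_free_power], intro subsetI, elim UnE CollectE exE conjE)
  fix c us x y vs
  assume "c = single R (us @ [x \<oplus>\<^bsub>V\<^esub> y] @ vs) \<ominus>\<^bsub>F\<^esub> single R (us @ [x] @ vs)
      \<ominus>\<^bsub>F\<^esub> single R (us @ [y] @ vs)"
    and "length us + 1 + length vs = n" "over V us" "over V vs"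
      "x \<in> carrier V" "y \<in> carrier V"
  then show "c \<in> carrier F"
    by (simp only:) (intro F.M.minus_closed single_closed; simp)
next
  fix c us r x vs
  assume "c = single R (us @ [r \<odot>\<^bsub>V\<^esub> x] @ vs) \<ominus>\<^bsub>F\<^esub> r \<odot>\<^bsub>F\<^esub> single R (us @ [x] @ vs)"
    and "length us + 1 + length vs = n" "over V us" "over V vs"
      "r \<in> carrier R" "x \<in> carrier V"
  then show "c \<in> carrier F"
    by (simp only:) (intro F.M.minus_closed F.smult_closed single_closed; simp)
qed

text \<open>The kernel of the linear map is a submodule, so only the generators matter; on them the
  claim is additivity and homogeneity of \<phi> in the slot between \<open>us\<close> and
  \<open>vs\<close>.\<close>

lemma free_lift_relations:
  fixes M :: "('k, 'b, 'z) module_scheme"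
  assumes M: "module R M" and \<phi>: "multilinear R V n M \<phi>" and c: "c \<in> N"
  shows "free_lift M \<phi> c = \<zero>\<^bsub>M\<^esub>"
proof -
  interpret M: module R M by fact
  note lin = free_lift_linear[OF M \<phi>]
  note lins = lin_minus[OF module_free_power M lin] lin_smult[OF lin]
    free_lift_single[OF M \<phi>] single_closed lin_closed[OF lin] F.M.minus_closed
  let ?H = "{c \<in> carrier F. free_lift M \<phi> c = \<zero>\<^bsub>M\<^esub>}"
  have H: "submodule ?H R F"
    by (rule submodule_equalizer[OF module_free_power M lin lin_zero_map[OF module_free_power M]])
  have "N \<subseteq> ?H"
    unfolding tensor_relations_def
  proof (rule generated_submodule_least[OF H], intro subsetI, elim UnE CollectE exE conjE)
    fix c us x y vs
    assume c: "c = single R (us @ [x \<oplus>\<^bsub>V\<^esub> y] @ vs) \<ominus>\<^bsub>F\<^esub> single R (us @ [x] @ vs)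
        \<ominus>\<^bsub>F\<^esub> single R (us @ [y] @ vs)"
      and n: "length us + 1 + length vs = n" and us: "over V us" and vs: "over V vs"
      and x: "x \<in> carrier V" and y: "y \<in> carrier V"
    have s: "us @ [z] @ vs \<in> L" if "z \<in> carrier V" for z using n us vs that by auto
    have n': "n = Suc (length us + length vs)" using n by simp
    note sl = multilinear_slot[OF \<phi> n' us vs]
    have "free_lift M \<phi> c = \<phi> (us @ [x \<oplus>\<^bsub>V\<^esub> y] @ vs) \<ominus>\<^bsub>M\<^esub> \<phi> (us @ [x] @ vs) \<ominus>\<^bsub>M\<^esub> \<phi> (us @ [y] @ vs)"
      unfolding c using lins s x y by (simp del: append_Cons append.simps)
    also have "... = \<zero>\<^bsub>M\<^esub>"
      using lin_add[OF sl x y] lin_closed[OF sl x] lin_closed[OF sl y]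
      by (simp add: M.M.add_minus_cancel M.M.minus_eq_zero_iff)
    finally have "free_lift M \<phi> c = \<zero>\<^bsub>M\<^esub>" .
    moreover have "c \<in> carrier F"
      unfolding c by (intro F.M.minus_closed single_closed s V.M.a_closed x y)
    ultimately show "c \<in> ?H" by simp
  next
    fix c us r x vs
    assume c: "c = single R (us @ [r \<odot>\<^bsub>V\<^esub> x] @ vs) \<ominus>\<^bsub>F\<^esub> r \<odot>\<^bsub>F\<^esub> single R (us @ [x] @ vs)"
      and n: "length us + 1 + length vs = n" and us: "over V us" and vs: "over V vs"
      and x: "x \<in> carrier V" and r: "r \<in> carrier R"
    have s: "us @ [z] @ vs \<in> L" if "z \<in> carrier V" for z using n us vs that by auto
    have n': "n = Suc (length us + length vs)" using n by simp
    note sl = multilinear_slot[OF \<phi> n' us vs]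
    have "free_lift M \<phi> c = \<phi> (us @ [r \<odot>\<^bsub>V\<^esub> x] @ vs) \<ominus>\<^bsub>M\<^esub> r \<odot>\<^bsub>M\<^esub> \<phi> (us @ [x] @ vs)"
      unfolding c using lins s x r by (simp del: append_Cons append.simps)
    also have "... = \<zero>\<^bsub>M\<^esub>"
      using lin_smult[OF sl r x] lin_closed[OF sl x] r
      by (simp add: a_minus_def M.M.r_neg)
    finally have "free_lift M \<phi> c = \<zero>\<^bsub>M\<^esub>" .
    moreover have "c \<in> carrier F"
      unfolding c by (intro F.M.minus_closed F.smult_closed single_closed s V.smult_closed x r)
    ultimately show "c \<in> ?H" by simp
  qed
  then show ?thesis using c by blast
qed

end

text \<open>The module axioms see only carrier, addition, zero and scalar multiplication, so they
  pass between records that differ in other fields such as the grading.\<close>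

lemma module_transfer:
  fixes M :: "('k, 'a, 'y) module_scheme" and M' :: "('k, 'a, 'z) module_scheme"
  assumes "module R M" "carrier M' = carrier M" "add M' = add M" "zero M' = zero M" "smult M' = smult M"
  shows "module R M'"
proof -
  interpret module R M by fact
  show ?thesis
  proof (rule moduleI)
    show "abelian_group M'"
      by (rule abelian_groupI) (auto simp: assms M.a_ac intro!: bexI[of _ "\<ominus>\<^bsub>M\<^esub> _"] M.l_neg)
  qed (auto simp: assms smult_l_distr smult_r_distr smult_assoc1 is_cring)
qed

section \<open>Quotients of modules as sets of cosets\<close>

context
  fixes R :: "'k ring" and F :: "('k, 'c) module" and N :: "'c set"
  assumes F: "module R F" and N: "submodule N R F"
begin
interpretation F: module R F by (rule F)

lemma quotient_abelian_subgroup: "abelian_subgroup N F"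
  by (rule abelian_subgroupI3)
    (use N F.abelian_group_axioms in "auto simp: additive_subgroup_def submodule_def")

interpretation N: abelian_subgroup N F by (rule quotient_abelian_subgroup)

private abbreviation (input) "Q4 \<equiv> quotient_module F N"

lemma quotient_carrier: "carrier Q4 = (\<lambda>c. N +>\<^bsub>F\<^esub> c) ` carrier F"
  by (auto simp: quotient_module_def A_RCOSETS_def')

lemma quotient_add: "c \<in> carrier F \<Longrightarrow> d \<in> carrier F \<Longrightarrow>
    (N +>\<^bsub>F\<^esub> c) \<oplus>\<^bsub>Q4\<^esub> (N +>\<^bsub>F\<^esub> d) = N +>\<^bsub>F\<^esub> (c \<oplus>\<^bsub>F\<^esub> d)"
  by (simp add: quotient_module_def N.a_rcos_sum)

text \<open>For a non-invertible \<open>r\<close> the multiples of the elements of a coset may form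
  less than a coset; the summand from \<open>N\<close> in the definition fills it up.\<close>

lemma quotient_smult:
  assumes r: "r \<in> carrier R" and c: "c \<in> carrier F"
  shows "r \<odot>\<^bsub>Q4\<^esub> (N +>\<^bsub>F\<^esub> c) = N +>\<^bsub>F\<^esub> (r \<odot>\<^bsub>F\<^esub> c)"
proof -
  note cl = submodule_closed[OF F N]
  have "{r \<odot>\<^bsub>F\<^esub> x \<oplus>\<^bsub>F\<^esub> n | x n. x \<in> N +>\<^bsub>F\<^esub> c \<and> n \<in> N} = N +>\<^bsub>F\<^esub> (r \<odot>\<^bsub>F\<^esub> c)"
  proof (intro equalityI subsetI)
    fix y assume "y \<in> {r \<odot>\<^bsub>F\<^esub> x \<oplus>\<^bsub>F\<^esub> n | x n. x \<in> N +>\<^bsub>F\<^esub> c \<and> n \<in> N}"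
    then obtain m n where mn: "m \<in> N" "n \<in> N" "y = r \<odot>\<^bsub>F\<^esub> (m \<oplus>\<^bsub>F\<^esub> c) \<oplus>\<^bsub>F\<^esub> n"
      by (auto simp: a_r_coset_def')
    have "m \<in> carrier F" "n \<in> carrier F" using mn cl(1) by auto
    then have "y = (r \<odot>\<^bsub>F\<^esub> m \<oplus>\<^bsub>F\<^esub> n) \<oplus>\<^bsub>F\<^esub> r \<odot>\<^bsub>F\<^esub> c"
      using mn(3) r c by (simp add: F.smult_r_distr F.M.a_ac)
    moreover have "r \<odot>\<^bsub>F\<^esub> m \<oplus>\<^bsub>F\<^esub> n \<in> N" using mn r cl by auto
    ultimately show "y \<in> N +>\<^bsub>F\<^esub> (r \<odot>\<^bsub>F\<^esub> c)" by (auto simp: a_r_coset_def')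
  next
    fix y assume "y \<in> N +>\<^bsub>F\<^esub> (r \<odot>\<^bsub>F\<^esub> c)"
    then obtain n where n: "n \<in> N" "y = n \<oplus>\<^bsub>F\<^esub> r \<odot>\<^bsub>F\<^esub> c" by (auto simp: a_r_coset_def')
    then have "n \<in> carrier F" using cl(1) by auto
    then have "y = r \<odot>\<^bsub>F\<^esub> (\<zero>\<^bsub>F\<^esub> \<oplus>\<^bsub>F\<^esub> c) \<oplus>\<^bsub>F\<^esub> n"
      using n r c by (simp add: F.M.a_comm)
    moreover have "\<zero>\<^bsub>F\<^esub> \<oplus>\<^bsub>F\<^esub> c \<in> N +>\<^bsub>F\<^esub> c" using cl(2) by (auto simp: a_r_coset_def')
    ultimately show "y \<in> {r \<odot>\<^bsub>F\<^esub> x \<oplus>\<^bsub>F\<^esub> n | x n. x \<in> N +>\<^bsub>F\<^esub> c \<and> n \<in> N}"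
      using n(1) by blast
  qed
  then show ?thesis by (simp add: quotient_module_def)
qed

lemma quotient_zero: "N +>\<^bsub>F\<^esub> \<zero>\<^bsub>F\<^esub> = \<zero>\<^bsub>Q4\<^esub>"
  using N.a_subset by (simp add: quotient_module_def)

lemma quotient_eqI: "c \<in> carrier F \<Longrightarrow> d \<in> carrier F \<Longrightarrow> c \<ominus>\<^bsub>F\<^esub> d \<in> N \<Longrightarrow> N +>\<^bsub>F\<^esub> c = N +>\<^bsub>F\<^esub> d"
  using N.a_rcos_module[of d c] F.M.a_repr_independence[of c N d] N.a_subgroup
  by (simp add: a_minus_def)

lemma module_quotient: "module R Q4"
proof (rule moduleI)
  show "abelian_group Q4"
  proof (rule abelian_groupI)
    fix X assume "X \<in> carrier Q4"
    then obtain c where c: "c \<in> carrier F" "X = N +>\<^bsub>F\<^esub> c" by (auto simp: quotient_carrier)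
    show "\<exists>Y \<in> carrier Q4. Y \<oplus>\<^bsub>Q4\<^esub> X = \<zero>\<^bsub>Q4\<^esub>"
      by (rule bexI[of _ "N +>\<^bsub>F\<^esub> (\<ominus>\<^bsub>F\<^esub> c)"])
        (use c in "auto simp: quotient_carrier quotient_add F.M.l_neg quotient_zero")
  qed (auto simp: quotient_carrier quotient_add F.M.a_ac simp flip: quotient_zero)
qed (auto simp: quotient_carrier quotient_add quotient_smult F.is_cring
    F.smult_l_distr F.smult_r_distr F.smult_assoc1)

lemma quotient_linear: "(\<lambda>c. N +>\<^bsub>F\<^esub> c) \<in> lin R F Q4"
  by (rule lin_mapsI) (auto simp: quotient_carrier quotient_add quotient_smult)

end

section \<open>The universal property of the tensor powers\<close>

lemma tensor_power_simps:
  "carrier (tpow R V n) = carrier (quotient_module (free_power R V n) (tensor_relations R V n))"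
  "add (tpow R V n) = add (quotient_module (free_power R V n) (tensor_relations R V n))"
  "zero (tpow R V n) = zero (quotient_module (free_power R V n) (tensor_relations R V n))"
  "smult (tpow R V n) = smult (quotient_module (free_power R V n) (tensor_relations R V n))"
  by (auto simp: tensor_power_def Let_def)

context
  fixes R :: "'k ring" and V :: "('k, 'a, 'y) gmodule_scheme"
  assumes V: "module R V"
begin
interpretation V: module R V by (rule V)

lemma module_tpow: "module R (tpow R V n)"
  by (rule module_transfer[OF module_quotient[OF module_free_power[OF V] relations_submodule[OF V]]])
    (simp_all add: tensor_power_simps)

lemma coset_linear: "(\<lambda>c. tensor_relations R V n +>\<^bsub>free_power R V n\<^esub> c)
    \<in> lin R (free_power R V n) (tpow R V n)"
  using quotient_linear[OF module_free_power[OF V] relations_submodule[OF V], of n]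
  by (simp add: linear_maps_def tensor_power_simps)

text \<open>Additivity and homogeneity in one slot are the two families of generators of the
  relations, read in the quotient.\<close>

lemma tensor_multilinear: "multilinear R V n (tpow R V n) (tensor R V)"
proof -
  interpret F: module R "free_power R V n" by (rule module_free_power[OF V])
  let ?p = "\<lambda>c. tensor_relations R V n +>\<^bsub>free_power R V n\<^esub> c"
  let ?s = "single R :: 'a list \<Rightarrow> 'a list \<Rightarrow> 'k"
  note rel = generated_submodule_incl[of _ R "free_power R V n", THEN subsetD]
  have s: "?s xs \<in> carrier (free_power R V n)" if "length xs = n" "over V xs" for xs
    using that by (auto intro: single_closed[OF V])
  note eqI = quotient_eqI[OF module_free_power[OF V] relations_submodule[OF V]]
  show ?thesis
  proof (rule multilinearI)
    fix xs assume "length xs = n" "over V xs"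
    then show "tensor R V xs \<in> carrier (tpow R V n)"
      using lin_closed[OF coset_linear s] by (auto simp: tensor_def)
  next
    fix us vs :: "'a list" assume n: "n = Suc (length us + length vs)"
      and us: "over V us" and vs: "over V vs"
    have s: "?s (us @ [x] @ vs) \<in> carrier (free_power R V n)" if "x \<in> carrier V" for x
      using s n us vs that by auto
    have t: "tensor R V (us @ x # vs) = ?p (?s (us @ [x] @ vs))" for x
      by (simp add: tensor_def n)
    show "(\<lambda>x. tensor R V (us @ x # vs)) \<in> lin R V (tpow R V n)"
    proof (rule lin_mapsI)
      fix x assume x: "x \<in> carrier V"
      show "tensor R V (us @ x # vs) \<in> carrier (tpow R V n)"
        unfolding t by (rule lin_closed[OF coset_linear s[OF x]])
      show "tensor R V (us @ (x \<oplus>\<^bsub>V\<^esub> y) # vs) =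
          tensor R V (us @ x # vs) \<oplus>\<^bsub>tpow R V n\<^esub> tensor R V (us @ y # vs)"
        if y: "y \<in> carrier V" for y
      proof -
        have "?s (us @ [x \<oplus>\<^bsub>V\<^esub> y] @ vs) \<ominus>\<^bsub>free_power R V n\<^esub> ?s (us @ [x] @ vs)
            \<ominus>\<^bsub>free_power R V n\<^esub> ?s (us @ [y] @ vs) \<in> tensor_relations R V n"
          unfolding tensor_relations_def by (rule rel) (use n us vs x y in fastforce)
        \<comment> \<open>\<open>eqI\<close> compares two elements through their difference, so the
          generator is rewritten as one element minus a sum.\<close>
        also have "?s (us @ [x \<oplus>\<^bsub>V\<^esub> y] @ vs) \<ominus>\<^bsub>free_power R V n\<^esub> ?s (us @ [x] @ vs)
            \<ominus>\<^bsub>free_power R V n\<^esub> ?s (us @ [y] @ vs) =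
          ?s (us @ [x \<oplus>\<^bsub>V\<^esub> y] @ vs) \<ominus>\<^bsub>free_power R V n\<^esub>
            (?s (us @ [x] @ vs) \<oplus>\<^bsub>free_power R V n\<^esub> ?s (us @ [y] @ vs))"
          using s x y by (simp add: a_minus_def F.M.minus_add F.M.a_assoc del: append_Cons append.simps)
        finally have "tensor R V (us @ (x \<oplus>\<^bsub>V\<^esub> y) # vs) =
            ?p (?s (us @ [x] @ vs) \<oplus>\<^bsub>free_power R V n\<^esub> ?s (us @ [y] @ vs))"
          unfolding t by (rule eqI[rotated 2]) (use s x y in auto)
        then show ?thesis
          unfolding t using lin_add[OF coset_linear s s] x y by simp
      qed
      show "tensor R V (us @ (r \<odot>\<^bsub>V\<^esub> x) # vs) = r \<odot>\<^bsub>tpow R V n\<^esub> tensor R V (us @ x # vs)"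
        if r: "r \<in> carrier R" for r
      proof -
        have "?s (us @ [r \<odot>\<^bsub>V\<^esub> x] @ vs) \<ominus>\<^bsub>free_power R V n\<^esub> r \<odot>\<^bsub>free_power R V n\<^esub> ?s (us @ [x] @ vs)
            \<in> tensor_relations R V n"
          unfolding tensor_relations_def by (rule rel) (use n us vs x r in fastforce)
        then have "tensor R V (us @ (r \<odot>\<^bsub>V\<^esub> x) # vs) = ?p (r \<odot>\<^bsub>free_power R V n\<^esub> ?s (us @ [x] @ vs))"
          unfolding t by (rule eqI[rotated 2]) (use s x r in auto)
        then show ?thesis
          unfolding t using lin_smult[OF coset_linear r s] x by simp
      qed
    qed
  qed
qed

lemma tensor_closed:
  "length xs = n \<Longrightarrow> over V xs \<Longrightarrow> tensor R V xs \<in> carrier (tpow R V n)"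
  using multilinear_closed[OF tensor_multilinear] by blast

lemma tensor_power_span:
  assumes H: "submodule H R (tpow R V n)"
    and t: "\<And>xs. length xs = n \<Longrightarrow> over V xs \<Longrightarrow> tensor R V xs \<in> H"
  shows "carrier (tpow R V n) \<subseteq> H"
proof
  fix X assume "X \<in> carrier (tpow R V n)"
  then obtain c where c: "c \<in> carrier (free_power R V n)"
    "X = tensor_relations R V n +>\<^bsub>free_power R V n\<^esub> c"
    unfolding tensor_power_simps quotient_carrier[OF module_free_power[OF V] relations_submodule[OF V]]
    by auto
  let ?H = "{c \<in> carrier (free_power R V n). tensor_relations R V n +>\<^bsub>free_power R V n\<^esub> c \<in> H}"
  have "carrier (free_power R V n) \<subseteq> ?H"
  proof (rule free_power_span[OF V])
    show "submodule ?H R (free_power R V n)"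
      by (rule submodule_preimage[OF module_free_power[OF V] module_tpow coset_linear H])
  qed (use t single_closed[OF V] in "auto simp: tensor_def")
  then show "X \<in> H" using c by auto
qed

lemma tensor_ext:
  assumes "module R M" "f \<in> tlin R V n M" "g \<in> tlin R V n M"
    and "\<And>xs. length xs = n \<Longrightarrow> over V xs \<Longrightarrow> f (tensor R V xs) = g (tensor R V xs)"
    and "X \<in> carrier (tpow R V n)"
  shows "f X = g X"
  using tensor_power_span[OF submodule_equalizer[OF module_tpow assms(1-3)]] assms(4,5) tensor_closed
  by auto

context
  fixes M :: "('k, 'b, 'z) module_scheme" and n and \<phi> :: "'a list \<Rightarrow> 'b"
  assumes M: "module R M" and \<phi>: "multilinear R V n M \<phi>"
begin
text \<open>The representative picked by \<open>SOME\<close> differs from \<open>c\<close> by a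
  relation, and \<open>free_lift\<close> vanishes on relations.\<close>

lemma tensor_lift_coset:
  assumes c: "c \<in> carrier (free_power R V n)"
  shows "tensor_lift R M \<phi> (tensor_relations R V n +>\<^bsub>free_power R V n\<^esub> c) = free_lift R M \<phi> c"
proof -
  interpret M: module R M by fact
  interpret F: module R "free_power R V n" by (rule module_free_power[OF V])
  let ?X = "tensor_relations R V n +>\<^bsub>free_power R V n\<^esub> c"
  note lin = free_lift_linear[OF V M \<phi>]
  have "c \<in> ?X"
    using abelian_subgroup.a_rcos_self[OF quotient_abelian_subgroup[OF module_free_power[OF V]
          relations_submodule[OF V]] c] .
  then have "(SOME c. c \<in> ?X) \<in> ?X" by (rule someI[of "\<lambda>c. c \<in> ?X"])
  then obtain m where m: "m \<in> tensor_relations R V n" "(SOME c. c \<in> ?X) = m \<oplus>\<^bsub>free_power R V n\<^esub> c"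
    by (auto simp: a_r_coset_def')
  then have "m \<in> carrier (free_power R V n)"
    using submodule_closed(1)[OF module_free_power[OF V] relations_submodule[OF V]] by auto
  then have "free_lift R M \<phi> (SOME c. c \<in> ?X) = free_lift R M \<phi> c"
    using free_lift_relations[OF V M \<phi> m(1)] c lin_closed[OF lin]
    by (simp add: m(2) lin_add[OF lin])
  then show ?thesis
    by (simp add: tensor_lift_def free_lift_def[OF V] Let_def)
qed

lemma tensor_lift_tensor:
  assumes "length xs = n" "over V xs"
  shows "tensor_lift R M \<phi> (tensor R V xs) = \<phi> xs"
  using tensor_lift_coset[of "single R xs"] free_lift_single[OF V M \<phi>] single_closed[OF V] assms
  by (auto simp: tensor_def)

lemma tensor_lift_linear: "tensor_lift R M \<phi> \<in> tlin R V n M"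
proof -
  interpret F: module R "free_power R V n" by (rule module_free_power[OF V])
  note lin = free_lift_linear[OF V M \<phi>]
  have ex: "\<exists>c \<in> carrier (free_power R V n). X = tensor_relations R V n +>\<^bsub>free_power R V n\<^esub> c"
    if "X \<in> carrier (tpow R V n)" for X
    using that unfolding tensor_power_simps
      quotient_carrier[OF module_free_power[OF V] relations_submodule[OF V]] by auto
  show ?thesis
  proof (rule lin_mapsI)
    fix X assume "X \<in> carrier (tpow R V n)"
    then obtain c where c: "c \<in> carrier (free_power R V n)"
      "X = tensor_relations R V n +>\<^bsub>free_power R V n\<^esub> c" using ex by blast
    show "tensor_lift R M \<phi> X \<in> carrier M"
      using c lin_closed[OF lin] by (simp add: tensor_lift_coset)
    show "tensor_lift R M \<phi> (r \<odot>\<^bsub>tpow R V n\<^esub> X) = r \<odot>\<^bsub>M\<^esub> tensor_lift R M \<phi> X"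
      if "r \<in> carrier R" for r
      using c that lin_smult[OF coset_linear that c(1)] lin_smult[OF lin]
      by (simp add: tensor_lift_coset flip: lin_smult[OF coset_linear])
    show "tensor_lift R M \<phi> (X \<oplus>\<^bsub>tpow R V n\<^esub> Y) = tensor_lift R M \<phi> X \<oplus>\<^bsub>M\<^esub> tensor_lift R M \<phi> Y"
      if Y: "Y \<in> carrier (tpow R V n)" for Y
    proof -
      obtain d where d: "d \<in> carrier (free_power R V n)"
        "Y = tensor_relations R V n +>\<^bsub>free_power R V n\<^esub> d" using ex[OF Y] by blast
      show ?thesis
        using c d lin_add[OF lin] by (simp add: tensor_lift_coset flip: lin_add[OF coset_linear])
    qed
  qed
qed

end

end

lemma untensor:
  assumes "module R V"
  shows "untensor R V \<in> tlin R V 1 V"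
    and "x \<in> carrier V \<Longrightarrow> untensor R V (tensor R V [x]) = x"
proof -
  interpret module R V by fact
  have "multilinear R V 1 V hd"
    by (rule multilinearI) (auto simp: length_Suc_conv lin_id[OF assms])
  from tensor_lift_linear[OF assms assms this] tensor_lift_tensor[OF assms assms this, of "[x]"]
  show "untensor R V \<in> tlin R V 1 V"
    and "x \<in> carrier V \<Longrightarrow> untensor R V (tensor R V [x]) = x"
    by (auto simp: untensor_def)
qed

lemma multilinear_zero_entry:
  assumes "module R V" "module R M" "multilinear R V n M \<phi>"
    and "length xs = n" "over V xs" "\<zero>\<^bsub>V\<^esub> \<in> set xs"
  shows "\<phi> xs = \<zero>\<^bsub>M\<^esub>"
proof -
  obtain us vs where xs: "xs = us @ \<zero>\<^bsub>V\<^esub> # vs" using assms(6) by (meson split_list)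
  show ?thesis
    using lin_zero[OF assms(1,2) multilinear_slot[OF assms(3), of us vs]] assms(4,5) by (simp add: xs)
qed

text \<open>The entries are freed one at a time. With the earlier entries in \<open>S\<close> and
  the later ones arbitrary, the admissible values of a slot form a submodule containing
  \<open>S\<close>, hence are everything. It is applied with \<open>S\<close> the homogeneous
  elements, and with the reduced elements together with the unit.\<close>

lemma list_span_induct:
  assumes S: "S \<subseteq> carrier V" "\<And>H. submodule H R V \<Longrightarrow> S \<subseteq> H \<Longrightarrow> carrier V \<subseteq> H"
    and sub: "\<And>us vs. n = Suc (length us + length vs) \<Longrightarrow> over V us \<Longrightarrow> over V vs \<Longrightarrow>
        submodule {x \<in> carrier V. P (us @ x # vs)} R V"
    and base: "\<And>xs. length xs = n \<Longrightarrow> set xs \<subseteq> S \<Longrightarrow> P xs"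
    and xs: "length xs = n" "over V xs"
  shows "P xs"
proof -
  have "P (us @ vs)" if "length us + length vs = n" "set us \<subseteq> S" "over V vs" for us vs
    using that
  proof (induction vs arbitrary: us)
    case Nil
    then show ?case using base by simp
  next
    case (Cons v vs)
    let ?H = "{x \<in> carrier V. P (us @ x # vs)}"
    have "submodule ?H R V" using Cons.prems S(1) by (intro sub) auto
    moreover have "S \<subseteq> ?H" using Cons.IH[of "us @ [_]"] Cons.prems S by auto
    ultimately have "carrier V \<subseteq> ?H" by (rule S(2))
    then show ?case using Cons.prems by auto
  qed
  from this[of "[]" xs] show ?thesis using xs by simp
qed

lemma multilinear_ext:
  assumes V: "module R V" and M: "module R M"
    and \<phi>: "multilinear R V n M \<phi>" and \<psi>: "multilinear R V n M \<psi>"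
    and S: "S \<subseteq> carrier V" "\<And>H. submodule H R V \<Longrightarrow> S \<subseteq> H \<Longrightarrow> carrier V \<subseteq> H"
    and eq: "\<And>xs. length xs = n \<Longrightarrow> set xs \<subseteq> S \<Longrightarrow> \<phi> xs = \<psi> xs"
    and xs: "length xs = n" "over V xs"
  shows "\<phi> xs = \<psi> xs"
  by (rule list_span_induct[OF S _ eq xs])
    (auto intro!: submodule_equalizer[OF V M] multilinear_slot[OF \<phi>] multilinear_slot[OF \<psi>])

lemma multilinear_mem:
  assumes V: "module R V" and M: "module R M" and \<phi>: "multilinear R V n M \<phi>" and H: "submodule H R M"
    and S: "S \<subseteq> carrier V" "\<And>H. submodule H R V \<Longrightarrow> S \<subseteq> H \<Longrightarrow> carrier V \<subseteq> H"
    and mem: "\<And>xs. length xs = n \<Longrightarrow> set xs \<subseteq> S \<Longrightarrow> \<phi> xs \<in> H"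
    and xs: "length xs = n" "over V xs"
  shows "\<phi> xs \<in> H"
  by (rule list_span_induct[OF S _ mem xs])
    (auto intro!: submodule_preimage[OF V M _ H] multilinear_slot[OF \<phi>])

section \<open>Suspension, ground module and homogeneous lists\<close>

lemma susp_simps [simp]:
  "carrier (susp M) = carrier M" "add (susp M) = add M" "zero (susp M) = zero M"
  "smult (susp M) = smult M" "grade (susp M) n = grade M (n - 1)"
  by (auto simp: susp_def)

lemma finsum_susp [simp]: "finsum (susp M) = finsum M"
  and a_inv_susp [simp]: "a_inv (susp M) = a_inv M"
  and a_minus_susp [simp]: "a_minus (susp M) = a_minus M"
  by (simp_all add: finsum_def a_inv_def a_minus_def fun_eq_iff)

lemma linear_maps_susp [simp]:
  "lin R (susp M) N = lin R M N" "lin R N (susp M) = lin R N M"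
  by (auto simp: linear_maps_def)

lemma multilinear_susp [simp]:
  "multilinear R (susp V) n N = multilinear R V n N" "multilinear R W n (susp V) = multilinear R W n V"
  by (auto simp: multilinear_def fun_eq_iff)

lemma submodule_susp [simp]: "submodule H R (susp M) = submodule H R M"
  by (simp add: submodule_def submodule_axioms_def)

lemma module_susp: "module R M \<Longrightarrow> module R (susp M)"
  by (rule module_transfer) auto

lemma decomposition_susp: "decomposition (susp M) c x \<longleftrightarrow> decomposition M (\<lambda>i. c (i + 1)) x"
  if "module R M" "\<And>i. submodule (grade M i) R M"
proof -
  interpret module R M by fact
  have img: "{i. c i \<noteq> \<zero>\<^bsub>M\<^esub>} = (\<lambda>i. i + 1) ` {i. c (i + 1) \<noteq> \<zero>\<^bsub>M\<^esub>}"
    by (auto simp: image_iff) (metis diff_add_cancel)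
  have gr: "(\<forall>i. c i \<in> grade M (i - 1)) \<longleftrightarrow> (\<forall>i. c (i + 1) \<in> grade M i)"
    by (metis add_diff_cancel_right' diff_add_cancel)
  have fin: "finite {i. c i \<noteq> \<zero>\<^bsub>M\<^esub>} \<longleftrightarrow> finite {i. c (i + 1) \<noteq> \<zero>\<^bsub>M\<^esub>}"
    unfolding img by (rule finite_image_iff) (auto simp: inj_on_def)
  have "(\<Oplus>\<^bsub>M\<^esub>i\<in>{i. c i \<noteq> \<zero>\<^bsub>M\<^esub>}. c i) = (\<Oplus>\<^bsub>M\<^esub>i\<in>{i. c (i + 1) \<noteq> \<zero>\<^bsub>M\<^esub>}. c (i + 1))"
    if "\<forall>i. c (i + 1) \<in> grade M i"
  proof -
    have "c i \<in> carrier M" for i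
      using that[rule_format, of "i - 1"] submodule_closed(1)[OF \<open>module R M\<close> \<open>\<And>i. submodule (grade M i) R M\<close>]
      by auto
    then show ?thesis
      unfolding img by (subst M.finsum_reindex) (auto simp: inj_on_def)
  qed
  then show ?thesis by (auto simp: decomposition_def gr fin)
qed

lemma graded_module_susp: "graded_module R M \<Longrightarrow> graded_module R (susp M)"
proof -
  assume M: "graded_module R M"
  note M' = graded_moduleD[OF M]
  show "graded_module R (susp M)"
  proof (rule graded_moduleI[OF module_susp[OF M'(1)]])
    show "submodule (grade (susp M) i) R (susp M)" for i using M'(2) by simp
    show "carrier (susp M) \<subseteq> H" if "submodule H R (susp M)" "\<And>i. grade (susp M) i \<subseteq> H" for H
      using graded_span[OF M, of H] that(1) that(2)[of "_ + 1"] by auto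
    fix c i assume "decomposition (susp M) c \<zero>\<^bsub>susp M\<^esub>"
    then have "decomposition M (\<lambda>i. c (i + 1)) \<zero>\<^bsub>M\<^esub>" by (simp add: decomposition_susp[OF M'])
    moreover have "decomposition M (\<lambda>i. \<zero>\<^bsub>M\<^esub>) \<zero>\<^bsub>M\<^esub>"
      using decomposition_homogeneous[OF M' submodule_closed(2)[OF M']] by (simp add: if_distrib cong: if_cong)
    ultimately have "(\<lambda>i. c (i + 1)) = (\<lambda>i. \<zero>\<^bsub>M\<^esub>)" by (rule decomposition_unique[OF M])
    from fun_cong[OF this, of "i - 1"] show "c i = \<zero>\<^bsub>susp M\<^esub>" by simp
  qed
qed

text \<open>An element of degree i has degree i + 1 in the suspension, so its sign changes. This
  reconciles \<open>mu_su\<close>, which uses the degree in the module, with the sign rule on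
  tensors, which uses the degree in the suspension.\<close>

lemma koszul_susp:
  assumes "graded_module R M" "x \<in> carrier M"
  shows "koszul (susp M) (-1) x = \<ominus>\<^bsub>M\<^esub> koszul M 1 x"
proof -
  note M' = graded_moduleD(1)[OF assms(1)]
  interpret module R M by fact
  show ?thesis
  proof (rule graded_ext[OF assms(1) M' _ _ _ assms(2)])
    show "koszul (susp M) (-1) \<in> lin R M M"
      using koszul_linear[OF graded_module_susp[OF assms(1)]] by simp
    show "(\<lambda>x. \<ominus>\<^bsub>M\<^esub> koszul M 1 x) \<in> lin R M M"
      by (rule lin_neg_map[OF M' M' koszul_linear[OF assms(1)]])
    fix i x assume x: "x \<in> grade M i"
    then have "x \<in> grade (susp M) (i + 1)" by simp
    then show "koszul (susp M) (-1) x = \<ominus>\<^bsub>M\<^esub> koszul M 1 x"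
      using koszul_homogeneous[OF graded_module_susp[OF assms(1)], of x "i + 1"]
        koszul_homogeneous[OF assms(1) x] grade_closed[OF assms(1) x] by auto
  qed
qed

lemma ground_simps [simp]:
  "carrier (ground R) = carrier R" "add (ground R) = add R" "zero (ground R) = zero R"
  "smult (ground R) = mult R" "grade (ground R) i = (if i = 0 then carrier R else {\<zero>\<^bsub>R\<^esub>})"
  by (auto simp: ground_def)

lemma a_inv_ground: "cring R \<Longrightarrow> x \<in> carrier R \<Longrightarrow> a_inv (ground R) x = \<ominus>\<^bsub>R\<^esub> x"
proof -
  assume R: "cring R" and x: "x \<in> carrier R"
  interpret R: cring R by fact
  interpret G: module R "ground R" by (rule module_ground[OF R])
  show ?thesis using G.M.minus_equality[of "\<ominus>\<^bsub>R\<^esub> x" x] x by (simp add: R.l_neg)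
qed

lemma homogeneous_span:
  assumes "graded_module R V"
  shows "(\<Union>i. grade V i) \<subseteq> carrier V"
    and "submodule H R V \<Longrightarrow> (\<Union>i. grade V i) \<subseteq> H \<Longrightarrow> carrier V \<subseteq> H"
proof -
  show "(\<Union>i. grade V i) \<subseteq> carrier V" using grade_closed[OF assms] by auto
  show "carrier V \<subseteq> H" if "submodule H R V" "(\<Union>i. grade V i) \<subseteq> H"
    using graded_span[OF assms that(1)] that(2) by auto
qed

lemma homogeneous_list:
  "set xs \<subseteq> (\<Union>i. grade V i) \<longleftrightarrow> (\<exists>ds. homogeneous V xs ds)"
proof (induction xs)
  case (Cons x xs)
  then show ?case by (auto simp: list_all2_Cons1)
qed simp

lemma homogeneous_list_carrier:
  assumes "graded_module R V" "homogeneous V xs ds"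
  shows "over V xs"
proof -
  have "set xs \<subseteq> (\<Union>i. grade V i)" unfolding homogeneous_list using assms(2) by blast
  then show ?thesis using homogeneous_span(1)[OF assms(1)] by (rule subset_trans)
qed

section \<open>The grading of the tensor powers\<close>

text \<open>Being a submodule depends on the module operations alone. This identifies the submodules
  of the graded record \<open>tensor_power\<close> with those of the quotient record in which its
  grades are generated.\<close>

lemma submodule_iff:
  assumes "module R M"
  shows "submodule H R M \<longleftrightarrow> H \<subseteq> carrier M \<and> \<zero>\<^bsub>M\<^esub> \<in> H \<and> (\<forall>x\<in>H. \<forall>y\<in>H. x \<oplus>\<^bsub>M\<^esub> y \<in> H) \<and>
    (\<forall>r\<in>carrier R. \<forall>x\<in>H. r \<odot>\<^bsub>M\<^esub> x \<in> H)"
  by (intro iffI conjI ballI submoduleI'[OF assms]) (auto dest: submodule_closed[OF assms])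

definition component :: "('k, 'a, 'z) gmodule_scheme \<Rightarrow> int \<Rightarrow> 'a \<Rightarrow> 'a" where
  "component M i x = (THE c. decomposition M c x) i"

lemma component_eq: "graded_module R M \<Longrightarrow> decomposition M c x \<Longrightarrow> component M i x = c i"
  unfolding component_def using the_equality[of "\<lambda>c. decomposition M c x" c] decomposition_unique by metis

lemma component_homogeneous:
  "graded_module R M \<Longrightarrow> x \<in> grade M j \<Longrightarrow> component M i x = (if i = j then x else \<zero>\<^bsub>M\<^esub>)"
  using component_eq[OF _ decomposition_homogeneous[OF graded_moduleD]] by metis

lemma component_linear: "graded_module R M \<Longrightarrow> component M i \<in> lin R M M"
proof -
  assume M: "graded_module R M"
  note M' = graded_moduleD[OF M]
  show ?thesis
  proof (rule lin_mapsI)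
    fix x assume x: "x \<in> carrier M"
    obtain c where c: "decomposition M c x" using decomposition_ex[OF M x] by blast
    show "component M i x \<in> carrier M"
      using decomposition_closed(2)[OF M' c] by (simp add: component_eq[OF M c])
    show "component M i (r \<odot>\<^bsub>M\<^esub> x) = r \<odot>\<^bsub>M\<^esub> component M i x" if "r \<in> carrier R" for r
      using component_eq[OF M decomposition_smult[OF M' c that]] component_eq[OF M c] by simp
    show "component M i (x \<oplus>\<^bsub>M\<^esub> y) = component M i x \<oplus>\<^bsub>M\<^esub> component M i y" if y: "y \<in> carrier M" for y
    proof -
      obtain d where d: "decomposition M d y" using decomposition_ex[OF M y] by blast
      show ?thesis
        using component_eq[OF M decomposition_add[OF M' c d]] component_eq[OF M c] component_eq[OF M d] by simp
    qed
  qed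
qed

context
  fixes R :: "'k ring" and V :: "('k, 'a, 'y) gmodule_scheme"
  assumes V: "graded_module R V"
begin
interpretation V: module R V by (rule graded_moduleD[OF V])

lemmas V_mod = V.module_axioms
lemmas TP_mod = module_tpow[OF V.module_axioms]

private abbreviation (input) "TP5 n \<equiv> tpow R V n"

private lemma gens_carrier: "{tensor R V xs | xs ds. length xs = n \<and> homogeneous V xs ds \<and>
    sum_list ds = d} \<subseteq> carrier (TP5 n)"
proof safe
  fix xs ds assume "homogeneous V xs ds"
  then have "over V xs" by (rule homogeneous_list_carrier[OF V])
  then show "tensor R V xs \<in> carrier (TP5 (length xs))" by (simp add: tensor_closed[OF V_mod])
qed

private lemma grade_eq: "grade (TP5 n) d = generated_submodule R (TP5 n)
    {tensor R V xs | xs ds. length xs = n \<and> homogeneous V xs ds \<and> sum_list ds = d}"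
proof -
  let ?Q = "quotient_module (free_power R V n) (tensor_relations R V n)"
  have "submodule H R ?Q \<longleftrightarrow> submodule H R (TP5 n)" for H
    unfolding submodule_iff[OF TP_mod]
      submodule_iff[OF module_quotient[OF module_free_power[OF V_mod] relations_submodule[OF V_mod]]]
      tensor_power_simps ..
  then have "generated_submodule R ?Q S = generated_submodule R (TP5 n) S" for S
    by (simp only: generated_submodule_def)
  moreover have "grade (TP5 n) d = generated_submodule R ?Q
      {tensor R V xs | xs ds. length xs = n \<and> homogeneous V xs ds \<and> sum_list ds = d}"
    by (simp add: tensor_power_def Let_def)
  ultimately show ?thesis by simp
qed

lemma tensor_power_grade_submodule: "submodule (grade (TP5 n) d) R (TP5 n)"
  unfolding grade_eq by (rule generated_submodule[OF TP_mod gens_carrier])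

lemma tensor_grade:
  "homogeneous V xs ds \<Longrightarrow> length xs = n \<Longrightarrow> d = sum_list ds \<Longrightarrow> tensor R V xs \<in> grade (TP5 n) d"
  unfolding grade_eq by (rule generated_submodule_incl[THEN subsetD]) auto

lemma tensor_power_grade_least:
  assumes "submodule H R (TP5 n)"
    and "\<And>xs ds. length xs = n \<Longrightarrow> homogeneous V xs ds \<Longrightarrow> sum_list ds = d \<Longrightarrow> tensor R V xs \<in> H"
  shows "grade (TP5 n) d \<subseteq> H"
  unfolding grade_eq by (rule generated_submodule_least) (use assms in auto)

text \<open>The projection to the degree \<open>d\<close> part of the tensor power, restricted to entries with degrees
  in the finite window \<open>I\<close>; it needs no knowledge of the supports of the entries.\<close>

private definition window :: "nat \<Rightarrow> int set \<Rightarrow> int \<Rightarrow> 'a list \<Rightarrow> ('a list \<Rightarrow> 'k) set" where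
  "window n I d xs = (\<Oplus>\<^bsub>TP5 n\<^esub>ds\<in>{ds. set ds \<subseteq> I \<and> length ds = n \<and> sum_list ds = d}.
     tensor R V (map2 (component V) ds xs))"

private lemma component_list:
  assumes "over V xs" shows "over V (map2 (component V) ds xs)"
  using assms lin_closed[OF component_linear[OF V]] by (auto dest!: set_zip_rightD)

private lemma window_multilinear: "multilinear R V n (TP5 n) (window n I d)"
  unfolding window_def
proof (rule multilinear_finsum[OF V_mod TP_mod], elim CollectE conjE)
  fix ds :: "int list" assume ds: "length ds = n"
  show "multilinear R V n (TP5 n) (\<lambda>xs. tensor R V (map2 (component V) ds xs))"
  proof (rule multilinearI)
    fix xs assume "length xs = n" "over V xs"
    then show "tensor R V (map2 (component V) ds xs) \<in> carrier (TP5 n)"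
      using ds by (intro tensor_closed[OF V_mod] component_list) auto
  next
    fix us vs assume n: "n = Suc (length us + length vs)" and us: "over V us" and vs: "over V vs"
    \<comment> \<open>The degree that \<open>ds\<close> prescribes for the open slot.\<close>
    define i where "i = ds ! length us"
    have d: "ds = take (length us) ds @ i # drop (Suc (length us)) ds"
      unfolding i_def by (rule id_take_nth_drop) (use n ds in auto)
    have eq: "map2 (component V) ds (us @ x # vs) = map2 (component V) (take (length us) ds) us @
        component V i x # map2 (component V) (drop (Suc (length us)) ds) vs" for x
      by (subst d) (use n ds in simp)
    show "(\<lambda>x. tensor R V (map2 (component V) ds (us @ x # vs))) \<in> lin R V (TP5 n)"
      unfolding eq
      by (rule lin_comp[OF multilinear_slot[OF tensor_multilinear[OF V_mod]] component_linear[OF V]])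
        (use n ds us vs component_list in auto)
  qed
qed

text \<open>A degree list other than \<open>es\<close> asks some entry for a component that it does
  not have, which puts a zero into the tensor.\<close>

private lemma window_tensor:
  assumes I: "finite I" and xs: "homogeneous V xs es" "length xs = n" "set es \<subseteq> I"
  shows "window n I d xs = (if d = sum_list es then tensor R V xs else \<zero>\<^bsub>TP5 n\<^esub>)"
proof -
  interpret T: module R "TP5 n" by (rule TP_mod)
  let ?D = "{ds. set ds \<subseteq> I \<and> length ds = n \<and> sum_list ds = d}"
  let ?t = "\<lambda>ds. tensor R V (map2 (component V) ds xs)"
  have len: "length es = n" using xs by (simp add: list_all2_lengthD[symmetric])
  have gr: "xs ! k \<in> grade V (es ! k)" if "k < n" for k using list_all2_nthD[OF xs(1)] that xs(2) by simp
  have carr: "over V xs" using xs(1) by (rule homogeneous_list_carrier[OF V])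
  have fin: "finite ?D"
    by (rule finite_subset[OF _ finite_lists_length_eq[OF I, of n]]) auto
  have zero: "?t ds = \<zero>\<^bsub>TP5 n\<^esub>" if ds: "length ds = n" "ds \<noteq> es" for ds
  proof -
    obtain k where k: "k < n" "ds ! k \<noteq> es ! k" using ds len nth_equalityI[of ds es] by auto
    have "map2 (component V) ds xs ! k = \<zero>\<^bsub>V\<^esub>"
      using k ds len xs(2) component_homogeneous[OF V gr[OF k(1)]] by simp
    then have "\<zero>\<^bsub>V\<^esub> \<in> set (map2 (component V) ds xs)"
      using k ds xs(2) by (metis length_map length_zip min.idem nth_mem)
    then show ?thesis
      by (intro multilinear_zero_entry[OF V_mod TP_mod tensor_multilinear[OF V_mod]])
        (use ds xs carr component_list in auto)
  qed
  have "map2 (component V) es xs = xs"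
  proof (rule nth_equalityI)
    fix k assume "k < length (map2 (component V) es xs)"
    then show "map2 (component V) es xs ! k = xs ! k"
      using len xs(2) component_homogeneous[OF V gr, of k "es ! k"] by simp
  qed (use len xs(2) in simp)
  then have es: "?t es = tensor R V xs" by simp
  have "window n I d xs = finsum (TP5 n) ?t (?D \<inter> {es})"
    unfolding window_def
    by (rule T.M.finsum_subset) (use fin zero es tensor_closed[OF V_mod] carr xs(2) in auto)
  also have "... = (if d = sum_list es then tensor R V xs else \<zero>\<^bsub>TP5 n\<^esub>)"
    using len xs(3) es tensor_closed[OF V_mod xs(2) carr] by (auto simp: T.M.finsum_insert)
  finally show ?thesis .
qed

text \<open>The window that works depends on \<open>X\<close>, but every larger finite window works
  too. So the windows of two elements can be united, and the elements possessing one form a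
  submodule.\<close>

private lemma window_grade:
  assumes "X \<in> grade (TP5 n) d"
  shows "\<exists>I0. finite I0 \<and> (\<forall>I e. finite I \<longrightarrow> I0 \<subseteq> I \<longrightarrow>
    tensor_lift R (TP5 n) (window n I e) X = (if e = d then X else \<zero>\<^bsub>TP5 n\<^esub>))"
proof -
  interpret T: module R "TP5 n" by (rule TP_mod)
  note lin = tensor_lift_linear[OF V_mod TP_mod window_multilinear]
  note tens = tensor_lift_tensor[OF V_mod TP_mod window_multilinear]
  let ?P = "\<lambda>X I e. tensor_lift R (TP5 n) (window n I e) X = (if e = d then X else \<zero>\<^bsub>TP5 n\<^esub>)"
  define good where "good X I0 \<longleftrightarrow> finite I0 \<and> (\<forall>I e. finite I \<longrightarrow> I0 \<subseteq> I \<longrightarrow> ?P X I e)" for X I0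
  let ?H = "{X \<in> carrier (TP5 n). \<exists>I0. good X I0}"
  have "submodule ?H R (TP5 n)"
  proof (rule submoduleI'[OF TP_mod])
    have "good \<zero>\<^bsub>TP5 n\<^esub> {}" using lin_zero[OF TP_mod TP_mod lin] by (simp add: good_def)
    then show "\<zero>\<^bsub>TP5 n\<^esub> \<in> ?H" by auto
  next
    fix X Y assume XY: "X \<in> ?H" "Y \<in> ?H"
    then obtain I J where "good X I" "good Y J" by auto
    then have "good (X \<oplus>\<^bsub>TP5 n\<^esub> Y) (I \<union> J)" using XY by (simp add: good_def lin_add[OF lin])
    then show "X \<oplus>\<^bsub>TP5 n\<^esub> Y \<in> ?H" using XY by auto
  next
    fix r X assume r: "r \<in> carrier R" and X: "X \<in> ?H"
    then obtain I where "good X I" by auto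
    then have "good (r \<odot>\<^bsub>TP5 n\<^esub> X) I" using r X by (simp add: good_def lin_smult[OF lin])
    then show "r \<odot>\<^bsub>TP5 n\<^esub> X \<in> ?H" using r X by auto
  qed auto
  then have "grade (TP5 n) d \<subseteq> ?H"
  proof (rule tensor_power_grade_least)
    fix xs ds assume xs: "length xs = n" "homogeneous V xs ds" "sum_list ds = d"
    have "over V xs" using xs(2) by (rule homogeneous_list_carrier[OF V])
    then have "good (tensor R V xs) (set ds)"
      using xs tens window_tensor[OF _ xs(2,1)] by (simp add: good_def)
    then show "tensor R V xs \<in> ?H"
      using \<open>set xs \<subseteq> carrier V\<close> tensor_closed[OF V_mod xs(1)] by auto
  qed
  then have "X \<in> ?H" using assms by (rule subsetD)
  then show ?thesis by (simp add: good_def)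
qed

text \<open>As the grades are given by generators, directness is the point. A projection whose
  window suits all members of a decomposition of zero returns its member of degree \<open>i\<close>,
  while its value on zero is zero.\<close>

lemma graded_module_tpow: "graded_module R (TP5 n)"
proof (rule graded_moduleI[OF TP_mod tensor_power_grade_submodule])
  fix H assume H: "submodule H R (TP5 n)" "\<And>i. grade (TP5 n) i \<subseteq> H"
  show "carrier (TP5 n) \<subseteq> H"
  proof (rule tensor_power_span[OF V_mod H(1)])
    fix xs assume xs: "length xs = n" "over V xs"
    show "tensor R V xs \<in> H"
    proof (rule multilinear_mem[OF V_mod TP_mod tensor_multilinear[OF V_mod] H(1) homogeneous_span[OF V] _ xs])
      fix ys assume "length ys = n" "set ys \<subseteq> (\<Union>i. grade V i)"
      then show "tensor R V ys \<in> H"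
        unfolding homogeneous_list using tensor_grade H(2) by blast
    qed
  qed
next
  interpret T: module R "TP5 n" by (rule TP_mod)
  note lin = tensor_lift_linear[OF V_mod TP_mod window_multilinear]
  fix c i assume c: "decomposition (TP5 n) c \<zero>\<^bsub>TP5 n\<^esub>"
  \<comment> \<open>\<open>i\<close> is adjoined so that the singleton of \<open>i\<close> lies
    inside \<open>?S\<close> even when \<open>c i\<close> is zero.\<close>
  let ?S = "{j. c j \<noteq> \<zero>\<^bsub>TP5 n\<^esub>} \<union> {i}"
  have S: "finite ?S" using c by (auto simp: decomposition_def)
  note cl = decomposition_closed[OF TP_mod tensor_power_grade_submodule c]
  have "\<forall>j. \<exists>I0. finite I0 \<and> (\<forall>I e. finite I \<longrightarrow> I0 \<subseteq> I \<longrightarrow>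
      tensor_lift R (TP5 n) (window n I e) (c j) = (if e = j then c j else \<zero>\<^bsub>TP5 n\<^esub>))"
    using window_grade[OF cl(1)] by (rule allI)
  from choice[OF this] obtain I0 where I0: "\<forall>j. finite (I0 j) \<and> (\<forall>I e. finite I \<longrightarrow> I0 j \<subseteq> I \<longrightarrow>
      tensor_lift R (TP5 n) (window n I e) (c j) = (if e = j then c j else \<zero>\<^bsub>TP5 n\<^esub>))"
    by (rule exE)
  \<comment> \<open>One window that serves all members \<open>c j\<close> at once, projected to
    degree \<open>i\<close>.\<close>
  let ?f = "tensor_lift R (TP5 n) (window n (\<Union>j\<in>?S. I0 j) i)"
  have "c i = (\<Oplus>\<^bsub>TP5 n\<^esub>j\<in>{i}. if i = j then c j else \<zero>\<^bsub>TP5 n\<^esub>)"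
    using cl by (simp add: T.M.finsum_insert)
  also have "... = (\<Oplus>\<^bsub>TP5 n\<^esub>j\<in>?S. if i = j then c j else \<zero>\<^bsub>TP5 n\<^esub>)"
    by (rule T.M.finsum_subset[symmetric]) (use S cl in auto)
  also have "... = (\<Oplus>\<^bsub>TP5 n\<^esub>j\<in>?S. ?f (c j))"
  proof (rule T.M.finsum_cong')
    fix j assume "j \<in> ?S"
    then show "(if i = j then c j else \<zero>\<^bsub>TP5 n\<^esub>) = ?f (c j)"
      using S I0 by (intro I0[rule_format, THEN conjunct2, rule_format, symmetric]) auto
  qed (use cl lin_closed[OF lin] in auto)
  also have "... = ?f (\<Oplus>\<^bsub>TP5 n\<^esub>j\<in>?S. c j)"
    by (rule lin_finsum[OF TP_mod TP_mod lin, symmetric]) (use cl in auto)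
  also have "(\<Oplus>\<^bsub>TP5 n\<^esub>j\<in>?S. c j) = \<zero>\<^bsub>TP5 n\<^esub>"
    by (rule decomposition_finsum[OF TP_mod tensor_power_grade_submodule c S, symmetric]) auto
  also have "?f ... = \<zero>\<^bsub>TP5 n\<^esub>" by (rule lin_zero[OF TP_mod TP_mod lin])
  finally show "c i = \<zero>\<^bsub>TP5 n\<^esub>" .
qed

lemma tensor_power_graded_hom:
  assumes N: "graded_module R N" and \<phi>: "f \<in> lin R (TP5 n) N"
    and deg: "\<And>xs ds. length xs = n \<Longrightarrow> homogeneous V xs ds \<Longrightarrow>
      f (tensor R V xs) \<in> grade N (sum_list ds + d)"
  shows "f \<in> graded_hom R (TP5 n) N d"
proof -
  have "grade (TP5 n) i \<subseteq> {X \<in> carrier (TP5 n). f X \<in> grade N (i + d)}" for i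
  proof (rule tensor_power_grade_least)
    show "submodule {X \<in> carrier (TP5 n). f X \<in> grade N (i + d)} R (TP5 n)"
      by (rule submodule_preimage[OF TP_mod graded_moduleD(1)[OF N] \<phi> graded_moduleD(2)[OF N]])
  qed (use deg tensor_closed[OF V_mod] homogeneous_list_carrier[OF V] in auto)
  then show ?thesis using \<phi> by (auto simp: graded_hom_def)
qed

end

section \<open>Cutting lists into pieces\<close>

text \<open>These cuts index the coproduct. The next two index sets serve the other constructions:
  \<open>infixes\<close> the coderivations and the Gerstenhaber product, where the outer parts may
  be empty, and \<open>segmentations\<close> the product \<open>star\<close> and the morphism
  \<open>Psi_inv\<close>.\<close>

definition cuts :: "'a list \<Rightarrow> ('a list \<times> 'a list) set" where
  "cuts xs = {(us, vs). us @ vs = xs \<and> us \<noteq> [] \<and> vs \<noteq> []}"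

definition infixes :: "'a list \<Rightarrow> ('a list \<times> 'a list \<times> 'a list) set" where
  "infixes xs = {(us, ys, vs). us @ ys @ vs = xs \<and> ys \<noteq> []}"

definition segmentations :: "'a list \<Rightarrow> 'a list list set" where
  "segmentations xs = {yss. concat yss = xs \<and> yss \<noteq> [] \<and> [] \<notin> set yss}"

lemma finite_cuts [simp]: "finite (cuts xs)"
  by (rule finite_subset[of _ "{ys. set ys \<subseteq> set xs \<and> length ys \<le> length xs} \<times>
      {ys. set ys \<subseteq> set xs \<and> length ys \<le> length xs}"])
    (auto simp: cuts_def intro!: finite_cartesian_product finite_lists_length_le)

lemma finite_infixes [simp]: "finite (infixes xs)"
  by (rule finite_subset[of _ "{ys. set ys \<subseteq> set xs \<and> length ys \<le> length xs} \<times>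
      {ys. set ys \<subseteq> set xs \<and> length ys \<le> length xs} \<times>
      {ys. set ys \<subseteq> set xs \<and> length ys \<le> length xs}"])
    (auto simp: infixes_def intro!: finite_cartesian_product finite_lists_length_le)

lemma concat_lengths_unique:
  "map length yss = map length zss \<Longrightarrow> concat yss = concat zss \<Longrightarrow> yss = zss"
proof (induction yss arbitrary: zss)
  case (Cons ys yss)
  then show ?case by (cases zss) auto
qed simp

lemma concat_lengths_exist: "sum_list ks = length xs \<Longrightarrow> \<exists>yss. map length yss = ks \<and> concat yss = xs"
proof (induction ks arbitrary: xs)
  case (Cons k ks)
  then have "sum_list ks = length (drop k xs)" by simp
  then obtain yss where "map length yss = ks" "concat yss = drop k xs" using Cons.IH by blast
  then show ?case using Cons.prems by (intro exI[of _ "take k xs # yss"]) auto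
qed simp

text \<open>A segmentation of a given word is determined by its block lengths. This turns the sums
  over \<open>compositions\<close> in \<open>star\<close> and \<open>Psi_inv\<close> into sums over
  cuttings of the word.\<close>

lemma bij_segmentations: "bij_betw (map length) (segmentations xs) (compositions (length xs))"
proof (rule bij_betw_imageI)
  show "inj_on (map length) (segmentations xs)"
    by (auto simp: inj_on_def segmentations_def intro: concat_lengths_unique)
  show "map length ` segmentations xs = compositions (length xs)"
  proof (intro equalityI subsetI)
    fix ks assume ks: "ks \<in> compositions (length xs)"
    then obtain yss where "map length yss = ks" "concat yss = xs"
      using concat_lengths_exist[of ks xs] by (auto simp: compositions_def)
    then show "ks \<in> map length ` segmentations xs"
      using ks by (force simp: segmentations_def compositions_def)
  qed (auto simp: segmentations_def compositions_def length_concat Suc_le_eq)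
qed

lemma finite_compositions: "finite (compositions n)"
proof (rule finite_subset)
  show "compositions n \<subseteq> {ks. set ks \<subseteq> {..n} \<and> length ks \<le> n}"
  proof
    fix ks assume "ks \<in> compositions n"
    then have ks: "\<forall>k\<in>set ks. 1 \<le> k" "sum_list ks = n" by (auto simp: compositions_def)
    have "length ks \<le> sum_list ks" using ks(1) by (induction ks) auto
    then show "ks \<in> {ks. set ks \<subseteq> {..n} \<and> length ks \<le> n}" using ks member_le_sum_list by auto
  qed
  show "finite {ks. set ks \<subseteq> {..n} \<and> length ks \<le> n}" by (rule finite_lists_length_le) simp
qed

lemma finite_segmentations [simp]: "finite (segmentations xs)"
  using bij_betw_finite[OF bij_segmentations] finite_compositions by blast

context abelian_monoid
begin
lemma finsum_cuts:
  assumes "\<And>us vs. (us, vs) \<in> cuts xs \<Longrightarrow> F (length us) = a us vs"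
    and "\<And>us vs. (us, vs) \<in> cuts xs \<Longrightarrow> a us vs \<in> carrier G"
  shows "(\<Oplus>i\<in>{1..length xs - 1}. F i) = finsum G (\<lambda>(us, vs). a us vs) (cuts xs)"
proof (rule finsum_bij_witness[where i = "\<lambda>i. (take i xs, drop i xs)" and j = "\<lambda>(us, vs). length us"])
  fix i assume i: "i \<in> {1..length xs - 1}"
  then have mem: "(take i xs, drop i xs) \<in> cuts xs" by (auto simp: cuts_def)
  then show "(take i xs, drop i xs) \<in> cuts xs" .
  show "(case (take i xs, drop i xs) of (us, vs) \<Rightarrow> length us) = i" using i by auto
  show "(case (take i xs, drop i xs) of (us, vs) \<Rightarrow> a us vs) = F i"
    using assms(1)[OF mem] i by (auto simp: min_absorb2)
qed (use assms in "auto simp: cuts_def neq_Nil_conv")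

lemma finsum_infixes:
  assumes "\<And>us ys vs. (us, ys, vs) \<in> infixes xs \<Longrightarrow> F (length ys) (length us) = a us ys vs"
    and "\<And>us ys vs. (us, ys, vs) \<in> infixes xs \<Longrightarrow> a us ys vs \<in> carrier G"
  shows "(\<Oplus>i\<in>{1..length xs}. \<Oplus>j\<in>{0..length xs - i}. F i j) =
    finsum G (\<lambda>(us, ys, vs). a us ys vs) (infixes xs)"
proof -
  let ?i = "\<lambda>(i, j). (take j xs, take i (drop j xs), drop i (drop j xs))"
  have mem: "?i (i, j) \<in> infixes xs" "length (take i (drop j xs)) = i" "length (take j xs) = j"
    if "i \<in> {1..length xs}" "j \<in> {0..length xs - i}" for i j
  proof -
    show "?i (i, j) \<in> infixes xs"
      using that by (auto simp: infixes_def) (metis append_take_drop_id drop_drop)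
  qed (use that in auto)
  have F: "F i j = a (take j xs) (take i (drop j xs)) (drop i (drop j xs))" "F i j \<in> carrier G"
    if "i \<in> {1..length xs}" "j \<in> {0..length xs - i}" for i j
    using assms mem[OF that] by (metis (no_types, lifting) case_prod_conv)+
  have "(\<Oplus>i\<in>{1..length xs}. \<Oplus>j\<in>{0..length xs - i}. F i j) =
      finsum G (\<lambda>(i, j). F i j) (SIGMA i:{1..length xs}. {0..length xs - i})"
    by (rule finsum_Sigma) (use F in auto)
  also have "... = finsum G (\<lambda>(us, ys, vs). a us ys vs) (infixes xs)"
  proof (rule finsum_bij_witness[where i = ?i and j = "\<lambda>(us, ys, vs). (length ys, length us)"])
    fix p assume "p \<in> (SIGMA i:{1..length xs}. {0..length xs - i})"
    then obtain i j where p: "p = (i, j)" "i \<in> {1..length xs}" "j \<in> {0..length xs - i}" by auto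
    show "?i p \<in> infixes xs" "(case ?i p of (us, ys, vs) \<Rightarrow> (length ys, length us)) = p"
      using mem[OF p(2,3)] p(1) by simp_all
    show "(case ?i p of (us, ys, vs) \<Rightarrow> a us ys vs) = (case p of (i, j) \<Rightarrow> F i j)"
      using F(1)[OF p(2,3)] p(1) by simp
  next
    fix q assume q: "q \<in> infixes xs"
    obtain us ys vs where uyv: "q = (us, ys, vs)" by (cases q)
    have "xs = us @ ys @ vs" "ys \<noteq> []" using q by (auto simp: uyv infixes_def)
    then show "(case q of (us, ys, vs) \<Rightarrow> (length ys, length us)) \<in> (SIGMA i:{1..length xs}. {0..length xs - i})"
      "?i (case q of (us, ys, vs) \<Rightarrow> (length ys, length us)) = q"
      by (auto simp: uyv Suc_le_eq)
    show "(case q of (us, ys, vs) \<Rightarrow> a us ys vs) \<in> carrier G"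
      using assms(2) q by (auto simp: uyv)
  qed
  finally show ?thesis .
qed

text \<open>\<open>gerstenhaber\<close> sums over the arity of the outer map and
  \<open>Phi_inv\<close> over that of the inner one. Replacing i by n - i + 1 passes from one to the
  other and keeps the position j.\<close>

lemma finsum_infixes':
  assumes "\<And>us ys vs. (us, ys, vs) \<in> infixes xs \<Longrightarrow> F (length us + 1 + length vs) (length us) = a us ys vs"
    and "\<And>us ys vs. (us, ys, vs) \<in> infixes xs \<Longrightarrow> a us ys vs \<in> carrier G"
  shows "(\<Oplus>i\<in>{1..length xs}. \<Oplus>j\<in>{0..i - 1}. F i j) =
    finsum G (\<lambda>(us, ys, vs). a us ys vs) (infixes xs)"
proof -
  let ?n = "length xs"
  have *: "F (?n - i + 1) j \<in> carrier G" if "i \<in> {1..?n}" "j \<in> {0..?n - i}" for i j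
  proof -
    have "(take j xs, take i (drop j xs), drop i (drop j xs)) \<in> infixes xs"
      using that by (auto simp: infixes_def) (metis append_take_drop_id drop_drop)
    from assms[OF this] show ?thesis using that by auto
  qed
  have "(\<Oplus>i\<in>{1..?n}. \<Oplus>j\<in>{0..i - 1}. F i j) = (\<Oplus>i\<in>{1..?n}. \<Oplus>j\<in>{0..?n - i}. F (?n - i + 1) j)"
    by (rule finsum_bij_witness[where i = "\<lambda>i. ?n - i + 1" and j = "\<lambda>i. ?n - i + 1"])
      (use * in "auto intro!: finsum_closed")
  also have "... = finsum G (\<lambda>(us, ys, vs). a us ys vs) (infixes xs)"
    by (rule finsum_infixes) (use assms in "auto simp: infixes_def")
  finally show ?thesis .
qed

lemma finsum_segmentations:
  assumes "\<And>yss. yss \<in> segmentations xs \<Longrightarrow> F (map length yss) = a yss"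
    and "\<And>yss. yss \<in> segmentations xs \<Longrightarrow> a yss \<in> carrier G"
  shows "(\<Oplus>ks\<in>compositions (length xs). F ks) = finsum G a (segmentations xs)"
proof -
  note bij = bij_segmentations[of xs]
  show ?thesis
    by (rule finsum_bij_witness[where i = "the_inv_into (segmentations xs) (map length)" and j = "map length"])
      (use assms bij in \<open>auto simp: bij_betw_def the_inv_into_into f_the_inv_into_f the_inv_into_f_f
        intro!: the_inv_into_into assms(1)[symmetric, THEN trans]\<close>)
qed

end

section \<open>Tensor products of maps, Gerstenhaber product and star product\<close>

definition valid_factors ::
  "'k ring \<Rightarrow> ('k, 'a, 'y) gmodule_scheme \<Rightarrow> ('k, 'b, 'z) gmodule_scheme \<Rightarrow> ('k, 'a, 'b) factor list \<Rightarrow> bool" where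
  "valid_factors R V W fs \<longleftrightarrow> (\<forall>(e, i, f) \<in> set fs. f \<in> tlin R V i W)"

abbreviation arity :: "('k, 'a, 'b) factor list \<Rightarrow> nat" where
  "arity fs \<equiv> sum_list (map (\<lambda>(e, i, f). i) fs)"

definition ev :: "'k ring \<Rightarrow> ('k, 'a, 'y) gmodule_scheme \<Rightarrow> ('k, 'a, 'b) cochain \<Rightarrow> 'a list \<Rightarrow> 'b" where
  "ev R V f xs = f (length xs) (tensor R V xs)"

lemma length_apply_factors [simp]: "length (apply_factors R V fs xs) = length fs"
  by (induction fs arbitrary: xs) auto

context
  fixes R :: "'k ring" and V :: "('k, 'a, 'y) gmodule_scheme" and W :: "('k, 'b, 'z) gmodule_scheme"
  assumes V: "graded_module R V" and W: "module R W"
begin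
interpretation V: module R V by (rule graded_moduleD[OF V])

lemma koszul_list_closed: "over V xs \<Longrightarrow> over V (map (koszul V e) xs)"
  using koszul_closed[OF V] by auto

lemma apply_factors_closed:
  assumes "valid_factors R V W fs" "length xs = arity fs" "over V xs"
  shows "over W (apply_factors R V fs xs)"
  using assms
proof (induction fs arbitrary: xs)
  case (Cons f fs)
  obtain e i h where f: "f = (e, i, h)" by (cases f)
  have "h (tensor R V (map (koszul V (sum_list (map fst fs))) (take i xs))) \<in> carrier W"
  proof (rule lin_closed[of h R "tpow R V i"])
    show "h \<in> tlin R V i W" using Cons.prems by (auto simp: f valid_factors_def)
    show "tensor R V (map (koszul V (sum_list (map fst fs))) (take i xs)) \<in> carrier (tpow R V i)"
      using Cons.prems set_take_subset[of i xs] koszul_list_closed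
      by (intro tensor_closed[OF V.module_axioms]) (auto simp: f)
  qed
  moreover have "over V (drop i xs)" using Cons.prems(3) set_drop_subset[of i xs] by blast
  ultimately show ?case
    using Cons by (auto simp: f valid_factors_def)
qed simp

text \<open>The varying letter is an argument of exactly one factor. So exactly one output depends
  on it, linearly through \<open>h\<close>, and multilinearity of the tensor product of maps reduces
  to a slot of \<open>tensor\<close>.\<close>

lemma apply_factors_slot:
  assumes "valid_factors R V W fs" "arity fs = Suc (length us + length vs)"
    "over V us" "over V vs"
  shows "\<exists>ps h qs. length fs = Suc (length ps + length qs) \<and> over W ps \<and> over W qs \<and>
    h \<in> lin R V W \<and> (\<forall>x. apply_factors R V fs (us @ x # vs) = ps @ h x # qs)"
  using assms
proof (induction fs arbitrary: us)
  case (Cons f fs)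
  obtain e i g where f: "f = (e, i, g)" by (cases f)
  have g: "g \<in> tlin R V i W" and fs: "valid_factors R V W fs"
    using Cons.prems(1) by (auto simp: f valid_factors_def)
  have ar: "i + arity fs = Suc (length us + length vs)" using Cons.prems(2) by (simp add: f)
  let ?k = "koszul V (sum_list (map fst fs))"
  note multi = multilinear_comp[OF multilinear_map[OF tensor_multilinear[OF V.module_axioms]
        koszul_linear[OF V, of "sum_list (map fst fs)"]] g]
  show ?case
  proof (cases "i \<le> length us")
    case True
    have sub: "over V (take i us)" "over V (drop i us)"
      using Cons.prems(3) set_take_subset[of i us] set_drop_subset[of i us] by blast+
    have ar': "arity fs = Suc (length (drop i us) + length vs)" using ar True by simp
    obtain ps h qs where IH: "length fs = Suc (length ps + length qs)" "over W ps" "over W qs"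
      "h \<in> lin R V W" "\<forall>x. apply_factors R V fs (drop i us @ x # vs) = ps @ h x # qs"
      using Cons.IH[OF fs ar' sub(2) Cons.prems(4)] by blast
    have "g (tensor R V (map ?k (take i us))) \<in> carrier W"
      by (rule multilinear_closed[OF multi]) (use True sub in auto)
    then show ?thesis
      using IH True
      by (intro exI[of _ "g (tensor R V (map ?k (take i us))) # ps"] exI[of _ h] exI[of _ qs]) (simp add: f)
  next
    case False
    \<comment> \<open>The number of arguments of the first factor that lie behind the slot.\<close>
    define j where "j = i - Suc (length us)"
    have i: "i = Suc (length us + j)" using False by (simp add: j_def)
    have sub: "over V (take j vs)" "over V (drop j vs)"
      using Cons.prems(4) set_take_subset[of j vs] set_drop_subset[of j vs] by blast+
    have "over W (apply_factors R V fs (drop j vs))"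
      by (rule apply_factors_closed[OF fs _ sub(2)]) (use ar i in auto)
    moreover have "(\<lambda>x. g (tensor R V (map ?k (us @ x # take j vs)))) \<in> lin R V W"
      by (rule multilinear_slot[OF multi _ Cons.prems(3) sub(1)]) (use ar i in auto)
    ultimately show ?thesis
      using i by (intro exI[of _ "[]"] exI[of _ "\<lambda>x. g (tensor R V (map ?k (us @ x # take j vs)))"]
          exI[of _ "apply_factors R V fs (drop j vs)"]) (simp add: f)
  qed
qed simp

lemma apply_factors_multilinear:
  assumes "valid_factors R V W fs" "arity fs = n"
  shows "multilinear R V n (tpow R W (length fs)) (\<lambda>xs. tensor R W (apply_factors R V fs xs))"
proof (rule multilinearI)
  fix xs assume "length xs = n" "over V xs"
  then show "tensor R W (apply_factors R V fs xs) \<in> carrier (tpow R W (length fs))"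
    using apply_factors_closed[OF assms(1)] assms(2) by (intro tensor_closed[OF W]) auto
next
  fix us vs assume *: "n = Suc (length us + length vs)" "over V us" "over V vs"
  then obtain ps h qs where h: "length fs = Suc (length ps + length qs)" "over W ps" "over W qs"
    "h \<in> lin R V W" "\<And>x. apply_factors R V fs (us @ x # vs) = ps @ h x # qs"
    using apply_factors_slot[OF assms(1), of us vs] assms(2) by auto
  show "(\<lambda>x. tensor R W (apply_factors R V fs (us @ x # vs))) \<in> lin R V (tpow R W (length fs))"
    unfolding h(5) by (rule lin_comp[OF multilinear_slot[OF tensor_multilinear[OF W] h(1-3)] h(4)])
qed

lemma tensor_maps_linear:
  assumes "valid_factors R V W fs" "arity fs = n" "length fs = m"
  shows "tensor_maps R V W fs \<in> tlin R V n (tpow R W m)"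
  using tensor_lift_linear[OF V.module_axioms module_tpow[OF W] apply_factors_multilinear[OF assms(1,2)]]
  unfolding tensor_maps_def assms(3) .

lemma tensor_maps_tensor:
  assumes "valid_factors R V W fs" "arity fs = length xs" "over V xs"
  shows "tensor_maps R V W fs (tensor R V xs) = tensor R W (apply_factors R V fs xs)"
  using tensor_lift_tensor[OF V.module_axioms module_tpow[OF W] apply_factors_multilinear[OF assms(1,2)]] assms
  by (simp add: tensor_maps_def)

text \<open>All factors have degree 0, so the sign operator applied to every argument is the
  identity.\<close>

lemma apply_factors_segmentation:
  assumes "over V (concat yss)"
  shows "apply_factors R V (map (\<lambda>k. (0, k, g k)) (map length yss)) (concat yss) = map (ev R V g) yss"
proof -
  have [simp]: "sum_list (map (fst \<circ> (\<lambda>k. (0 :: int, k, g k))) ks) = 0" for ks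
    by (induction ks) auto
  have [simp]: "sum_list (map (fst \<circ> ((\<lambda>k. (0 :: int, k, g k)) \<circ> length)) zss) = 0" for zss :: "'a list list"
    by (induction zss) auto
  show ?thesis using assms
  proof (induction yss)
    case (Cons ys yss)
    have "map (koszul V 0) ys = ys"
      by (rule map_idI) (use Cons.prems koszul_even[OF V] in auto)
    then show ?case using Cons by (simp add: ev_def)
  qed simp
qed

end

lemma sum_list_id_factors [simp]: "sum_list (map fst (replicate n (id_factor R V))) = 0"
  by (induction n) (auto simp: id_factor_def)

lemma apply_factors_id_Cons:
  assumes "graded_module R V" "u \<in> carrier V"
  shows "apply_factors R V (id_factor R V # fs) (u # zs) =
    koszul V (sum_list (map fst fs)) u # apply_factors R V fs zs"
  using untensor(2)[OF graded_moduleD(1)[OF assms(1)] koszul_closed[OF assms]] by (simp add: id_factor_def)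

lemma apply_factors_id:
  assumes V: "graded_module R V" and "over V xs"
  shows "apply_factors R V (replicate (length xs) (id_factor R V)) xs = xs"
  using assms(2)
proof (induction xs)
  case (Cons x xs)
  then show ?case
    using koszul_even[OF V] by (simp add: apply_factors_id_Cons[OF V] del: map_replicate)
qed simp

text \<open>Only the middle factor carries a degree, and it has to pass the arguments of the factors
  before it. So the letters of \<open>us\<close> pick up the sign of degree \<open>e\<close>, those
  of \<open>ys\<close> and \<open>vs\<close> none.\<close>

lemma apply_factors_infix:
  assumes V: "graded_module R V" and xs: "over V (us @ ys @ vs)"
  shows "apply_factors R V (replicate (length us) (id_factor R V) @ [(e, length ys, f (length ys))] @
      replicate (length vs) (id_factor R V)) (us @ ys @ vs) = map (koszul V e) us @ ev R V f ys # vs"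
  using xs
proof (induction us)
  case Nil
  have "map (koszul V 0) ys = ys"
    by (rule map_idI) (use Nil.prems koszul_even[OF V] in auto)
  then show ?case
    using Nil apply_factors_id[OF V, of vs] by (simp add: ev_def del: map_replicate)
next
  case (Cons u us)
  then show ?case by (simp add: apply_factors_id_Cons[OF V] del: map_replicate)
qed

lemma infix_factors:
  assumes "module R V" "f \<in> tlin R V m V"
  shows "valid_factors R V V (replicate j (id_factor R V) @ [(e, m, f)] @ replicate k (id_factor R V))"
    and "arity (replicate j (id_factor R V) @ [(e, m, f)] @ replicate k (id_factor R V)) = j + m + k"
  using assms untensor(1)[OF assms(1)]
  by (auto simp: valid_factors_def id_factor_def sum_list_replicate)

context
  fixes R :: "'k ring" and A :: "('k, 'a, 'x) gmodule_scheme" and B :: "('k, 'b, 'y) gmodule_scheme"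
  assumes A: "graded_module R A" and B: "module R B"
begin
interpretation B: module R B by (rule B)

private lemmas sA = graded_module_susp[OF A]

private lemma sA': "module R (susp A)" by (rule graded_moduleD[OF sA])

lemma ev_closed:
  "f (length xs) \<in> tlin R (susp A) (length xs) B \<Longrightarrow> over A xs \<Longrightarrow>
    ev R (susp A) f xs \<in> carrier B"
  unfolding ev_def
  by (rule lin_closed[of "f (length xs)" R "tpow R (susp A) (length xs)"])
    (simp_all add: tensor_closed[OF sA'])

lemma ev_multilinear:
  "f n \<in> tlin R (susp A) n B \<Longrightarrow> multilinear R A n B (ev R (susp A) f)"
  using multilinear_comp[OF tensor_multilinear[OF sA', of n], of "f n" B]
  unfolding multilinear_susp
  by (rule multilinear_cong) (simp_all add: ev_def graded_moduleD[OF A])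

context
  fixes f g and e :: int
  assumes f: "\<And>n. 1 \<le> n \<Longrightarrow> f n \<in> tlin R (susp A) n A"
    and g: "\<And>n. 1 \<le> n \<Longrightarrow> g n \<in> tlin R (susp A) n B"
begin
lemma gerst_linear:
  "gerst R A B e g f n \<in> tlin R (susp A) n B"
  unfolding gerstenhaber_def
proof (intro lin_finsum_map[OF module_tpow[OF sA'] B])
  fix i j assume ij: "i \<in> {1..n}" "j \<in> {0..i - 1}"
  note fs = infix_factors[OF sA', of "f (n - i + 1)" "n - i + 1" j e "i - j - 1"]
  show "(\<lambda>X. g i (tensor_maps R (susp A) (susp A) (replicate j (id_factor R (susp A)) @
      [(e, n - i + 1, f (n - i + 1))] @ replicate (i - j - 1) (id_factor R (susp A))) X))
      \<in> tlin R (susp A) n B"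
    by (rule lin_comp[OF g tensor_maps_linear[OF sA sA' fs(1)]]) (use ij f fs(2) in auto)
qed

lemma gerst_tensor:
  assumes xs: "over A xs"
  shows "gerst R A B e g f (length xs) (tensor R (susp A) xs) =
    finsum B (\<lambda>(us, ys, vs). ev R (susp A) g (map (koszul (susp A) e) us @ ev R (susp A) f ys # vs)) (infixes xs)"
proof -
  let ?F = "\<lambda>i j. g i (tensor_maps R (susp A) (susp A) (replicate j (id_factor R (susp A)) @
      [(e, length xs - i + 1, f (length xs - i + 1))] @ replicate (i - j - 1) (id_factor R (susp A)))
      (tensor R (susp A) xs))"
  have "?F (length us + 1 + length vs) (length us) =
      ev R (susp A) g (map (koszul (susp A) e) us @ ev R (susp A) f ys # vs) \<and>
      ev R (susp A) g (map (koszul (susp A) e) us @ ev R (susp A) f ys # vs) \<in> carrier B"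
    if uyv: "(us, ys, vs) \<in> infixes xs" for us ys vs
  proof -
    have eq: "xs = us @ ys @ vs" and ys: "1 \<le> length ys" using uyv by (auto simp: infixes_def Suc_le_eq)
    \<comment> \<open>The outer map takes the letters of \<open>us\<close> and \<open>vs\<close> and
      one output, so n - i + 1, the inner arity in the definition, is the length of
      \<open>ys\<close>.\<close>
    have len: "length xs - (length us + 1 + length vs) + 1 = length ys" using eq ys by simp
    have sub: "over (susp A) (us @ ys @ vs)" using xs eq by simp
    note fs = infix_factors[OF sA', of "f (length ys)" "length ys" "length us" e "length vs"]
    have "ev R (susp A) f ys \<in> carrier A"
      unfolding ev_def using sub by (intro lin_closed[OF f[OF ys]] tensor_closed[OF sA']) auto
    then have "over (susp A) (map (koszul (susp A) e) us @ ev R (susp A) f ys # vs)"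
      using sub koszul_closed[OF sA] by auto
    then have "ev R (susp A) g (map (koszul (susp A) e) us @ ev R (susp A) f ys # vs) \<in> carrier B"
      by (intro ev_closed g) auto
    moreover have "tensor_maps R (susp A) (susp A) (replicate (length us) (id_factor R (susp A)) @
      [(e, length ys, f (length ys))] @ replicate (length vs) (id_factor R (susp A))) (tensor R (susp A) xs) =
      tensor R (susp A) (map (koszul (susp A) e) us @ ev R (susp A) f ys # vs)"
      unfolding eq apply_factors_infix[OF sA sub, symmetric]
      by (rule tensor_maps_tensor[OF sA sA' fs(1)]) (use f ys fs(2) sub in auto)
    ultimately show ?thesis unfolding len by (simp add: ev_def)
  qed
  then show ?thesis
    unfolding gerstenhaber_def by (intro B.M.finsum_infixes') blast+
qed

end

lemma segmentation_closed:
  assumes "yss \<in> segmentations xs" "over A xs" "ys \<in> set yss"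
  shows "ys \<noteq> []" "1 \<le> length ys" "over A ys"
proof -
  show "ys \<noteq> []" "1 \<le> length ys" using assms by (auto simp: segmentations_def Suc_le_eq)
  have "set ys \<subseteq> set xs" using assms(1,3) by (auto simp: segmentations_def)
  then show "over A ys" using assms(2) by simp
qed

context
  fixes g
  assumes g: "\<And>n. 1 \<le> n \<Longrightarrow> g n \<in> tlin R (susp A) n B"
begin
lemma map_ev_closed: "yss \<in> segmentations xs \<Longrightarrow> over A xs \<Longrightarrow> over B (map (ev R (susp A) g) yss)"
  by (auto intro!: ev_closed[of g, OF g] dest: segmentation_closed)

lemma segmentation_factors:
  assumes "ks \<in> compositions n"
  shows "valid_factors R (susp A) (susp B) (map (\<lambda>k. (0, k, g k)) ks)"
    and "arity (map (\<lambda>k. (0, k, g k)) ks) = n" and "1 \<le> length ks"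
proof -
  show "valid_factors R (susp A) (susp B) (map (\<lambda>k. (0, k, g k)) ks)"
    using assms g by (simp add: compositions_def valid_factors_def)
  show "arity (map (\<lambda>k. (0, k, g k)) ks) = n"
    using assms by (simp add: compositions_def comp_def)
  show "1 \<le> length ks" using assms by (cases ks) (simp_all add: compositions_def)
qed

lemma segmentation_tensor:
  assumes "yss \<in> segmentations xs" "over A xs"
  shows "tensor_maps R (susp A) (susp B) (map (\<lambda>k. (0, k, g k)) (map length yss)) (tensor R (susp A) xs) =
    tensor R (susp B) (map (ev R (susp A) g) yss)"
proof -
  have eq: "xs = concat yss" using assms by (auto simp: segmentations_def)
  have "map length yss \<in> compositions (length xs)" using bij_segmentations assms(1) by (auto simp: bij_betw_def)
  note fs = segmentation_factors[OF this]
  show ?thesis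
    using tensor_maps_tensor[OF sA module_susp[OF B] fs(1,2)] apply_factors_segmentation[OF sA module_susp[OF B], of yss g] assms(2) eq
    by simp
qed

lemma star_linear:
  assumes C: "module R C" and f: "\<And>n. 1 \<le> n \<Longrightarrow> f n \<in> tlin R (susp B) n C"
  shows "star R A B C f g n \<in> tlin R (susp A) n C"
  unfolding star_def
proof (intro lin_finsum_map[OF module_tpow[OF sA'] C])
  fix ks assume ks: "ks \<in> compositions n"
  show "(\<lambda>X. f (length ks) (tensor_maps R (susp A) (susp B) (map (\<lambda>k. (0, k, g k)) ks) X))
      \<in> tlin R (susp A) n C"
    by (rule lin_comp[OF f tensor_maps_linear[OF sA module_susp[OF B]]])
      (use segmentation_factors[OF ks] in auto)
qed

lemma star_tensor:
  assumes C: "module R C" and f: "\<And>n. 1 \<le> n \<Longrightarrow> f n \<in> tlin R (susp B) n C"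
    and xs: "over A xs"
  shows "star R A B C f g (length xs) (tensor R (susp A) xs) =
    (\<Oplus>\<^bsub>C\<^esub> yss \<in> segmentations xs. ev R (susp B) f (map (ev R (susp A) g) yss))"
proof -
  interpret C: module R C by (rule C)
  show ?thesis
    unfolding star_def
  proof (rule C.M.finsum_segmentations)
    fix yss assume yss: "yss \<in> segmentations xs"
    show "f (length (map length yss)) (tensor_maps R (susp A) (susp B) (map (\<lambda>k. (0, k, g k)) (map length yss))
        (tensor R (susp A) xs)) = ev R (susp B) f (map (ev R (susp A) g) yss)"
      using segmentation_tensor[OF yss xs] by (simp add: ev_def)
    have "yss \<noteq> []" using yss by (auto simp: segmentations_def)
    then have "1 \<le> length (map (ev R (susp A) g) yss)" by (cases yss) auto
    then show "ev R (susp B) f (map (ev R (susp A) g) yss) \<in> carrier C"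
      unfolding ev_def[of R "susp B"] using map_ev_closed[OF yss xs]
      by (intro lin_closed[OF f] tensor_closed[OF module_susp[OF B]]) auto
  qed
qed

end

end

section \<open>The tensor coalgebra as a graded module\<close>

lemma decomposition_zero:
  assumes "graded_module R M" "decomposition M c \<zero>\<^bsub>M\<^esub>"
  shows "c i = \<zero>\<^bsub>M\<^esub>"
proof -
  note M' = graded_moduleD[OF assms(1)]
  have "decomposition M (\<lambda>i. \<zero>\<^bsub>M\<^esub>) \<zero>\<^bsub>M\<^esub>"
    using decomposition_homogeneous[OF M' submodule_closed(2)[OF M']] by (simp add: if_distrib cong: if_cong)
  from decomposition_unique[OF assms(1) assms(2) this] show ?thesis by simp
qed

text \<open>The signs of the entries multiply to the sign of the total degree. They are taken out
  slot by slot, which is why the claim is generalised to an arbitrary prefix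
  \<open>us\<close>.\<close>

lemma multilinear_koszul:
  assumes V: "graded_module R V" and M: "module R M" and \<phi>: "multilinear R V n M \<phi>"
    and xs: "homogeneous V xs ds" "length xs = n"
  shows "\<phi> (map (koszul V e) xs) = (if even (e * sum_list ds) then \<phi> xs else \<ominus>\<^bsub>M\<^esub> \<phi> xs)"
proof -
  interpret M: module R M by (rule M)
  note V' = graded_moduleD(1)[OF V]
  have "\<phi> (us @ map (koszul V e) xs) = (if even (e * sum_list ds) then \<phi> (us @ xs) else \<ominus>\<^bsub>M\<^esub> \<phi> (us @ xs))"
    if "length us + length xs = n" "over V us" for us
    using xs(1) that
  proof (induction xs ds arbitrary: us rule: list_all2_induct)
    case (Cons x xs d ds)
    have x: "x \<in> carrier V" using Cons.hyps(1) grade_closed[OF V] by blast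
    have xs: "over V xs" using homogeneous_list_carrier[OF V Cons.hyps(2)] .
    have "multilinear R V n M \<phi>" by (rule \<phi>)
    from multilinear_slot[OF this _ Cons.prems(2), of xs] have lin: "(\<lambda>x. \<phi> (us @ x # xs)) \<in> lin R V M"
      using Cons.prems(1) xs by simp
    have IH: "\<phi> ((us @ [koszul V e x]) @ map (koszul V e) xs) =
        (if even (e * sum_list ds) then \<phi> (us @ koszul V e x # xs) else \<ominus>\<^bsub>M\<^esub> \<phi> (us @ koszul V e x # xs))"
      using Cons.IH[of "us @ [koszul V e x]"] Cons.prems koszul_closed[OF V x] by simp
    have "\<phi> (us @ koszul V e x # xs) = (if even (e * d) then \<phi> (us @ x # xs) else \<ominus>\<^bsub>M\<^esub> \<phi> (us @ x # xs))"
      using koszul_homogeneous[OF V Cons.hyps(1)] lin_neg[OF V' M lin x] by simp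
    then show ?case
      using IH lin_closed[OF lin x] by (auto simp: distrib_left)
  qed simp
  from this[of "[]"] show ?thesis using xs(2) by simp
qed

text \<open>Hence the sign operator of a tensor power acts letter by letter; by multilinearity it
  suffices to see this on homogeneous letters.\<close>

lemma koszul_tensor:
  assumes V: "graded_module R V" and xs: "length xs = n" "over V xs"
  shows "koszul (tpow R V n) e (tensor R V xs) = tensor R V (map (koszul V e) xs)"
proof -
  note V' = graded_moduleD(1)[OF V] and T7 = graded_module_tpow[OF V, of n]
  note ml = tensor_multilinear[OF V', of n]
  show ?thesis
  proof (rule multilinear_ext[OF V' graded_moduleD(1)[OF T7] multilinear_comp[OF ml koszul_linear[OF T7]]
        multilinear_map[OF ml koszul_linear[OF V]] homogeneous_span[OF V] _ xs])
    fix ys assume ys: "length ys = n" "set ys \<subseteq> (\<Union>i. grade V i)"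
    then obtain ds where ds: "homogeneous V ys ds" unfolding homogeneous_list by blast
    show "koszul (tpow R V n) e (tensor R V ys) = tensor R V (map (koszul V e) ys)"
      using multilinear_koszul[OF V graded_moduleD(1)[OF T7] ml ds ys(1)]
        koszul_homogeneous[OF T7 tensor_grade[OF V ds ys(1) refl]] by simp
  qed
qed

section \<open>Words in the tensor coalgebra\<close>

definition word :: "'k ring \<Rightarrow> ('k, 'a, 'y) gmodule_scheme \<Rightarrow> 'a list \<Rightarrow> ('k, 'a) tco" where
  "word R V xs = tco_incl R V (length xs) (tensor R V xs)"

lemma Tco_simps:
  "carrier (Tco R V) = {t \<in> (\<Pi>\<^sub>E n \<in> {1..}. carrier (tpow R V n)).
        finite {n. 1 \<le> n \<and> t n \<noteq> \<zero>\<^bsub>tpow R V n\<^esub>}}"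
  "zero (Tco R V) = (\<lambda>n \<in> {1..}. \<zero>\<^bsub>tpow R V n\<^esub>)"
  "add (Tco R V) = (\<lambda>s t. \<lambda>n \<in> {1..}. s n \<oplus>\<^bsub>tpow R V n\<^esub> t n)"
  "smult (Tco R V) = (\<lambda>r t. \<lambda>n \<in> {1..}. r \<odot>\<^bsub>tpow R V n\<^esub> t n)"
  "grade (Tco R V) = (\<lambda>d. {t \<in> (\<Pi>\<^sub>E n \<in> {1..}. grade (tpow R V n) d).
        finite {n. 1 \<le> n \<and> t n \<noteq> \<zero>\<^bsub>tpow R V n\<^esub>}})"
  by (simp_all add: tensor_module_def)

context
  fixes R :: "'k ring" and V :: "('k, 'a, 'y) gmodule_scheme"
  assumes V: "module R V"
begin
private abbreviation (input) "T7 \<equiv> Tco R V"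
private abbreviation (input) "TP7 \<equiv> tpow R V"

interpretation TP7: module R "TP7 n" for n by (rule module_tpow[OF V])

private lemma tmD:
  assumes "t \<in> carrier T7"
  shows "1 \<le> n \<Longrightarrow> t n \<in> carrier (TP7 n)" "\<not> 1 \<le> n \<Longrightarrow> t n = undefined"
    "finite {n. 1 \<le> n \<and> t n \<noteq> \<zero>\<^bsub>TP7 n\<^esub>}"
  using assms by (auto simp: Tco_simps PiE_def Pi_def extensional_def)

text \<open>Elements of the carrier are extensional on the positive naturals, so at index 0 both are
  \<open>undefined\<close>.\<close>

lemma Tco_eqI:
  "t \<in> carrier T7 \<Longrightarrow> u \<in> carrier T7 \<Longrightarrow> (\<And>n. 1 \<le> n \<Longrightarrow> t n = u n) \<Longrightarrow> t = u"
  by (rule ext) (metis tmD(2))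

private lemma tm_closed:
  "\<zero>\<^bsub>T7\<^esub> \<in> carrier T7"
  "s \<in> carrier T7 \<Longrightarrow> t \<in> carrier T7 \<Longrightarrow> s \<oplus>\<^bsub>T7\<^esub> t \<in> carrier T7"
  "r \<in> carrier R \<Longrightarrow> t \<in> carrier T7 \<Longrightarrow> r \<odot>\<^bsub>T7\<^esub> t \<in> carrier T7"
proof -
  show "\<zero>\<^bsub>T7\<^esub> \<in> carrier T7" by (auto simp: Tco_simps)
  show "s \<oplus>\<^bsub>T7\<^esub> t \<in> carrier T7" if s: "s \<in> carrier T7" and t: "t \<in> carrier T7"
  proof -
    have "finite {n. 1 \<le> n \<and> (s \<oplus>\<^bsub>T7\<^esub> t) n \<noteq> \<zero>\<^bsub>TP7 n\<^esub>}"
      by (rule finite_subset[OF _ finite_UnI[OF tmD(3)[OF s] tmD(3)[OF t]]]) (auto simp: Tco_simps)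
    then show ?thesis using tmD(1)[OF s] tmD(1)[OF t] by (auto simp: Tco_simps)
  qed
  show "r \<odot>\<^bsub>T7\<^esub> t \<in> carrier T7" if r: "r \<in> carrier R" and t: "t \<in> carrier T7"
  proof -
    have "finite {n. 1 \<le> n \<and> (r \<odot>\<^bsub>T7\<^esub> t) n \<noteq> \<zero>\<^bsub>TP7 n\<^esub>}"
      by (rule finite_subset[OF _ tmD(3)[OF t]]) (use r in "auto simp: Tco_simps")
    then show ?thesis using tmD(1)[OF t] r by (auto simp: Tco_simps)
  qed
qed

private lemma tm_at:
  assumes "1 \<le> n"
  shows "(s \<oplus>\<^bsub>T7\<^esub> t) n = s n \<oplus>\<^bsub>TP7 n\<^esub> t n" "(r \<odot>\<^bsub>T7\<^esub> t) n = r \<odot>\<^bsub>TP7 n\<^esub> t n" "\<zero>\<^bsub>T7\<^esub> n = \<zero>\<^bsub>TP7 n\<^esub>"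
  using assms by (simp_all add: Tco_simps)

lemma module_Tco: "module R T7"
proof (rule moduleI)
  show "abelian_group T7"
  proof (rule abelian_groupI)
    fix t assume t: "t \<in> carrier T7"
    have "\<zero>\<^bsub>T7\<^esub> = (\<ominus>\<^bsub>R\<^esub> \<one>\<^bsub>R\<^esub>) \<odot>\<^bsub>T7\<^esub> t \<oplus>\<^bsub>T7\<^esub> t"
      by (rule Tco_eqI)
        (use t tm_closed in "auto simp: tm_at tmD(1)[OF t] TP7.smult_l_minus TP7.M.l_neg")
    then show "\<exists>s \<in> carrier T7. s \<oplus>\<^bsub>T7\<^esub> t = \<zero>\<^bsub>T7\<^esub>"
      using t tm_closed(3)[of "\<ominus>\<^bsub>R\<^esub> \<one>\<^bsub>R\<^esub>" t] by auto
  qed (auto intro!: Tco_eqI tm_closed simp: tm_at tmD(1) TP7.M.a_ac)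
  show "cring R" using V by (simp add: module_def)
qed (auto intro!: Tco_eqI tm_closed simp: tm_at tmD(1) TP7.smult_l_distr TP7.smult_r_distr TP7.smult_assoc1)

interpretation T7: module R T7 by (rule module_Tco)

lemma Tco_proj: "1 \<le> n \<Longrightarrow> (\<lambda>t. t n) \<in> lin R T7 (TP7 n)"
  by (rule lin_mapsI) (auto simp: tm_at tmD(1))

lemma tco_incl_at: "1 \<le> m \<Longrightarrow> tco_incl R V n X m = (if m = n then X else \<zero>\<^bsub>TP7 m\<^esub>)"
  by (simp add: tco_incl_def)

lemma tco_incl_linear: "1 \<le> n \<Longrightarrow> tco_incl R V n \<in> lin R (TP7 n) T7"
proof -
  assume n: "1 \<le> n"
  have cl: "tco_incl R V n X \<in> carrier T7" if "X \<in> carrier (TP7 n)" for X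
  proof -
    have "finite {m. 1 \<le> m \<and> tco_incl R V n X m \<noteq> \<zero>\<^bsub>TP7 m\<^esub>}"
      by (rule finite_subset[of _ "{n}"]) (auto simp: tco_incl_def)
    then show ?thesis using that by (auto simp: Tco_simps tco_incl_def)
  qed
  show ?thesis
    by (rule lin_mapsI) (auto intro!: Tco_eqI tm_closed cl simp: tm_at tco_incl_at)
qed

lemma Tco_sum:
  assumes t: "t \<in> carrier T7"
  shows "t = (\<Oplus>\<^bsub>T7\<^esub>n\<in>{n. 1 \<le> n \<and> t n \<noteq> \<zero>\<^bsub>TP7 n\<^esub>}. tco_incl R V n (t n))"
    (is "_ = finsum T7 ?f ?S")
proof (rule Tco_eqI[OF t])
  note cl = lin_closed[OF tco_incl_linear tmD(1)[OF t]]
  show "finsum T7 ?f ?S \<in> carrier T7" by (rule T7.M.finsum_closed) (use cl in auto)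
  fix m :: nat assume m: "1 \<le> m"
  have "finsum T7 ?f ?S m = (\<Oplus>\<^bsub>TP7 m\<^esub>n\<in>?S. tco_incl R V n (t n) m)"
    by (rule lin_finsum[OF module_Tco TP7.module_axioms Tco_proj[OF m]]) (use cl in auto)
  also have "... = (\<Oplus>\<^bsub>TP7 m\<^esub>n\<in>?S \<inter> {m}. tco_incl R V n (t n) m)"
    by (rule TP7.M.finsum_subset) (use tmD[OF t] m in "auto simp: tco_incl_at")
  also have "... = t m"
    using m tmD(1)[OF t m] by (auto simp: TP7.M.finsum_insert tco_incl_at Int_insert_right)
  finally show "t m = finsum T7 ?f ?S m" ..
qed

lemma word_multilinear: "1 \<le> n \<Longrightarrow> multilinear R V n T7 (word R V)"
  by (rule multilinear_cong[OF multilinear_comp[OF tensor_multilinear[OF V] tco_incl_linear] V])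
    (auto simp: word_def)

lemma word_closed: "xs \<noteq> [] \<Longrightarrow> over V xs \<Longrightarrow> word R V xs \<in> carrier T7"
  using multilinear_closed[OF word_multilinear, of "length xs" xs] by (simp add: Suc_le_eq)

lemma Tco_span:
  assumes H: "submodule H R T7" and w: "\<And>xs. xs \<noteq> [] \<Longrightarrow> over V xs \<Longrightarrow> word R V xs \<in> H"
  shows "carrier T7 \<subseteq> H"
proof
  fix t assume t: "t \<in> carrier T7"
  have "tco_incl R V n (t n) \<in> H" if n: "1 \<le> n" for n
  proof -
    have "carrier (TP7 n) \<subseteq> {X \<in> carrier (TP7 n). tco_incl R V n X \<in> H}"
    proof (rule tensor_power_span[OF V])
      show "submodule {X \<in> carrier (TP7 n). tco_incl R V n X \<in> H} R (TP7 n)"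
        by (rule submodule_preimage[OF TP7.module_axioms module_Tco tco_incl_linear[OF n] H])
      fix xs assume xs: "length xs = n" "over V xs"
      then show "tensor R V xs \<in> {X \<in> carrier (TP7 n). tco_incl R V n X \<in> H}"
        using w[of xs] n tensor_closed[OF V xs] by (cases xs) (auto simp: word_def)
    qed
    then show ?thesis using tmD(1)[OF t n] by auto
  qed
  then show "t \<in> H"
    by (subst Tco_sum[OF t], intro submodule_finsum[OF module_Tco H]) auto
qed

lemma Tco_ext:
  assumes "module R M" "f \<in> lin R T7 M" "g \<in> lin R T7 M"
    and "\<And>xs. xs \<noteq> [] \<Longrightarrow> over V xs \<Longrightarrow> f (word R V xs) = g (word R V xs)"
    and "t \<in> carrier T7"
  shows "f t = g t"
  using Tco_span[OF submodule_equalizer[OF module_Tco assms(1-3)]] assms(4,5) word_closed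
  by auto

context
  fixes M :: "('k, 'b, 'z) module_scheme" and \<phi>
  assumes M: "module R M" and \<phi>: "\<And>n. 1 \<le> n \<Longrightarrow> \<phi> n \<in> lin R (TP7 n) M"
begin
interpretation M: module R M by (rule M)

private lemma tco_lift_eq:
  assumes t: "t \<in> carrier T7" and S: "finite S" "{n. 1 \<le> n \<and> t n \<noteq> \<zero>\<^bsub>TP7 n\<^esub>} \<subseteq> S" "S \<subseteq> {1..}"
  shows "tco_lift R V M \<phi> t = (\<Oplus>\<^bsub>M\<^esub>n\<in>S. \<phi> n (t n))"
  unfolding tco_lift_def
proof (rule M.M.finsum_subset[symmetric, OF S(1,2)])
  fix n assume "n \<in> S - {n. 1 \<le> n \<and> t n \<noteq> \<zero>\<^bsub>TP7 n\<^esub>}"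
  then show "\<phi> n (t n) = \<zero>\<^bsub>M\<^esub>"
    using S(3) lin_zero[OF TP7.module_axioms M \<phi>] by auto
qed (use lin_closed[OF \<phi> tmD(1)[OF t]] in auto)

lemma tco_lift_linear: "tco_lift R V M \<phi> \<in> lin R T7 M"
proof (rule lin_mapsI)
  note cl = lin_closed[OF \<phi> tmD(1)]
  fix t assume t: "t \<in> carrier T7"
  let ?S = "{n. 1 \<le> n \<and> t n \<noteq> \<zero>\<^bsub>TP7 n\<^esub>}"
  show "tco_lift R V M \<phi> t \<in> carrier M"
    unfolding tco_lift_def by (rule M.M.finsum_closed) (use cl[OF _ t] in auto)
  show "tco_lift R V M \<phi> (r \<odot>\<^bsub>T7\<^esub> t) = r \<odot>\<^bsub>M\<^esub> tco_lift R V M \<phi> t" if r: "r \<in> carrier R" for r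
  proof -
    have "tco_lift R V M \<phi> (r \<odot>\<^bsub>T7\<^esub> t) = (\<Oplus>\<^bsub>M\<^esub>n\<in>?S. \<phi> n ((r \<odot>\<^bsub>T7\<^esub> t) n))"
      by (rule tco_lift_eq) (use r t tm_closed(3)[OF r t] tmD(3)[OF t] in "auto simp: tm_at")
    also have "... = (\<Oplus>\<^bsub>M\<^esub>n\<in>?S. r \<odot>\<^bsub>M\<^esub> \<phi> n (t n))"
      by (rule M.M.finsum_cong') (use cl[OF _ t] r tmD(1)[OF t] lin_smult[OF \<phi>] in "auto simp: tm_at")
    also have "... = r \<odot>\<^bsub>M\<^esub> tco_lift R V M \<phi> t"
      unfolding tco_lift_def
      by (rule M.finsum_smult_ldistr[symmetric]) (use cl[OF _ t] r tmD(3)[OF t] in auto)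
    finally show ?thesis .
  qed
  show "tco_lift R V M \<phi> (t \<oplus>\<^bsub>T7\<^esub> u) = tco_lift R V M \<phi> t \<oplus>\<^bsub>M\<^esub> tco_lift R V M \<phi> u" if u: "u \<in> carrier T7" for u
  proof -
    let ?U = "?S \<union> {n. 1 \<le> n \<and> u n \<noteq> \<zero>\<^bsub>TP7 n\<^esub>}"
    have U: "finite ?U" "?U \<subseteq> {1..}" using tmD(3)[OF t] tmD(3)[OF u] by auto
    have "tco_lift R V M \<phi> (t \<oplus>\<^bsub>T7\<^esub> u) = (\<Oplus>\<^bsub>M\<^esub>n\<in>?U. \<phi> n ((t \<oplus>\<^bsub>T7\<^esub> u) n))"
      by (rule tco_lift_eq[OF tm_closed(2)[OF t u] U(1) _ U(2)]) (auto simp: tm_at)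
    also have "... = (\<Oplus>\<^bsub>M\<^esub>n\<in>?U. \<phi> n (t n) \<oplus>\<^bsub>M\<^esub> \<phi> n (u n))"
      by (rule M.M.finsum_cong')
        (use cl[OF _ t] cl[OF _ u] tmD(1)[OF t] tmD(1)[OF u] lin_add[OF \<phi>] in "auto simp: tm_at")
    also have "... = (\<Oplus>\<^bsub>M\<^esub>n\<in>?U. \<phi> n (t n)) \<oplus>\<^bsub>M\<^esub> (\<Oplus>\<^bsub>M\<^esub>n\<in>?U. \<phi> n (u n))"
      by (rule M.M.finsum_addf) (use cl[OF _ t] cl[OF _ u] in auto)
    also have "... = tco_lift R V M \<phi> t \<oplus>\<^bsub>M\<^esub> tco_lift R V M \<phi> u"
      by (intro arg_cong2[where f = "add M"] tco_lift_eq[symmetric] t u U) auto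
    finally show ?thesis .
  qed
qed

lemma tco_lift_incl:
  assumes "1 \<le> n" "X \<in> carrier (TP7 n)"
  shows "tco_lift R V M \<phi> (tco_incl R V n X) = \<phi> n X"
  by (subst tco_lift_eq[of _ "{n}"])
    (use assms lin_closed[OF tco_incl_linear assms(2)] lin_closed[OF \<phi> assms(2)] in
      \<open>auto simp: tco_incl_at M.M.finsum_insert\<close>)

lemma tco_lift_word:
  assumes "xs \<noteq> []" "over V xs"
  shows "tco_lift R V M \<phi> (word R V xs) = \<phi> (length xs) (tensor R V xs)"
  unfolding word_def by (rule tco_lift_incl) (use assms tensor_closed[OF V] in "auto simp: Suc_le_eq")

end

end

context
  fixes R :: "'k ring" and V :: "('k, 'a, 'y) gmodule_scheme"
  assumes V: "graded_module R V"
begin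
private abbreviation (input) "TV \<equiv> Tco R V"
private abbreviation (input) "TPV \<equiv> tpow R V"

private lemmas V_module = graded_moduleD(1)[OF V]

interpretation T7: module R TV by (rule module_Tco[OF V_module])
interpretation TP7: module R "TPV n" for n by (rule module_tpow[OF V_module])

private lemma tm_grade: "t \<in> grade TV d \<longleftrightarrow> t \<in> carrier TV \<and> (\<forall>n\<ge>1. t n \<in> grade (TPV n) d)"
  using submodule_closed(1)[OF TP7.module_axioms tensor_power_grade_submodule[OF V]]
  by (auto simp: Tco_simps PiE_def Pi_def)

lemma Tco_grade_submodule: "submodule (grade TV d) R TV"
proof (rule submoduleI'[OF T7.module_axioms])
  note cl = submodule_closed[OF TP7.module_axioms tensor_power_grade_submodule[OF V]]
  note lin = Tco_proj[OF V_module]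
  show "\<zero>\<^bsub>TV\<^esub> \<in> grade TV d"
    using lin_zero[OF T7.module_axioms TP7.module_axioms lin] cl(2) by (simp add: tm_grade)
  show "x \<oplus>\<^bsub>TV\<^esub> y \<in> grade TV d" if "x \<in> grade TV d" "y \<in> grade TV d" for x y
    using that lin_add[OF lin] cl(3) by (simp add: tm_grade)
  show "r \<odot>\<^bsub>TV\<^esub> x \<in> grade TV d" if "r \<in> carrier R" "x \<in> grade TV d" for r x
    using that lin_smult[OF lin] cl(4) by (simp add: tm_grade)
qed (auto simp: tm_grade)

lemma tco_incl_grade:
  assumes "1 \<le> n" "X \<in> grade (TPV n) d" shows "tco_incl R V n X \<in> grade TV d"
  using assms lin_closed[OF tco_incl_linear[OF V_module assms(1)]]
    submodule_closed(1,2)[OF TP7.module_axioms tensor_power_grade_submodule[OF V]]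
  by (auto simp: tm_grade tco_incl_at[OF V_module])

lemma word_grade:
  assumes "xs \<noteq> []" "homogeneous V xs ds" "d = sum_list ds"
  shows "word R V xs \<in> grade TV d"
  unfolding word_def by (intro tco_incl_grade tensor_grade[OF V]) (use assms in "auto simp: Suc_le_eq")

text \<open>Directness is inherited from the tensor powers, because the projection to a component
  takes a decomposition of zero to a decomposition of zero.\<close>

lemma graded_module_Tco: "graded_module R TV"
proof (rule graded_moduleI[OF T7.module_axioms Tco_grade_submodule])
  fix H assume H: "submodule H R TV" "\<And>i. grade TV i \<subseteq> H"
  show "carrier TV \<subseteq> H"
  proof (rule Tco_span[OF V_module H(1)])
    fix xs assume xs: "xs \<noteq> []" "over V xs"
    show "word R V xs \<in> H"
    proof (rule multilinear_mem[OF V_module T7.module_axioms word_multilinear[OF V_module] H(1) homogeneous_span[OF V] _ refl xs(2)])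
      fix ys assume ys: "length ys = length xs" "set ys \<subseteq> (\<Union>i. grade V i)"
      then obtain ds where "homogeneous V ys ds" unfolding homogeneous_list by blast
      moreover have "ys \<noteq> []" using ys(1) xs(1) by auto
      ultimately show "word R V ys \<in> H" using word_grade[OF _ _ refl] H(2) by blast
    qed (use xs in "simp_all add: Suc_le_eq")
  qed
next
  fix c i assume c: "decomposition TV c \<zero>\<^bsub>TV\<^esub>"
  note cl = decomposition_closed[OF T7.module_axioms Tco_grade_submodule c]
  have fin: "finite {i. c i \<noteq> \<zero>\<^bsub>TV\<^esub>}" using c by (simp add: decomposition_def)
  show "c i = \<zero>\<^bsub>TV\<^esub>"
  proof (rule Tco_eqI[OF V_module cl(2) T7.M.zero_closed])
    fix n :: nat assume n: "1 \<le> n"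
    note lin = Tco_proj[OF V_module n]
    note zero = lin_zero[OF T7.module_axioms TP7.module_axioms lin]
    have "decomposition (TPV n) (\<lambda>i. c i n) \<zero>\<^bsub>TPV n\<^esub>"
    proof (rule decompositionI[OF TP7.module_axioms tensor_power_grade_submodule[OF V] _ fin])
      show "c j n \<in> grade (TPV n) j" for j using cl(1) n by (simp add: tm_grade)
      show "c j n = \<zero>\<^bsub>TPV n\<^esub>" if "j \<notin> {i. c i \<noteq> \<zero>\<^bsub>TV\<^esub>}" for j using that zero by simp
      have "\<zero>\<^bsub>TV\<^esub> = (\<Oplus>\<^bsub>TV\<^esub>i\<in>{i. c i \<noteq> \<zero>\<^bsub>TV\<^esub>}. c i)" using c by (simp add: decomposition_def)
      then show "\<zero>\<^bsub>TPV n\<^esub> = (\<Oplus>\<^bsub>TPV n\<^esub>i\<in>{i. c i \<noteq> \<zero>\<^bsub>TV\<^esub>}. c i n)"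
        using lin_finsum[OF T7.module_axioms TP7.module_axioms lin, of "{i. c i \<noteq> \<zero>\<^bsub>TV\<^esub>}" c] cl(2) zero by metis
    qed
    then show "c i n = \<zero>\<^bsub>TV\<^esub> n"
      using decomposition_zero[OF graded_module_tpow[OF V]] zero by simp
  qed
qed

lemma Tco_graded_hom:
  assumes N: "graded_module R N" and F: "F \<in> lin R TV N"
    and deg: "\<And>xs ds. xs \<noteq> [] \<Longrightarrow> homogeneous V xs ds \<Longrightarrow> F (word R V xs) \<in> grade N (sum_list ds + d)"
  shows "F \<in> graded_hom R TV N d"
proof -
  have hom: "(\<lambda>X. F (tco_incl R V n X)) \<in> graded_hom R (TPV n) N d" if n: "1 \<le> n" for n
  proof (rule tensor_power_graded_hom[OF V N lin_comp[OF F tco_incl_linear[OF V_module n]]])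
    fix xs ds assume "length xs = n" "homogeneous V xs ds"
    then show "F (tco_incl R V n (tensor R V xs)) \<in> grade N (sum_list ds + d)"
      using deg[of xs ds] n by (cases xs) (auto simp: word_def)
  qed
  have "F t \<in> grade N (i + d)" if t: "t \<in> grade TV i" for t i
  proof -
    have tc: "t \<in> carrier TV" and tg: "\<And>n. 1 \<le> n \<Longrightarrow> t n \<in> grade (TPV n) i" using t by (auto simp: tm_grade)
    have cl: "1 \<le> n \<Longrightarrow> tco_incl R V n (t n) \<in> carrier TV" for n
      by (intro lin_closed[OF tco_incl_linear[OF V_module]] lin_closed[OF Tco_proj[OF V_module] tc]) auto
    have "F t = F (\<Oplus>\<^bsub>TV\<^esub>n\<in>{n. 1 \<le> n \<and> t n \<noteq> \<zero>\<^bsub>TPV n\<^esub>}. tco_incl R V n (t n))"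
      using Tco_sum[OF V_module tc] by simp
    also have "... = (\<Oplus>\<^bsub>N\<^esub>n\<in>{n. 1 \<le> n \<and> t n \<noteq> \<zero>\<^bsub>TPV n\<^esub>}. F (tco_incl R V n (t n)))"
      by (rule lin_finsum[OF T7.module_axioms graded_moduleD(1)[OF N] F]) (use cl in auto)
    also have "... \<in> grade N (i + d)"
      by (rule submodule_finsum[OF graded_moduleD[OF N]]) (use graded_homD(2)[OF hom tg] in auto)
    finally show ?thesis .
  qed
  then show ?thesis using F by (auto simp: graded_hom_def)
qed

lemma koszul_word:
  assumes xs: "xs \<noteq> []" "over V xs"
  shows "koszul TV e (word R V xs) = word R V (map (koszul V e) xs)"
proof -
  have len: "1 \<le> length xs" using xs by (simp add: Suc_le_eq)
  have "tco_incl R V (length xs) \<in> graded_hom R (TPV (length xs)) TV 0"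
    using tco_incl_linear[OF V_module len] tco_incl_grade[OF len] by (auto simp: graded_hom_def)
  from koszul_commute[OF graded_module_tpow[OF V] graded_module_Tco this
      tensor_closed[OF V_module refl xs(2)], of e]
  show ?thesis using koszul_tensor[OF V refl xs(2)] by (simp add: word_def)
qed

end

text \<open>In iterated lifts the inner linear map depends on an outer argument x. Linearity in x is
  visible on pure tensors only; the tensors \<open>Y\<close> for which it holds form a
  submodule.\<close>

lemma lin_tensor_param:
  assumes V: "module R V" and W: "module R W" and M: "module R M" and F: "\<And>x. x \<in> carrier W \<Longrightarrow> F x \<in> tlin R V n M"
    and pure: "\<And>ys. length ys = n \<Longrightarrow> over V ys \<Longrightarrow> (\<lambda>x. F x (tensor R V ys)) \<in> lin R W M"
    and Y: "Y \<in> carrier (tpow R V n)"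
  shows "(\<lambda>x. F x Y) \<in> lin R W M"
proof -
  let ?H = "{Y \<in> carrier (tpow R V n). (\<lambda>x. F x Y) \<in> lin R W M}"
  note T = module_tpow[OF V, of n]
  interpret T: module R "tpow R V n" by (rule T)
  have "submodule ?H R (tpow R V n)"
  proof (rule submoduleI'[OF T])
    show "\<zero>\<^bsub>tpow R V n\<^esub> \<in> ?H"
      using lin_cong[OF lin_zero_map[OF W M] W] lin_zero[OF T M F] by simp
    show "X \<oplus>\<^bsub>tpow R V n\<^esub> Y \<in> ?H" if "X \<in> ?H" "Y \<in> ?H" for X Y
      using that lin_cong[OF lin_add_map[OF W M, of "\<lambda>x. F x X" "\<lambda>x. F x Y"] W] lin_add[OF F, of _ X Y] by simp
    show "r \<odot>\<^bsub>tpow R V n\<^esub> X \<in> ?H" if "r \<in> carrier R" "X \<in> ?H" for r X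
      using that lin_cong[OF lin_smult_map[OF W M, of "\<lambda>x. F x X" r] W] lin_smult[OF F, of _ r X] by simp
  qed auto
  from tensor_power_span[OF V this] pure Y tensor_closed[OF V] show ?thesis by auto
qed

lemma tensor_append:
  assumes V: "module R V"
  shows "X \<in> carrier (tpow R V p) \<Longrightarrow>
      tensor_append R V p q X \<in> tlin R V q (tpow R V (p + q))"
    and "Y \<in> carrier (tpow R V q) \<Longrightarrow>
      (\<lambda>X. tensor_append R V p q X Y) \<in> tlin R V p (tpow R V (p + q))"
    and "length xs = p \<Longrightarrow> length ys = q \<Longrightarrow> over V (xs @ ys) \<Longrightarrow>
      tensor_append R V p q (tensor R V xs) (tensor R V ys) = tensor R V (xs @ ys)"
proof -
  let ?T = "tpow R V"
  let ?L = "\<lambda>xs. tensor_lift R (?T (p + q)) (\<lambda>ys. tensor R V (xs @ ys))"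
  note mT = module_tpow[OF V]
  interpret T: module R "?T n" for n by (rule mT)
  note tm = tensor_multilinear[OF V, of "p + q"]
  have in_multi: "multilinear R V q (?T (p + q)) (\<lambda>ys. tensor R V (xs @ ys))"
    if "length xs = p" "over V xs" for xs
  proof (rule multilinearI)
    show "tensor R V (xs @ ys) \<in> carrier (?T (p + q))" if "length ys = q" "over V ys" for ys
      using that \<open>length xs = p\<close> \<open>set xs \<subseteq> carrier V\<close> by (intro tensor_closed[OF V]) auto
    show "(\<lambda>x. tensor R V (xs @ us @ x # vs)) \<in> lin R V (?T (p + q))"
      if "q = Suc (length us + length vs)" "over V us" "over V vs" for us vs
      using multilinear_slot[OF tm, of "xs @ us" vs] that \<open>length xs = p\<close> \<open>set xs \<subseteq> carrier V\<close> by simp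
  qed
  note L_lin = tensor_lift_linear[OF V mT in_multi] and L_val = tensor_lift_tensor[OF V mT in_multi]
  have out_multi: "multilinear R V p (?T (p + q)) (\<lambda>xs. ?L xs Y)" if Y: "Y \<in> carrier (?T q)" for Y
  proof (rule multilinearI)
    show "?L xs Y \<in> carrier (?T (p + q))" if "length xs = p" "over V xs" for xs
      using lin_closed[OF L_lin[OF that] Y] .
    fix us vs assume n: "p = Suc (length us + length vs)" and us: "over V us" and vs: "over V vs"
    have xs: "length (us @ x # vs) = p" "over V (us @ x # vs)" if "x \<in> carrier V" for x
      using n us vs that by auto
    have slot: "(\<lambda>x. tensor R V ((us @ x # vs) @ ys)) \<in> lin R V (?T (p + q))"
      if "length ys = q" "over V ys" for ys
      using multilinear_slot[OF tm, of us "vs @ ys"] n us vs that by simp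
    show "(\<lambda>x. ?L (us @ x # vs) Y) \<in> lin R V (?T (p + q))"
      by (rule lin_tensor_param[OF V V mT L_lin[OF xs] _ Y])
        (assumption | rule lin_cong[OF slot V] L_val[OF xs])+
  qed
  note A_lin = tensor_lift_linear[OF V mT out_multi, folded tensor_append_def]
  note A_val = tensor_lift_tensor[OF V mT out_multi, folded tensor_append_def]
  show lin2: "(\<lambda>X. tensor_append R V p q X Y) \<in> lin R (?T p) (?T (p + q))"
    if "Y \<in> carrier (?T q)" for Y
    using A_lin[OF that] by (simp add: tensor_append_def[abs_def])
  have val: "tensor_append R V p q (tensor R V xs) Y = ?L xs Y"
    if "length xs = p" "over V xs" "Y \<in> carrier (?T q)" for xs Y
    using A_val[OF that(3,1,2)] .
  show "tensor_append R V p q (tensor R V xs) (tensor R V ys) = tensor R V (xs @ ys)"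
    if "length xs = p" "length ys = q" "over V (xs @ ys)"
    using val[OF that(1) _ tensor_closed[OF V that(2)]] L_val[OF that(1) _ that(2)] that(3) by simp
  show "tensor_append R V p q X \<in> lin R (?T q) (?T (p + q))" if X: "X \<in> carrier (?T p)"
    by (rule lin_tensor_param[OF V mT mT lin2 _ X])
      (assumption | rule lin_cong[OF L_lin mT] val)+
qed

section \<open>Maps out of a tensor square\<close>

context
  fixes R :: "'k ring" and C :: "('k, 'c, 'y) gmodule_scheme" and M :: "('k, 'b, 'z) module_scheme" and \<beta>
  assumes C: "module R C" and M: "module R M"
    and \<beta>: "\<And>y. y \<in> carrier C \<Longrightarrow> (\<lambda>x. \<beta> x y) \<in> lin R C M"
      "\<And>x. x \<in> carrier C \<Longrightarrow> \<beta> x \<in> lin R C M"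
begin
lemma pair_lift_linear: "tensor_lift R M (\<lambda>xs. \<beta> (xs ! 0) (xs ! 1)) \<in> tlin R C 2 M"
  by (rule tensor_lift_linear[OF C M multilinear_pair]) (use \<beta> in auto)

lemma pair_lift_tensor:
  "x \<in> carrier C \<Longrightarrow> y \<in> carrier C \<Longrightarrow> tensor_lift R M (\<lambda>xs. \<beta> (xs ! 0) (xs ! 1)) (tensor R C [x, y]) = \<beta> x y"
  using tensor_lift_tensor[OF C M multilinear_pair, of \<beta> "[x, y]"] \<beta> by simp

end

lemma pair_ext:
  assumes "module R C" "module R M" "f \<in> tlin R C 2 M" "g \<in> tlin R C 2 M"
    and "\<And>x y. x \<in> carrier C \<Longrightarrow> y \<in> carrier C \<Longrightarrow> f (tensor R C [x, y]) = g (tensor R C [x, y])"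
    and "Z \<in> carrier (tpow R C 2)"
  shows "f Z = g Z"
proof (rule tensor_ext[OF assms(1-4) _ assms(6)])
  fix xs assume "length xs = 2" "over C xs"
  then show "f (tensor R C xs) = g (tensor R C xs)"
    using assms(5) by (auto simp: numeral_2_eq_2 length_Suc_conv)
qed

lemma pair_linear:
  assumes "module R C"
  shows "y \<in> carrier C \<Longrightarrow> (\<lambda>x. tensor R C [x, y]) \<in> lin R C (tpow R C 2)"
    and "x \<in> carrier C \<Longrightarrow> (\<lambda>y. tensor R C [x, y]) \<in> lin R C (tpow R C 2)"
    and "x \<in> carrier C \<Longrightarrow> y \<in> carrier C \<Longrightarrow> tensor R C [x, y] \<in> carrier (tpow R C 2)"
  using multilinear_slot[OF tensor_multilinear[OF assms], of 2 "[]" "[y]"]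
    multilinear_slot[OF tensor_multilinear[OF assms], of 2 "[x]" "[]"] tensor_closed[OF assms, of "[x, y]" 2]
  by auto

text \<open>The tensor product of two maps without Koszul sign. The sign rule enters by composing
  the left factor with \<open>koszul\<close>, as in \<open>tensor_maps_pair\<close>.\<close>

definition tensor2 ::
  "'k ring \<Rightarrow> ('k, 'c, 'y) gmodule_scheme \<Rightarrow> ('k, 'd, 'z) gmodule_scheme \<Rightarrow> ('c \<Rightarrow> 'd) \<Rightarrow> ('c \<Rightarrow> 'd) \<Rightarrow>
   ('c list \<Rightarrow> 'k) set \<Rightarrow> ('d list \<Rightarrow> 'k) set" where
  "tensor2 R C D f g = tensor_lift R (tpow R D 2) (\<lambda>xs. tensor R D [f (xs ! 0), g (xs ! 1)])"

lemma tensor2: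
  assumes C: "module R C" and D: "module R D" and f: "f \<in> lin R C D" and g: "g \<in> lin R C D"
  shows tensor2_linear: "tensor2 R C D f g \<in> tlin R C 2 (tpow R D 2)"
    and tensor2_tensor: "x \<in> carrier C \<Longrightarrow> y \<in> carrier C \<Longrightarrow>
      tensor2 R C D f g (tensor R C [x, y]) = tensor R D [f x, g y]"
proof -
  have b: "(\<lambda>x. tensor R D [f x, g y]) \<in> lin R C (tpow R D 2)"
    "(\<lambda>y. tensor R D [f x, g y]) \<in> lin R C (tpow R D 2)"
    if "x \<in> carrier C" "y \<in> carrier C" for x y
    using lin_comp[OF pair_linear(1)[OF D lin_closed[OF g]] f]
      lin_comp[OF pair_linear(2)[OF D lin_closed[OF f]] g] that by auto
  show "tensor2 R C D f g \<in> tlin R C 2 (tpow R D 2)"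
    unfolding tensor2_def by (rule pair_lift_linear[OF C module_tpow[OF D]]) (use b in auto)
  show "x \<in> carrier C \<Longrightarrow> y \<in> carrier C \<Longrightarrow>
      tensor2 R C D f g (tensor R C [x, y]) = tensor R D [f x, g y]"
    unfolding tensor2_def
    by (rule pair_lift_tensor[OF C module_tpow[OF D], where \<beta> = "\<lambda>x y. tensor R D [f x, g y]"])
      (use b in auto)
qed

lemma tensor2_comp:
  assumes "module R C" "module R D" "module R E" "f \<in> lin R C D" "g \<in> lin R C D"
    "f' \<in> lin R D E" "g' \<in> lin R D E" "Z \<in> carrier (tpow R C 2)"
  shows "tensor2 R D E f' g' (tensor2 R C D f g Z) = tensor2 R C E (\<lambda>x. f' (f x)) (\<lambda>x. g' (g x)) Z"
  by (rule pair_ext[OF assms(1) module_tpow[OF assms(3)]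
        lin_comp[OF tensor2_linear[OF assms(2,3,6,7)] tensor2_linear[OF assms(1,2,4,5)]]
        tensor2_linear[OF assms(1,3) lin_comp[OF assms(6,4)] lin_comp[OF assms(7,5)]] _ assms(8)])
    (use assms in "auto simp: tensor2_tensor lin_comp lin_closed")

lemma tensor2_cong:
  assumes "module R C" "module R D" "f \<in> lin R C D" "g \<in> lin R C D"
    "\<And>x. x \<in> carrier C \<Longrightarrow> f' x = f x" "\<And>x. x \<in> carrier C \<Longrightarrow> g' x = g x"
    "Z \<in> carrier (tpow R C 2)"
  shows "tensor2 R C D f' g' Z = tensor2 R C D f g Z"
proof -
  have fg': "f' \<in> lin R C D" "g' \<in> lin R C D"
    using assms lin_cong[OF _ assms(1)] by blast+
  show ?thesis
    by (rule pair_ext[OF assms(1) module_tpow[OF assms(2)] tensor2_linear[OF assms(1,2) fg']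
          tensor2_linear[OF assms(1-4)] _ assms(7)]) (use assms fg' in "simp add: tensor2_tensor")
qed

lemma tensor2_minus:
  assumes "module R C" "module R D" "f \<in> lin R C D" "f' \<in> lin R C D" "g \<in> lin R C D"
    "Z \<in> carrier (tpow R C 2)"
  shows "tensor2 R C D (\<lambda>x. f x \<ominus>\<^bsub>D\<^esub> f' x) g Z =
      tensor2 R C D f g Z \<ominus>\<^bsub>tpow R D 2\<^esub> tensor2 R C D f' g Z" (is ?A)
    and "tensor2 R C D g (\<lambda>x. f x \<ominus>\<^bsub>D\<^esub> f' x) Z =
      tensor2 R C D g f Z \<ominus>\<^bsub>tpow R D 2\<^esub> tensor2 R C D g f' Z" (is ?B)
proof -
  note mD = module_tpow[OF assms(2), of 2] and mC = module_tpow[OF assms(1), of 2]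
  note lin = tensor2_linear[OF assms(1,2)]
  note fm = lin_minus_map[OF assms(1-4)]
  note cl = lin_closed[OF assms(3)] lin_closed[OF assms(4)] lin_closed[OF assms(5)]
  show ?A
    by (rule pair_ext[OF assms(1) mD lin[OF fm assms(5)] lin_minus_map[OF mC mD lin[OF assms(3,5)] lin[OF assms(4,5)]] _ assms(6)])
      (use assms fm cl in "simp add: tensor2_tensor lin_minus[OF assms(2) mD pair_linear(1)[OF assms(2)]]")
  show ?B
    by (rule pair_ext[OF assms(1) mD lin[OF assms(5) fm] lin_minus_map[OF mC mD lin[OF assms(5,3)] lin[OF assms(5,4)]] _ assms(6)])
      (use assms fm cl in "simp add: tensor2_tensor lin_minus[OF assms(2) mD pair_linear(2)[OF assms(2)]]")
qed

lemma tensor2_neg: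
  assumes "module R C" "module R D" "f \<in> lin R C D" "g \<in> lin R C D"
    "Z \<in> carrier (tpow R C 2)"
  shows "tensor2 R C D (\<lambda>x. \<ominus>\<^bsub>D\<^esub> f x) g Z = \<ominus>\<^bsub>tpow R D 2\<^esub> tensor2 R C D f g Z"
proof -
  note mD = module_tpow[OF assms(2), of 2] and mC = module_tpow[OF assms(1), of 2]
  note lin = tensor2_linear[OF assms(1,2)]
  note fm = lin_neg_map[OF assms(1-3)]
  note cl = lin_closed[OF assms(3)] lin_closed[OF assms(4)]
  show ?thesis
    by (rule pair_ext[OF assms(1) mD lin[OF fm assms(4)] lin_neg_map[OF mC mD lin[OF assms(3,4)]] _ assms(5)])
      (use assms fm cl in "simp add: tensor2_tensor lin_neg[OF assms(2) mD pair_linear(1)[OF assms(2)]]")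
qed

lemma unary_factor_linear:
  assumes "module R C" "f \<in> lin R C D"
  shows "(\<lambda>X. f (untensor R C X)) \<in> tlin R C 1 D"
  by (rule lin_comp[OF assms(2) untensor(1)[OF assms(1)]])

text \<open>The second factor has to pass the first argument, which puts the sign operator of its
  degree there.\<close>

lemma tensor_maps_pair:
  assumes C: "graded_module R C" and D: "module R D" and f: "f \<in> lin R C D" and g: "g \<in> lin R C D"
    and Z: "Z \<in> carrier (tpow R C 2)"
  shows "tensor_maps R C D [(e, 1, \<lambda>X. f (untensor R C X)), (e', 1, \<lambda>X. g (untensor R C X))] Z =
    tensor2 R C D (\<lambda>x. f (koszul C e' x)) g Z"
proof -
  note C' = graded_moduleD(1)[OF C]
  let ?fs = "[(e, 1, \<lambda>X. f (untensor R C X)), (e', 1, \<lambda>X. g (untensor R C X))]"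
  have valid: "valid_factors R C D ?fs" "arity ?fs = 2"
    using unary_factor_linear[OF C' f] unary_factor_linear[OF C' g] by (auto simp: valid_factors_def)
  show ?thesis
  proof (rule pair_ext[OF C' module_tpow[OF D] tensor_maps_linear[OF C D valid]
        tensor2_linear[OF C' D lin_comp[OF f koszul_linear[OF C]] g] _ Z])
    fix x y assume xy: "x \<in> carrier C" "y \<in> carrier C"
    have "tensor_maps R C D ?fs (tensor R C [x, y]) = tensor R D (apply_factors R C ?fs [x, y])"
      by (rule tensor_maps_tensor[OF C D]) (use valid xy in auto)
    also have "apply_factors R C ?fs [x, y] = [f (koszul C e' x), g y]"
      using xy untensor(2)[OF C'] koszul_closed[OF C] koszul_even[OF C] by simp
    finally show "tensor_maps R C D ?fs (tensor R C [x, y]) =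
        tensor2 R C D (\<lambda>x. f (koszul C e' x)) g (tensor R C [x, y])"
      using tensor2_tensor[OF C' D lin_comp[OF f koszul_linear[OF C]] g xy] by simp
  qed simp
qed

section \<open>The comultiplication of the tensor coalgebra\<close>

text \<open>The open slot lies among the first \<open>i\<close> letters or among the others. Either
  way one argument of \<beta> is constant and the other one linear in the slot.\<close>

lemma multilinear_split:
  assumes "module R V" "i \<le> n"
    and \<beta>: "\<And>y. y \<in> carrier N \<Longrightarrow> (\<lambda>x. \<beta> x y) \<in> lin R M P" "\<And>x. x \<in> carrier M \<Longrightarrow> \<beta> x \<in> lin R N P"
    and \<phi>: "multilinear R V i M \<phi>" and \<psi>: "multilinear R V (n - i) N \<psi>"
  shows "multilinear R V n P (\<lambda>xs. \<beta> (\<phi> (take i xs)) (\<psi> (drop i xs)))"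
proof (rule multilinearI)
  fix xs assume xs: "length xs = n" "over V xs"
  have "over V (take i xs)" "over V (drop i xs)"
    using xs(2) set_take_subset[of i xs] set_drop_subset[of i xs] by blast+
  then show "\<beta> (\<phi> (take i xs)) (\<psi> (drop i xs)) \<in> carrier P"
    using xs(1) assms(2)
    by (intro lin_closed[OF \<beta>(2)] multilinear_closed[OF \<phi>] multilinear_closed[OF \<psi>]) auto
next
  fix us vs assume n: "n = Suc (length us + length vs)" and us: "over V us" and vs: "over V vs"
  show "(\<lambda>x. \<beta> (\<phi> (take i (us @ x # vs))) (\<psi> (drop i (us @ x # vs)))) \<in> lin R V P"
  proof (cases "i \<le> length us")
    case True
    have sub: "over V (take i us)" "over V (drop i us)"
      using us set_take_subset[of i us] set_drop_subset[of i us] by blast+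
    have "(\<lambda>x. \<psi> (drop i us @ x # vs)) \<in> lin R V N"
      by (rule multilinear_slot[OF \<psi> _ sub(2) vs]) (use n True in auto)
    moreover have "\<phi> (take i us) \<in> carrier M"
      by (rule multilinear_closed[OF \<phi> _ sub(1)]) (use True in auto)
    ultimately show ?thesis using lin_comp[OF \<beta>(2)] True by simp
  next
    case False
    define j where "j = i - Suc (length us)"
    have i: "i = Suc (length us + j)" using False by (simp add: j_def)
    have sub: "over V (take j vs)" "over V (drop j vs)"
      using vs set_take_subset[of j vs] set_drop_subset[of j vs] by blast+
    have "(\<lambda>x. \<phi> (us @ x # take j vs)) \<in> lin R V M"
      by (rule multilinear_slot[OF \<phi> _ us sub(1)]) (use n i assms(2) in auto)
    moreover have "\<psi> (drop j vs) \<in> carrier N"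
      by (rule multilinear_closed[OF \<psi> _ sub(2)]) (use n i in auto)
    ultimately show ?thesis using lin_comp[OF \<beta>(1)] i by simp
  qed
qed

lemma cuts_closed:
  assumes "(us, vs) \<in> cuts xs" "set xs \<subseteq> C"
  shows "us \<noteq> []" "vs \<noteq> []" "set us \<subseteq> C" "set vs \<subseteq> C" "length us < length xs" "length vs < length xs"
    "xs = us @ vs"
  using assms by (auto simp: cuts_def)

context
  fixes R :: "'k ring" and V :: "('k, 'a, 'y) gmodule_scheme"
  assumes V: "module R V"
begin
private abbreviation (input) "T9 \<equiv> Tco R V"
private abbreviation (input) "TT9 \<equiv> tpow R (Tco R V) 2"

interpretation T9: module R T9 by (rule module_Tco[OF V])
interpretation TT9: module R TT9 by (rule module_tpow[OF T9.module_axioms])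

private lemma comult_body:
  "multilinear R V n TT9 (\<lambda>xs. \<Oplus>\<^bsub>TT9\<^esub> i \<in> {1..n - 1}.
      tensor R T9 [tco_incl R V i (tensor R V (take i xs)), tco_incl R V (n - i) (tensor R V (drop i xs))])"
proof (rule multilinear_finsum[OF V TT9.module_axioms])
  fix i assume i: "i \<in> {1..n - 1}"
  show "multilinear R V n TT9 (\<lambda>xs. tensor R T9
      [tco_incl R V i (tensor R V (take i xs)), tco_incl R V (n - i) (tensor R V (drop i xs))])"
    by (rule multilinear_split[where \<beta> = "\<lambda>x y. tensor R T9 [x, y]", OF V _ pair_linear(1,2)[OF T9.module_axioms]
          multilinear_comp[OF tensor_multilinear[OF V] tco_incl_linear[OF V]]
          multilinear_comp[OF tensor_multilinear[OF V] tco_incl_linear[OF V]]])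
      (use i in auto)
qed

lemma tco_comult_linear: "tco_comult R V \<in> lin R T9 TT9"
  unfolding tco_comult_def Let_def
  by (rule tco_lift_linear[OF V TT9.module_axioms tensor_lift_linear[OF V TT9.module_axioms comult_body]])

lemma word_pair_closed:
  "us \<noteq> [] \<Longrightarrow> vs \<noteq> [] \<Longrightarrow> over V us \<Longrightarrow> over V vs \<Longrightarrow>
    tensor R T9 [word R V us, word R V vs] \<in> carrier TT9"
  by (intro pair_linear(3)[OF T9.module_axioms] word_closed[OF V])

lemma tco_comult_word:
  assumes xs: "xs \<noteq> []" "over V xs"
  shows "tco_comult R V (word R V xs) =
    finsum TT9 (\<lambda>(us, vs). tensor R T9 [word R V us, word R V vs]) (cuts xs)"
proof -
  have "tco_comult R V (word R V xs) = (\<Oplus>\<^bsub>TT9\<^esub> i \<in> {1..length xs - 1}.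
      tensor R T9 [tco_incl R V i (tensor R V (take i xs)),
        tco_incl R V (length xs - i) (tensor R V (drop i xs))])"
    unfolding tco_comult_def Let_def
    by (subst tco_lift_word[OF V TT9.module_axioms tensor_lift_linear[OF V TT9.module_axioms comult_body] xs])
      (rule tensor_lift_tensor[OF V TT9.module_axioms comult_body refl xs(2)])
  also have "... = finsum TT9 (\<lambda>(us, vs). tensor R T9 [word R V us, word R V vs]) (cuts xs)"
  proof (rule TT9.M.finsum_cuts)
    fix us vs assume uv: "(us, vs) \<in> cuts xs"
    note c = cuts_closed[OF uv xs(2)]
    show "tensor R T9 [word R V us, word R V vs] \<in> carrier TT9" using c by (intro word_pair_closed)
    show "tensor R T9 [tco_incl R V (length us) (tensor R V (take (length us) xs)),
        tco_incl R V (length xs - length us) (tensor R V (drop (length us) xs))] =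
      tensor R T9 [word R V us, word R V vs]"
      unfolding c(7) by (simp add: word_def)
  qed
  finally show ?thesis .
qed

text \<open>The way in which linear maps on the tensor square are evaluated on coproducts from here
  on: only their values on pairs of words enter.\<close>

lemma tco_comult_word_map:
  assumes M: "module R M" and f: "f \<in> lin R TT9 M" and xs: "xs \<noteq> []" "over V xs"
    and h: "\<And>us vs. (us, vs) \<in> cuts xs \<Longrightarrow> f (tensor R T9 [word R V us, word R V vs]) = h us vs"
  shows "f (tco_comult R V (word R V xs)) = finsum M (\<lambda>(us, vs). h us vs) (cuts xs)"
proof -
  interpret M: module R M by (rule M)
  have c: "tensor R T9 [word R V us, word R V vs] \<in> carrier TT9" if "(us, vs) \<in> cuts xs" for us vs
    using cuts_closed[OF that xs(2)] by (intro word_pair_closed)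
  have "f (tco_comult R V (word R V xs)) =
      finsum M (\<lambda>p. f (case p of (us, vs) \<Rightarrow> tensor R T9 [word R V us, word R V vs])) (cuts xs)"
    unfolding tco_comult_word[OF xs] by (rule lin_finsum[OF TT9.module_axioms M f]) (use c in auto)
  also have "... = finsum M (\<lambda>(us, vs). h us vs) (cuts xs)"
    by (rule M.M.finsum_cong') (use h lin_closed[OF f c] in "auto simp flip: h")
  finally show ?thesis .
qed

text \<open>The \<open>n\<close>-th component of an element is recovered from the \<open>(1, n - 1)\<close> part of its coproduct.\<close>

lemma tco_comult_injective:
  assumes t: "t \<in> carrier T9" and "tco_comult R V t = \<zero>\<^bsub>TT9\<^esub>" and "t 1 = \<zero>\<^bsub>tpow R V 1\<^esub>"
  shows "t = \<zero>\<^bsub>T9\<^esub>"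
proof (rule Tco_eqI[OF V t T9.M.zero_closed])
  fix n :: nat assume n: "1 \<le> n"
  note TP = module_tpow[OF V]
  interpret TP: module R "tpow R V m" for m by (rule TP)
  note proj = Tco_proj[OF V]
  have at0: "\<zero>\<^bsub>T9\<^esub> n = \<zero>\<^bsub>tpow R V n\<^esub>" using n by (simp add: Tco_simps)
  show "t n = \<zero>\<^bsub>T9\<^esub> n"
  proof (cases "n = 1")
    case False
    then have n': "1 \<le> n - 1" "1 + (n - 1) = n" using n by auto
    let ?b = "\<lambda>x y. tensor_append R V 1 (n - 1) (x 1) (y (n - 1))"
    have b: "(\<lambda>x. ?b x y) \<in> lin R T9 (tpow R V n)" "?b x \<in> lin R T9 (tpow R V n)"
      if "x \<in> carrier T9" "y \<in> carrier T9" for x y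
      using lin_comp[OF tensor_append(2)[OF V lin_closed[OF proj[OF n'(1)] that(2)]] proj[OF order_refl]]
        lin_comp[OF tensor_append(1)[OF V lin_closed[OF proj[OF order_refl] that(1)]] proj[OF n'(1)]]
      unfolding n'(2) by auto
    let ?M = "tensor_lift R (tpow R V n) (\<lambda>xs. ?b (xs ! 0) (xs ! 1))"
    have M_lin: "?M \<in> lin R TT9 (tpow R V n)"
      by (rule pair_lift_linear[OF T9.module_axioms TP]) (use b in auto)
    have M_val: "?M (tensor R T9 [x, y]) = ?b x y" if "x \<in> carrier T9" "y \<in> carrier T9" for x y
      by (rule pair_lift_tensor[OF T9.module_axioms TP, where \<beta> = ?b]) (use b that in auto)
    have "?M (tco_comult R V t) = t n"
    proof (rule Tco_ext[OF V TP lin_comp[OF M_lin tco_comult_linear] proj[OF n] _ t])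
      fix xs assume xs: "xs \<noteq> []" "over V xs"
      have cut: "?M (tensor R T9 [word R V us, word R V vs]) =
          (if length us = 1 \<and> length xs = n then tensor R V xs else \<zero>\<^bsub>tpow R V n\<^esub>)"
        if uv: "(us, vs) \<in> cuts xs" for us vs
      proof -
        note c = cuts_closed[OF uv xs(2)]
        have w: "word R V us \<in> carrier T9" "word R V vs \<in> carrier T9" using c word_closed[OF V] by auto
        have at: "word R V us 1 = (if length us = 1 then tensor R V us else \<zero>\<^bsub>tpow R V 1\<^esub>)"
          "word R V vs (n - 1) = (if length vs = n - 1 then tensor R V vs else \<zero>\<^bsub>tpow R V (n - 1)\<^esub>)"
          using n' by (auto simp: word_def tco_incl_at[OF V])
        note cl = lin_closed[OF proj[OF order_refl] w(1)] lin_closed[OF proj[OF n'(1)] w(2)]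
        note zero = lin_zero[OF TP TP tensor_append(2)[OF V cl(2)]] lin_zero[OF TP TP tensor_append(1)[OF V cl(1)]]
        show ?thesis
        proof (cases "length us = 1 \<and> length vs = n - 1")
          case True
          then show ?thesis
            unfolding M_val[OF w] at
            using tensor_append(3)[OF V, of us 1 vs "n - 1"] c n' by simp
        next
          case False
          then have "?b (word R V us) (word R V vs) = \<zero>\<^bsub>tpow R V n\<^esub>"
            using zero at n'(2) by (cases "length us = 1") auto
          moreover have "\<not> (length us = 1 \<and> length xs = n)" using False c(7) n' by auto
          ultimately show ?thesis unfolding M_val[OF w] by (simp only: if_False)
        qed
      qed
      have "?M (tco_comult R V (word R V xs)) = finsum (tpow R V n) (\<lambda>(us, vs).
          if length us = 1 \<and> length xs = n then tensor R V xs else \<zero>\<^bsub>tpow R V n\<^esub>) (cuts xs)"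
        by (rule tco_comult_word_map[OF TP M_lin xs cut])
      also have "... = finsum (tpow R V n) (\<lambda>(us, vs). if length us = 1 \<and> length xs = n then tensor R V xs
          else \<zero>\<^bsub>tpow R V n\<^esub>) (if length xs = n then {([hd xs], tl xs)} else {})"
      proof (rule TP.M.finsum_subset[OF finite_cuts])
        \<comment> \<open>\<open>tl xs\<close> is nonempty because \<open>n\<close> is not 1, so
          splitting off the first letter is a cut.\<close>
        show "(if length xs = n then {([hd xs], tl xs)} else {}) \<subseteq> cuts xs"
          using False n xs(1) by (cases xs) (auto simp: cuts_def)
      qed (use tensor_closed[OF V _ xs(2)] in "auto simp: cuts_def length_Suc_conv split: if_splits")
      also have "... = word R V xs n"
        using tensor_closed[OF V _ xs(2)] n by (auto simp: TP.M.finsum_insert word_def tco_incl_at[OF V])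
      finally show "?M (tco_comult R V (word R V xs)) = word R V xs n" .
    qed
    then have "t n = ?M \<zero>\<^bsub>TT9\<^esub>" using assms(2) by simp
    then show ?thesis using lin_zero[OF TT9.module_axioms TP M_lin] at0 by simp
  qed (use assms(3) at0 in simp)
qed

end

definition triples :: "'a list \<Rightarrow> ('a list \<times> 'a list \<times> 'a list) set" where
  "triples xs = {(us, vs, ws). us @ vs @ ws = xs \<and> us \<noteq> [] \<and> vs \<noteq> [] \<and> ws \<noteq> []}"

text \<open>Cutting once and then cutting a fixed one of the two parts again yields every cut into
  three parts exactly once. This is coassociativity on the level of index sets.\<close>

lemma (in abelian_monoid) finsum_cuts_cuts:
  assumes "\<And>us vs ws. (us, vs, ws) \<in> triples xs \<Longrightarrow> F us vs ws \<in> carrier G"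
  shows "finsum G (\<lambda>(us, vs). finsum G (\<lambda>(p, q). F us p q) (cuts vs)) (cuts xs) =
      finsum G (\<lambda>(us, vs, ws). F us vs ws) (triples xs)" (is ?A)
    and "finsum G (\<lambda>(us, vs). finsum G (\<lambda>(p, q). F p q vs) (cuts us)) (cuts xs) =
      finsum G (\<lambda>(us, vs, ws). F us vs ws) (triples xs)" (is ?B)
proof -
  have "finsum G (\<lambda>(us, vs). finsum G (\<lambda>(p, q). F us p q) (cuts vs)) (cuts xs) =
      finsum G (\<lambda>p. \<Oplus>q\<in>cuts (snd p). F (fst p) (fst q) (snd q)) (cuts xs)"
    by (simp add: case_prod_unfold)
  also have "... = finsum G (\<lambda>(p, q). F (fst p) (fst q) (snd q)) (SIGMA p:cuts xs. cuts (snd p))"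
    by (rule finsum_Sigma[OF finite_cuts finite_cuts]) (auto intro!: assms simp: cuts_def triples_def)
  also have "... = finsum G (\<lambda>(us, vs, ws). F us vs ws) (triples xs)"
    by (rule finsum_bij_witness[where i = "\<lambda>(p, q). (fst p, fst q, snd q)"
          and j = "\<lambda>(us, vs, ws). ((us, vs @ ws), (vs, ws))"])
      (auto intro: assms simp: cuts_def triples_def)
  finally show ?A .
  have "finsum G (\<lambda>(us, vs). finsum G (\<lambda>(p, q). F p q vs) (cuts us)) (cuts xs) =
      finsum G (\<lambda>p. \<Oplus>q\<in>cuts (fst p). F (fst q) (snd q) (snd p)) (cuts xs)"
    by (simp add: case_prod_unfold)
  also have "... = finsum G (\<lambda>(p, q). F (fst q) (snd q) (snd p)) (SIGMA p:cuts xs. cuts (fst p))"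
    by (rule finsum_Sigma[OF finite_cuts finite_cuts]) (auto intro!: assms simp: cuts_def triples_def)
  also have "... = finsum G (\<lambda>(us, vs, ws). F us vs ws) (triples xs)"
    by (rule finsum_bij_witness[where i = "\<lambda>(p, q). (fst q, snd q, snd p)"
          and j = "\<lambda>(us, vs, ws). ((us @ vs, ws), (us, vs))"])
      (auto intro: assms simp: cuts_def triples_def)
  finally show ?B .
qed

context
  fixes R :: "'k ring" and V :: "('k, 'a, 'y) gmodule_scheme"
  assumes V: "graded_module R V"
begin
private abbreviation (input) "T1 \<equiv> Tco R V"
private abbreviation (input) "TT1 \<equiv> tpow R (Tco R V) 2"

private lemmas mV9 = graded_moduleD(1)[OF V]

interpretation T9: module R T1 by (rule module_Tco[OF mV9])
interpretation TT9: module R TT1 by (rule module_tpow[OF T9.module_axioms])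

lemma graded_coalgebra_tco: "graded_coalgebra R T1 (tco_comult R V)"
  unfolding graded_coalgebra_def
proof (intro conjI ballI)
  note gT = graded_module_Tco[OF V]
  note gTT = graded_module_tpow[OF gT, of 2]
  show "graded_module R T1" by (rule gT)
  show "tco_comult R V \<in> graded_hom R T1 TT1 0"
  proof (rule Tco_graded_hom[OF V gTT tco_comult_linear[OF mV9]])
    fix xs ds assume xs: "xs \<noteq> []" and ds: "homogeneous V xs ds"
    have sub: "over V xs" by (rule homogeneous_list_carrier[OF V ds])
    show "tco_comult R V (word R V xs) \<in> grade TT1 (sum_list ds + 0)"
      unfolding tco_comult_word[OF mV9 xs sub]
    proof (rule submodule_finsum[OF graded_moduleD[OF gTT]], clarify)
      fix us vs assume uv: "(us, vs) \<in> cuts xs"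
      note c = cuts_closed[OF uv sub]
      obtain ds1 ds2 where d: "ds = ds1 @ ds2" "homogeneous V us ds1"
        "homogeneous V vs ds2"
        using ds unfolding c(7) list_all2_append1 by blast
      show "tensor R T1 [word R V us, word R V vs] \<in> grade TT1 (sum_list ds + 0)"
        by (rule tensor_grade[OF gT, of _ "[sum_list ds1, sum_list ds2]"])
          (use c d word_grade[OF V] in auto)
    qed
  qed
  fix t assume t: "t \<in> carrier T1"
  note comult = tco_comult_linear[OF mV9]
  have mT3: "module R (tpow R T1 3)" by (rule module_tpow[OF T9.module_axioms])
  interpret T3: module R "tpow R T1 3" by (rule mT3)
  let ?bl = "\<lambda>x y. tensor_append R T1 2 1 (tco_comult R V x) (tensor R T1 [y])"
  let ?br = "\<lambda>x y. tensor_append R T1 1 2 (tensor R T1 [x]) (tco_comult R V y)"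
  have one: "(\<lambda>x. tensor R T1 [x]) \<in> lin R T1 (tpow R T1 1)"
    using multilinear_slot[OF tensor_multilinear[OF T9.module_axioms], of 1 "[]" "[]"] by simp
  note app = tensor_append[OF T9.module_axioms]
  have bl: "(\<lambda>x. ?bl x y) \<in> lin R T1 (tpow R T1 3)" "?bl x \<in> lin R T1 (tpow R T1 3)"
    and br: "(\<lambda>x. ?br x y) \<in> lin R T1 (tpow R T1 3)" "?br x \<in> lin R T1 (tpow R T1 3)"
    if "x \<in> carrier T1" "y \<in> carrier T1" for x y
    using that lin_comp[OF app(2)[OF lin_closed[OF one], of y 2] comult]
      lin_comp[OF app(1)[OF lin_closed[OF comult], of x 1] one]
      lin_comp[OF app(2)[OF lin_closed[OF comult], of y 1] one]
      lin_comp[OF app(1)[OF lin_closed[OF one], of x 2] comult]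
    by (simp_all add: numeral_3_eq_3 numeral_2_eq_2)
  let ?L = "tensor_lift R (tpow R T1 3) (\<lambda>xs. ?bl (xs ! 0) (xs ! 1))"
  let ?R = "tensor_lift R (tpow R T1 3) (\<lambda>xs. ?br (xs ! 0) (xs ! 1))"
  have lin: "?L \<in> lin R TT1 (tpow R T1 3)" "?R \<in> lin R TT1 (tpow R T1 3)"
    using pair_lift_linear[OF T9.module_axioms mT3, of ?bl] pair_lift_linear[OF T9.module_axioms mT3, of ?br] bl br by auto
  have L_val: "?L (tensor R T1 [x, y]) = ?bl x y" and R_val: "?R (tensor R T1 [x, y]) = ?br x y"
    if "x \<in> carrier T1" "y \<in> carrier T1" for x y
    using pair_lift_tensor[OF T9.module_axioms mT3, of ?bl x y] pair_lift_tensor[OF T9.module_axioms mT3, of ?br x y]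
      bl br that by auto
  show "?L (tco_comult R V t) = ?R (tco_comult R V t)"
  proof (rule Tco_ext[OF mV9 mT3 lin_comp[OF lin(1) comult] lin_comp[OF lin(2) comult] _ t])
    fix xs assume xs: "xs \<noteq> []" "over V xs"
    let ?F = "\<lambda>us vs ws. tensor R T1 [word R V us, word R V vs, word R V ws]"
    have F: "?F us vs ws \<in> carrier (tpow R T1 3)"
      if "us \<noteq> []" "vs \<noteq> []" "ws \<noteq> []" "over V us" "over V vs" "over V ws" for us vs ws
      using that word_closed[OF mV9] by (intro tensor_closed[OF T9.module_axioms]) auto
    have eqs: "?L (tensor R T1 [word R V us, word R V vs]) = finsum (tpow R T1 3) (\<lambda>(p, q). ?F p q vs) (cuts us)"
      "?R (tensor R T1 [word R V us, word R V vs]) = finsum (tpow R T1 3) (\<lambda>(p, q). ?F us p q) (cuts vs)"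
      if uv: "(us, vs) \<in> cuts xs" for us vs
    proof -
      note c = cuts_closed[OF uv xs(2)]
      have w: "word R V us \<in> carrier T1" "word R V vs \<in> carrier T1" using c word_closed[OF mV9] by auto
      note s1 = lin_closed[OF one w(1)] lin_closed[OF one w(2)]
      have app2: "(\<lambda>X. tensor_append R T1 2 1 X (tensor R T1 [word R V vs])) \<in> lin R TT1 (tpow R T1 3)"
        and app1: "tensor_append R T1 1 2 (tensor R T1 [word R V us]) \<in> lin R TT1 (tpow R T1 3)"
        using app(2)[OF s1(2), of 2] app(1)[OF s1(1), of 2] by (simp_all add: numeral_3_eq_3)
      show "?L (tensor R T1 [word R V us, word R V vs]) = finsum (tpow R T1 3) (\<lambda>(p, q). ?F p q vs) (cuts us)"
        unfolding L_val[OF w]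
        by (rule tco_comult_word_map[OF mV9 mT3 app2 c(1,3)])
          (use cuts_closed[OF _ c(3)] w c word_closed[OF mV9] app(3) in auto)
      show "?R (tensor R T1 [word R V us, word R V vs]) = finsum (tpow R T1 3) (\<lambda>(p, q). ?F us p q) (cuts vs)"
        unfolding R_val[OF w]
        by (rule tco_comult_word_map[OF mV9 mT3 app1 c(2,4)])
          (use cuts_closed[OF _ c(4)] w c word_closed[OF mV9] app(3) in auto)
    qed
    have tr: "(us, vs, ws) \<in> triples xs \<Longrightarrow> ?F us vs ws \<in> carrier (tpow R T1 3)" for us vs ws
      using xs(2) F by (auto simp: triples_def)
    have "?L (tco_comult R V (word R V xs)) = finsum (tpow R T1 3) (\<lambda>(us, vs, ws). ?F us vs ws) (triples xs)"
      by (rule trans[OF tco_comult_word_map[OF mV9 mT3 lin(1) xs eqs(1)] T3.M.finsum_cuts_cuts(2)[OF tr]])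
    also have "... = ?R (tco_comult R V (word R V xs))"
      by (rule trans[OF tco_comult_word_map[OF mV9 mT3 lin(2) xs eqs(2)] T3.M.finsum_cuts_cuts(1)[OF tr], symmetric])
    finally show "?L (tco_comult R V (word R V xs)) = ?R (tco_comult R V (word R V xs))" .
  qed
qed

end

section \<open>Twisted coderivations\<close>

text \<open>A coderivation along \<gamma>. The Koszul sign is absorbed in \<kappa>, which in the
  applications is \<gamma> composed with \<open>koszul\<close>; so no degree occurs and everything
  is phrased with the unsigned \<open>tensor2\<close>.\<close>

definition twisted_coderivation ::
  "'k ring \<Rightarrow> ('k, 'c, 'y) gmodule_scheme \<Rightarrow> ('c \<Rightarrow> ('c list \<Rightarrow> 'k) set) \<Rightarrow>
   ('k, 'd, 'z) gmodule_scheme \<Rightarrow> ('d \<Rightarrow> ('d list \<Rightarrow> 'k) set) \<Rightarrow>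
   ('c \<Rightarrow> 'd) \<Rightarrow> ('c \<Rightarrow> 'd) \<Rightarrow> ('c \<Rightarrow> 'd) \<Rightarrow> bool" where
  "twisted_coderivation R C \<Delta>C D \<Delta>D \<gamma> \<kappa> E \<longleftrightarrow>
     E \<in> lin R C D \<and>
     (\<forall>c \<in> carrier C. \<Delta>D (E c) = tensor2 R C D E \<gamma> (\<Delta>C c) \<oplus>\<^bsub>tpow R D 2\<^esub> tensor2 R C D \<kappa> E (\<Delta>C c))"

abbreviation (input) "tcoder \<equiv> twisted_coderivation"

lemma tcoderD:
  assumes "tcoder R C \<Delta>C D \<Delta>D \<gamma> \<kappa> E"
  shows "E \<in> lin R C D"
    and "c \<in> carrier C \<Longrightarrow> \<Delta>D (E c) =
      tensor2 R C D E \<gamma> (\<Delta>C c) \<oplus>\<^bsub>tpow R D 2\<^esub> tensor2 R C D \<kappa> E (\<Delta>C c)"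
  using assms by (auto simp: twisted_coderivation_def)

context
  fixes R :: "'k ring" and C :: "('k, 'c) gmodule" and \<Delta>C and D :: "('k, 'd) gmodule" and \<Delta>D
  assumes C: "module R C" and D: "module R D"
    and \<Delta>C: "\<Delta>C \<in> lin R C (tpow R C 2)"
    and \<Delta>D: "\<Delta>D \<in> lin R D (tpow R D 2)"
begin
interpretation D: module R D by (rule D)
interpretation DD: module R "tpow R D 2" by (rule module_tpow[OF D])

private lemmas t2_closed = lin_closed[OF tensor2_linear lin_closed[OF \<Delta>C]]

text \<open>Taking differences requires a common \<kappa>. This exchanges maps \<kappa> that agree
  on the carrier, such as \<open>koszul\<close> before and after a map of degree 0, or
  \<open>koszul\<close> of even degree and the identity.\<close>

lemma tcoder_cong:
  assumes E: "tcoder R C \<Delta>C D \<Delta>D \<gamma> \<kappa> E"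
    and \<kappa>: "\<kappa> \<in> lin R C D" "\<And>c. c \<in> carrier C \<Longrightarrow> \<kappa>' c = \<kappa> c"
  shows "tcoder R C \<Delta>C D \<Delta>D \<gamma> \<kappa>' E"
  unfolding twisted_coderivation_def
  using tcoderD[OF E] tensor2_cong[OF C D \<kappa>(1) tcoderD(1)[OF E] \<kappa>(2)]
    lin_closed[OF \<Delta>C] by simp

lemma tcoder_minus:
  assumes \<gamma>: "\<gamma> \<in> lin R C D" and \<kappa>: "\<kappa> \<in> lin R C D"
    and E: "tcoder R C \<Delta>C D \<Delta>D \<gamma> \<kappa> E" and F: "tcoder R C \<Delta>C D \<Delta>D \<gamma> \<kappa> F"
  shows "tcoder R C \<Delta>C D \<Delta>D \<gamma> \<kappa> (\<lambda>c. E c \<ominus>\<^bsub>D\<^esub> F c)"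
  unfolding twisted_coderivation_def
proof (intro conjI ballI)
  note E' = tcoderD[OF E] and F' = tcoderD[OF F]
  show "(\<lambda>c. E c \<ominus>\<^bsub>D\<^esub> F c) \<in> lin R C D" by (rule lin_minus_map[OF C D E'(1) F'(1)])
  fix c assume c: "c \<in> carrier C"
  note Z = lin_closed[OF \<Delta>C c]
  note cl = t2_closed[OF C D E'(1) \<gamma> c] t2_closed[OF C D F'(1) \<gamma> c]
    t2_closed[OF C D \<kappa> E'(1) c] t2_closed[OF C D \<kappa> F'(1) c]
  have "\<Delta>D (E c \<ominus>\<^bsub>D\<^esub> F c) = \<Delta>D (E c) \<ominus>\<^bsub>tpow R D 2\<^esub> \<Delta>D (F c)"
    by (rule lin_minus[OF D DD.module_axioms \<Delta>D lin_closed[OF E'(1) c] lin_closed[OF F'(1) c]])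
  also have "... = (tensor2 R C D E \<gamma> (\<Delta>C c) \<ominus>\<^bsub>tpow R D 2\<^esub> tensor2 R C D F \<gamma> (\<Delta>C c))
      \<oplus>\<^bsub>tpow R D 2\<^esub>
      (tensor2 R C D \<kappa> E (\<Delta>C c) \<ominus>\<^bsub>tpow R D 2\<^esub> tensor2 R C D \<kappa> F (\<Delta>C c))"
    using cl by (simp add: E'(2)[OF c] F'(2)[OF c] a_minus_def DD.M.minus_add DD.M.a_ac)
  finally show "\<Delta>D (E c \<ominus>\<^bsub>D\<^esub> F c) = tensor2 R C D (\<lambda>c. E c \<ominus>\<^bsub>D\<^esub> F c) \<gamma> (\<Delta>C c)
      \<oplus>\<^bsub>tpow R D 2\<^esub> tensor2 R C D \<kappa> (\<lambda>c. E c \<ominus>\<^bsub>D\<^esub> F c) (\<Delta>C c)"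
    by (simp add: tensor2_minus[OF C D E'(1) F'(1) _ Z] \<gamma> \<kappa>)
qed

context
  fixes \<gamma> assumes \<gamma>: "\<gamma> \<in> lin R C D" "\<And>c. c \<in> carrier C \<Longrightarrow> \<Delta>D (\<gamma> c) = tensor2 R C D \<gamma> \<gamma> (\<Delta>C c)"
begin
text \<open>Composing a coderivation with a coalgebra morphism on either side gives a coderivation
  along the morphism; the two versions differ in the side on which the sign operator meets
  \<gamma>.\<close>

lemma tcoder_morphism_left:
  assumes \<kappa>: "\<kappa> \<in> lin R D D" and d: "tcoder R D \<Delta>D D \<Delta>D (\<lambda>x. x) \<kappa> d"
  shows "tcoder R C \<Delta>C D \<Delta>D \<gamma> (\<lambda>c. \<kappa> (\<gamma> c)) (\<lambda>c. d (\<gamma> c))"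
  unfolding twisted_coderivation_def
proof (intro conjI ballI)
  note d' = tcoderD[OF d]
  show "(\<lambda>c. d (\<gamma> c)) \<in> lin R C D" by (rule lin_comp[OF d'(1) \<gamma>(1)])
  fix c assume c: "c \<in> carrier C"
  show "\<Delta>D (d (\<gamma> c)) = tensor2 R C D (\<lambda>c. d (\<gamma> c)) \<gamma> (\<Delta>C c) \<oplus>\<^bsub>tpow R D 2\<^esub>
      tensor2 R C D (\<lambda>c. \<kappa> (\<gamma> c)) (\<lambda>c. d (\<gamma> c)) (\<Delta>C c)"
    unfolding d'(2)[OF lin_closed[OF \<gamma>(1) c]] \<gamma>(2)[OF c]
    using tensor2_comp[OF C D D \<gamma>(1,1) _ _ lin_closed[OF \<Delta>C c]] d'(1) \<kappa> lin_id[OF D] by simp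
qed

lemma tcoder_morphism_right:
  assumes \<kappa>: "\<kappa> \<in> lin R C C" and d: "tcoder R C \<Delta>C C \<Delta>C (\<lambda>x. x) \<kappa> d"
  shows "tcoder R C \<Delta>C D \<Delta>D \<gamma> (\<lambda>c. \<gamma> (\<kappa> c)) (\<lambda>c. \<gamma> (d c))"
  unfolding twisted_coderivation_def
proof (intro conjI ballI)
  note d' = tcoderD[OF d]
  show "(\<lambda>c. \<gamma> (d c)) \<in> lin R C D" by (rule lin_comp[OF \<gamma>(1) d'(1)])
  fix c assume c: "c \<in> carrier C"
  note Z = lin_closed[OF \<Delta>C c]
  note cl = lin_closed[OF tensor2_linear[OF C C d'(1) lin_id[OF C]] Z]
    lin_closed[OF tensor2_linear[OF C C \<kappa> d'(1)] Z]
  show "\<Delta>D (\<gamma> (d c)) = tensor2 R C D (\<lambda>c. \<gamma> (d c)) \<gamma> (\<Delta>C c) \<oplus>\<^bsub>tpow R D 2\<^esub>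
      tensor2 R C D (\<lambda>c. \<gamma> (\<kappa> c)) (\<lambda>c. \<gamma> (d c)) (\<Delta>C c)"
    unfolding \<gamma>(2)[OF lin_closed[OF d'(1) c]] d'(2)[OF c] lin_add[OF tensor2_linear[OF C D \<gamma>(1,1)] cl]
    using tensor2_comp[OF C C D _ _ \<gamma>(1,1) Z] d'(1) \<kappa> lin_id[OF C] by simp
qed

end

end

text \<open>With K the sign operator, the cross terms are d K \<otimes> d and K d \<otimes> d. They
  cancel because \<open>d\<close> is odd and hence anticommutes with K. In the last term K K is the
  identity, so the square obeys the rule without sign.\<close>

lemma tcoder_square:
  fixes C :: "('k, 'c) gmodule"
  assumes C: "graded_module R C" and \<Delta>: "\<Delta> \<in> lin R C (tpow R C 2)"
    and dg: "d \<in> graded_hom R C C (-1)" and d: "tcoder R C \<Delta> C \<Delta> (\<lambda>x. x) (koszul C (-1)) d"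
  shows "tcoder R C \<Delta> C \<Delta> (\<lambda>x. x) (\<lambda>x. x) (\<lambda>c. d (d c))"
  unfolding twisted_coderivation_def
proof (intro conjI ballI)
  note C' = graded_moduleD(1)[OF C] and d' = tcoderD[OF d] and k = koszul_linear[OF C, of "- 1"]
  let ?k = "koszul C (-1)" and ?TT10 = "tpow R C 2"
  interpret TT10: module R ?TT10 by (rule module_tpow[OF C'])
  show "(\<lambda>c. d (d c)) \<in> lin R C C" by (rule lin_comp[OF d'(1,1)])
  fix c assume c: "c \<in> carrier C"
  note Z = lin_closed[OF \<Delta> c]
  note id = lin_id[OF C'] and comp = tensor2_comp[OF C' C' C' _ _ _ _ Z]
  note cl = lin_closed[OF tensor2_linear[OF C' C' d'(1) id] Z] lin_closed[OF tensor2_linear[OF C' C' k d'(1)] Z]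
  have kd: "d (?k x) = \<ominus>\<^bsub>C\<^esub> ?k (d x)" if "x \<in> carrier C" for x
    using koszul_commute[OF C C dg that, of "- 1"] by simp
  have kd_lin: "(\<lambda>x. ?k (d x)) \<in> lin R C C" "(\<lambda>x. d (d x)) \<in> lin R C C"
    using lin_comp[OF k d'(1)] lin_comp[OF d'(1,1)] by auto
  have 1: "tensor2 R C C (\<lambda>x. d (?k x)) d (\<Delta> c) = \<ominus>\<^bsub>?TT10\<^esub> tensor2 R C C (\<lambda>x. ?k (d x)) d (\<Delta> c)"
    unfolding tensor2_neg[OF C' C' kd_lin(1) d'(1) Z, symmetric]
    by (rule tensor2_cong[OF C' C' lin_neg_map[OF C' C' kd_lin(1)] d'(1) kd refl Z])
  have 2: "tensor2 R C C (\<lambda>x. ?k (?k x)) (\<lambda>x. d (d x)) (\<Delta> c) = tensor2 R C C (\<lambda>x. x) (\<lambda>x. d (d x)) (\<Delta> c)"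
    by (rule tensor2_cong[OF C' C' id kd_lin(2) koszul_koszul[OF C] refl Z])
  have "\<Delta> (d (d c)) =
      (tensor2 R C C (\<lambda>x. d (d x)) (\<lambda>x. x) (\<Delta> c) \<oplus>\<^bsub>?TT10\<^esub> tensor2 R C C (\<lambda>x. d (?k x)) d (\<Delta> c)) \<oplus>\<^bsub>?TT10\<^esub>
      (tensor2 R C C (\<lambda>x. ?k (d x)) d (\<Delta> c) \<oplus>\<^bsub>?TT10\<^esub> tensor2 R C C (\<lambda>x. ?k (?k x)) (\<lambda>x. d (d x)) (\<Delta> c))"
    unfolding d'(2)[OF lin_closed[OF d'(1) c]] d'(2)[OF c]
      lin_add[OF tensor2_linear[OF C' C' d'(1) id] cl] lin_add[OF tensor2_linear[OF C' C' k d'(1)] cl]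
    using comp[OF d'(1) id d'(1) id] comp[OF k d'(1) d'(1) id] comp[OF d'(1) id k d'(1)] comp[OF k d'(1) k d'(1)]
    by simp
  also have "... = tensor2 R C C (\<lambda>x. d (d x)) (\<lambda>x. x) (\<Delta> c) \<oplus>\<^bsub>?TT10\<^esub> tensor2 R C C (\<lambda>x. x) (\<lambda>x. d (d x)) (\<Delta> c)"
    unfolding 1 2
    using lin_closed[OF tensor2_linear[OF C' C' kd_lin(2) id] Z] lin_closed[OF tensor2_linear[OF C' C' id kd_lin(2)] Z]
      lin_closed[OF tensor2_linear[OF C' C' kd_lin(1) d'(1)] Z]
    by (simp add: TT10.M.a_assoc TT10.M.r_neg1)
  finally show "\<Delta> (d (d c)) = tensor2 R C C (\<lambda>c. d (d c)) (\<lambda>x. x) (\<Delta> c) \<oplus>\<^bsub>?TT10\<^esub>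
      tensor2 R C C (\<lambda>x. x) (\<lambda>c. d (d c)) (\<Delta> c)" .
qed

lemma coderivation_iff:
  assumes C: "graded_module R C" and \<Delta>: "\<Delta> \<in> lin R C (tpow R C 2)"
  shows "coderivation R C \<Delta> e d \<longleftrightarrow>
    d \<in> graded_hom R C C e \<and> tcoder R C \<Delta> C \<Delta> (\<lambda>x. x) (koszul C e) d"
proof (cases "d \<in> graded_hom R C C e")
  case True
  note C' = graded_moduleD(1)[OF C] and d = graded_homD(1)[OF True] and id = lin_id[OF graded_moduleD(1)[OF C]]
  have "tensor_maps R C C [unary_factor R C e d, id_factor R C] (\<Delta> c) = tensor2 R C C d (\<lambda>x. x) (\<Delta> c)"
    "tensor_maps R C C [id_factor R C, unary_factor R C e d] (\<Delta> c) = tensor2 R C C (koszul C e) d (\<Delta> c)"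
    if c: "c \<in> carrier C" for c
  proof -
    note Z = lin_closed[OF \<Delta> c]
    have "tensor2 R C C (\<lambda>x. d (koszul C 0 x)) (\<lambda>x. x) (\<Delta> c) = tensor2 R C C d (\<lambda>x. x) (\<Delta> c)"
      by (rule tensor2_cong[OF C' C' d id _ _ Z]) (simp_all add: koszul_even[OF C])
    then show "tensor_maps R C C [unary_factor R C e d, id_factor R C] (\<Delta> c) = tensor2 R C C d (\<lambda>x. x) (\<Delta> c)"
      using tensor_maps_pair[OF C C' d id Z, of e 0] by (simp add: unary_factor_def id_factor_def)
    show "tensor_maps R C C [id_factor R C, unary_factor R C e d] (\<Delta> c) = tensor2 R C C (koszul C e) d (\<Delta> c)"
      using tensor_maps_pair[OF C C' id d Z, of 0 e] by (simp add: unary_factor_def id_factor_def)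
  qed
  then show ?thesis using True d by (simp add: coderivation_def twisted_coderivation_def)
qed (simp add: coderivation_def)

lemma coalgebra_morphism_iff:
  assumes C: "graded_module R C" and D: "module R D" and \<Delta>: "\<Delta>C \<in> lin R C (tpow R C 2)"
  shows "coalgebra_morphism R C \<Delta>C D \<Delta>D \<gamma> \<longleftrightarrow>
    \<gamma> \<in> graded_hom R C D 0 \<and> (\<forall>c \<in> carrier C. \<Delta>D (\<gamma> c) = tensor2 R C D \<gamma> \<gamma> (\<Delta>C c))"
proof (cases "\<gamma> \<in> graded_hom R C D 0")
  case True
  note C' = graded_moduleD(1)[OF C] and \<gamma> = graded_homD(1)[OF True]
  have "tensor_maps R C D [unary_factor R C 0 \<gamma>, unary_factor R C 0 \<gamma>] (\<Delta>C c) = tensor2 R C D \<gamma> \<gamma> (\<Delta>C c)"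
    if c: "c \<in> carrier C" for c
  proof -
    note Z = lin_closed[OF \<Delta> c]
    have "tensor2 R C D (\<lambda>x. \<gamma> (koszul C 0 x)) \<gamma> (\<Delta>C c) = tensor2 R C D \<gamma> \<gamma> (\<Delta>C c)"
      by (rule tensor2_cong[OF C' D \<gamma> \<gamma> _ _ Z]) (simp_all add: koszul_even[OF C])
    then show ?thesis
      using tensor_maps_pair[OF C D \<gamma> \<gamma> Z, of 0 0] by (simp add: unary_factor_def)
  qed
  then show ?thesis using True by (simp add: coalgebra_morphism_def)
qed (simp add: coalgebra_morphism_def)

lemma (in abelian_monoid) finsum_cong2:
  assumes "\<And>x y. (x, y) \<in> S \<Longrightarrow> f x y = g x y" "\<And>x y. (x, y) \<in> S \<Longrightarrow> g x y \<in> carrier G"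
  shows "finsum G (\<lambda>(x, y). f x y) S = finsum G (\<lambda>(x, y). g x y) S"
  by (rule finsum_cong') (use assms in auto)

lemma lin_finsum2:
  assumes "module R M" "module R N" "f \<in> lin R M N" "\<And>x y. (x, y) \<in> S \<Longrightarrow> g x y \<in> carrier M"
  shows "f (finsum M (\<lambda>(x, y). g x y) S) = finsum N (\<lambda>(x, y). f (g x y)) S"
proof -
  have "f (finsum M (\<lambda>(x, y). g x y) S) = finsum N (\<lambda>p. f (case p of (x, y) \<Rightarrow> g x y)) S"
    by (rule lin_finsum[OF assms(1-3)]) (use assms(4) in auto)
  then show ?thesis by (simp add: case_prod_unfold)
qed

lemma lin_finsum3:
  assumes "module R M" "module R N" "f \<in> lin R M N" "\<And>x y z. (x, y, z) \<in> S \<Longrightarrow> g x y z \<in> carrier M"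
  shows "f (finsum M (\<lambda>(x, y, z). g x y z) S) = finsum N (\<lambda>(x, y, z). f (g x y z)) S"
proof -
  have "f (finsum M (\<lambda>(x, y, z). g x y z) S) = finsum N (\<lambda>p. f (case p of (x, y, z) \<Rightarrow> g x y z)) S"
    by (rule lin_finsum[OF assms(1-3)]) (use assms(4) in auto)
  then show ?thesis by (simp add: case_prod_unfold)
qed

text \<open>A twisted coderivation with values in a tensor coalgebra is determined by its corestriction:
  on words of length \<open>n\<close> its coproduct only involves its values on shorter words.\<close>

lemma tcoder_zero:
  fixes V :: "('k, 'a, 'y) gmodule_scheme" and W :: "('k, 'b, 'z) gmodule_scheme"
  assumes V: "module R V" and W: "module R W"
    and \<gamma>: "\<gamma> \<in> lin R (Tco R V) (Tco R W)"
    and \<kappa>: "\<kappa> \<in> lin R (Tco R V) (Tco R W)"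
    and E: "tcoder R (Tco R V) (tco_comult R V) (Tco R W) (tco_comult R W) \<gamma> \<kappa> E"
    and E1: "\<And>xs. xs \<noteq> [] \<Longrightarrow> over V xs \<Longrightarrow> E (word R V xs) 1 = \<zero>\<^bsub>tpow R W 1\<^esub>"
    and t: "t \<in> carrier (Tco R V)"
  shows "E t = \<zero>\<^bsub>Tco R W\<^esub>"
proof -
  let ?C = "Tco R V" and ?D = "Tco R W"
  let ?CC = "tpow R ?C 2" and ?DD = "tpow R ?D 2"
  note C = module_Tco[OF V] and D = module_Tco[OF W]
  note CC = module_tpow[OF C, of 2] and DD = module_tpow[OF D, of 2]
  interpret DD: module R ?DD by (rule DD)
  note E' = tcoderD[OF E]
  have words: "E (word R V xs) = \<zero>\<^bsub>?D\<^esub>" if "xs \<noteq> []" "over V xs" for xs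
    using that
  proof (induction xs rule: length_induct)
    case (1 xs)
    note w = word_closed[OF V 1(2,3)]
    have pair: "word R V us \<in> carrier ?C" "word R V vs \<in> carrier ?C" "E (word R V us) = \<zero>\<^bsub>?D\<^esub>" "E (word R V vs) = \<zero>\<^bsub>?D\<^esub>"
      if "(us, vs) \<in> cuts xs" for us vs
      using cuts_closed[OF that 1(3)] word_closed[OF V] 1(1) by auto
    note zl = lin_zero[OF D DD pair_linear(1)[OF D]] and zr = lin_zero[OF D DD pair_linear(2)[OF D]]
    have "tensor2 R ?C ?D E \<gamma> (tco_comult R V (word R V xs)) = finsum ?DD (\<lambda>(us, vs). \<zero>\<^bsub>?DD\<^esub>) (cuts xs)"
      by (rule tco_comult_word_map[OF V DD tensor2_linear[OF C D E'(1) \<gamma>] 1(2,3)])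
        (simp add: tensor2_tensor[OF C D E'(1) \<gamma>] pair zl lin_closed[OF \<gamma>])
    moreover have "tensor2 R ?C ?D \<kappa> E (tco_comult R V (word R V xs)) = finsum ?DD (\<lambda>(us, vs). \<zero>\<^bsub>?DD\<^esub>) (cuts xs)"
      by (rule tco_comult_word_map[OF V DD tensor2_linear[OF C D \<kappa> E'(1)] 1(2,3)])
        (simp add: tensor2_tensor[OF C D \<kappa> E'(1)] pair zr lin_closed[OF \<kappa>])
    ultimately have 12: "tensor2 R ?C ?D E \<gamma> (tco_comult R V (word R V xs)) = \<zero>\<^bsub>?DD\<^esub>"
      "tensor2 R ?C ?D \<kappa> E (tco_comult R V (word R V xs)) = \<zero>\<^bsub>?DD\<^esub>"
      by (simp_all add: case_prod_unfold DD.M.finsum_zero)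
    show "E (word R V xs) = \<zero>\<^bsub>?D\<^esub>"
      by (rule tco_comult_injective[OF W lin_closed[OF E'(1) w]])
        (simp_all add: E'(2)[OF w] 12 E1[OF \<open>xs \<noteq> []\<close> \<open>set xs \<subseteq> carrier V\<close>, simplified])
  qed
  show ?thesis
    by (rule Tco_ext[OF V D E'(1) lin_zero_map[OF C D] _ t]) (rule words)
qed

section \<open>The adjoint coderivation\<close>

text \<open>Cuts are matched by position and not by letters, because \<open>f\<close> may identify
  letters.\<close>

lemma (in abelian_monoid) finsum_cuts_map:
  assumes "\<And>us vs. (us, vs) \<in> cuts xs \<Longrightarrow> F (map f us) (map f vs) \<in> carrier G"
  shows "finsum G (\<lambda>(us, vs). F us vs) (cuts (map f xs)) = finsum G (\<lambda>(us, vs). F (map f us) (map f vs)) (cuts xs)"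
proof -
  let ?i = "\<lambda>(us, vs). (take (length us) xs, drop (length us) xs)" and ?j = "\<lambda>(us, vs). (map f us, map f vs)"
  have ij: "?i p \<in> cuts xs" "?j (?i p) = p" if p: "p \<in> cuts (map f xs)" for p
  proof -
    obtain us vs where p': "p = (us, vs)" by (cases p)
    with p have c: "map f xs = us @ vs" "us \<noteq> []" "vs \<noteq> []" by (auto simp: cuts_def)
    then have "length us < length xs" by (metis length_append length_greater_0_conv length_map less_add_same_cancel1)
    moreover have "map f (take (length us) xs) = us" "map f (drop (length us) xs) = vs"
      by (simp_all add: c(1) flip: take_map drop_map)
    ultimately show "?i p \<in> cuts xs" "?j (?i p) = p" using c(2) by (auto simp: p' cuts_def)
  qed
  show ?thesis
    by (rule finsum_bij_witness[where i = ?i and j = ?j])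
      (use ij assms in "auto simp: cuts_def split: prod.splits")
qed

context
  fixes R :: "'k ring" and V :: "('k, 'a, 'y) gmodule_scheme" and \<xi> and e :: int
  assumes V: "graded_module R V" and \<xi>: "\<xi> \<in> lin R (Tco R V) (ground R)"
begin
private abbreviation (input) "T10 \<equiv> Tco R V"
private abbreviation (input) "TT10 \<equiv> tpow R (Tco R V) 2"
private abbreviation (input) "K10 \<equiv> map (koszul V e)"

private lemmas mV10 = graded_moduleD(1)[OF V]
private lemmas gT10 = graded_module_Tco[OF V]

interpretation T10: module R T10 by (rule module_Tco[OF mV10])
interpretation TT10: module R TT10 by (rule module_tpow[OF T10.module_axioms])

private lemmas tm10 = T10.module_axioms and ttm10 = TT10.module_axioms

private lemma \<xi>_closed: "t \<in> carrier T10 \<Longrightarrow> \<xi> t \<in> carrier R"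
  using lin_closed[OF \<xi>] by simp

private lemma bil:
  assumes "x \<in> carrier T10" "y \<in> carrier T10"
  shows "(\<lambda>x. \<xi> x \<odot>\<^bsub>T10\<^esub> y) \<in> lin R T10 T10" "(\<lambda>y. \<xi> x \<odot>\<^bsub>T10\<^esub> y) \<in> lin R T10 T10"
    "(\<lambda>x. \<xi> y \<odot>\<^bsub>T10\<^esub> koszul T10 e x) \<in> lin R T10 T10" "(\<lambda>y. \<xi> y \<odot>\<^bsub>T10\<^esub> koszul T10 e x) \<in> lin R T10 T10"
  using assms
  by (auto intro!: lin_scalar_map[OF tm10 tm10 \<xi>] koszul_closed[OF gT10] \<xi>_closed
      lin_smult_map[OF tm10 tm10 lin_id[OF tm10]]
      lin_smult_map[OF tm10 tm10 koszul_linear[OF gT10]])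

text \<open>The halves (\<xi> \<otimes> 1) \<Delta> and (1 \<otimes> \<xi>) \<Delta> of
  \<open>ad\<close> are kept apart because the cross terms in \<open>ad_tcoder\<close> cancel
  between them.\<close>

private definition "lad t = tensor_lift R T10 (\<lambda>xs. \<xi> (xs ! 0) \<odot>\<^bsub>T10\<^esub> (xs ! 1)) (tco_comult R V t)"
private definition "rad t = tensor_lift R T10 (\<lambda>xs. \<xi> (xs ! 1) \<odot>\<^bsub>T10\<^esub> koszul T10 e (xs ! 0)) (tco_comult R V t)"

private lemma ad_eq: "ad R T10 (tco_comult R V) e \<xi> = (\<lambda>t. lad t \<ominus>\<^bsub>T10\<^esub> rad t)"
  by (simp add: ad_def[abs_def] lad_def rad_def)

private lemma pair_lin:
  "tensor_lift R T10 (\<lambda>xs. \<xi> (xs ! 0) \<odot>\<^bsub>T10\<^esub> (xs ! 1)) \<in> lin R TT10 T10"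
  "tensor_lift R T10 (\<lambda>xs. \<xi> (xs ! 1) \<odot>\<^bsub>T10\<^esub> koszul T10 e (xs ! 0)) \<in> lin R TT10 T10"
  using pair_lift_linear[OF tm10 tm10, of "\<lambda>x y. \<xi> x \<odot>\<^bsub>T10\<^esub> y"]
    pair_lift_linear[OF tm10 tm10, of "\<lambda>x y. \<xi> y \<odot>\<^bsub>T10\<^esub> koszul T10 e x"] bil by auto

private lemma lrad_linear: "lad \<in> lin R T10 T10" "rad \<in> lin R T10 T10"
  using lin_comp[OF pair_lin(1) tco_comult_linear[OF mV10]] lin_comp[OF pair_lin(2) tco_comult_linear[OF mV10]]
  by (simp_all add: lad_def[abs_def] rad_def[abs_def])

lemma ad_linear: "ad R T10 (tco_comult R V) e \<xi> \<in> lin R T10 T10"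
  unfolding ad_eq by (rule lin_minus_map[OF tm10 tm10 lrad_linear])

private lemma K_closed10: "us \<noteq> [] \<Longrightarrow> over V us \<Longrightarrow> K10 us \<noteq> [] \<and> over V (K10 us)"
  using koszul_closed[OF V] by auto

private lemma w_closed:
  assumes "us \<noteq> []" "over V us"
  shows "word R V us \<in> carrier T10" "word R V (K10 us) \<in> carrier T10" "\<xi> (word R V us) \<in> carrier R"
  using word_closed[OF mV10 assms] word_closed[OF mV10, of "K10 us"] K_closed10[OF assms] \<xi>_closed by auto

private lemma lrad_word:
  assumes xs: "xs \<noteq> []" "over V xs"
  shows "lad (word R V xs) = finsum T10 (\<lambda>(us, vs). \<xi> (word R V us) \<odot>\<^bsub>T10\<^esub> word R V vs) (cuts xs)"
    and "rad (word R V xs) = finsum T10 (\<lambda>(us, vs). \<xi> (word R V vs) \<odot>\<^bsub>T10\<^esub> word R V (K10 us)) (cuts xs)"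
proof -
  let ?L = "tensor_lift R T10 (\<lambda>xs. \<xi> (xs ! 0) \<odot>\<^bsub>T10\<^esub> (xs ! 1))"
  let ?R = "tensor_lift R T10 (\<lambda>xs. \<xi> (xs ! 1) \<odot>\<^bsub>T10\<^esub> koszul T10 e (xs ! 0))"
  have val: "?L (tensor R T10 [x, y]) = \<xi> x \<odot>\<^bsub>T10\<^esub> y" "?R (tensor R T10 [x, y]) = \<xi> y \<odot>\<^bsub>T10\<^esub> koszul T10 e x"
    if "x \<in> carrier T10" "y \<in> carrier T10" for x y
    using pair_lift_tensor[OF tm10 tm10, of "\<lambda>x y. \<xi> x \<odot>\<^bsub>T10\<^esub> y" x y]
      pair_lift_tensor[OF tm10 tm10, of "\<lambda>x y. \<xi> y \<odot>\<^bsub>T10\<^esub> koszul T10 e x" x y] bil that by auto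
  have c: "word R V us \<in> carrier T10" "word R V vs \<in> carrier T10" "koszul T10 e (word R V us) = word R V (K10 us)"
    if "(us, vs) \<in> cuts xs" for us vs
    using cuts_closed[OF that xs(2)] w_closed koszul_word[OF V] by auto
  show "lad (word R V xs) = finsum T10 (\<lambda>(us, vs). \<xi> (word R V us) \<odot>\<^bsub>T10\<^esub> word R V vs) (cuts xs)"
    unfolding lad_def by (rule tco_comult_word_map[OF mV10 tm10 pair_lin(1) xs]) (simp add: val c del: One_nat_def)
  show "rad (word R V xs) = finsum T10 (\<lambda>(us, vs). \<xi> (word R V vs) \<odot>\<^bsub>T10\<^esub> word R V (K10 us)) (cuts xs)"
    unfolding rad_def by (rule tco_comult_word_map[OF mV10 tm10 pair_lin(2) xs]) (simp add: val c del: One_nat_def)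
qed

lemma ad_word:
  assumes xs: "xs \<noteq> []" "over V xs"
  shows "ad R T10 (tco_comult R V) e \<xi> (word R V xs) =
    finsum T10 (\<lambda>(us, vs). \<xi> (word R V us) \<odot>\<^bsub>T10\<^esub> word R V vs) (cuts xs) \<ominus>\<^bsub>T10\<^esub>
    finsum T10 (\<lambda>(us, vs). \<xi> (word R V vs) \<odot>\<^bsub>T10\<^esub> word R V (K10 us)) (cuts xs)"
  by (simp add: ad_eq lrad_word[OF xs])

text \<open>\<open>H\<close> stands for the summands of \<open>lad\<close> or of \<open>rad\<close>,
  so that one computation serves both.\<close>

private lemma tensor2_left_word:
  assumes F: "F \<in> lin R T10 T10"
    and H: "\<And>p q. p \<noteq> [] \<Longrightarrow> q \<noteq> [] \<Longrightarrow> over V p \<Longrightarrow> over V q \<Longrightarrow> H p q \<in> carrier T10"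
      "\<And>xs. xs \<noteq> [] \<Longrightarrow> over V xs \<Longrightarrow> F (word R V xs) = finsum T10 (\<lambda>(p, q). H p q) (cuts xs)"
    and xs: "xs \<noteq> []" "over V xs"
  shows "tensor2 R T10 T10 F (\<lambda>x. x) (tco_comult R V (word R V xs)) =
    finsum TT10 (\<lambda>(us, vs, ws). tensor R T10 [H us vs, word R V ws]) (triples xs)"
proof -
  note t2 = tensor2[OF tm10 tm10 F lin_id[OF tm10]]
  have "tensor2 R T10 T10 F (\<lambda>x. x) (tco_comult R V (word R V xs)) =
      finsum TT10 (\<lambda>(us, vs). finsum TT10 (\<lambda>(p, q). tensor R T10 [H p q, word R V vs]) (cuts us)) (cuts xs)"
  proof (rule tco_comult_word_map[OF mV10 ttm10 t2(1) xs])
    fix us vs assume uv: "(us, vs) \<in> cuts xs"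
    note c = cuts_closed[OF uv xs(2)]
    show "tensor2 R T10 T10 F (\<lambda>x. x) (tensor R T10 [word R V us, word R V vs]) =
        finsum TT10 (\<lambda>(p, q). tensor R T10 [H p q, word R V vs]) (cuts us)"
      unfolding t2(2)[OF w_closed(1)[OF c(1,3)] w_closed(1)[OF c(2,4)]] H(2)[OF c(1,3)]
      by (rule lin_finsum2[OF tm10 ttm10 pair_linear(1)[OF tm10 w_closed(1)[OF c(2,4)]]]) (rule H(1); use cuts_closed[OF _ c(3)] in blast)
  qed
  also have "... = finsum TT10 (\<lambda>(us, vs, ws). tensor R T10 [H us vs, word R V ws]) (triples xs)"
    by (rule TT10.M.finsum_cuts_cuts(2), intro pair_linear(3)[OF tm10] H(1) w_closed)
      (use xs(2) in "auto simp: triples_def")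
  finally show ?thesis .
qed

private lemma tensor2_right_word:
  assumes F: "F \<in> lin R T10 T10"
    and H: "\<And>p q. p \<noteq> [] \<Longrightarrow> q \<noteq> [] \<Longrightarrow> over V p \<Longrightarrow> over V q \<Longrightarrow> H p q \<in> carrier T10"
      "\<And>xs. xs \<noteq> [] \<Longrightarrow> over V xs \<Longrightarrow> F (word R V xs) = finsum T10 (\<lambda>(p, q). H p q) (cuts xs)"
    and xs: "xs \<noteq> []" "over V xs"
  shows "tensor2 R T10 T10 (koszul T10 e) F (tco_comult R V (word R V xs)) =
    finsum TT10 (\<lambda>(us, vs, ws). tensor R T10 [word R V (K10 us), H vs ws]) (triples xs)"
proof -
  note t2 = tensor2[OF tm10 tm10 koszul_linear[OF gT10] F]
  have "tensor2 R T10 T10 (koszul T10 e) F (tco_comult R V (word R V xs)) =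
      finsum TT10 (\<lambda>(us, vs). finsum TT10 (\<lambda>(p, q). tensor R T10 [word R V (K10 us), H p q]) (cuts vs)) (cuts xs)"
  proof (rule tco_comult_word_map[OF mV10 ttm10 t2(1) xs])
    fix us vs assume uv: "(us, vs) \<in> cuts xs"
    note c = cuts_closed[OF uv xs(2)]
    show "tensor2 R T10 T10 (koszul T10 e) F (tensor R T10 [word R V us, word R V vs]) =
        finsum TT10 (\<lambda>(p, q). tensor R T10 [word R V (K10 us), H p q]) (cuts vs)"
      unfolding t2(2)[OF w_closed(1)[OF c(1,3)] w_closed(1)[OF c(2,4)]] H(2)[OF c(2,4)] koszul_word[OF V c(1,3)]
      by (rule lin_finsum2[OF tm10 ttm10 pair_linear(2)[OF tm10 w_closed(2)[OF c(1,3)]]]) (rule H(1); use cuts_closed[OF _ c(4)] in blast)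
  qed
  also have "... = finsum TT10 (\<lambda>(us, vs, ws). tensor R T10 [word R V (K10 us), H vs ws]) (triples xs)"
    by (rule TT10.M.finsum_cuts_cuts(1), intro pair_linear(3)[OF tm10] H(1) w_closed)
      (use xs(2) in "auto simp: triples_def")
  finally show ?thesis .
qed

text \<open>Everything becomes a sum over cuts into three pieces. The coproduct of \<open>ad\<close>
  lets \<xi> consume the first piece, minus the last one. On the other side the middle piece occurs
  twice: in \<open>rad\<close> \<otimes> 1 with a minus, and in K \<otimes> \<open>lad\<close>, K
  the sign operator, with a plus; these cancel.\<close>

lemma ad_tcoder:
  "tcoder R T10 (tco_comult R V) T10 (tco_comult R V) (\<lambda>x. x) (koszul T10 e)
    (ad R T10 (tco_comult R V) e \<xi>)"
  unfolding twisted_coderivation_def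
proof (intro conjI ballI)
  note \<Delta> = tco_comult_linear[OF mV10] and id = lin_id[OF tm10] and kl = koszul_linear[OF gT10, of e]
  let ?\<Delta> = "tco_comult R V"
  let ?ad = "ad R T10 ?\<Delta> e \<xi>"
  show ad: "?ad \<in> lin R T10 T10" by (rule ad_linear)
  fix t assume t: "t \<in> carrier T10"
  show "?\<Delta> (?ad t) = tensor2 R T10 T10 ?ad (\<lambda>x. x) (?\<Delta> t) \<oplus>\<^bsub>TT10\<^esub> tensor2 R T10 T10 (koszul T10 e) ?ad (?\<Delta> t)"
  proof (rule Tco_ext[OF mV10 ttm10 lin_comp[OF \<Delta> ad] lin_add_map[OF tm10 ttm10
          lin_comp[OF tensor2_linear[OF tm10 tm10 ad id] \<Delta>] lin_comp[OF tensor2_linear[OF tm10 tm10 kl ad] \<Delta>]] _ t])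
    fix xs assume xs: "xs \<noteq> []" "over V xs"
    let ?w = "word R V" and ?p = "\<lambda>us vs. tensor R T10 [word R V us, word R V vs]"
    have c: "us \<noteq> []" "vs \<noteq> []" "over V us" "over V vs"
      if "(us, vs) \<in> cuts zs" "over V zs" for us vs zs using cuts_closed[OF that] by auto
    have tr: "us \<noteq> []" "vs \<noteq> []" "ws \<noteq> []" "over V us" "over V vs" "over V ws"
      if "(us, vs, ws) \<in> triples xs" for us vs ws using that xs(2) by (auto simp: triples_def)
    have pc: "?p us vs \<in> carrier TT10" if "us \<noteq> []" "vs \<noteq> []" "over V us" "over V vs" for us vs
      using word_pair_closed[OF mV10 that] .
    \<comment> \<open>In \<open>Ta\<close>, \<open>Tb\<close> and \<open>Tc\<close> the functional
      consumes the first, the middle and the last piece.\<close>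
    define Ta where "Ta = finsum TT10 (\<lambda>(us, vs, ws). \<xi> (?w us) \<odot>\<^bsub>TT10\<^esub> ?p vs ws) (triples xs)"
    define Tb where "Tb = finsum TT10 (\<lambda>(us, vs, ws). \<xi> (?w vs) \<odot>\<^bsub>TT10\<^esub> ?p (K10 us) ws) (triples xs)"
    define Tc where "Tc = finsum TT10 (\<lambda>(us, vs, ws). \<xi> (?w ws) \<odot>\<^bsub>TT10\<^esub> ?p (K10 us) (K10 vs)) (triples xs)"
    have cl: "\<xi> (?w us) \<odot>\<^bsub>TT10\<^esub> ?p vs ws \<in> carrier TT10" "\<xi> (?w vs) \<odot>\<^bsub>TT10\<^esub> ?p (K10 us) ws \<in> carrier TT10"
      "\<xi> (?w ws) \<odot>\<^bsub>TT10\<^esub> ?p (K10 us) (K10 vs) \<in> carrier TT10" if "(us, vs, ws) \<in> triples xs" for us vs ws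
      using tr[OF that] by (auto intro!: TT10.smult_closed pair_linear(3)[OF tm10] w_closed)
    have Tcl: "Ta \<in> carrier TT10" "Tb \<in> carrier TT10" "Tc \<in> carrier TT10"
      unfolding Ta_def Tb_def Tc_def using cl by (auto intro!: TT10.M.finsum_closed)
    have smp: "tensor R T10 [r \<odot>\<^bsub>T10\<^esub> x, y] = r \<odot>\<^bsub>TT10\<^esub> tensor R T10 [x, y]" "tensor R T10 [y, r \<odot>\<^bsub>T10\<^esub> x] = r \<odot>\<^bsub>TT10\<^esub> tensor R T10 [y, x]"
      if "x \<in> carrier T10" "y \<in> carrier T10" "r \<in> carrier R" for x y r
      using lin_smult[OF pair_linear(1)[OF tm10 that(2)] that(3,1)]
        lin_smult[OF pair_linear(2)[OF tm10 that(2)] that(3,1)] by auto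
    have \<Delta>L: "?\<Delta> (lad (?w xs)) = Ta"
    proof -
      have "?\<Delta> (lad (?w xs)) = finsum TT10 (\<lambda>(us, vs). ?\<Delta> (\<xi> (?w us) \<odot>\<^bsub>T10\<^esub> ?w vs)) (cuts xs)"
        unfolding lrad_word[OF xs]
        by (rule lin_finsum2[OF tm10 ttm10 \<Delta>]) (use c[OF _ xs(2)] w_closed in auto)
      also have "... = finsum TT10 (\<lambda>(us, vs). finsum TT10 (\<lambda>(p, q). \<xi> (?w us) \<odot>\<^bsub>TT10\<^esub> ?p p q) (cuts vs)) (cuts xs)"
      proof (rule TT10.M.finsum_cong2)
        fix us vs assume uv: "(us, vs) \<in> cuts xs"
        note c1 = c[OF uv xs(2)]
        have pp: "?p p q \<in> carrier TT10" if "(p, q) \<in> cuts vs" for p q using c[OF that c1(4)] by (intro pc)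
        have "?\<Delta> (\<xi> (?w us) \<odot>\<^bsub>T10\<^esub> ?w vs) = \<xi> (?w us) \<odot>\<^bsub>TT10\<^esub> finsum TT10 (\<lambda>(p, q). ?p p q) (cuts vs)"
          using lin_smult[OF \<Delta> w_closed(3)[OF c1(1,3)] w_closed(1)[OF c1(2,4)]]
            tco_comult_word[OF mV10 c1(2,4)] by simp
        also have "... = finsum TT10 (\<lambda>(p, q). \<xi> (?w us) \<odot>\<^bsub>TT10\<^esub> ?p p q) (cuts vs)"
          by (rule lin_finsum2[OF ttm10 ttm10 lin_smult_map[OF ttm10 ttm10 lin_id[OF ttm10] w_closed(3)[OF c1(1,3)]]])
            (rule pp)
        finally show "?\<Delta> (\<xi> (?w us) \<odot>\<^bsub>T10\<^esub> ?w vs) = finsum TT10 (\<lambda>(p, q). \<xi> (?w us) \<odot>\<^bsub>TT10\<^esub> ?p p q) (cuts vs)" .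
        show "finsum TT10 (\<lambda>(p, q). \<xi> (?w us) \<odot>\<^bsub>TT10\<^esub> ?p p q) (cuts vs) \<in> carrier TT10"
          using w_closed(3)[OF c1(1,3)] pp by (auto intro!: TT10.M.finsum_closed)
      qed
      also have "... = Ta" unfolding Ta_def by (rule TT10.M.finsum_cuts_cuts(1)) (rule cl)
      finally show ?thesis .
    qed
    have \<Delta>R: "?\<Delta> (rad (?w xs)) = Tc"
    proof -
      have "?\<Delta> (rad (?w xs)) = finsum TT10 (\<lambda>(us, vs). ?\<Delta> (\<xi> (?w vs) \<odot>\<^bsub>T10\<^esub> ?w (K10 us))) (cuts xs)"
        unfolding lrad_word[OF xs]
        by (rule lin_finsum2[OF tm10 ttm10 \<Delta>]) (use c[OF _ xs(2)] w_closed in auto)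
      also have "... = finsum TT10 (\<lambda>(us, vs). finsum TT10 (\<lambda>(p, q). \<xi> (?w vs) \<odot>\<^bsub>TT10\<^esub> ?p (K10 p) (K10 q)) (cuts us)) (cuts xs)"
      proof (rule TT10.M.finsum_cong2)
        fix us vs assume uv: "(us, vs) \<in> cuts xs"
        note c1 = c[OF uv xs(2)]
        have pp: "?p (K10 p) (K10 q) \<in> carrier TT10" if "(p, q) \<in> cuts us" for p q
          using c[OF that c1(3)] by (intro pair_linear(3)[OF tm10] w_closed)
        have "?\<Delta> (\<xi> (?w vs) \<odot>\<^bsub>T10\<^esub> ?w (K10 us)) = \<xi> (?w vs) \<odot>\<^bsub>TT10\<^esub> finsum TT10 (\<lambda>(p, q). ?p p q) (cuts (K10 us))"
          using lin_smult[OF \<Delta> w_closed(3)[OF c1(2,4)] w_closed(2)[OF c1(1,3)]]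
            tco_comult_word[OF mV10, of "K10 us"] K_closed10[OF c1(1,3)] by simp
        also have "finsum TT10 (\<lambda>(p, q). ?p p q) (cuts (K10 us)) = finsum TT10 (\<lambda>(p, q). ?p (K10 p) (K10 q)) (cuts us)"
          by (rule TT10.M.finsum_cuts_map) (rule pp)
        also have "\<xi> (?w vs) \<odot>\<^bsub>TT10\<^esub> ... = finsum TT10 (\<lambda>(p, q). \<xi> (?w vs) \<odot>\<^bsub>TT10\<^esub> ?p (K10 p) (K10 q)) (cuts us)"
          by (rule lin_finsum2[OF ttm10 ttm10 lin_smult_map[OF ttm10 ttm10 lin_id[OF ttm10] w_closed(3)[OF c1(2,4)]]])
            (rule pp)
        finally show "?\<Delta> (\<xi> (?w vs) \<odot>\<^bsub>T10\<^esub> ?w (K10 us)) =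
            finsum TT10 (\<lambda>(p, q). \<xi> (?w vs) \<odot>\<^bsub>TT10\<^esub> ?p (K10 p) (K10 q)) (cuts us)" .
        show "finsum TT10 (\<lambda>(p, q). \<xi> (?w vs) \<odot>\<^bsub>TT10\<^esub> ?p (K10 p) (K10 q)) (cuts us) \<in> carrier TT10"
          using w_closed(3)[OF c1(2,4)] pp by (auto intro!: TT10.M.finsum_closed)
      qed
      also have "... = Tc" unfolding Tc_def by (rule TT10.M.finsum_cuts_cuts(2)) (rule cl)
      finally show ?thesis .
    qed
    have Hl: "\<xi> (?w p) \<odot>\<^bsub>T10\<^esub> ?w q \<in> carrier T10" and Hr: "\<xi> (?w q) \<odot>\<^bsub>T10\<^esub> ?w (K10 p) \<in> carrier T10"
      if "p \<noteq> []" "q \<noteq> []" "over V p" "over V q" for p q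
      using w_closed[OF that(1,3)] w_closed[OF that(2,4)] by auto
    have L1: "tensor2 R T10 T10 lad (\<lambda>x. x) (?\<Delta> (?w xs)) = Ta"
      unfolding Ta_def
      by (rule trans[OF tensor2_left_word[where H = "\<lambda>p q. \<xi> (?w p) \<odot>\<^bsub>T10\<^esub> ?w q", OF lrad_linear(1) Hl lrad_word(1) xs] TT10.M.finsum_cong']) (use smp w_closed tr cl in "auto split: prod.splits")
    have R1: "tensor2 R T10 T10 rad (\<lambda>x. x) (?\<Delta> (?w xs)) = Tb"
      unfolding Tb_def
      by (rule trans[OF tensor2_left_word[where H = "\<lambda>p q. \<xi> (?w q) \<odot>\<^bsub>T10\<^esub> ?w (K10 p)", OF lrad_linear(2) Hr lrad_word(2) xs] TT10.M.finsum_cong']) (use smp w_closed tr cl in "auto split: prod.splits")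
    have L2: "tensor2 R T10 T10 (koszul T10 e) lad (?\<Delta> (?w xs)) = Tb"
      unfolding Tb_def
      by (rule trans[OF tensor2_right_word[where H = "\<lambda>p q. \<xi> (?w p) \<odot>\<^bsub>T10\<^esub> ?w q", OF lrad_linear(1) Hl lrad_word(1) xs] TT10.M.finsum_cong']) (use smp w_closed tr cl in "auto split: prod.splits")
    have R2: "tensor2 R T10 T10 (koszul T10 e) rad (?\<Delta> (?w xs)) = Tc"
      unfolding Tc_def
      by (rule trans[OF tensor2_right_word[where H = "\<lambda>p q. \<xi> (?w q) \<odot>\<^bsub>T10\<^esub> ?w (K10 p)", OF lrad_linear(2) Hr lrad_word(2) xs] TT10.M.finsum_cong']) (use smp w_closed tr cl in "auto split: prod.splits")
    note w = w_closed(1)[OF xs]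
    note Z = lin_closed[OF \<Delta> w]
    show "?\<Delta> (?ad (?w xs)) =
        tensor2 R T10 T10 ?ad (\<lambda>x. x) (?\<Delta> (?w xs)) \<oplus>\<^bsub>TT10\<^esub> tensor2 R T10 T10 (koszul T10 e) ?ad (?\<Delta> (?w xs))"
      unfolding ad_eq lin_minus[OF tm10 ttm10 \<Delta> lin_closed[OF lrad_linear(1) w] lin_closed[OF lrad_linear(2) w]]
        tensor2_minus(1)[OF tm10 tm10 lrad_linear id Z] tensor2_minus(2)[OF tm10 tm10 lrad_linear kl Z] \<Delta>L \<Delta>R L1 L2 R1 R2
      using Tcl by (simp add: a_minus_def TT10.M.a_assoc TT10.M.r_neg1)
  qed
qed

end

section \<open>The coderivation and the morphism induced by a cochain\<close>

text \<open>Cuts before a marked letter: the second part may be empty because the letter follows it.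
  \<open>suffix_cuts\<close> is the mirror image. Both arise when a word containing the output of an
  inner operation is cut.\<close>

definition prefix_cuts :: "'a list \<Rightarrow> ('a list \<times> 'a list) set" where
  "prefix_cuts xs = {(us, vs). us @ vs = xs \<and> us \<noteq> []}"

definition suffix_cuts :: "'a list \<Rightarrow> ('a list \<times> 'a list) set" where
  "suffix_cuts xs = {(us, vs). us @ vs = xs \<and> vs \<noteq> []}"

lemma finite_prefix_cuts [simp]: "finite (prefix_cuts xs)"
  by (rule finite_subset[of _ "insert (xs, []) (cuts xs)"]) (auto simp: prefix_cuts_def cuts_def intro: finite_cuts[unfolded cuts_def])

lemma finite_suffix_cuts [simp]: "finite (suffix_cuts xs)"
  by (rule finite_subset[of _ "insert ([], xs) (cuts xs)"]) (auto simp: suffix_cuts_def cuts_def intro: finite_cuts[unfolded cuts_def])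

lemma cuts_insert:
  "cuts (us @ z # vs) = (\<lambda>(a, b). (us @ z # a, b)) ` suffix_cuts vs \<union> (\<lambda>(a, b). (a, b @ z # vs)) ` prefix_cuts us"
proof (intro equalityI subsetI)
  fix p assume "p \<in> cuts (us @ z # vs)"
  then obtain l r where p: "p = (l, r)" "l @ r = us @ z # vs" "l \<noteq> []" "r \<noteq> []" by (auto simp: cuts_def)
  from p(2) consider (1) c where "l = us @ c" "c @ r = z # vs" | (2) c where "l @ c = us" "r = c @ z # vs"
    by (auto simp: append_eq_append_conv2)
  then show "p \<in> (\<lambda>(a, b). (us @ z # a, b)) ` suffix_cuts vs \<union> (\<lambda>(a, b). (a, b @ z # vs)) ` prefix_cuts us"
  proof cases
    case 1
    show ?thesis
    proof (cases c)
      case Nil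
      then show ?thesis using 1 p by (intro UnI2 image_eqI[of _ _ "(us, [])"]) (auto simp: prefix_cuts_def)
    next
      case (Cons c' cs)
      then show ?thesis using 1 p by (intro UnI1 image_eqI[of _ _ "(cs, r)"]) (auto simp: suffix_cuts_def)
    qed
  next
    case 2
    then show ?thesis using p by (intro UnI2 image_eqI[of _ _ "(l, c)"]) (auto simp: prefix_cuts_def)
  qed
qed (auto simp: cuts_def prefix_cuts_def suffix_cuts_def)

section \<open>Interchange of summations over cuts, infixes and segmentations\<close>

context abelian_monoid
begin
lemma finsum_cuts_insert:
  assumes "\<And>p q. (p, q) \<in> cuts (us @ z # vs) \<Longrightarrow> F p q \<in> carrier G"
  shows "finsum G (\<lambda>(p, q). F p q) (cuts (us @ z # vs)) =
    finsum G (\<lambda>(a, b). F (us @ z # a) b) (suffix_cuts vs) \<oplus> finsum G (\<lambda>(a, b). F a (b @ z # vs)) (prefix_cuts us)"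
proof -
  let ?i = "\<lambda>(a, b). (us @ z # a, b)" and ?j = "\<lambda>(a, b). (a, b @ z # vs)"
  have inj: "inj_on ?i (suffix_cuts vs)" "inj_on ?j (prefix_cuts us)" by (auto simp: inj_on_def)
  have "length p > length us" if "(p, q) \<in> ?i ` suffix_cuts vs" for p q using that by auto
  moreover have "length p \<le> length us" if "(p, q) \<in> ?j ` prefix_cuts us" for p q
    using that by (auto simp: prefix_cuts_def)
  ultimately have disj: "?i ` suffix_cuts vs \<inter> ?j ` prefix_cuts us = {}" by fastforce
  have cl: "(\<lambda>(p, q). F p q) \<in> ?i ` suffix_cuts vs \<rightarrow> carrier G" "(\<lambda>(p, q). F p q) \<in> ?j ` prefix_cuts us \<rightarrow> carrier G"
    using assms unfolding cuts_insert by (auto simp: Pi_def)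
  have "finsum G (\<lambda>(p, q). F p q) (cuts (us @ z # vs)) =
      finsum G (\<lambda>(p, q). F p q) (?i ` suffix_cuts vs) \<oplus> finsum G (\<lambda>(p, q). F p q) (?j ` prefix_cuts us)"
    unfolding cuts_insert by (rule finsum_Un_disjoint) (use disj cl in auto)
  then show ?thesis
    unfolding finsum_reindex[OF cl(1) inj(1)] finsum_reindex[OF cl(2) inj(2)]
    by (simp add: case_prod_unfold)
qed

lemma finsum_prefix_cuts_map:
  assumes "\<And>us vs. (us, vs) \<in> prefix_cuts xs \<Longrightarrow> F (map f us) (map f vs) \<in> carrier G"
  shows "finsum G (\<lambda>(us, vs). F us vs) (prefix_cuts (map f xs)) =
    finsum G (\<lambda>(us, vs). F (map f us) (map f vs)) (prefix_cuts xs)"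
proof -
  let ?i = "\<lambda>(us, vs). (take (length us) xs, drop (length us) xs)" and ?j = "\<lambda>(us, vs). (map f us, map f vs)"
  have ij: "?i p \<in> prefix_cuts xs" "?j (?i p) = p" if p: "p \<in> prefix_cuts (map f xs)" for p
  proof -
    obtain us vs where p': "p = (us, vs)" by (cases p)
    with p have c: "map f xs = us @ vs" "us \<noteq> []" by (auto simp: prefix_cuts_def)
    then have "map f (take (length us) xs) = us" "map f (drop (length us) xs) = vs" "xs \<noteq> []"
      by (auto simp flip: take_map drop_map)
    then show "?i p \<in> prefix_cuts xs" "?j (?i p) = p" using c(2) by (auto simp: p' prefix_cuts_def)
  qed
  show ?thesis
    by (rule finsum_bij_witness[where i = ?i and j = ?j])
      (use ij assms in "auto simp: prefix_cuts_def split: prod.splits")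
qed

text \<open>Acting on an infix and then cutting behind it amounts to cutting first and acting inside
  the left part. The version with \<open>prefix_cuts\<close> does the same for the right
  part.\<close>

lemma finsum_infixes_suffix_cuts:
  assumes "\<And>us ys a b. us @ ys @ a @ b = xs \<Longrightarrow> ys \<noteq> [] \<Longrightarrow> b \<noteq> [] \<Longrightarrow> F us ys a b \<in> carrier G"
  shows "finsum G (\<lambda>(us, ys, vs). finsum G (\<lambda>(a, b). F us ys a b) (suffix_cuts vs)) (infixes xs) =
    finsum G (\<lambda>(p, q). finsum G (\<lambda>(us, ys, vs). F us ys vs q) (infixes p)) (cuts xs)"
proof -
  let ?F = "\<lambda>((us, ys, vs), (a, b)). F us ys a b" and ?G = "\<lambda>((p, q), (us, ys, vs)). F us ys vs q"
  have "finsum G (\<lambda>(us, ys, vs). finsum G (\<lambda>(a, b). F us ys a b) (suffix_cuts vs)) (infixes xs) =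
      finsum G (\<lambda>t. \<Oplus>c\<in>suffix_cuts (snd (snd t)). ?F (t, c)) (infixes xs)"
    by (simp add: case_prod_unfold)
  also have "... = finsum G (\<lambda>(t, c). ?F (t, c)) (SIGMA t:infixes xs. suffix_cuts (snd (snd t)))"
    by (rule finsum_Sigma[OF finite_infixes finite_suffix_cuts]) (auto intro!: assms simp: infixes_def suffix_cuts_def)
  also have "... = finsum G (\<lambda>(c, t). ?G (c, t)) (SIGMA c:cuts xs. infixes (fst c))"
    by (rule finsum_bij_witness[where i = "\<lambda>((us, ys, vs), (a, b)). ((us @ ys @ a, b), (us, ys, a))"
          and j = "\<lambda>((p, q), (us, ys, vs)). ((us, ys, vs @ q), (vs, q))"])
      (auto intro: assms simp: infixes_def suffix_cuts_def cuts_def)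
  also have "... = finsum G (\<lambda>c. \<Oplus>t\<in>infixes (fst c). ?G (c, t)) (cuts xs)"
    by (rule finsum_Sigma[OF finite_cuts finite_infixes, symmetric]) (auto intro!: assms simp: infixes_def cuts_def)
  finally show ?thesis by (simp add: case_prod_unfold)
qed

lemma finsum_infixes_prefix_cuts:
  assumes "\<And>a b ys vs. a @ b @ ys @ vs = xs \<Longrightarrow> ys \<noteq> [] \<Longrightarrow> a \<noteq> [] \<Longrightarrow> F a b ys vs \<in> carrier G"
  shows "finsum G (\<lambda>(us, ys, vs). finsum G (\<lambda>(a, b). F a b ys vs) (prefix_cuts us)) (infixes xs) =
    finsum G (\<lambda>(p, q). finsum G (\<lambda>(us, ys, vs). F p us ys vs) (infixes q)) (cuts xs)"
proof -
  let ?F = "\<lambda>((us, ys, vs), (a, b)). F a b ys vs" and ?G = "\<lambda>((p, q), (us, ys, vs)). F p us ys vs"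
  have "finsum G (\<lambda>(us, ys, vs). finsum G (\<lambda>(a, b). F a b ys vs) (prefix_cuts us)) (infixes xs) =
      finsum G (\<lambda>t. \<Oplus>c\<in>prefix_cuts (fst t). ?F (t, c)) (infixes xs)"
    by (simp add: case_prod_unfold)
  also have "... = finsum G (\<lambda>(t, c). ?F (t, c)) (SIGMA t:infixes xs. prefix_cuts (fst t))"
    by (rule finsum_Sigma[OF finite_infixes finite_prefix_cuts]) (auto intro!: assms simp: infixes_def prefix_cuts_def)
  also have "... = finsum G (\<lambda>(c, t). ?G (c, t)) (SIGMA c:cuts xs. infixes (snd c))"
    by (rule finsum_bij_witness[where i = "\<lambda>((us, ys, vs), (a, b)). ((a, b @ ys @ vs), (b, ys, vs))"
          and j = "\<lambda>((p, q), (us, ys, vs)). ((p @ us, ys, vs), (p, us))"])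
      (auto intro: assms simp: infixes_def prefix_cuts_def cuts_def)
  also have "... = finsum G (\<lambda>c. \<Oplus>t\<in>infixes (snd c). ?G (c, t)) (cuts xs)"
    by (rule finsum_Sigma[OF finite_cuts finite_infixes, symmetric]) (auto intro!: assms simp: infixes_def cuts_def)
  finally show ?thesis by (simp add: case_prod_unfold)
qed

text \<open>A cut between blocks becomes a cut of the word by concatenating either side, and
  conversely two segmentations are appended. This is the combinatorial core of
  \<open>Psi_inv_comult\<close>.\<close>

lemma finsum_segmentations_cuts:
  assumes "\<And>us vs p q. (us, vs) \<in> cuts xs \<Longrightarrow> p \<in> segmentations us \<Longrightarrow> q \<in> segmentations vs \<Longrightarrow> F p q \<in> carrier G"
  shows "(\<Oplus>yss\<in>segmentations xs. finsum G (\<lambda>(p, q). F p q) (cuts yss)) =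
    finsum G (\<lambda>(us, vs). \<Oplus>p\<in>segmentations us. \<Oplus>q\<in>segmentations vs. F p q) (cuts xs)"
proof -
  have c: "(concat p, concat q) \<in> cuts xs" "p \<in> segmentations (concat p)" "q \<in> segmentations (concat q)"
    if "yss \<in> segmentations xs" "(p, q) \<in> cuts yss" for yss p q
    using that by (cases p; cases q; auto simp: segmentations_def cuts_def)+
  have s: "p @ q \<in> segmentations xs" "(p, q) \<in> cuts (p @ q)" "concat p = us" "concat q = vs"
    if "(us, vs) \<in> cuts xs" "p \<in> segmentations us" "q \<in> segmentations vs" for us vs p q
    using that by (auto simp: segmentations_def cuts_def)
  have "(\<Oplus>yss\<in>segmentations xs. finsum G (\<lambda>(p, q). F p q) (cuts yss)) =
      finsum G (\<lambda>(yss, c). case c of (p, q) \<Rightarrow> F p q) (Sigma (segmentations xs) cuts)"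
    by (rule finsum_Sigma[OF finite_segmentations finite_cuts]) (use assms c in fastforce)
  also have "... = finsum G (\<lambda>(c, (p, q)). F p q) (SIGMA c:cuts xs. segmentations (fst c) \<times> segmentations (snd c))"
  proof (rule finsum_bij_witness[where i = "\<lambda>(yss, (p, q)). ((concat p, concat q), (p, q))"
        and j = "\<lambda>(c, (p, q)). (p @ q, (p, q))"])
    fix t assume "t \<in> Sigma (segmentations xs) cuts"
    then obtain yss p q where t: "t = (yss, (p, q))" "yss \<in> segmentations xs" "(p, q) \<in> cuts yss" by auto
    show "(case t of (yss, (p, q)) \<Rightarrow> ((concat p, concat q), (p, q)))
        \<in> (SIGMA c:cuts xs. segmentations (fst c) \<times> segmentations (snd c))"
      using c[OF t(2,3)] by (simp add: t(1))
    have "p @ q = yss" using t(3) by (simp add: cuts_def)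
    then show "(case (case t of (yss, (p, q)) \<Rightarrow> ((concat p, concat q), (p, q))) of (c, (p, q)) \<Rightarrow> (p @ q, (p, q))) = t"
      by (simp add: t(1))
    show "(case (case t of (yss, (p, q)) \<Rightarrow> ((concat p, concat q), (p, q))) of (c, (p, q)) \<Rightarrow> F p q) =
        (case t of (yss, c) \<Rightarrow> case c of (p, q) \<Rightarrow> F p q)" by (simp add: t(1))
  next
    fix t assume "t \<in> (SIGMA c:cuts xs. segmentations (fst c) \<times> segmentations (snd c))"
    then obtain us vs p q where t: "t = ((us, vs), (p, q))" "(us, vs) \<in> cuts xs" "p \<in> segmentations us"
      "q \<in> segmentations vs" by auto
    show "(case t of (c, (p, q)) \<Rightarrow> (p @ q, (p, q))) \<in> Sigma (segmentations xs) cuts"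
      "(case (case t of (c, (p, q)) \<Rightarrow> (p @ q, (p, q))) of (yss, (p, q)) \<Rightarrow> ((concat p, concat q), (p, q))) = t"
      using s[OF t(2-4)] by (simp_all add: t(1))
    show "(case t of (c, (p, q)) \<Rightarrow> F p q) \<in> carrier G" using assms[OF t(2-4)] by (simp add: t(1))
  qed
  also have "... = finsum G (\<lambda>c. finsum G (\<lambda>(p, q). F p q) (segmentations (fst c) \<times> segmentations (snd c))) (cuts xs)"
    by (rule finsum_Sigma[OF finite_cuts, symmetric]) (use assms in auto)
  also have "... = finsum G (\<lambda>(us, vs). \<Oplus>p\<in>segmentations us. \<Oplus>q\<in>segmentations vs. F p q) (cuts xs)"
    by (rule finsum_cong') (use assms in "auto simp: finsum_Sigma intro!: finsum_closed")
  finally show ?thesis .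
qed

end

section \<open>The coderivation induced by a homogeneous cochain\<close>

context
  fixes R :: "'k ring" and A :: "('k, 'a, 'x) gmodule_scheme" and f and e :: int
  assumes A: "graded_module R A"
    and f: "\<And>n. 1 \<le> n \<Longrightarrow> f n \<in> graded_hom R (tpow R (susp A) n) (susp A) e"
begin
private abbreviation (input) "V11 \<equiv> susp A"
private abbreviation (input) "T11 \<equiv> Tco R (susp A)"
private abbreviation (input) "TT11 \<equiv> tpow R (Tco R (susp A)) 2"
private abbreviation (input) "K11 \<equiv> map (koszul (susp A) e)"
private abbreviation (input) "d \<equiv> Phi_inv R A e f"

private lemmas gV11 = graded_module_susp[OF A]
private lemmas mV11 = graded_moduleD(1)[OF gV11]
private lemmas gT11 = graded_module_Tco[OF gV11]

interpretation T11: module R T11 by (rule module_Tco[OF mV11])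
interpretation TT11: module R TT11 by (rule module_tpow[OF T11.module_axioms])

private lemmas tm11 = T11.module_axioms and ttm11 = TT11.module_axioms

private lemma f_lin: "1 \<le> n \<Longrightarrow> f n \<in> tlin R V11 n A"
  using graded_homD(1)[OF f] by simp

private lemma K_closed11: "over A us \<Longrightarrow> over A (K11 us)"
  using koszul_closed[OF gV11] by auto

private lemma m_closed: "ys \<noteq> [] \<Longrightarrow> over A ys \<Longrightarrow> ev R V11 f ys \<in> carrier A"
  by (rule ev_closed[OF A graded_moduleD(1)[OF A]]) (auto intro: f_lin simp: Suc_le_eq)

lemma infix_closed:
  assumes "(us, ys, vs) \<in> infixes xs" "over A xs"
  shows "over A (K11 us @ ev R V11 f ys # vs)" "over A us" "over A ys" "over A vs"
    "ys \<noteq> []" "xs = us @ ys @ vs" "ev R V11 f ys \<in> carrier A"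
proof -
  show eq: "xs = us @ ys @ vs" and ys: "ys \<noteq> []" using assms(1) by (auto simp: infixes_def)
  show us: "over A us" and ys': "over A ys" and vs: "over A vs"
    using assms(2) by (auto simp: eq)
  show m: "ev R V11 f ys \<in> carrier A" using ys ys' by (rule m_closed)
  show "over A (K11 us @ ev R V11 f ys # vs)" using K_closed11[OF us] m vs by simp
qed

private lemma Phi_body:
  "(\<lambda>X. \<Oplus>\<^bsub>T11\<^esub> i \<in> {1..n}. \<Oplus>\<^bsub>T11\<^esub> j \<in> {0..n - i}.
          tco_incl R V11 (n - i + 1) (tensor_maps R V11 V11
            (replicate j (id_factor R V11) @ [(e, i, f i)] @
             replicate (n - i - j) (id_factor R V11)) X)) \<in> tlin R V11 n T11"
proof (intro lin_finsum_map[OF module_tpow[OF mV11] tm11])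
  fix i j assume ij: "i \<in> {1..n}" "j \<in> {0..n - i}"
  note fs = infix_factors[OF mV11, of "f i" i j e "n - i - j"]
  have "f i \<in> tlin R V11 i V11" using ij f_lin by simp
  then show "(\<lambda>X. tco_incl R V11 (n - i + 1) (tensor_maps R V11 V11
            (replicate j (id_factor R V11) @ [(e, i, f i)] @
             replicate (n - i - j) (id_factor R V11)) X)) \<in> tlin R V11 n T11"
    by (intro lin_comp[OF tco_incl_linear[OF mV11] tensor_maps_linear[OF gV11 mV11 fs(1)]])
      (use ij fs(2) in auto)
qed

lemma Phi_inv_linear: "d \<in> lin R T11 T11"
  unfolding Phi_inv_def Let_def by (rule tco_lift_linear[OF mV11 tm11 Phi_body])

lemma Phi_inv_word:
  assumes xs: "xs \<noteq> []" "over A xs"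
  shows "d (word R V11 xs) = finsum T11 (\<lambda>(us, ys, vs). word R V11 (K11 us @ ev R V11 f ys # vs)) (infixes xs)"
proof -
  let ?n = "length xs"
  have xs': "over V11 xs" using xs by simp
  have "d (word R V11 xs) = (\<Oplus>\<^bsub>T11\<^esub> i \<in> {1..?n}. \<Oplus>\<^bsub>T11\<^esub> j \<in> {0..?n - i}.
          tco_incl R V11 (?n - i + 1) (tensor_maps R V11 V11
            (replicate j (id_factor R V11) @ [(e, i, f i)] @
             replicate (?n - i - j) (id_factor R V11)) (tensor R V11 xs)))"
    unfolding Phi_inv_def Let_def by (rule tco_lift_word[OF mV11 tm11 Phi_body xs(1) xs'])
  also have "... = finsum T11 (\<lambda>(us, ys, vs). word R V11 (K11 us @ ev R V11 f ys # vs)) (infixes xs)"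
  proof (rule T11.M.finsum_infixes)
    fix us ys vs assume uyv: "(us, ys, vs) \<in> infixes xs"
    note c = infix_closed[OF uyv xs(2)]
    show "word R V11 (K11 us @ ev R V11 f ys # vs) \<in> carrier T11"
      using c(1) by (intro word_closed[OF mV11]) auto
    have sub: "over V11 (us @ ys @ vs)" using xs' c(6) by simp
    have "f (length ys) \<in> tlin R V11 (length ys) V11" using c(5) f_lin by (simp add: Suc_le_eq)
    note fs = infix_factors[OF mV11 this, of "length us" e "length vs"]
    have "tensor_maps R V11 V11 (replicate (length us) (id_factor R V11) @ [(e, length ys, f (length ys))] @
        replicate (length vs) (id_factor R V11)) (tensor R V11 xs) = tensor R V11 (K11 us @ ev R V11 f ys # vs)"
      unfolding c(6) apply_factors_infix[OF gV11 sub, symmetric]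
      by (rule tensor_maps_tensor[OF gV11 mV11 fs(1)]) (use fs(2) sub in auto)
    moreover have "?n - length ys - length us = length vs" "?n - length ys + 1 = length us + 1 + length vs"
      using c(6) by auto
    ultimately show "tco_incl R V11 (?n - length ys + 1) (tensor_maps R V11 V11
            (replicate (length us) (id_factor R V11) @ [(e, length ys, f (length ys))] @
             replicate (?n - length ys - length us) (id_factor R V11)) (tensor R V11 xs)) =
        word R V11 (K11 us @ ev R V11 f ys # vs)"
      by (simp add: word_def)
  qed
  finally show ?thesis .
qed

lemma Phi_inv_graded: "d \<in> graded_hom R T11 T11 e"
proof (rule Tco_graded_hom[OF gV11 gT11 Phi_inv_linear])
  fix xs ds assume xs: "xs \<noteq> []" and ds: "homogeneous V11 xs ds"
  have sub: "over A xs" using homogeneous_list_carrier[OF gV11 ds] by simp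
  show "d (word R V11 xs) \<in> grade T11 (sum_list ds + e)"
    unfolding Phi_inv_word[OF xs sub]
  proof (rule submodule_finsum[OF graded_moduleD[OF gT11]], clarify)
    fix us ys vs assume uyv: "(us, ys, vs) \<in> infixes xs"
    note c = infix_closed[OF uyv sub]
    obtain ds1 ds2 ds3 where d: "ds = ds1 @ ds2 @ ds3" "homogeneous V11 us ds1"
      "homogeneous V11 ys ds2" "homogeneous V11 vs ds3"
      using ds unfolding c(6) by (auto simp: list_all2_append1)
    have "tensor R V11 ys \<in> grade (tpow R V11 (length ys)) (sum_list ds2)"
      by (rule tensor_grade[OF gV11 d(3) refl refl])
    then have "ev R V11 f ys \<in> grade V11 (sum_list ds2 + e)"
      unfolding ev_def using graded_homD(2)[OF f] c(5) by (simp add: Suc_le_eq)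
    moreover have "homogeneous V11 (K11 us) ds1"
      unfolding list_all2_map1
      by (rule list_all2_mono[OF d(2)]) (use graded_homD(2)[OF koszul_graded[OF gV11], of _ _ e] in fastforce)
    ultimately show "word R V11 (K11 us @ ev R V11 f ys # vs) \<in> grade T11 (sum_list ds + e)"
      by (intro word_grade[OF gV11, of _ "ds1 @ (sum_list ds2 + e) # ds3"])
        (use d in "auto intro!: list_all2_appendI")
  qed
qed

text \<open>The word us, f(ys), vs is cut behind or before its new letter. In the first case the
  left part is a term of the coderivation on a prefix. In the second the signs on \<open>us\<close>
  are distributed over both parts, and those on the left part are the sign operator of the left
  factor.\<close>

lemma Phi_inv_tcoder:
  "tcoder R T11 (tco_comult R V11) T11 (tco_comult R V11) (\<lambda>x. x) (koszul T11 e) d"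
  unfolding twisted_coderivation_def
proof (intro conjI ballI)
  note \<Delta> = tco_comult_linear[OF mV11] and id = lin_id[OF tm11] and kl = koszul_linear[OF gT11, of e]
  let ?\<Delta> = "tco_comult R V11" and ?w = "word R V11" and ?m = "ev R V11 f"
  let ?p = "\<lambda>us vs. tensor R T11 [word R V11 us, word R V11 vs]"
  show dl: "d \<in> lin R T11 T11" by (rule Phi_inv_linear)
  fix t assume t: "t \<in> carrier T11"
  show "?\<Delta> (d t) = tensor2 R T11 T11 d (\<lambda>x. x) (?\<Delta> t) \<oplus>\<^bsub>TT11\<^esub> tensor2 R T11 T11 (koszul T11 e) d (?\<Delta> t)"
  proof (rule Tco_ext[OF mV11 ttm11 lin_comp[OF \<Delta> dl] lin_add_map[OF tm11 ttm11
          lin_comp[OF tensor2_linear[OF tm11 tm11 dl id] \<Delta>] lin_comp[OF tensor2_linear[OF tm11 tm11 kl dl] \<Delta>]] _ t])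
    fix xs assume xs: "xs \<noteq> []" "over V11 xs"
    have xs': "over A xs" using xs(2) by simp
    have pc: "?p us vs \<in> carrier TT11" if "us \<noteq> []" "vs \<noteq> []" "over A us" "over A vs" for us vs
      using word_pair_closed[OF mV11, of us vs] that by simp
    have wc: "?w us \<in> carrier T11" if "us \<noteq> []" "over A us" for us using word_closed[OF mV11, of us] that by simp
    have p1: "?p (K11 us @ ?m ys # a) b \<in> carrier TT11" if "us @ ys @ a @ b = xs" "ys \<noteq> []" "b \<noteq> []" for us ys a b
      using that(2,3) xs' K_closed11[of us] m_closed[of ys] by (intro pc) (auto simp flip: that(1))
    have p2: "?p (K11 a) (K11 b @ ?m ys # vs) \<in> carrier TT11" if "a @ b @ ys @ vs = xs" "ys \<noteq> []" "a \<noteq> []" for a b ys vs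
      using that(2,3) xs' K_closed11[of a] K_closed11[of b] m_closed[of ys] by (intro pc) (auto simp flip: that(1))
    \<comment> \<open>\<open>?S\<close> collects the cuts behind the new letter, \<open>?P\<close>
      those before it.\<close>
    let ?S = "\<lambda>us ys vs. finsum TT11 (\<lambda>(a, b). ?p (K11 us @ ?m ys # a) b) (suffix_cuts vs)"
    let ?P = "\<lambda>us ys vs. finsum TT11 (\<lambda>(a, b). ?p (K11 a) (K11 b @ ?m ys # vs)) (prefix_cuts us)"
    have SP: "?S us ys vs \<in> carrier TT11" "?P us ys vs \<in> carrier TT11" if "(us, ys, vs) \<in> infixes xs" for us ys vs
      using that by (auto intro!: TT11.M.finsum_closed p1 p2 simp: infixes_def suffix_cuts_def prefix_cuts_def)
    have "?\<Delta> (d (?w xs)) = finsum TT11 (\<lambda>(us, ys, vs). ?\<Delta> (?w (K11 us @ ?m ys # vs))) (infixes xs)"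
      unfolding Phi_inv_word[OF xs(1) xs']
      by (rule lin_finsum3[OF tm11 ttm11 \<Delta>], rule wc) (use infix_closed(1)[OF _ xs'] in auto)
    also have "... = finsum TT11 (\<lambda>t. (case t of (us, ys, vs) \<Rightarrow> ?S us ys vs) \<oplus>\<^bsub>TT11\<^esub> (case t of (us, ys, vs) \<Rightarrow> ?P us ys vs)) (infixes xs)"
    proof (rule TT11.M.finsum_cong')
      fix t assume t: "t \<in> infixes xs"
      obtain us ys vs where t': "t = (us, ys, vs)" by (cases t)
      note c = infix_closed[OF t[unfolded t'] xs']
      have pq: "?p p q \<in> carrier TT11" if "(p, q) \<in> cuts (K11 us @ ?m ys # vs)" for p q
        using cuts_closed[OF that c(1)] by (intro pc)
      have "?\<Delta> (?w (K11 us @ ?m ys # vs)) = finsum TT11 (\<lambda>(p, q). ?p p q) (cuts (K11 us @ ?m ys # vs))"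
        by (rule tco_comult_word[OF mV11]) (use c(1) in auto)
      also have "... = ?S us ys vs \<oplus>\<^bsub>TT11\<^esub> finsum TT11 (\<lambda>(a, b). ?p a (b @ ?m ys # vs)) (prefix_cuts (K11 us))"
        by (rule TT11.M.finsum_cuts_insert) (rule pq)
      also have "finsum TT11 (\<lambda>(a, b). ?p a (b @ ?m ys # vs)) (prefix_cuts (K11 us)) = ?P us ys vs"
        by (rule TT11.M.finsum_prefix_cuts_map, rule p2) (use c in "auto simp: prefix_cuts_def")
      finally show "(case t of (us, ys, vs) \<Rightarrow> ?\<Delta> (?w (K11 us @ ?m ys # vs))) =
          (case t of (us, ys, vs) \<Rightarrow> ?S us ys vs) \<oplus>\<^bsub>TT11\<^esub> (case t of (us, ys, vs) \<Rightarrow> ?P us ys vs)"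
        by (simp add: t')
    qed (use SP in auto)
    also have "... = finsum TT11 (\<lambda>(us, ys, vs). ?S us ys vs) (infixes xs) \<oplus>\<^bsub>TT11\<^esub>
        finsum TT11 (\<lambda>(us, ys, vs). ?P us ys vs) (infixes xs)"
      by (rule TT11.M.finsum_addf) (use SP in auto)
    also have "finsum TT11 (\<lambda>(us, ys, vs). ?S us ys vs) (infixes xs) =
        finsum TT11 (\<lambda>(p, q). finsum TT11 (\<lambda>(us, ys, vs). ?p (K11 us @ ?m ys # vs) q) (infixes p)) (cuts xs)"
      by (rule TT11.M.finsum_infixes_suffix_cuts) (rule p1)
    also have "... = tensor2 R T11 T11 d (\<lambda>x. x) (?\<Delta> (?w xs))"
    proof (rule tco_comult_word_map[OF mV11 ttm11 tensor2_linear[OF tm11 tm11 dl id] xs, symmetric])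
      fix p q assume pq: "(p, q) \<in> cuts xs"
      note c = cuts_closed[OF pq xs']
      have "tensor2 R T11 T11 d (\<lambda>x. x) (?p p q) = tensor R T11 [d (?w p), ?w q]"
        using tensor2_tensor[OF tm11 tm11 dl id] c wc by simp
      also have "... = finsum TT11 (\<lambda>(us, ys, vs). ?p (K11 us @ ?m ys # vs) q) (infixes p)"
        unfolding Phi_inv_word[OF c(1,3)]
        by (rule lin_finsum3[OF tm11 ttm11 pair_linear(1)[OF tm11 wc[OF c(2,4)]]], rule wc)
          (use infix_closed(1)[OF _ c(3)] in auto)
      finally show "tensor2 R T11 T11 d (\<lambda>x. x) (?p p q) =
          finsum TT11 (\<lambda>(us, ys, vs). ?p (K11 us @ ?m ys # vs) q) (infixes p)" .
    qed
    also have "finsum TT11 (\<lambda>(us, ys, vs). ?P us ys vs) (infixes xs) =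
        finsum TT11 (\<lambda>(p, q). finsum TT11 (\<lambda>(us, ys, vs). ?p (K11 p) (K11 us @ ?m ys # vs)) (infixes q)) (cuts xs)"
      by (rule TT11.M.finsum_infixes_prefix_cuts) (rule p2)
    also have "... = tensor2 R T11 T11 (koszul T11 e) d (?\<Delta> (?w xs))"
    proof (rule tco_comult_word_map[OF mV11 ttm11 tensor2_linear[OF tm11 tm11 kl dl] xs, symmetric])
      fix p q assume pq: "(p, q) \<in> cuts xs"
      note c = cuts_closed[OF pq xs']
      have Kp: "K11 p \<noteq> []" "over A (K11 p)" using c K_closed11[of p] by auto
      have "tensor2 R T11 T11 (koszul T11 e) d (?p p q) = tensor R T11 [?w (K11 p), d (?w q)]"
        using tensor2_tensor[OF tm11 tm11 kl dl] c wc koszul_word[OF gV11, of p] by simp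
      also have "... = finsum TT11 (\<lambda>(us, ys, vs). ?p (K11 p) (K11 us @ ?m ys # vs)) (infixes q)"
        unfolding Phi_inv_word[OF c(2,4)]
        by (rule lin_finsum3[OF tm11 ttm11 pair_linear(2)[OF tm11 wc[OF Kp]]], rule wc)
          (use infix_closed(1)[OF _ c(4)] in auto)
      finally show "tensor2 R T11 T11 (koszul T11 e) d (?p p q) =
          finsum TT11 (\<lambda>(us, ys, vs). ?p (K11 p) (K11 us @ ?m ys # vs)) (infixes q)" .
    qed
    finally show "?\<Delta> (d (?w xs)) =
        tensor2 R T11 T11 d (\<lambda>x. x) (?\<Delta> (?w xs)) \<oplus>\<^bsub>TT11\<^esub> tensor2 R T11 T11 (koszul T11 e) d (?\<Delta> (?w xs))" .
  qed
qed

text \<open>Acting on \<open>ys\<close> leaves a word of length one only if \<open>us\<close> and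
  \<open>vs\<close> are empty, so the length 1 part of the coderivation recovers the
  cochain.\<close>

lemma Phi_inv_first:
  assumes xs: "xs \<noteq> []" "over A xs"
  shows "d (word R V11 xs) 1 = tensor R V11 [ev R V11 f xs]"
proof -
  interpret TP: module R "tpow R V11 1" by (rule module_tpow[OF mV11])
  note proj = Tco_proj[OF mV11 order_refl]
  have w: "word R V11 (K11 us @ ev R V11 f ys # vs) \<in> carrier T11" if "(us, ys, vs) \<in> infixes xs" for us ys vs
    using infix_closed(1)[OF that xs(2)] by (intro word_closed[OF mV11]) auto
  have m: "tensor R V11 [ev R V11 f xs] \<in> carrier (tpow R V11 1)"
    using m_closed[OF xs] by (intro tensor_closed[OF mV11]) auto
  have at: "word R V11 (K11 us @ ev R V11 f ys # vs) 1 =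
      (if us = [] \<and> vs = [] then tensor R V11 [ev R V11 f ys] else \<zero>\<^bsub>tpow R V11 1\<^esub>)" for us ys vs
    by (auto simp: word_def tco_incl_at[OF mV11])
  have "d (word R V11 xs) 1 = finsum (tpow R V11 1) (\<lambda>(us, ys, vs). word R V11 (K11 us @ ev R V11 f ys # vs) 1) (infixes xs)"
    unfolding Phi_inv_word[OF xs] by (rule lin_finsum3[OF tm11 TP.module_axioms proj]) (rule w)
  also have "... = finsum (tpow R V11 1) (\<lambda>(us, ys, vs). word R V11 (K11 us @ ev R V11 f ys # vs) 1) {([], xs, [])}"
  proof (rule TP.M.finsum_subset[OF finite_infixes])
    fix t assume t: "t \<in> infixes xs - {([], xs, [])}"
    obtain us ys vs where t': "t = (us, ys, vs)" by (cases t)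
    have "\<not> (us = [] \<and> vs = [])" using t by (auto simp: t' infixes_def)
    then show "(case t of (us, ys, vs) \<Rightarrow> word R V11 (K11 us @ ev R V11 f ys # vs) 1) = \<zero>\<^bsub>tpow R V11 1\<^esub>"
      by (simp only: t' prod.case at if_False)
  qed (use xs m in "auto simp: at infixes_def simp del: One_nat_def")
  also have "... = tensor R V11 [ev R V11 f xs]" using m by (simp add: TP.M.finsum_insert at del: One_nat_def)
  finally show ?thesis .
qed

text \<open>What turns compositions with the coderivation into Gerstenhaber products: \<phi> is
  \<mu> for \<open>d\<^sup>2\<close>, the reduced part g of the morphism for \<gamma> d, and h or a
  for the scalar conditions.\<close>

lemma Phi_inv_lift:
  fixes B :: "('k, 'b, 'y) gmodule_scheme"
  assumes B: "module R B" and \<phi>: "\<And>n. 1 \<le> n \<Longrightarrow> \<phi> n \<in> tlin R V11 n B"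
    and xs: "xs \<noteq> []" "over A xs"
  shows "tco_lift R V11 B \<phi> (d (word R V11 xs)) = gerst R A B e \<phi> f (length xs) (tensor R V11 xs)"
proof -
  interpret B: module R B by (rule B)
  have lin: "tco_lift R V11 B \<phi> \<in> lin R T11 B" by (rule tco_lift_linear[OF mV11 B]) (rule \<phi>)
  have w: "word R V11 (K11 us @ ev R V11 f ys # vs) \<in> carrier T11"
    "tco_lift R V11 B \<phi> (word R V11 (K11 us @ ev R V11 f ys # vs)) = ev R V11 \<phi> (K11 us @ ev R V11 f ys # vs)"
    if "(us, ys, vs) \<in> infixes xs" for us ys vs
    using infix_closed(1)[OF that xs(2)] word_closed[OF mV11, of "K11 us @ ev R V11 f ys # vs"]
      tco_lift_word[OF mV11 B \<phi>, of "K11 us @ ev R V11 f ys # vs"] by (auto simp: ev_def)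
  have "tco_lift R V11 B \<phi> (d (word R V11 xs)) =
      finsum B (\<lambda>(us, ys, vs). tco_lift R V11 B \<phi> (word R V11 (K11 us @ ev R V11 f ys # vs))) (infixes xs)"
    unfolding Phi_inv_word[OF xs] by (rule lin_finsum3[OF tm11 B lin]) (rule w)
  also have "... = finsum B (\<lambda>(us, ys, vs). ev R V11 \<phi> (K11 us @ ev R V11 f ys # vs)) (infixes xs)"
    by (rule B.M.finsum_cong') (use w lin_closed[OF lin w(1)] in auto)
  also have "... = gerst R A B e \<phi> f (length xs) (tensor R V11 xs)"
    by (rule gerst_tensor[OF A B f_lin \<phi> xs(2), symmetric])
  finally show ?thesis .
qed

end

section \<open>The coalgebra morphism induced by a cochain of degree 0\<close>

context
  fixes R :: "'k ring" and A :: "('k, 'a, 'x) gmodule_scheme" and B :: "('k, 'b, 'y) gmodule_scheme" and g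
  assumes A: "graded_module R A" and B: "graded_module R B"
    and g: "\<And>n. 1 \<le> n \<Longrightarrow> g n \<in> graded_hom R (tpow R (susp A) n) (susp B) 0"
begin
private abbreviation (input) "V12 \<equiv> susp A"
private abbreviation (input) "W12 \<equiv> susp B"
private abbreviation (input) "T12 \<equiv> Tco R (susp A)"
private abbreviation (input) "U12 \<equiv> Tco R (susp B)"
private abbreviation (input) "TT12 \<equiv> tpow R (Tco R (susp A)) 2"
private abbreviation (input) "UU \<equiv> tpow R (Tco R (susp B)) 2"
private abbreviation (input) "\<gamma>12 \<equiv> Psi_inv R A B g"

private lemmas gV12 = graded_module_susp[OF A]
private lemmas mV12 = graded_moduleD(1)[OF gV12]
private lemmas gW12 = graded_module_susp[OF B]
private lemmas mW12 = graded_moduleD(1)[OF gW12]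
private lemmas mB12 = graded_moduleD(1)[OF B]
private lemmas gU12 = graded_module_Tco[OF gW12]

interpretation T12: module R T12 by (rule module_Tco[OF mV12])
interpretation TT12: module R TT12 by (rule module_tpow[OF T12.module_axioms])
interpretation U12: module R U12 by (rule module_Tco[OF mW12])
interpretation UU: module R UU by (rule module_tpow[OF U12.module_axioms])

private lemmas tm12 = T12.module_axioms and um12 = U12.module_axioms and uum = UU.module_axioms

private lemma g_lin12: "1 \<le> n \<Longrightarrow> g n \<in> tlin R V12 n B"
  using graded_homD(1)[OF g] by simp

private lemma seg_word:
  assumes "yss \<in> segmentations xs" "over A xs"
  shows "map (ev R V12 g) yss \<noteq> []" "over W12 (map (ev R V12 g) yss)" "word R W12 (map (ev R V12 g) yss) \<in> carrier U12"
proof -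
  show ne: "map (ev R V12 g) yss \<noteq> []" using assms(1) by (auto simp: segmentations_def)
  show cl: "over W12 (map (ev R V12 g) yss)"
    using map_ev_closed[OF A mB12, of g, OF g_lin12 assms] by simp
  show "word R W12 (map (ev R V12 g) yss) \<in> carrier U12" by (rule word_closed[OF mW12 ne cl])
qed

private lemma Psi_body:
  "(\<lambda>X. \<Oplus>\<^bsub>U12\<^esub> ks \<in> compositions n. tco_incl R W12 (length ks) (tensor_maps R V12 W12 (map (\<lambda>k. (0, k, g k)) ks) X))
    \<in> tlin R V12 n U12"
proof (intro lin_finsum_map[OF module_tpow[OF mV12] um12])
  fix ks assume ks: "ks \<in> compositions n"
  note fs = segmentation_factors[OF A mB12, of g, OF g_lin12 ks]
  show "(\<lambda>X. tco_incl R W12 (length ks) (tensor_maps R V12 W12 (map (\<lambda>k. (0, k, g k)) ks) X))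
      \<in> tlin R V12 n U12"
    by (rule lin_comp[OF tco_incl_linear[OF mW12 fs(3)] tensor_maps_linear[OF gV12 mW12 fs(1,2)]]) simp_all
qed

lemma Psi_inv_linear: "\<gamma>12 \<in> lin R T12 U12"
  unfolding Psi_inv_def by (rule tco_lift_linear[OF mV12 um12 Psi_body])

lemma Psi_inv_word:
  assumes xs: "xs \<noteq> []" "over A xs"
  shows "\<gamma>12 (word R V12 xs) = (\<Oplus>\<^bsub>U12\<^esub> yss \<in> segmentations xs. word R W12 (map (ev R V12 g) yss))"
proof -
  have xs': "over V12 xs" using xs by simp
  have "\<gamma>12 (word R V12 xs) = (\<Oplus>\<^bsub>U12\<^esub> ks \<in> compositions (length xs).
      tco_incl R W12 (length ks) (tensor_maps R V12 W12 (map (\<lambda>k. (0, k, g k)) ks) (tensor R V12 xs)))"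
    unfolding Psi_inv_def by (rule tco_lift_word[OF mV12 um12 Psi_body xs(1) xs'])
  also have "... = (\<Oplus>\<^bsub>U12\<^esub> yss \<in> segmentations xs. word R W12 (map (ev R V12 g) yss))"
  proof (rule U12.M.finsum_segmentations)
    fix yss assume yss: "yss \<in> segmentations xs"
    show "word R W12 (map (ev R V12 g) yss) \<in> carrier U12" by (rule seg_word[OF yss xs(2)])
    show "tco_incl R W12 (length (map length yss)) (tensor_maps R V12 W12 (map (\<lambda>k. (0, k, g k)) (map length yss)) (tensor R V12 xs))
        = word R W12 (map (ev R V12 g) yss)"
      using segmentation_tensor[OF A mB12, of g, OF g_lin12 yss xs(2)] by (simp add: word_def)
  qed
  finally show ?thesis .
qed

lemma Psi_inv_graded: "\<gamma>12 \<in> graded_hom R T12 U12 0"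
proof (rule Tco_graded_hom[OF gV12 gU12 Psi_inv_linear])
  fix xs ds assume xs: "xs \<noteq> []" and ds: "homogeneous V12 xs ds"
  have sub: "over A xs" using homogeneous_list_carrier[OF gV12 ds] by simp
  show "\<gamma>12 (word R V12 xs) \<in> grade U12 (sum_list ds + 0)"
    unfolding Psi_inv_word[OF xs sub]
  proof (rule submodule_finsum[OF graded_moduleD[OF gU12]])
    fix yss assume yss: "yss \<in> segmentations xs"
    \<comment> \<open>Generalised over the degree list, so that the blocks can be split off one by
      one.\<close>
    have "\<exists>es. list_all2 (\<lambda>x i. x \<in> grade W12 i) (map (ev R V12 g) yss) es \<and> sum_list es = sum_list ds"
      if "homogeneous V12 (concat yss) ds" "[] \<notin> set yss" for ds
      using that
    proof (induction yss arbitrary: ds)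
      case (Cons ys yss)
      then obtain ds1 ds2 where d: "ds = ds1 @ ds2" "homogeneous V12 ys ds1"
        "homogeneous V12 (concat yss) ds2" by (auto simp: list_all2_append1)
      obtain es where es: "list_all2 (\<lambda>x i. x \<in> grade W12 i) (map (ev R V12 g) yss) es" "sum_list es = sum_list ds2"
        using Cons.IH[OF d(3)] Cons.prems(2) by auto
      have "tensor R V12 ys \<in> grade (tpow R V12 (length ys)) (sum_list ds1)"
        by (rule tensor_grade[OF gV12 d(2) refl refl])
      moreover have "1 \<le> length ys" using Cons.prems(2) by (cases ys) auto
      ultimately have "ev R V12 g ys \<in> grade W12 (sum_list ds1)"
        unfolding ev_def using graded_homD(2)[OF g] by fastforce
      then show ?case using es d(1) by (intro exI[of _ "sum_list ds1 # es"]) auto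
    qed simp
    then obtain es where "list_all2 (\<lambda>x i. x \<in> grade W12 i) (map (ev R V12 g) yss) es" "sum_list es = sum_list ds"
      using yss ds by (auto simp: segmentations_def)
    then show "word R W12 (map (ev R V12 g) yss) \<in> grade U12 (sum_list ds + 0)"
      using seg_word(1)[OF yss sub] by (intro word_grade[OF gW12, of _ es]) auto
  qed
qed

lemma Psi_inv_comult:
  assumes t: "t \<in> carrier T12"
  shows "tco_comult R W12 (\<gamma>12 t) = tensor2 R T12 U12 \<gamma>12 \<gamma>12 (tco_comult R V12 t)"
proof (rule Tco_ext[OF mV12 uum lin_comp[OF tco_comult_linear[OF mW12] Psi_inv_linear]
      lin_comp[OF tensor2_linear[OF tm12 um12 Psi_inv_linear Psi_inv_linear]
        tco_comult_linear[OF mV12]] _ t])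
  fix xs assume xs: "xs \<noteq> []" "over V12 xs"
  have xs': "over A xs" using xs(2) by simp
  let ?G = "map (ev R V12 g)" and ?w = "word R W12"
  let ?p = "\<lambda>us vs. tensor R U12 [word R W12 us, word R W12 vs]"
  have pc: "?p (?G p) (?G q) \<in> carrier UU"
    if "(us, vs) \<in> cuts xs" "p \<in> segmentations us" "q \<in> segmentations vs" for us vs p q
    using seg_word(3)[OF that(2)] seg_word(3)[OF that(3)] cuts_closed[OF that(1) xs']
    by (intro pair_linear(3)[OF um12]) auto
  have "tco_comult R W12 (\<gamma>12 (word R V12 xs)) = (\<Oplus>\<^bsub>UU\<^esub> yss \<in> segmentations xs. tco_comult R W12 (?w (?G yss)))"
    unfolding Psi_inv_word[OF xs(1) xs']
    by (rule lin_finsum[OF um12 uum tco_comult_linear[OF mW12]]) (rule seg_word(3)[OF _ xs'])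
  also have "... = (\<Oplus>\<^bsub>UU\<^esub> yss \<in> segmentations xs. finsum UU (\<lambda>(p, q). ?p (?G p) (?G q)) (cuts yss))"
  proof (rule UU.M.finsum_cong'[OF refl])
    have cl: "?p (?G p) (?G q) \<in> carrier UU" if "yss \<in> segmentations xs" "(p, q) \<in> cuts yss" for yss p q
    proof (rule pc)
      show "(concat p, concat q) \<in> cuts xs" "p \<in> segmentations (concat p)" "q \<in> segmentations (concat q)"
        using that by (cases p; cases q; auto simp: segmentations_def cuts_def)+
    qed
    then show "(\<lambda>yss. finsum UU (\<lambda>(p, q). ?p (?G p) (?G q)) (cuts yss)) \<in> segmentations xs \<rightarrow> carrier UU"
      by (auto intro!: UU.M.finsum_closed)
    fix yss assume yss: "yss \<in> segmentations xs"
    show "tco_comult R W12 (?w (?G yss)) = finsum UU (\<lambda>(p, q). ?p (?G p) (?G q)) (cuts yss)"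
      unfolding tco_comult_word[OF mW12 seg_word(1,2)[OF yss xs']]
      by (rule UU.M.finsum_cuts_map) (rule cl[OF yss])
  qed
  also have "... = finsum UU (\<lambda>(us, vs). \<Oplus>\<^bsub>UU\<^esub>p\<in>segmentations us. \<Oplus>\<^bsub>UU\<^esub>q\<in>segmentations vs. ?p (?G p) (?G q)) (cuts xs)"
    by (rule UU.M.finsum_segmentations_cuts) (rule pc)
  also have "... = tensor2 R T12 U12 \<gamma>12 \<gamma>12 (tco_comult R V12 (word R V12 xs))"
  proof (rule tco_comult_word_map[OF mV12 uum tensor2_linear[OF tm12 um12 Psi_inv_linear Psi_inv_linear] xs, symmetric])
    fix us vs assume uv: "(us, vs) \<in> cuts xs"
    note c = cuts_closed[OF uv xs']
    have w: "word R V12 us \<in> carrier T12" "word R V12 vs \<in> carrier T12" using c word_closed[OF mV12] by simp_all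
    have \<gamma>v: "\<gamma>12 (word R V12 vs) \<in> carrier U12" by (rule lin_closed[OF Psi_inv_linear w(2)])
    have "tensor2 R T12 U12 \<gamma>12 \<gamma>12 (tensor R T12 [word R V12 us, word R V12 vs]) = tensor R U12 [\<gamma>12 (word R V12 us), \<gamma>12 (word R V12 vs)]"
      by (rule tensor2_tensor[OF tm12 um12 Psi_inv_linear Psi_inv_linear w])
    also have "... = (\<Oplus>\<^bsub>UU\<^esub>p\<in>segmentations us. tensor R U12 [?w (?G p), \<gamma>12 (word R V12 vs)])"
      unfolding Psi_inv_word[OF c(1,3)]
      by (rule lin_finsum[OF um12 uum pair_linear(1)[OF um12 \<gamma>v]]) (rule seg_word(3)[OF _ c(3)])
    also have "... = (\<Oplus>\<^bsub>UU\<^esub>p\<in>segmentations us. \<Oplus>\<^bsub>UU\<^esub>q\<in>segmentations vs. ?p (?G p) (?G q))"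
    proof (rule UU.M.finsum_cong'[OF refl])
      show "(\<lambda>p. \<Oplus>\<^bsub>UU\<^esub>q\<in>segmentations vs. ?p (?G p) (?G q)) \<in> segmentations us \<rightarrow> carrier UU"
        using pc[OF uv] by (auto intro!: UU.M.finsum_closed)
      fix p assume p: "p \<in> segmentations us"
      show "tensor R U12 [?w (?G p), \<gamma>12 (word R V12 vs)] = (\<Oplus>\<^bsub>UU\<^esub>q\<in>segmentations vs. ?p (?G p) (?G q))"
        unfolding Psi_inv_word[OF c(2,4)]
        by (rule lin_finsum[OF um12 uum pair_linear(2)[OF um12 seg_word(3)[OF p c(3)]]]) (rule seg_word(3)[OF _ c(4)])
    qed
    finally show "tensor2 R T12 U12 \<gamma>12 \<gamma>12 (tensor R T12 [word R V12 us, word R V12 vs]) =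
        (\<Oplus>\<^bsub>UU\<^esub>p\<in>segmentations us. \<Oplus>\<^bsub>UU\<^esub>q\<in>segmentations vs. ?p (?G p) (?G q))" .
  qed
  finally show "tco_comult R W12 (\<gamma>12 (word R V12 xs)) = tensor2 R T12 U12 \<gamma>12 \<gamma>12 (tco_comult R V12 (word R V12 xs))" .
qed

text \<open>Only the segmentation into a single block gives a word of length one.\<close>

lemma Psi_inv_first:
  assumes xs: "xs \<noteq> []" "over A xs"
  shows "\<gamma>12 (word R V12 xs) 1 = tensor R W12 [ev R V12 g xs]"
proof -
  interpret TP: module R "tpow R W12 1" by (rule module_tpow[OF mW12])
  note proj = Tco_proj[OF mW12 order_refl]
  have at: "word R W12 (map (ev R V12 g) yss) 1 =
      (if length yss = 1 then tensor R W12 (map (ev R V12 g) yss) else \<zero>\<^bsub>tpow R W12 1\<^esub>)" for yss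
    by (simp add: word_def tco_incl_at[OF mW12])
  have seg: "[xs] \<in> segmentations xs" using xs(1) by (simp add: segmentations_def)
  have m: "tensor R W12 [ev R V12 g xs] \<in> carrier (tpow R W12 1)"
    using tensor_closed[OF mW12 _ seg_word(2)[OF seg xs(2)]] by simp
  have "\<gamma>12 (word R V12 xs) 1 = (\<Oplus>\<^bsub>tpow R W12 1\<^esub> yss \<in> segmentations xs. word R W12 (map (ev R V12 g) yss) 1)"
    unfolding Psi_inv_word[OF xs]
    by (rule lin_finsum[OF um12 TP.module_axioms proj]) (rule seg_word(3)[OF _ xs(2)])
  also have "... = (\<Oplus>\<^bsub>tpow R W12 1\<^esub> yss \<in> {[xs]}. word R W12 (map (ev R V12 g) yss) 1)"
  proof (rule TP.M.finsum_subset[OF finite_segmentations])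
    fix yss assume "yss \<in> segmentations xs - {[xs]}"
    then have "length yss \<noteq> 1" by (auto simp: segmentations_def length_Suc_conv)
    then show "word R W12 (map (ev R V12 g) yss) 1 = \<zero>\<^bsub>tpow R W12 1\<^esub>" by (simp only: at if_False)
  qed (use seg m at[of "[xs]"] in "auto simp del: One_nat_def")
  also have "... = tensor R W12 [ev R V12 g xs]" using m at[of "[xs]"] by (simp add: TP.M.finsum_insert del: One_nat_def)
  finally show ?thesis .
qed

text \<open>Counterpart of \<open>Phi_inv_lift\<close> for the morphism: \<phi> is the \<mu> of the
  target in the first equation and its h in the second.\<close>

lemma Psi_inv_lift:
  fixes C :: "('k, 'c, 'z) gmodule_scheme"
  assumes C: "module R C" and \<phi>: "\<And>n. 1 \<le> n \<Longrightarrow> \<phi> n \<in> tlin R W12 n C"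
    and xs: "xs \<noteq> []" "over A xs"
  shows "tco_lift R W12 C \<phi> (\<gamma>12 (word R V12 xs)) = star R A B C \<phi> g (length xs) (tensor R V12 xs)"
proof -
  interpret C: module R C by (rule C)
  have lin: "tco_lift R W12 C \<phi> \<in> lin R U12 C" by (rule tco_lift_linear[OF mW12 C]) (rule \<phi>)
  have w: "tco_lift R W12 C \<phi> (word R W12 (map (ev R V12 g) yss)) = ev R W12 \<phi> (map (ev R V12 g) yss)"
    if "yss \<in> segmentations xs" for yss
    using tco_lift_word[OF mW12 C, of \<phi>, OF \<phi> seg_word(1,2)[OF that xs(2)]] by (simp add: ev_def[of R W12])
  have "tco_lift R W12 C \<phi> (\<gamma>12 (word R V12 xs)) =
      (\<Oplus>\<^bsub>C\<^esub> yss \<in> segmentations xs. tco_lift R W12 C \<phi> (word R W12 (map (ev R V12 g) yss)))"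
    unfolding Psi_inv_word[OF xs]
    by (rule lin_finsum[OF um12 C lin]) (rule seg_word(3)[OF _ xs(2)])
  also have "... = (\<Oplus>\<^bsub>C\<^esub> yss \<in> segmentations xs. ev R W12 \<phi> (map (ev R V12 g) yss))"
    by (rule C.M.finsum_cong') (use w lin_closed[OF lin seg_word(3)[OF _ xs(2)]] in auto)
  also have "... = star R A B C \<phi> g (length xs) (tensor R V12 xs)"
    by (rule star_tensor[OF A mB12, of g, OF g_lin12 C \<phi> xs(2), symmetric])
  finally show ?thesis .
qed

end

text \<open>\<open>susp (ground R)\<close> is concentrated in degree 1, so a cochain of degree
  \<open>e\<close> yields a functional of degree e - 1 with values in the unsuspended ground
  module.\<close>

lemma neg_desusp:
  fixes A :: "('k, 'a, 'x) gmodule_scheme"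
  assumes R: "cring R" and A: "graded_module R A"
    and a: "\<And>n. 1 \<le> n \<Longrightarrow> a n \<in> graded_hom R (tpow R (susp A) n) (susp (ground R)) e"
  shows neg_desusp_linear: "neg_desusp R A a \<in> lin R (Tco R (susp A)) (ground R)"
    and neg_desusp_word: "xs \<noteq> [] \<Longrightarrow> over A xs \<Longrightarrow>
      neg_desusp R A a (word R (susp A) xs) = \<ominus>\<^bsub>R\<^esub> ev R (susp A) a xs"
    and neg_desusp_graded: "neg_desusp R A a \<in> graded_hom R (Tco R (susp A)) (ground R) (e - 1)"
proof -
  interpret R: cring R by (rule R)
  note gV12 = graded_module_susp[OF A]
  note mV12 = graded_moduleD(1)[OF gV12] and mG = module_ground[OF R]
  have al: "a n \<in> tlin R (susp A) n (ground R)" if "1 \<le> n" for n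
    using graded_homD(1)[OF a[OF that]] by simp
  have body: "(\<lambda>X. \<ominus>\<^bsub>R\<^esub> a n X) \<in> tlin R (susp A) n (ground R)" if "1 \<le> n" for n
    by (rule lin_cong[OF lin_neg_map[OF module_tpow[OF mV12] mG al[OF that]] module_tpow[OF mV12]])
      (use a_inv_ground[OF R] lin_closed[OF al[OF that]] in simp)
  show lin: "neg_desusp R A a \<in> lin R (Tco R (susp A)) (ground R)"
    unfolding neg_desusp_def by (rule tco_lift_linear[OF mV12 mG]) (rule body)
  show val: "neg_desusp R A a (word R (susp A) xs) = \<ominus>\<^bsub>R\<^esub> ev R (susp A) a xs"
    if "xs \<noteq> []" "over A xs" for xs
    unfolding neg_desusp_def ev_def by (rule tco_lift_word[OF mV12 mG]) (use body that in auto)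
  have gG: "graded_module R (ground R)"
  proof (rule graded_moduleI[OF mG])
    interpret G: module R "ground R" by (rule mG)
    show gs: "submodule (grade (ground R) i) R (ground R)" for i
      by (rule submoduleI'[OF mG]) (auto split: if_splits)
    show "carrier (ground R) \<subseteq> H" if "submodule H R (ground R)" "\<And>i. grade (ground R) i \<subseteq> H" for H
      using that(2)[of 0] by simp
    fix c i assume c: "decomposition (ground R) c \<zero>\<^bsub>ground R\<^esub>"
    have cl: "c j \<in> grade (ground R) j" for j using c by (simp add: decomposition_def)
    have z: "c j = \<zero>\<^bsub>R\<^esub>" if "j \<noteq> 0" for j using cl[of j] that by simp
    have "\<zero>\<^bsub>ground R\<^esub> = finsum (ground R) c {0}"
      by (rule decomposition_finsum[OF mG gs c]) (use z in auto)
    then have "c 0 = \<zero>\<^bsub>R\<^esub>" using cl[of 0] by (simp add: G.M.finsum_insert)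
    then show "c i = \<zero>\<^bsub>ground R\<^esub>" using z by (cases "i = 0") auto
  qed
  show "neg_desusp R A a \<in> graded_hom R (Tco R (susp A)) (ground R) (e - 1)"
  proof (rule Tco_graded_hom[OF gV12 gG lin])
    fix xs ds assume xs: "xs \<noteq> []" and ds: "homogeneous (susp A) xs ds"
    have sub: "over A xs" using homogeneous_list_carrier[OF gV12 ds] by simp
    have "tensor R (susp A) xs \<in> grade (tpow R (susp A) (length xs)) (sum_list ds)"
      by (rule tensor_grade[OF gV12 ds refl refl])
    then have "ev R (susp A) a xs \<in> grade (susp (ground R)) (sum_list ds + e)"
      unfolding ev_def using xs by (intro graded_homD(2)[OF a]) (auto simp: Suc_le_eq)
    then show "neg_desusp R A a (word R (susp A) xs) \<in> grade (ground R) (sum_list ds + (e - 1))"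
      unfolding val[OF xs sub] by (auto split: if_splits simp: algebra_simps)
  qed
qed

text \<open>Moves the sign outside the lift, so that \<open>Phi_inv_lift\<close> and
  \<open>Psi_inv_lift\<close> apply to the cochain itself.\<close>

lemma neg_desusp_lift:
  fixes A :: "('k, 'a, 'x) gmodule_scheme"
  assumes R: "cring R" and A: "graded_module R A"
    and a: "\<And>n. 1 \<le> n \<Longrightarrow> a n \<in> graded_hom R (tpow R (susp A) n) (susp (ground R)) e"
    and t: "t \<in> carrier (Tco R (susp A))"
  shows "neg_desusp R A a t = \<ominus>\<^bsub>R\<^esub> tco_lift R (susp A) (ground R) a t" "tco_lift R (susp A) (ground R) a t \<in> carrier R"
proof -
  note mV12 = module_susp[OF graded_moduleD(1)[OF A]] and mG = module_ground[OF R]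
  have al: "1 \<le> n \<Longrightarrow> a n \<in> tlin R (susp A) n (ground R)" for n using graded_homD(1)[OF a] by simp
  have l: "tco_lift R (susp A) (ground R) a \<in> lin R (Tco R (susp A)) (ground R)"
    by (rule tco_lift_linear[OF mV12 mG]) (rule al)
  show c: "tco_lift R (susp A) (ground R) a t \<in> carrier R" using lin_closed[OF l t] by simp
  have "neg_desusp R A a t = \<ominus>\<^bsub>ground R\<^esub> tco_lift R (susp A) (ground R) a t"
  proof (rule Tco_ext[OF mV12 mG neg_desusp_linear[OF R A a] lin_neg_map[OF module_Tco[OF mV12] mG l] _ t])
    fix us assume us: "us \<noteq> []" "over (susp A) us"
    then show "neg_desusp R A a (word R (susp A) us) = \<ominus>\<^bsub>ground R\<^esub> tco_lift R (susp A) (ground R) a (word R (susp A) us)"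
      using neg_desusp_word[OF R A a] tco_lift_word[OF mV12 mG, of a, OF al us] a_inv_ground[OF R]
        lin_closed[OF l word_closed[OF mV12 us]] by (simp add: ev_def)
  qed
  then show "neg_desusp R A a t = \<ominus>\<^bsub>R\<^esub> tco_lift R (susp A) (ground R) a t" using a_inv_ground[OF R c] by simp
qed

section \<open>The curved bar construction\<close>

text \<open>The hypothesis is about words, but the conclusion is needed at elements that are not
  words, such as the value of another coderivation or morphism on a word.\<close>

lemma first_eq:
  fixes V :: "('k, 'a, 'x) gmodule_scheme" and W :: "('k, 'b, 'y) gmodule_scheme"
  assumes V: "module R V" and W: "module R W"
    and F: "F \<in> lin R (Tco R V) (Tco R W)"
    and \<phi>: "\<And>n. 1 \<le> n \<Longrightarrow> \<phi> n \<in> tlin R V n W"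
    and first: "\<And>xs. xs \<noteq> [] \<Longrightarrow> over V xs \<Longrightarrow> F (word R V xs) 1 = tensor R W [ev R V \<phi> xs]"
    and t: "t \<in> carrier (Tco R V)"
  shows "F t 1 = tensor R W [tco_lift R V W \<phi> t]"
proof -
  have lin: "tco_lift R V W \<phi> \<in> lin R (Tco R V) W" by (rule tco_lift_linear[OF V W]) (rule \<phi>)
  have one: "(\<lambda>x. tensor R W [x]) \<in> lin R W (tpow R W 1)"
    using multilinear_slot[OF tensor_multilinear[OF W], of 1 "[]" "[]"] by simp
  show ?thesis
  proof (rule Tco_ext[OF V module_tpow[OF W] lin_comp[OF Tco_proj[OF W order_refl] F]
        lin_comp[OF one lin] _ t])
    fix xs assume xs: "xs \<noteq> []" "over V xs"
    then show "F (word R V xs) 1 = tensor R W [tco_lift R V W \<phi> (word R V xs)]"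
      using first[OF xs] tco_lift_word[OF V W, of \<phi>, OF \<phi> xs] by (simp add: ev_def)
  qed
qed

text \<open>Used with \<phi> the projection to length 1 for \<open>d\<^sup>2 = ad(\<xi>)\<close>,
  and with \<phi> = g for the term \<gamma> ad(\<alpha>).\<close>

lemma tco_lift_ad:
  fixes V :: "('k, 'a, 'x) gmodule_scheme" and W :: "('k, 'b, 'y) gmodule_scheme"
  assumes V: "graded_module R V" and W: "module R W" and \<xi>: "\<xi> \<in> lin R (Tco R V) (ground R)"
    and \<phi>: "\<And>n. 1 \<le> n \<Longrightarrow> \<phi> n \<in> tlin R V n W"
    and xs: "xs \<noteq> []" "over V xs"
  shows "tco_lift R V W \<phi> (ad R (Tco R V) (tco_comult R V) e \<xi> (word R V xs)) =
    finsum W (\<lambda>(us, vs). \<xi> (word R V us) \<odot>\<^bsub>W\<^esub> ev R V \<phi> vs) (cuts xs) \<ominus>\<^bsub>W\<^esub>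
    finsum W (\<lambda>(us, vs). \<xi> (word R V vs) \<odot>\<^bsub>W\<^esub> ev R V \<phi> (map (koszul V e) us)) (cuts xs)"
proof -
  let ?T = "Tco R V" and ?w = "word R V" and ?P = "tco_lift R V W \<phi>" and ?K = "map (koszul V e)"
  note mV = graded_moduleD(1)[OF V]
  note tm = module_Tco[OF mV]
  interpret W: module R W by (rule W)
  interpret T: module R ?T by (rule tm)
  have lin: "?P \<in> lin R ?T W" by (rule tco_lift_linear[OF mV W]) (rule \<phi>)
  have val: "?P (?w us) = ev R V \<phi> us" "ev R V \<phi> us \<in> carrier W" "?w us \<in> carrier ?T" "\<xi> (?w us) \<in> carrier R"
    if "us \<noteq> []" "over V us" for us
  proof -
    show w: "?w us \<in> carrier ?T" by (rule word_closed[OF mV that])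
    show P: "?P (?w us) = ev R V \<phi> us" using tco_lift_word[OF mV W, of \<phi>, OF \<phi> that] by (simp add: ev_def)
    show "ev R V \<phi> us \<in> carrier W" using lin_closed[OF lin w] P by simp
    show "\<xi> (?w us) \<in> carrier R" using lin_closed[OF \<xi> w] by simp
  qed
  have K: "?K us \<noteq> []" "over V (?K us)" if "us \<noteq> []" "over V us" for us
    using that koszul_closed[OF V] by auto
  have sums: "?P (finsum ?T (\<lambda>(us, vs). r us vs \<odot>\<^bsub>?T\<^esub> ?w (u us vs)) (cuts xs)) =
      finsum W (\<lambda>(us, vs). r us vs \<odot>\<^bsub>W\<^esub> ev R V \<phi> (u us vs)) (cuts xs)"
    "finsum ?T (\<lambda>(us, vs). r us vs \<odot>\<^bsub>?T\<^esub> ?w (u us vs)) (cuts xs) \<in> carrier ?T"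
    if ru: "\<And>us vs. (us, vs) \<in> cuts xs \<Longrightarrow> r us vs \<in> carrier R"
      "\<And>us vs. (us, vs) \<in> cuts xs \<Longrightarrow> u us vs \<noteq> [] \<and> over V (u us vs)" for r u
  proof -
    have "?P (finsum ?T (\<lambda>(us, vs). r us vs \<odot>\<^bsub>?T\<^esub> ?w (u us vs)) (cuts xs)) =
        finsum W (\<lambda>(us, vs). ?P (r us vs \<odot>\<^bsub>?T\<^esub> ?w (u us vs))) (cuts xs)"
      by (rule lin_finsum2[OF tm W lin]) (use ru val in auto)
    also have "... = finsum W (\<lambda>(us, vs). r us vs \<odot>\<^bsub>W\<^esub> ev R V \<phi> (u us vs)) (cuts xs)"
    proof (rule W.M.finsum_cong2)
      fix us vs assume uv: "(us, vs) \<in> cuts xs"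
      note u = ru(2)[OF uv, THEN conjunct1] ru(2)[OF uv, THEN conjunct2]
      show "?P (r us vs \<odot>\<^bsub>?T\<^esub> ?w (u us vs)) = r us vs \<odot>\<^bsub>W\<^esub> ev R V \<phi> (u us vs)"
        using lin_smult[OF lin ru(1)[OF uv] val(3)[OF u]] val(1)[OF u] by simp
      show "r us vs \<odot>\<^bsub>W\<^esub> ev R V \<phi> (u us vs) \<in> carrier W" using ru(1)[OF uv] val(2)[OF u] by simp
    qed
    finally show "?P (finsum ?T (\<lambda>(us, vs). r us vs \<odot>\<^bsub>?T\<^esub> ?w (u us vs)) (cuts xs)) =
      finsum W (\<lambda>(us, vs). r us vs \<odot>\<^bsub>W\<^esub> ev R V \<phi> (u us vs)) (cuts xs)" .
    show "finsum ?T (\<lambda>(us, vs). r us vs \<odot>\<^bsub>?T\<^esub> ?w (u us vs)) (cuts xs) \<in> carrier ?T"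
      using ru val(3) by (auto intro!: T.M.finsum_closed)
  qed
  have c1: "\<xi> (?w us) \<in> carrier R" "vs \<noteq> [] \<and> over V vs" and c2: "\<xi> (?w vs) \<in> carrier R"
    "?K us \<noteq> [] \<and> over V (?K us)" if "(us, vs) \<in> cuts xs" for us vs
    using cuts_closed[OF that xs(2)] val(4) K by auto
  show ?thesis
    unfolding ad_word[OF V \<xi> xs]
    by (subst lin_minus[OF tm W lin]) (use sums[OF c1] sums[OF c2] in auto)
qed

text \<open>\<open>g\<close> has degree 0 and so commutes with the sign operators;
  \<open>koszul_susp\<close> then expresses the sign through the degree in \<open>B\<close>, as
  \<open>mu_su\<close> does.\<close>

lemma koszul_ev:
  fixes A :: "('k, 'a, 'x) gmodule_scheme" and B :: "('k, 'b, 'y) gmodule_scheme"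
  assumes A: "graded_module R A" and B: "graded_module R B"
    and g: "\<And>n. 1 \<le> n \<Longrightarrow> g n \<in> graded_hom R (tpow R (susp A) n) (susp B) 0"
    and us: "us \<noteq> []" "over A us"
  shows "ev R (susp A) g (map (koszul (susp A) (-1)) us) = \<ominus>\<^bsub>B\<^esub> koszul B 1 (ev R (susp A) g us)"
proof -
  note gV = graded_module_susp[OF A] and gW = graded_module_susp[OF B]
  have n: "1 \<le> length us" using us by (simp add: Suc_le_eq)
  have "tensor R (susp A) us \<in> carrier (tpow R (susp A) (length us))"
    using us by (intro tensor_closed[OF graded_moduleD(1)[OF gV]]) auto
  from koszul_commute[OF graded_module_tpow[OF gV] gW g[OF n] this, of "- 1"]
    koszul_tensor[OF gV refl, of us "- 1"] us
  have "ev R (susp A) g (map (koszul (susp A) (-1)) us) = koszul (susp B) (-1) (ev R (susp A) g us)"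
    by (simp add: ev_def)
  also have "... = \<ominus>\<^bsub>B\<^esub> koszul B 1 (ev R (susp A) g us)"
    using graded_homD(1)[OF g[OF n]] us(2)
    by (intro koszul_susp[OF B] ev_closed[OF A graded_moduleD(1)[OF B]]) auto
  finally show ?thesis .
qed

text \<open>Only the cut before the last letter, respectively behind the first one, has a part of
  length one on the required side.\<close>

lemma finsum_cuts_single:
  fixes W :: "('k, 'b, 'y) gmodule_scheme"
  assumes W: "module R W" and cl: "\<And>us vs. (us, vs) \<in> cuts xs \<Longrightarrow> F us vs \<in> carrier W"
  shows "finsum W (\<lambda>(us, vs). if length vs = 1 then F us vs else \<zero>\<^bsub>W\<^esub>) (cuts xs) =
      (if 2 \<le> length xs then F (butlast xs) [last xs] else \<zero>\<^bsub>W\<^esub>)"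
    and "finsum W (\<lambda>(us, vs). if length us = 1 then F us vs else \<zero>\<^bsub>W\<^esub>) (cuts xs) =
      (if 2 \<le> length xs then F [hd xs] (tl xs) else \<zero>\<^bsub>W\<^esub>)"
proof -
  interpret W: module R W by (rule W)
  have e: "{p \<in> cuts xs. length (snd p) = 1} = (if 2 \<le> length xs then {(butlast xs, [last xs])} else {})"
    "{p \<in> cuts xs. length (fst p) = 1} = (if 2 \<le> length xs then {([hd xs], tl xs)} else {})"
    by (cases xs rule: rev_cases; auto simp: cuts_def length_Suc_conv Suc_le_eq)
      (cases xs; auto simp: cuts_def length_Suc_conv Suc_le_eq)
  have c: "F (butlast xs) [last xs] \<in> carrier W" "F [hd xs] (tl xs) \<in> carrier W" if "2 \<le> length xs"
  proof -
    have "(butlast xs, [last xs]) \<in> {p \<in> cuts xs. length (snd p) = 1}" "([hd xs], tl xs) \<in> {p \<in> cuts xs. length (fst p) = 1}"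
      unfolding e using that by auto
    then show "F (butlast xs) [last xs] \<in> carrier W" "F [hd xs] (tl xs) \<in> carrier W" using cl by auto
  qed
  have "finsum W (\<lambda>(us, vs). if length vs = 1 then F us vs else \<zero>\<^bsub>W\<^esub>) (cuts xs) =
      finsum W (\<lambda>(us, vs). if length vs = 1 then F us vs else \<zero>\<^bsub>W\<^esub>) {p \<in> cuts xs. length (snd p) = 1}"
    by (rule W.M.finsum_subset[OF finite_cuts]) (use cl in auto)
  then show "finsum W (\<lambda>(us, vs). if length vs = 1 then F us vs else \<zero>\<^bsub>W\<^esub>) (cuts xs) =
      (if 2 \<le> length xs then F (butlast xs) [last xs] else \<zero>\<^bsub>W\<^esub>)"
    using c unfolding e by (auto simp: W.M.finsum_insert split: if_splits)
  have "finsum W (\<lambda>(us, vs). if length us = 1 then F us vs else \<zero>\<^bsub>W\<^esub>) (cuts xs) =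
      finsum W (\<lambda>(us, vs). if length us = 1 then F us vs else \<zero>\<^bsub>W\<^esub>) {p \<in> cuts xs. length (fst p) = 1}"
    by (rule W.M.finsum_subset[OF finite_cuts]) (use cl in auto)
  then show "finsum W (\<lambda>(us, vs). if length us = 1 then F us vs else \<zero>\<^bsub>W\<^esub>) (cuts xs) =
      (if 2 \<le> length xs then F [hd xs] (tl xs) else \<zero>\<^bsub>W\<^esub>)"
    using c unfolding e by (auto simp: W.M.finsum_insert split: if_splits)
qed

text \<open>Both \<open>d\<^sup>2\<close> and ad(\<xi>) have even degree, hence are coderivations
  with \<kappa> the identity, and \<open>tcoder_zero\<close> compares them in length 1. There
  \<open>d\<^sup>2\<close> gives \<mu> \<circ> \<mu>, while ad(\<xi>) keeps the cuts that split off
  one letter; so the identity is \<open>rel1\<close>. Up to sign, \<open>rel2\<close> is the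
  vanishing of \<xi> d.\<close>

lemma curved_dg_coalgebra_tco:
  fixes A :: "('k, 'a) gmodule"
  assumes R: "cring R" and A: "graded_module R A"
    and \<mu>: "\<And>n. 1 \<le> n \<Longrightarrow> \<mu> n \<in> graded_hom R (tpow R (susp A) n) (susp A) (-1)"
    and h: "\<And>n. 1 \<le> n \<Longrightarrow> h n \<in> graded_hom R (tpow R (susp A) n) (susp (ground R)) (-1)"
    and rel1: "\<And>xs. xs \<noteq> [] \<Longrightarrow> over A xs \<Longrightarrow>
      gerst R A A (-1) \<mu> \<mu> (length xs) (tensor R (susp A) xs) =
      (if 2 \<le> length xs then ev R (susp A) h (tl xs) \<odot>\<^bsub>A\<^esub> hd xs \<ominus>\<^bsub>A\<^esub> ev R (susp A) h (butlast xs) \<odot>\<^bsub>A\<^esub> last xs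
       else \<zero>\<^bsub>A\<^esub>)"
    and rel2: "\<And>xs. xs \<noteq> [] \<Longrightarrow> over A xs \<Longrightarrow>
      gerst R A (ground R) (-1) h \<mu> (length xs) (tensor R (susp A) xs) = \<zero>\<^bsub>R\<^esub>"
  shows "curved_dg_coalgebra R \<lparr>space = Tco R (susp A), comult = tco_comult R (susp A),
    codiff = Phi_inv R A (-1) \<mu>, curv = neg_desusp R A h\<rparr>"
proof -
  let ?V = "susp A" and ?T = "Tco R (susp A)" and ?\<Delta> = "tco_comult R (susp A)"
  let ?d = "Phi_inv R A (-1) \<mu>" and ?\<xi> = "neg_desusp R A h" and ?w = "word R (susp A)"
  note gV = graded_module_susp[OF A]
  note mV = graded_moduleD(1)[OF gV] and mA = graded_moduleD(1)[OF A]
  note gT = graded_module_Tco[OF gV]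
  note tm = graded_moduleD(1)[OF gT] and \<Delta> = tco_comult_linear[OF mV]
  interpret A: module R A by (rule mA)
  interpret T: module R ?T by (rule tm)
  interpret T1: module R "tpow R ?V 1" by (rule module_tpow[OF mV])
  have dl: "?d \<in> lin R ?T ?T" and dg: "?d \<in> graded_hom R ?T ?T (-1)"
    and dt: "tcoder R ?T ?\<Delta> ?T ?\<Delta> (\<lambda>x. x) (koszul ?T (-1)) ?d"
    using Phi_inv_linear[OF A, of \<mu>] Phi_inv_graded[OF A, of \<mu>] Phi_inv_tcoder[OF A, of \<mu>] \<mu> by auto
  have \<xi>l: "?\<xi> \<in> lin R ?T (ground R)" and \<xi>g: "?\<xi> \<in> graded_hom R ?T (ground R) (-2)"
    using neg_desusp[OF R A, of h "- 1"] h by auto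
  have \<xi>w: "?\<xi> (?w us) = \<ominus>\<^bsub>R\<^esub> ev R ?V h us" "ev R ?V h us \<in> carrier R"
    if "us \<noteq> []" "over A us" for us
  proof -
    show "?\<xi> (?w us) = \<ominus>\<^bsub>R\<^esub> ev R ?V h us" using neg_desusp_word[OF R A, of h "- 1"] h that by auto
    have "h (length us) \<in> tlin R ?V (length us) (ground R)"
      using graded_homD(1)[OF h, of "length us"] that(1) by (simp add: Suc_le_eq)
    from ev_closed[OF A module_ground[OF R], of h, OF this that(2)] show "ev R ?V h us \<in> carrier R" by simp
  qed
  let ?ad = "ad R ?T ?\<Delta> (-2) ?\<xi>"
  have \<mu>_lin: "1 \<le> n \<Longrightarrow> \<mu> n \<in> tlin R ?V n A" for n using graded_homD(1)[OF \<mu>] by simp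
  have h_lin: "1 \<le> n \<Longrightarrow> h n \<in> tlin R ?V n (ground R)" for n using graded_homD(1)[OF h] by simp
  note adl = ad_linear[OF gV \<xi>l, of "- 2"]
  have "?d (?d t) = ?ad t" if t: "t \<in> carrier ?T" for t
  proof -
    let ?E = "\<lambda>t. ?d (?d t) \<ominus>\<^bsub>?T\<^esub> ?ad t"
    have "?E t = \<zero>\<^bsub>?T\<^esub>"
    proof (rule tcoder_zero[OF mV mV lin_id[OF tm] lin_id[OF tm] _ _ t])
      \<comment> \<open>The sign operator of even degree is trivial, which gives ad(\<xi>) the same
        \<kappa> as the square of \<open>d\<close>.\<close>
      have k2: "koszul ?T (-2) x = x" if "x \<in> carrier ?T" for x using koszul_even[OF gT _ that] by simp
      have "tcoder R ?T ?\<Delta> ?T ?\<Delta> (\<lambda>x. x) (\<lambda>x. x) ?ad"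
        by (rule tcoder_cong[OF tm tm \<Delta> \<Delta> ad_tcoder[OF gV \<xi>l] koszul_linear[OF gT]])
          (simp add: k2)
      then show "tcoder R ?T ?\<Delta> ?T ?\<Delta> (\<lambda>x. x) (\<lambda>x. x) ?E"
        by (intro tcoder_minus[OF tm tm \<Delta> \<Delta> lin_id[OF tm] lin_id[OF tm]]
            tcoder_square[OF gT \<Delta> dg dt])
    next
      fix xs assume xs: "xs \<noteq> []" "over ?V xs"
      have xs': "over A xs" using xs(2) by simp
      note w = word_closed[OF mV xs]
      have "?d (?d (?w xs)) 1 = tensor R ?V [tco_lift R ?V ?V \<mu> (?d (?w xs))]"
        by (rule first_eq[OF mV mV dl _ _ lin_closed[OF dl w]])
          (use \<mu>_lin Phi_inv_first[OF A, of \<mu>] \<mu> in auto)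
      also have "tco_lift R ?V ?V \<mu> (?d (?w xs)) = gerst R A ?V (-1) \<mu> \<mu> (length xs) (tensor R ?V xs)"
        by (rule Phi_inv_lift[OF A _ mV _ xs(1) xs']) (use \<mu> \<mu>_lin in auto)
      also have "... = gerst R A A (-1) \<mu> \<mu> (length xs) (tensor R ?V xs)"
        by (simp add: gerstenhaber_def)
      finally have dd: "?d (?d (?w xs)) 1 =
          tensor R ?V [gerst R A A (-1) \<mu> \<mu> (length xs) (tensor R ?V xs)]" .
      \<comment> \<open>The projection to words of length one, that is, the corestriction of the
        identity.\<close>
      let ?\<phi> = "\<lambda>n. if n = 1 then untensor R ?V else (\<lambda>X. \<zero>\<^bsub>A\<^esub>)"
      have \<phi>: "?\<phi> n \<in> tlin R ?V n ?V" for n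
        using untensor(1)[OF mV] lin_zero_map[OF module_tpow[OF mV] mV] by auto
      have ev\<phi>: "ev R ?V ?\<phi> us = (if length us = 1 then hd us else \<zero>\<^bsub>A\<^esub>)" if "over A us" for us
        using that untensor(2)[OF mV] by (auto simp: ev_def length_Suc_conv simp del: One_nat_def)
          (auto simp: length_Suc_conv)
      have F: "?\<xi> (?w us) \<odot>\<^bsub>A\<^esub> ev R ?V ?\<phi> vs = (if length vs = 1 then \<ominus>\<^bsub>A\<^esub> (ev R ?V h us \<odot>\<^bsub>A\<^esub> hd vs) else \<zero>\<^bsub>A\<^esub>)"
        "?\<xi> (?w vs) \<odot>\<^bsub>A\<^esub> ev R ?V ?\<phi> (map (koszul ?V (-2)) us) =
          (if length us = 1 then \<ominus>\<^bsub>A\<^esub> (ev R ?V h vs \<odot>\<^bsub>A\<^esub> hd us) else \<zero>\<^bsub>A\<^esub>)"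
        "\<ominus>\<^bsub>A\<^esub> (ev R ?V h us \<odot>\<^bsub>A\<^esub> hd vs) \<in> carrier A" "\<ominus>\<^bsub>A\<^esub> (ev R ?V h vs \<odot>\<^bsub>A\<^esub> hd us) \<in> carrier A"
        if uv: "(us, vs) \<in> cuts xs" for us vs
      proof -
        note c = cuts_closed[OF uv xs']
        have "hd us \<in> carrier A" "hd vs \<in> carrier A" using c by (cases us; cases vs; auto)+
        moreover have "map (koszul ?V (-2)) us = us" by (rule map_idI) (use c(3) koszul_even[OF gV] in auto)
        ultimately show "?\<xi> (?w us) \<odot>\<^bsub>A\<^esub> ev R ?V ?\<phi> vs = (if length vs = 1 then \<ominus>\<^bsub>A\<^esub> (ev R ?V h us \<odot>\<^bsub>A\<^esub> hd vs) else \<zero>\<^bsub>A\<^esub>)"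
          "?\<xi> (?w vs) \<odot>\<^bsub>A\<^esub> ev R ?V ?\<phi> (map (koszul ?V (-2)) us) =
            (if length us = 1 then \<ominus>\<^bsub>A\<^esub> (ev R ?V h vs \<odot>\<^bsub>A\<^esub> hd us) else \<zero>\<^bsub>A\<^esub>)"
          "\<ominus>\<^bsub>A\<^esub> (ev R ?V h us \<odot>\<^bsub>A\<^esub> hd vs) \<in> carrier A" "\<ominus>\<^bsub>A\<^esub> (ev R ?V h vs \<odot>\<^bsub>A\<^esub> hd us) \<in> carrier A"
          using \<xi>w[OF c(1,3)] \<xi>w[OF c(2,4)] ev\<phi>[OF c(3)] ev\<phi>[OF c(4)] by (simp_all add: A.smult_l_minus)
      qed
      have "?ad (?w xs) 1 = tensor R ?V [tco_lift R ?V ?V ?\<phi> (?ad (?w xs))]"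
      proof (rule first_eq[OF mV mV lin_id[OF tm] \<phi> _ lin_closed[OF adl w]])
        fix us assume us: "us \<noteq> []" "over ?V us"
        have z: "tensor R ?V [\<zero>\<^bsub>A\<^esub>] = \<zero>\<^bsub>tpow R ?V 1\<^esub>"
          by (rule multilinear_zero_entry[OF mV T1.module_axioms tensor_multilinear[OF mV]]) auto
        have us': "over A us" using us(2) by simp
        show "?w us 1 = tensor R ?V [ev R ?V ?\<phi> us]"
          unfolding ev\<phi>[OF us'] using z by (cases us) (auto simp: word_def tco_incl_at[OF mV])
      qed
      also have "tco_lift R ?V ?V ?\<phi> (?ad (?w xs)) =
          finsum A (\<lambda>(us, vs). ?\<xi> (?w us) \<odot>\<^bsub>A\<^esub> ev R ?V ?\<phi> vs) (cuts xs) \<ominus>\<^bsub>A\<^esub>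
          finsum A (\<lambda>(us, vs). ?\<xi> (?w vs) \<odot>\<^bsub>A\<^esub> ev R ?V ?\<phi> (map (koszul ?V (-2)) us)) (cuts xs)"
        using tco_lift_ad[OF gV mV \<xi>l, of ?\<phi>, OF \<phi> xs, of "- 2"] by simp
      also have "finsum A (\<lambda>(us, vs). ?\<xi> (?w us) \<odot>\<^bsub>A\<^esub> ev R ?V ?\<phi> vs) (cuts xs) =
          (if 2 \<le> length xs then \<ominus>\<^bsub>A\<^esub> (ev R ?V h (butlast xs) \<odot>\<^bsub>A\<^esub> last xs) else \<zero>\<^bsub>A\<^esub>)"
        by (rule trans[OF A.M.finsum_cong2[OF F(1)] trans[OF finsum_cuts_single(1)[OF mA,
          where F = "\<lambda>us vs. \<ominus>\<^bsub>A\<^esub> (ev R ?V h us \<odot>\<^bsub>A\<^esub> hd vs)", OF F(3)]]]) (use F(3) in auto)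
      also have "finsum A (\<lambda>(us, vs). ?\<xi> (?w vs) \<odot>\<^bsub>A\<^esub> ev R ?V ?\<phi> (map (koszul ?V (-2)) us)) (cuts xs) =
          (if 2 \<le> length xs then \<ominus>\<^bsub>A\<^esub> (ev R ?V h (tl xs) \<odot>\<^bsub>A\<^esub> hd xs) else \<zero>\<^bsub>A\<^esub>)"
        by (rule trans[OF A.M.finsum_cong2[OF F(2)] trans[OF finsum_cuts_single(2)[OF mA,
          where F = "\<lambda>us vs. \<ominus>\<^bsub>A\<^esub> (ev R ?V h vs \<odot>\<^bsub>A\<^esub> hd us)", OF F(4)]]]) (use F(4) in auto)
      \<comment> \<open>The minus in \<xi> = -s^-1 h exchanges the roles of the two boundary terms,
        which produces their order in \<open>rel1\<close>.\<close>
      also have "(if 2 \<le> length xs then \<ominus>\<^bsub>A\<^esub> (ev R ?V h (butlast xs) \<odot>\<^bsub>A\<^esub> last xs) else \<zero>\<^bsub>A\<^esub>) \<ominus>\<^bsub>A\<^esub>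
          (if 2 \<le> length xs then \<ominus>\<^bsub>A\<^esub> (ev R ?V h (tl xs) \<odot>\<^bsub>A\<^esub> hd xs) else \<zero>\<^bsub>A\<^esub>) =
          gerst R A A (-1) \<mu> \<mu> (length xs) (tensor R ?V xs)"
      proof (cases "2 \<le> length xs")
        case True
        have tl: "tl xs \<noteq> []" "over A (tl xs)" "hd xs \<in> carrier A"
          using True xs' by (cases xs; cases "tl xs"; auto)+
        have bl: "butlast xs \<noteq> []" "over A (butlast xs)" "last xs \<in> carrier A"
          using True xs(1) xs' by (auto simp: butlast_conv_take dest: in_set_takeD)
        show ?thesis
          unfolding rel1[OF xs(1) xs'] using True \<xi>w(2)[OF tl(1,2)] \<xi>w(2)[OF bl(1,2)] tl(3) bl(3)
          by (simp add: a_minus_def A.M.a_comm)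
      qed (simp add: rel1[OF xs(1) xs'] a_minus_def)
      finally have ad1: "?ad (?w xs) 1 = tensor R ?V [gerst R A A (-1) \<mu> \<mu> (length xs) (tensor R ?V xs)]" .
      have p: "(\<lambda>t. t 1) \<in> lin R ?T (tpow R ?V 1)" by (rule Tco_proj[OF mV order_refl])
      have "?E (?w xs) 1 = ?d (?d (?w xs)) 1 \<ominus>\<^bsub>tpow R ?V 1\<^esub> ?ad (?w xs) 1"
        by (rule lin_minus[OF tm T1.module_axioms p]) (use lin_closed[OF dl] lin_closed[OF adl] w in auto)
      also have "... = \<zero>\<^bsub>tpow R ?V 1\<^esub>"
        using lin_closed[OF p lin_closed[OF adl w]] unfolding dd ad1 a_minus_def by (rule T1.M.r_neg)
      finally show "?E (?w xs) 1 = \<zero>\<^bsub>tpow R ?V 1\<^esub>" .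
    qed
    then show ?thesis
      using T.M.minus_eq_zero_iff lin_closed[OF dl lin_closed[OF dl t]] lin_closed[OF adl t] by simp
  qed
  moreover have "?\<xi> (?d t) = \<zero>\<^bsub>R\<^esub>" if t: "t \<in> carrier ?T" for t
  proof -
    have "?\<xi> (?d t) = \<zero>\<^bsub>ground R\<^esub>"
    proof (rule Tco_ext[OF mV module_ground[OF R] lin_comp[OF \<xi>l dl]
          lin_zero_map[OF tm module_ground[OF R]] _ t])
      fix xs assume xs: "xs \<noteq> []" "over ?V xs"
      have xs': "over A xs" using xs(2) by simp
      note w = word_closed[OF mV xs]
      have "tco_lift R ?V (ground R) h (?d (?w xs)) = \<zero>\<^bsub>R\<^esub>"
        using Phi_inv_lift[OF A, of \<mu> "- 1" "ground R" h xs] \<mu> h_lin module_ground[OF R] rel2[OF xs(1) xs'] xs(1) xs'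
        by simp
      then show "?\<xi> (?d (?w xs)) = \<zero>\<^bsub>ground R\<^esub>"
        using neg_desusp_lift(1)[OF R A h lin_closed[OF dl w]] by simp
    qed
    then show ?thesis by simp
  qed
  ultimately show ?thesis
    unfolding curved_dg_coalgebra_def
    using graded_coalgebra_tco[OF gV] \<xi>g coderivation_iff[OF gT \<Delta>] dg dt by simp
qed

section \<open>Morphisms of curved bar constructions\<close>

lemma square_linear:
  fixes V14 :: "('k, 'a, 'x) gmodule_scheme"
  assumes R: "cring R" and V14: "module R V14" and \<alpha>: "\<alpha> \<in> lin R (Tco R V14) (ground R)"
  shows "square R (tco_comult R V14) \<alpha> \<in> lin R (Tco R V14) (ground R)" (is ?A)
    and "xs \<noteq> [] \<Longrightarrow> over V14 xs \<Longrightarrow> square R (tco_comult R V14) \<alpha> (word R V14 xs) =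
      finsum (ground R) (\<lambda>(us, vs). \<alpha> (word R V14 us) \<otimes>\<^bsub>R\<^esub> \<alpha> (word R V14 vs)) (cuts xs)" (is "_ \<Longrightarrow> _ \<Longrightarrow> ?B")
proof -
  let ?T14 = "Tco R V14" and ?G = "ground R"
  note tm14 = module_Tco[OF V14] and mG14 = module_ground[OF R] and \<Delta> = tco_comult_linear[OF V14]
  interpret R: cring R by (rule R)
  interpret G: module R ?G by (rule mG14)
  have \<alpha>c: "x \<in> carrier ?T14 \<Longrightarrow> \<alpha> x \<in> carrier R" for x using lin_closed[OF \<alpha>] by simp
  have b: "(\<lambda>x. \<alpha> x \<otimes>\<^bsub>R\<^esub> \<alpha> y) \<in> lin R ?T14 ?G" "(\<lambda>y. \<alpha> x \<otimes>\<^bsub>R\<^esub> \<alpha> y) \<in> lin R ?T14 ?G"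
    if "x \<in> carrier ?T14" "y \<in> carrier ?T14" for x y
    using lin_scalar_map[OF tm14 mG14 \<alpha>, of "\<alpha> y"] lin_smult_map[OF tm14 mG14 \<alpha>, of "\<alpha> x"] \<alpha>c that by auto
  let ?S = "tensor_lift R ?G (\<lambda>xs. \<alpha> (xs ! 0) \<otimes>\<^bsub>R\<^esub> \<alpha> (xs ! 1))"
  have S: "?S \<in> tlin R ?T14 2 ?G"
    using pair_lift_linear[OF tm14 mG14, of "\<lambda>x y. \<alpha> x \<otimes>\<^bsub>R\<^esub> \<alpha> y"] b by auto
  have val: "?S (tensor R ?T14 [x, y]) = \<alpha> x \<otimes>\<^bsub>R\<^esub> \<alpha> y" if "x \<in> carrier ?T14" "y \<in> carrier ?T14" for x y
    using pair_lift_tensor[OF tm14 mG14, of "\<lambda>x y. \<alpha> x \<otimes>\<^bsub>R\<^esub> \<alpha> y" x y] b that by auto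
  show ?A using lin_comp[OF S \<Delta>] by (simp add: square_def[abs_def])
  show ?B if xs: "xs \<noteq> []" "over V14 xs"
  proof -
    have w: "word R V14 us \<in> carrier ?T14" "word R V14 vs \<in> carrier ?T14" if "(us, vs) \<in> cuts xs" for us vs
      using cuts_closed[OF that xs(2)] word_closed[OF V14] by auto
    show ?thesis unfolding square_def by (rule tco_comult_word_map[OF V14 mG14 S xs]) (simp add: val w del: One_nat_def)
  qed
qed

context
  fixes R :: "'k ring" and A :: "('k, 'a) gmodule" and B :: "('k, 'b) gmodule" and \<mu>A hA \<mu>B hB g a
  assumes R: "cring R" and A: "graded_module R A" and B: "graded_module R B"
    and \<mu>A: "\<And>n. 1 \<le> n \<Longrightarrow> \<mu>A n \<in> graded_hom R (tpow R (susp A) n) (susp A) (-1)"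
    and hA: "\<And>n. 1 \<le> n \<Longrightarrow> hA n \<in> graded_hom R (tpow R (susp A) n) (susp (ground R)) (-1)"
    and \<mu>B: "\<And>n. 1 \<le> n \<Longrightarrow> \<mu>B n \<in> graded_hom R (tpow R (susp B) n) (susp B) (-1)"
    and hB: "\<And>n. 1 \<le> n \<Longrightarrow> hB n \<in> graded_hom R (tpow R (susp B) n) (susp (ground R)) (-1)"
    and g: "\<And>n. 1 \<le> n \<Longrightarrow> g n \<in> graded_hom R (tpow R (susp A) n) (susp B) 0"
    and a: "\<And>n. 1 \<le> n \<Longrightarrow> a n \<in> graded_hom R (tpow R (susp A) n) (susp (ground R)) 0"
begin
private abbreviation (input) "V14 \<equiv> susp A"
private abbreviation (input) "W14 \<equiv> susp B"
private abbreviation (input) "T14 \<equiv> Tco R (susp A)"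
private abbreviation (input) "U14 \<equiv> Tco R (susp B)"
private abbreviation (input) "\<gamma>14 \<equiv> Psi_inv R A B g"
private abbreviation (input) "\<alpha> \<equiv> neg_desusp R A a"
private abbreviation (input) "dA \<equiv> Phi_inv R A (-1) \<mu>A"
private abbreviation (input) "dB \<equiv> Phi_inv R B (-1) \<mu>B"
private abbreviation (input) "w \<equiv> word R (susp A)"
private abbreviation (input) "ad\<alpha> \<equiv> ad R (Tco R (susp A)) (tco_comult R (susp A)) (-1) (neg_desusp R A a)"

private lemmas gV14 = graded_module_susp[OF A]
private lemmas mV14 = graded_moduleD(1)[OF gV14]
private lemmas gW14 = graded_module_susp[OF B]
private lemmas mW14 = graded_moduleD(1)[OF gW14]
private lemmas mB14 = graded_moduleD(1)[OF B]
private lemmas gT14 = graded_module_Tco[OF gV14]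
private lemmas gU14 = graded_module_Tco[OF gW14]
private lemmas mG14 = module_ground[OF R]

interpretation R: cring R by (rule R)
interpretation B: module R B by (rule mB14)
interpretation T14: module R T14 by (rule module_Tco[OF mV14])
interpretation U14: module R U14 by (rule module_Tco[OF mW14])

private lemmas tm14 = T14.module_axioms and um14 = U14.module_axioms

private lemma lin:
  shows \<mu>A_lin: "1 \<le> n \<Longrightarrow> \<mu>A n \<in> tlin R V14 n A"
    and hA_lin: "1 \<le> n \<Longrightarrow> hA n \<in> tlin R V14 n (ground R)"
    and \<mu>B_lin: "1 \<le> n \<Longrightarrow> \<mu>B n \<in> tlin R W14 n B"
    and hB_lin: "1 \<le> n \<Longrightarrow> hB n \<in> tlin R W14 n (ground R)"
    and g_lin14: "1 \<le> n \<Longrightarrow> g n \<in> tlin R V14 n B"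
    and a_lin: "1 \<le> n \<Longrightarrow> a n \<in> tlin R V14 n (ground R)"
  using graded_homD(1)[OF \<mu>A] graded_homD(1)[OF hA] graded_homD(1)[OF \<mu>B] graded_homD(1)[OF hB]
    graded_homD(1)[OF g] graded_homD(1)[OF a] by auto

private lemma g_closed: "us \<noteq> [] \<Longrightarrow> over A us \<Longrightarrow> ev R V14 g us \<in> carrier B"
  by (rule ev_closed[OF A mB14]) (auto intro: g_lin14 simp: Suc_le_eq)

private lemma a_closed: "us \<noteq> [] \<Longrightarrow> over A us \<Longrightarrow> ev R V14 a us \<in> carrier R"
  using ev_closed[OF A mG14, of a us] a_lin[of "length us"] by (simp add: Suc_le_eq)

private lemma K_closed14: "us \<noteq> [] \<Longrightarrow> over A us \<Longrightarrow> koszul B 1 (ev R V14 g us) \<in> carrier B"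
  by (rule koszul_closed[OF B g_closed])

private lemma \<alpha>: "\<alpha> \<in> lin R T14 (ground R)" "\<alpha> \<in> graded_hom R T14 (ground R) (-1)"
  "us \<noteq> [] \<Longrightarrow> over A us \<Longrightarrow> \<alpha> (w us) = \<ominus>\<^bsub>R\<^esub> ev R V14 a us"
  using neg_desusp[OF R A, of a 0] a by auto

private lemma \<gamma>14: "\<gamma>14 \<in> lin R T14 U14" "\<gamma>14 \<in> graded_hom R T14 U14 0"
  "t \<in> carrier T14 \<Longrightarrow> tco_comult R W14 (\<gamma>14 t) = tensor2 R T14 U14 \<gamma>14 \<gamma>14 (tco_comult R V14 t)"
  "us \<noteq> [] \<Longrightarrow> over A us \<Longrightarrow> \<gamma>14 (w us) 1 = tensor R W14 [ev R V14 g us]"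
  using Psi_inv_linear[OF A B, of g] Psi_inv_graded[OF A B, of g] Psi_inv_comult[OF A B, of g]
    Psi_inv_first[OF A B, of g] g by auto

private lemma d_lin: "dA \<in> lin R T14 T14" "dB \<in> lin R U14 U14"
  using Phi_inv_linear[OF A, of \<mu>A] Phi_inv_linear[OF B, of \<mu>B] \<mu>A \<mu>B by auto

private lemma one: "(\<lambda>x. tensor R W14 [x]) \<in> lin R W14 (tpow R W14 1)"
  using multilinear_slot[OF tensor_multilinear[OF mW14], of 1 "[]" "[]"] by simp

private lemma tensor_one_eq: "x \<in> carrier B \<Longrightarrow> y \<in> carrier B \<Longrightarrow> tensor R W14 [x] = tensor R W14 [y] \<longleftrightarrow> x = y"
  using untensor(2)[OF mW14] by (metis susp_simps(1))

text \<open>As \<alpha> = -s^-1 a, the left half of ad contributes with a minus. In the right half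
  this minus meets the one from \<open>koszul_ev\<close>, and the result is then subtracted. So both
  halves enter negatively.\<close>

private lemma firsts:
  assumes xs: "xs \<noteq> []" "over A xs"
  shows "dB (\<gamma>14 (w xs)) 1 = tensor R W14 [star R A B B \<mu>B g (length xs) (tensor R V14 xs)]"
    and "\<gamma>14 (dA (w xs)) 1 = tensor R W14 [gerst R A B (-1) g \<mu>A (length xs) (tensor R V14 xs)]"
    and "\<gamma>14 (ad\<alpha> (w xs)) 1 = tensor R W14 [\<ominus>\<^bsub>B\<^esub>
      (finsum B (\<lambda>(us, vs). ev R V14 a vs \<odot>\<^bsub>B\<^esub> koszul B 1 (ev R V14 g us)) (cuts xs) \<oplus>\<^bsub>B\<^esub>
       finsum B (\<lambda>(us, vs). ev R V14 a us \<odot>\<^bsub>B\<^esub> ev R V14 g vs) (cuts xs))]"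
proof -
  have xs': "over V14 xs" using xs by simp
  note wx = word_closed[OF mV14 xs(1) xs']
  have "dB (\<gamma>14 (w xs)) 1 = tensor R W14 [tco_lift R W14 W14 \<mu>B (\<gamma>14 (w xs))]"
    by (rule first_eq[OF mW14 mW14 d_lin(2) _ _ lin_closed[OF \<gamma>14(1) wx]])
      (use \<mu>B_lin Phi_inv_first[OF B, of \<mu>B] \<mu>B in auto)
  also have "tco_lift R W14 W14 \<mu>B (\<gamma>14 (w xs)) = star R A B W14 \<mu>B g (length xs) (tensor R V14 xs)"
    by (rule Psi_inv_lift[OF A B _ mW14 _ xs]) (use g \<mu>B_lin in auto)
  also have "... = star R A B B \<mu>B g (length xs) (tensor R V14 xs)" by (simp add: star_def)
  finally show "dB (\<gamma>14 (w xs)) 1 = tensor R W14 [star R A B B \<mu>B g (length xs) (tensor R V14 xs)]" .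
  have first_\<gamma>: "\<gamma>14 t 1 = tensor R W14 [tco_lift R V14 W14 g t]" if "t \<in> carrier T14" for t
    by (rule first_eq[OF mV14 mW14 \<gamma>14(1) _ _ that]) (use g_lin14 \<gamma>14(4) in auto)
  have "\<gamma>14 (dA (w xs)) 1 = tensor R W14 [tco_lift R V14 W14 g (dA (w xs))]"
    by (rule first_\<gamma>[OF lin_closed[OF d_lin(1) wx]])
  also have "tco_lift R V14 W14 g (dA (w xs)) = gerst R A W14 (-1) g \<mu>A (length xs) (tensor R V14 xs)"
    by (rule Phi_inv_lift[OF A _ mW14 _ xs]) (use \<mu>A g_lin14 in auto)
  also have "... = gerst R A B (-1) g \<mu>A (length xs) (tensor R V14 xs)" by (simp add: gerstenhaber_def)
  finally show "\<gamma>14 (dA (w xs)) 1 = tensor R W14 [gerst R A B (-1) g \<mu>A (length xs) (tensor R V14 xs)]" .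
  let ?X = "finsum B (\<lambda>(us, vs). ev R V14 a vs \<odot>\<^bsub>B\<^esub> koszul B 1 (ev R V14 g us)) (cuts xs)"
  let ?Y = "finsum B (\<lambda>(us, vs). ev R V14 a us \<odot>\<^bsub>B\<^esub> ev R V14 g vs) (cuts xs)"
  have cl: "ev R V14 a vs \<odot>\<^bsub>B\<^esub> koszul B 1 (ev R V14 g us) \<in> carrier B" "ev R V14 a us \<odot>\<^bsub>B\<^esub> ev R V14 g vs \<in> carrier B"
    if "(us, vs) \<in> cuts xs" for us vs
    using cuts_closed[OF that xs(2)] by (auto intro!: B.smult_closed a_closed g_closed K_closed14)
  have XY: "?X \<in> carrier B" "?Y \<in> carrier B" using cl by (auto intro!: B.M.finsum_closed)
  have "\<gamma>14 (ad\<alpha> (w xs)) 1 = tensor R W14 [tco_lift R V14 W14 g (ad\<alpha> (w xs))]"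
    by (rule first_\<gamma>[OF lin_closed[OF ad_linear[OF gV14 \<alpha>(1)] wx]])
  also have "tco_lift R V14 W14 g (ad\<alpha> (w xs)) =
      finsum B (\<lambda>(us, vs). \<alpha> (w us) \<odot>\<^bsub>B\<^esub> ev R V14 g vs) (cuts xs) \<ominus>\<^bsub>B\<^esub>
      finsum B (\<lambda>(us, vs). \<alpha> (w vs) \<odot>\<^bsub>B\<^esub> ev R V14 g (map (koszul V14 (-1)) us)) (cuts xs)"
    using tco_lift_ad[OF gV14 mW14 \<alpha>(1), of g, OF _ xs(1) xs', of "- 1"] g_lin14 by simp
  also have "finsum B (\<lambda>(us, vs). \<alpha> (w us) \<odot>\<^bsub>B\<^esub> ev R V14 g vs) (cuts xs) =
      finsum B (\<lambda>(us, vs). \<ominus>\<^bsub>B\<^esub> (ev R V14 a us \<odot>\<^bsub>B\<^esub> ev R V14 g vs)) (cuts xs)"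
    by (rule B.M.finsum_cong2)
      (use cuts_closed[OF _ xs(2)] \<alpha>(3) a_closed g_closed in "auto simp: B.smult_l_minus")
  also have "... = \<ominus>\<^bsub>B\<^esub> ?Y"
    using B.M.finsum_neg[of "cuts xs" "\<lambda>(us, vs). ev R V14 a us \<odot>\<^bsub>B\<^esub> ev R V14 g vs"] cl
    by (auto simp: case_prod_unfold)
  also have "finsum B (\<lambda>(us, vs). \<alpha> (w vs) \<odot>\<^bsub>B\<^esub> ev R V14 g (map (koszul V14 (-1)) us)) (cuts xs) = ?X"
  proof (rule B.M.finsum_cong2)
    fix us vs assume uv: "(us, vs) \<in> cuts xs"
    note c = cuts_closed[OF uv xs(2)]
    have k: "ev R V14 g (map (koszul V14 (-1)) us) = \<ominus>\<^bsub>B\<^esub> koszul B 1 (ev R V14 g us)"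
      by (rule koszul_ev[OF A B _ c(1,3)]) (rule g)
    show "\<alpha> (w vs) \<odot>\<^bsub>B\<^esub> ev R V14 g (map (koszul V14 (-1)) us) = ev R V14 a vs \<odot>\<^bsub>B\<^esub> koszul B 1 (ev R V14 g us)"
      unfolding \<alpha>(3)[OF c(2,4)] k
      using a_closed[OF c(2,4)] K_closed14[OF c(1,3)] by (simp add: B.smult_l_minus B.smult_r_minus)
  qed (rule cl)
  also have "\<ominus>\<^bsub>B\<^esub> ?Y \<ominus>\<^bsub>B\<^esub> ?X = \<ominus>\<^bsub>B\<^esub> (?X \<oplus>\<^bsub>B\<^esub> ?Y)"
    using XY by (simp add: a_minus_def B.M.minus_add B.M.a_comm)
  finally show "\<gamma>14 (ad\<alpha> (w xs)) 1 = tensor R W14 [\<ominus>\<^bsub>B\<^esub> (?X \<oplus>\<^bsub>B\<^esub> ?Y)]" .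
qed

text \<open>The difference \<open>?E\<close> of the two sides vanishes once its length 1 part does,
  and on words that part is the one-letter tensor of the left side of the first equation.
  Conversely, a one-letter tensor determines its letter.\<close>

lemma bar_morphism_differential:
  "(\<forall>t \<in> carrier T14. dB (\<gamma>14 t) = \<gamma>14 (dA t) \<oplus>\<^bsub>U14\<^esub> \<gamma>14 (ad\<alpha> t)) \<longleftrightarrow>
   (\<forall>xs. xs \<noteq> [] \<longrightarrow> over A xs \<longrightarrow>
      star R A B B \<mu>B g (length xs) (tensor R V14 xs)
      \<ominus>\<^bsub>B\<^esub> gerst R A B (-1) g \<mu>A (length xs) (tensor R V14 xs)
      \<oplus>\<^bsub>B\<^esub> finsum B (\<lambda>(us, vs). ev R V14 a vs \<odot>\<^bsub>B\<^esub> koszul B 1 (ev R V14 g us)) (cuts xs)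
      \<oplus>\<^bsub>B\<^esub> finsum B (\<lambda>(us, vs). ev R V14 a us \<odot>\<^bsub>B\<^esub> ev R V14 g vs) (cuts xs) = \<zero>\<^bsub>B\<^esub>)"
    (is "?L \<longleftrightarrow> (\<forall>xs. xs \<noteq> [] \<longrightarrow> _ \<longrightarrow> ?S xs \<ominus>\<^bsub>B\<^esub> ?G xs \<oplus>\<^bsub>B\<^esub> ?X xs \<oplus>\<^bsub>B\<^esub> ?Y xs = _)")
proof -
  note adl = ad_linear[OF gV14 \<alpha>(1), of "- 1"]
  note lins = lin_comp[OF d_lin(2) \<gamma>14(1)] lin_comp[OF \<gamma>14(1) d_lin(1)] lin_comp[OF \<gamma>14(1) adl]
  interpret U1: module R "tpow R W14 1" by (rule module_tpow[OF mW14])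
  let ?E = "\<lambda>t. dB (\<gamma>14 t) \<ominus>\<^bsub>U14\<^esub> \<gamma>14 (dA t) \<ominus>\<^bsub>U14\<^esub> \<gamma>14 (ad\<alpha> t)"
  note El = lin_minus_map[OF tm14 um14 lin_minus_map[OF tm14 um14 lins(1,2)] lins(3)]
  have E0: "?E t = \<zero>\<^bsub>U14\<^esub> \<longleftrightarrow> dB (\<gamma>14 t) = \<gamma>14 (dA t) \<oplus>\<^bsub>U14\<^esub> \<gamma>14 (ad\<alpha> t)" if t: "t \<in> carrier T14" for t
  proof -
    note c = lin_closed[OF lins(1) t] lin_closed[OF lins(2) t] lin_closed[OF lins(3) t]
    have "?E t = dB (\<gamma>14 t) \<ominus>\<^bsub>U14\<^esub> (\<gamma>14 (dA t) \<oplus>\<^bsub>U14\<^esub> \<gamma>14 (ad\<alpha> t))"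
      using c by (simp add: a_minus_def U14.M.minus_add U14.M.a_assoc)
    then show ?thesis using U14.M.minus_eq_zero_iff c by simp
  qed
  have cl: "?S xs \<in> carrier B" "?G xs \<in> carrier B" "?X xs \<in> carrier B" "?Y xs \<in> carrier B"
    if xs: "xs \<noteq> []" "over A xs" for xs
  proof -
    have t: "tensor R V14 xs \<in> carrier (tpow R V14 (length xs))"
      using xs by (intro tensor_closed[OF mV14]) auto
    have sg: "star R A B B \<mu>B g (length xs) \<in> tlin R V14 (length xs) B"
      "gerst R A B (-1) g \<mu>A (length xs) \<in> tlin R V14 (length xs) B"
      using star_linear[OF A mB14, of g, OF g_lin14 mB14] gerst_linear[OF A mB14, of \<mu>A g "- 1"] \<mu>A_lin \<mu>B_lin g_lin14
      by auto
    show "?S xs \<in> carrier B" "?G xs \<in> carrier B" by (rule lin_closed[OF sg(1) t] lin_closed[OF sg(2) t])+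
    have "ev R V14 a vs \<odot>\<^bsub>B\<^esub> koszul B 1 (ev R V14 g us) \<in> carrier B" "ev R V14 a us \<odot>\<^bsub>B\<^esub> ev R V14 g vs \<in> carrier B"
      if "(us, vs) \<in> cuts xs" for us vs
      using cuts_closed[OF that xs(2)] by (auto intro!: B.smult_closed a_closed g_closed K_closed14)
    then show "?X xs \<in> carrier B" "?Y xs \<in> carrier B" by (auto intro!: B.M.finsum_closed)
  qed
  have E1: "?E (w xs) 1 = tensor R W14 [?S xs \<ominus>\<^bsub>B\<^esub> ?G xs \<oplus>\<^bsub>B\<^esub> ?X xs \<oplus>\<^bsub>B\<^esub> ?Y xs]"
    if xs: "xs \<noteq> []" "over A xs" for xs
  proof -
    have wx: "w xs \<in> carrier T14" using xs by (intro word_closed[OF mV14]) auto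
    note c = lin_closed[OF lins(1) wx] lin_closed[OF lins(2) wx] lin_closed[OF lins(3) wx]
    note p = Tco_proj[OF mW14 order_refl]
    note f = firsts[OF xs] and c' = cl[OF xs]
    have "?E (w xs) 1 = dB (\<gamma>14 (w xs)) 1 \<ominus>\<^bsub>tpow R W14 1\<^esub> \<gamma>14 (dA (w xs)) 1 \<ominus>\<^bsub>tpow R W14 1\<^esub> \<gamma>14 (ad\<alpha> (w xs)) 1"
      using lin_minus[OF um14 U1.module_axioms p] c by (simp del: One_nat_def)
    also have "... = tensor R W14 [?S xs \<ominus>\<^bsub>B\<^esub> ?G xs \<ominus>\<^bsub>B\<^esub> \<ominus>\<^bsub>B\<^esub> (?X xs \<oplus>\<^bsub>B\<^esub> ?Y xs)]"
      unfolding f using lin_minus[OF mW14 U1.module_axioms one] c' by (simp del: One_nat_def)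
    also have "?S xs \<ominus>\<^bsub>B\<^esub> ?G xs \<ominus>\<^bsub>B\<^esub> \<ominus>\<^bsub>B\<^esub> (?X xs \<oplus>\<^bsub>B\<^esub> ?Y xs) = ?S xs \<ominus>\<^bsub>B\<^esub> ?G xs \<oplus>\<^bsub>B\<^esub> ?X xs \<oplus>\<^bsub>B\<^esub> ?Y xs"
      using c' by (simp add: a_minus_def B.M.a_assoc)
    finally show ?thesis .
  qed
  have tz: "tensor R W14 [\<zero>\<^bsub>B\<^esub>] = \<zero>\<^bsub>tpow R W14 1\<^esub>"
    using lin_zero[OF mW14 U1.module_axioms one] by simp
  have uz: "\<zero>\<^bsub>U14\<^esub> 1 = \<zero>\<^bsub>tpow R W14 1\<^esub>" by (simp add: Tco_simps)
  show ?thesis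
  proof (intro iffI allI impI ballI)
    fix xs assume L: ?L and xs: "xs \<noteq> []" "over A xs"
    have wx: "w xs \<in> carrier T14" using xs by (intro word_closed[OF mV14]) auto
    then have "?E (w xs) = \<zero>\<^bsub>U14\<^esub>" using L E0 by blast
    then have "tensor R W14 [?S xs \<ominus>\<^bsub>B\<^esub> ?G xs \<oplus>\<^bsub>B\<^esub> ?X xs \<oplus>\<^bsub>B\<^esub> ?Y xs] = tensor R W14 [\<zero>\<^bsub>B\<^esub>]"
      using E1[OF xs] tz uz by simp
    then show "?S xs \<ominus>\<^bsub>B\<^esub> ?G xs \<oplus>\<^bsub>B\<^esub> ?X xs \<oplus>\<^bsub>B\<^esub> ?Y xs = \<zero>\<^bsub>B\<^esub>"
      using tensor_one_eq cl[OF xs] by simp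
  next
    fix t assume S: "\<forall>xs. xs \<noteq> [] \<longrightarrow> over A xs \<longrightarrow> ?S xs \<ominus>\<^bsub>B\<^esub> ?G xs \<oplus>\<^bsub>B\<^esub> ?X xs \<oplus>\<^bsub>B\<^esub> ?Y xs = \<zero>\<^bsub>B\<^esub>"
      and t: "t \<in> carrier T14"
    let ?\<Delta>V14 = "tco_comult R V14" and ?\<Delta>W14 = "tco_comult R W14"
    note \<Delta>V14 = tco_comult_linear[OF mV14] and \<Delta>W14 = tco_comult_linear[OF mW14]
    note kT = koszul_linear[OF gT14, of "- 1"] and kU = koszul_linear[OF gU14, of "- 1"]
    let ?\<kappa> = "\<lambda>t. \<gamma>14 (koszul T14 (-1) t)"
    note \<kappa> = lin_comp[OF \<gamma>14(1) kT]
    have dBt: "tcoder R U14 ?\<Delta>W14 U14 ?\<Delta>W14 (\<lambda>x. x) (koszul U14 (-1)) dB"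
      and dAt: "tcoder R T14 ?\<Delta>V14 T14 ?\<Delta>V14 (\<lambda>x. x) (koszul T14 (-1)) dA"
      using Phi_inv_tcoder[OF B, of \<mu>B] Phi_inv_tcoder[OF A, of \<mu>A] \<mu>A \<mu>B by auto
    \<comment> \<open>The \<kappa> that comes with this composite is \<open>koszul\<close> after
      \<gamma>; since \<gamma> has degree 0 it equals the \<kappa> of the other two terms,
      \<open>koszul\<close> before \<gamma>.\<close>
    have "tcoder R T14 ?\<Delta>V14 U14 ?\<Delta>W14 \<gamma>14 ?\<kappa> (\<lambda>t. dB (\<gamma>14 t))"
      by (rule tcoder_cong[OF tm14 um14 \<Delta>V14 \<Delta>W14
            tcoder_morphism_left[OF tm14 um14 \<Delta>V14 \<Delta>W14 \<gamma>14(1,3) kU dBt] lin_comp[OF kU \<gamma>14(1)]])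
        (use koszul_commute[OF gT14 gU14 \<gamma>14(2), of _ "- 1"] in auto)
    moreover have "tcoder R T14 ?\<Delta>V14 U14 ?\<Delta>W14 \<gamma>14 ?\<kappa> (\<lambda>t. \<gamma>14 (dA t))"
      by (rule tcoder_morphism_right[OF tm14 um14 \<Delta>V14 \<Delta>W14 \<gamma>14(1,3) kT dAt])
    moreover have "tcoder R T14 ?\<Delta>V14 U14 ?\<Delta>W14 \<gamma>14 ?\<kappa> (\<lambda>t. \<gamma>14 (ad\<alpha> t))"
      by (rule tcoder_morphism_right[OF tm14 um14 \<Delta>V14 \<Delta>W14 \<gamma>14(1,3) kT ad_tcoder[OF gV14 \<alpha>(1)]])
    ultimately have E: "tcoder R T14 ?\<Delta>V14 U14 ?\<Delta>W14 \<gamma>14 ?\<kappa> ?E"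
      by (intro tcoder_minus[OF tm14 um14 \<Delta>V14 \<Delta>W14 \<gamma>14(1) \<kappa>])
    have "?E t = \<zero>\<^bsub>U14\<^esub>"
      by (rule tcoder_zero[OF mV14 mW14 \<gamma>14(1) \<kappa> E _ t]) (use E1 S tz in simp)
    then show "dB (\<gamma>14 t) = \<gamma>14 (dA t) \<oplus>\<^bsub>U14\<^esub> \<gamma>14 (ad\<alpha> t)" using E0[OF t] by simp
  qed
qed

text \<open>Three terms carry the sign of -s^-1 once. In \<alpha>^2 two such signs cancel, but this
  term is subtracted; so all four terms change sign together.\<close>

lemma bar_morphism_curvature:
  "(\<forall>t \<in> carrier T14. neg_desusp R B hB (\<gamma>14 t) \<ominus>\<^bsub>R\<^esub> square R (tco_comult R V14) \<alpha> t =
      \<alpha> (dA t) \<oplus>\<^bsub>R\<^esub> neg_desusp R A hA t) \<longleftrightarrow>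
   (\<forall>xs. xs \<noteq> [] \<longrightarrow> over A xs \<longrightarrow>
      star R A B (ground R) hB g (length xs) (tensor R V14 xs)
      \<ominus>\<^bsub>R\<^esub> gerst R A (ground R) (-1) a \<mu>A (length xs) (tensor R V14 xs)
      \<ominus>\<^bsub>R\<^esub> ev R V14 hA xs
      \<oplus>\<^bsub>R\<^esub> finsum (ground R) (\<lambda>(us, vs). ev R V14 a us \<otimes>\<^bsub>R\<^esub> ev R V14 a vs) (cuts xs) = \<zero>\<^bsub>R\<^esub>)"
    (is "?L \<longleftrightarrow> (\<forall>xs. xs \<noteq> [] \<longrightarrow> _ \<longrightarrow> ?S xs \<ominus>\<^bsub>R\<^esub> ?G xs \<ominus>\<^bsub>R\<^esub> ?H xs \<oplus>\<^bsub>R\<^esub> ?Q xs = _)")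
proof -
  interpret G: module R "ground R" by (rule mG14)
  let ?\<xi>B = "neg_desusp R B hB" and ?\<xi>A = "neg_desusp R A hA" and ?q = "square R (tco_comult R V14) \<alpha>"
  have \<xi>: "?\<xi>B \<in> lin R U14 (ground R)" "?\<xi>A \<in> lin R T14 (ground R)"
    "us \<noteq> [] \<Longrightarrow> over A us \<Longrightarrow> ?\<xi>A (w us) = \<ominus>\<^bsub>R\<^esub> ?H us" for us
    using neg_desusp[OF R B, of hB "- 1"] neg_desusp[OF R A, of hA "- 1"] hA hB by auto
  note q = square_linear[OF R mV14 \<alpha>(1)]
  have words: "?\<xi>B (\<gamma>14 (w xs)) = \<ominus>\<^bsub>R\<^esub> ?S xs" "\<alpha> (dA (w xs)) = \<ominus>\<^bsub>R\<^esub> ?G xs" "?q (w xs) = ?Q xs"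
    "?\<xi>A (w xs) = \<ominus>\<^bsub>R\<^esub> ?H xs"
    "?S xs \<in> carrier R" "?G xs \<in> carrier R" "?Q xs \<in> carrier R" "?H xs \<in> carrier R"
    if xs: "xs \<noteq> []" "over A xs" for xs
  proof -
    have xs': "over V14 xs" using xs(2) by simp
    have wx: "w xs \<in> carrier T14" by (rule word_closed[OF mV14 xs(1) xs'])
    have 1: "tco_lift R W14 (ground R) hB (\<gamma>14 (w xs)) = ?S xs"
      by (rule Psi_inv_lift[OF A B _ mG14 _ xs]) (use g hB_lin in auto)
    have 2: "tco_lift R V14 (ground R) a (dA (w xs)) = ?G xs"
      by (rule Phi_inv_lift[OF A _ mG14 _ xs]) (use \<mu>A a_lin in auto)
    note n1 = neg_desusp_lift[OF R B hB lin_closed[OF \<gamma>14(1) wx]] and n2 = neg_desusp_lift[OF R A a lin_closed[OF d_lin(1) wx]]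
    show "?\<xi>B (\<gamma>14 (w xs)) = \<ominus>\<^bsub>R\<^esub> ?S xs" "\<alpha> (dA (w xs)) = \<ominus>\<^bsub>R\<^esub> ?G xs"
      using n1(1) n2(1) 1 2 by simp_all
    show "?S xs \<in> carrier R" "?G xs \<in> carrier R"
      using n1(2) n2(2) 1 2 by simp_all
    show "?\<xi>A (w xs) = \<ominus>\<^bsub>R\<^esub> ?H xs" by (rule \<xi>(3)[OF xs])
    show "?H xs \<in> carrier R"
      using ev_closed[OF A mG14, of hA xs] hA_lin[of "length xs"] xs by (simp add: Suc_le_eq)
    show "?q (w xs) = ?Q xs"
      unfolding q(2)[OF xs(1) xs']
    proof (rule G.M.finsum_cong2)
      fix us vs assume uv: "(us, vs) \<in> cuts xs"
      note c = cuts_closed[OF uv xs(2)]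
      show "\<alpha> (w us) \<otimes>\<^bsub>R\<^esub> \<alpha> (w vs) = ev R V14 a us \<otimes>\<^bsub>R\<^esub> ev R V14 a vs"
        unfolding \<alpha>(3)[OF c(1,3)] \<alpha>(3)[OF c(2,4)] using a_closed[OF c(1,3)] a_closed[OF c(2,4)]
        by (simp add: R.l_minus R.r_minus)
      show "ev R V14 a us \<otimes>\<^bsub>R\<^esub> ev R V14 a vs \<in> carrier (ground R)" using a_closed[OF c(1,3)] a_closed[OF c(2,4)] by simp
    qed
    then show "?Q xs \<in> carrier R" using lin_closed[OF q(1) wx] by simp
  qed
  have word_iff: "?\<xi>B (\<gamma>14 (w xs)) \<ominus>\<^bsub>R\<^esub> ?q (w xs) = \<alpha> (dA (w xs)) \<oplus>\<^bsub>R\<^esub> ?\<xi>A (w xs) \<longleftrightarrow>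
      ?S xs \<ominus>\<^bsub>R\<^esub> ?G xs \<ominus>\<^bsub>R\<^esub> ?H xs \<oplus>\<^bsub>R\<^esub> ?Q xs = \<zero>\<^bsub>R\<^esub>"
    if xs: "xs \<noteq> []" "over A xs" for xs
  proof -
    note c = words(5-8)[OF xs]
    have "?S xs \<ominus>\<^bsub>R\<^esub> ?G xs \<ominus>\<^bsub>R\<^esub> ?H xs \<oplus>\<^bsub>R\<^esub> ?Q xs =
        (\<ominus>\<^bsub>R\<^esub> ?G xs \<oplus>\<^bsub>R\<^esub> \<ominus>\<^bsub>R\<^esub> ?H xs) \<ominus>\<^bsub>R\<^esub> (\<ominus>\<^bsub>R\<^esub> ?S xs \<ominus>\<^bsub>R\<^esub> ?Q xs)"
      using c by (simp add: a_minus_def R.minus_add R.a_ac)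
    then show ?thesis
      unfolding words(1-4)[OF xs] using c R.minus_eq_zero_iff[of "\<ominus>\<^bsub>R\<^esub> ?G xs \<oplus>\<^bsub>R\<^esub> \<ominus>\<^bsub>R\<^esub> ?H xs" "\<ominus>\<^bsub>R\<^esub> ?S xs \<ominus>\<^bsub>R\<^esub> ?Q xs"]
      by (auto simp: eq_commute)
  qed
  show ?thesis
  proof (intro iffI allI impI ballI)
    fix xs assume L: ?L and xs: "xs \<noteq> []" "over A xs"
    have "w xs \<in> carrier T14" using xs by (intro word_closed[OF mV14]) auto
    then show "?S xs \<ominus>\<^bsub>R\<^esub> ?G xs \<ominus>\<^bsub>R\<^esub> ?H xs \<oplus>\<^bsub>R\<^esub> ?Q xs = \<zero>\<^bsub>R\<^esub>" using L word_iff[OF xs] by blast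
  next
    fix t assume S: "\<forall>xs. xs \<noteq> [] \<longrightarrow> over A xs \<longrightarrow> ?S xs \<ominus>\<^bsub>R\<^esub> ?G xs \<ominus>\<^bsub>R\<^esub> ?H xs \<oplus>\<^bsub>R\<^esub> ?Q xs = \<zero>\<^bsub>R\<^esub>"
      and t: "t \<in> carrier T14"
    \<comment> \<open>Inverses in \<open>ground R\<close> and in \<open>R\<close> are taken in
      different records and are identified on the carrier.\<close>
    have m: "x \<ominus>\<^bsub>ground R\<^esub> y = x \<ominus>\<^bsub>R\<^esub> y" if "y \<in> carrier R" for x y
      using a_inv_ground[OF R that] by (simp add: a_minus_def)
    have "?\<xi>B (\<gamma>14 t) \<ominus>\<^bsub>ground R\<^esub> ?q t = \<alpha> (dA t) \<oplus>\<^bsub>ground R\<^esub> ?\<xi>A t"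
    proof (rule Tco_ext[OF mV14 mG14 lin_minus_map[OF tm14 mG14 lin_comp[OF \<xi>(1) \<gamma>14(1)] q(1)]
          lin_add_map[OF tm14 mG14 lin_comp[OF \<alpha>(1) d_lin(1)] \<xi>(2)] _ t])
      fix xs assume xs: "xs \<noteq> []" "over V14 xs"
      then have xs': "over A xs" by simp
      show "?\<xi>B (\<gamma>14 (w xs)) \<ominus>\<^bsub>ground R\<^esub> ?q (w xs) = \<alpha> (dA (w xs)) \<oplus>\<^bsub>ground R\<^esub> ?\<xi>A (w xs)"
        using S word_iff[OF xs(1) xs'] xs(1) xs' m words(3,7)[OF xs(1) xs'] by simp
    qed
    then show "?\<xi>B (\<gamma>14 t) \<ominus>\<^bsub>R\<^esub> ?q t = \<alpha> (dA t) \<oplus>\<^bsub>R\<^esub> ?\<xi>A t"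
      using m lin_closed[OF q(1) t] by simp
  qed
qed

end

section \<open>Split units\<close>

lemma reduced_simps [simp]:
  "carrier (reduced R A) = {x \<in> carrier A. splitting A x = \<zero>\<^bsub>R\<^esub>}" "add (reduced R A) = add A"
  "zero (reduced R A) = zero A" "smult (reduced R A) = smult A"
  "grade (reduced R A) i = {x \<in> grade A i. splitting A x = \<zero>\<^bsub>R\<^esub>}"
  by (simp_all add: reduced_def)

section \<open>The reduced module as a graded complement of the unit\<close>

context
  fixes R :: "'k ring" and A :: "('k, 'a) split_gmodule"
  assumes split: "split_element R A"
begin
private lemma gA15: "graded_module R A" using split by (simp add: split_element_def)
private lemmas mA15 = graded_moduleD(1)[OF gA15]

interpretation A: module R A by (rule mA15)

private lemma mG15: "module R (ground R)" by (rule module_ground) (rule A.R.is_cring)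

lemma split_elementD:
  shows unt_closed: "unt A \<in> carrier A" and unt_grade: "unt A \<in> grade A 0"
    and splitting_linear: "splitting A \<in> lin R A (ground R)"
    and splitting_unt: "splitting A (unt A) = \<one>\<^bsub>R\<^esub>"
    and splitting_closed: "x \<in> carrier A \<Longrightarrow> splitting A x \<in> carrier R"
    and splitting_grade: "x \<in> grade A i \<Longrightarrow> i \<noteq> 0 \<Longrightarrow> splitting A x = \<zero>\<^bsub>R\<^esub>"
proof -
  show u: "unt A \<in> grade A 0" using split by (simp add: split_element_def)
  then show "unt A \<in> carrier A" by (rule grade_closed[OF gA15])
  have g: "splitting A \<in> graded_hom R A (ground R) 0" using split by (simp add: split_element_def)
  then show s: "splitting A \<in> lin R A (ground R)" by (rule graded_homD)
  show "splitting A (unt A) = \<one>\<^bsub>R\<^esub>" using split by (simp add: split_element_def)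
  show "x \<in> carrier A \<Longrightarrow> splitting A x \<in> carrier R" using lin_closed[OF s] by simp
  show "x \<in> grade A i \<Longrightarrow> i \<noteq> 0 \<Longrightarrow> splitting A x = \<zero>\<^bsub>R\<^esub>" using graded_homD(2)[OF g, of x i] by simp
qed

lemma reduced_submodule: "submodule (carrier (reduced R A)) R A"
  using submodule_equalizer[OF mA15 mG15 splitting_linear lin_zero_map[OF mA15 mG15]] by simp

lemma module_reduced: "module R (reduced R A)"
  by (rule module_transfer[OF submodule.submodule_is_module[OF reduced_submodule mA15]]) auto

lemma reduced_incl: "(\<lambda>x. x) \<in> lin R (reduced R A) A"
  by (rule lin_mapsI) auto

text \<open>The inverse in the reduced record is taken inside its own carrier; there it agrees with
  that of \<open>A\<close> because the inclusion is linear.\<close>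

lemma a_inv_reduced: "x \<in> carrier (reduced R A) \<Longrightarrow> a_inv (reduced R A) x = \<ominus>\<^bsub>A\<^esub> x"
  using lin_neg[OF module_reduced mA15 reduced_incl] by simp

lemma a_minus_reduced: "y \<in> carrier (reduced R A) \<Longrightarrow> a_minus (reduced R A) x y = x \<ominus>\<^bsub>A\<^esub> y"
  by (simp add: a_minus_def a_inv_reduced)

lemma finsum_reduced: "(\<And>i. i \<in> I \<Longrightarrow> f i \<in> carrier (reduced R A)) \<Longrightarrow> finsum (reduced R A) f I = finsum A f I"
  using lin_finsum[OF module_reduced mA15 reduced_incl, of I f] by simp

lemma reduced_grade_submodule: "submodule (grade (reduced R A) i) R (reduced R A)"
proof (rule submoduleI'[OF module_reduced])
  note g = submodule_closed[OF mA15 graded_moduleD(2)[OF gA15]]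
  note r = submodule_closed[OF mA15 reduced_submodule]
  show "grade (reduced R A) i \<subseteq> carrier (reduced R A)" using g(1) by auto
  show "\<zero>\<^bsub>reduced R A\<^esub> \<in> grade (reduced R A) i" using g(2) r(2) by simp
  show "x \<oplus>\<^bsub>reduced R A\<^esub> y \<in> grade (reduced R A) i"
    if "x \<in> grade (reduced R A) i" "y \<in> grade (reduced R A) i" for x y
    using that g(1)[of i] g(3)[of x i y] r(3)[of x y] by auto
  show "c \<odot>\<^bsub>reduced R A\<^esub> x \<in> grade (reduced R A) i"
    if "c \<in> carrier R" "x \<in> grade (reduced R A) i" for x c
    using that g(1)[of i] g(4)[of c x i] r(4)[of c x] by auto
qed

text \<open>The ground module sits in degree 0, so the splitting kills every component of nonzero
  degree. If it kills the element, it therefore kills the component of degree 0 as well, and the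
  decomposition in \<open>A\<close> is one in the reduced module.\<close>

lemma graded_module_reduced: "graded_module R (reduced R A)"
proof (rule graded_moduleI[OF module_reduced reduced_grade_submodule])
  have dec: "decomposition (reduced R A) c x \<Longrightarrow> decomposition A c x" for c x
  proof -
    assume d: "decomposition (reduced R A) c x"
    have "c i \<in> carrier (reduced R A)" for i
      using decomposition_closed(2)[OF module_reduced reduced_grade_submodule d] .
    then have "finsum (reduced R A) c S = finsum A c S" for S by (intro finsum_reduced)
    then show ?thesis using d by (auto simp: decomposition_def)
  qed
  show "c i = \<zero>\<^bsub>reduced R A\<^esub>" if "decomposition (reduced R A) c \<zero>\<^bsub>reduced R A\<^esub>" for c i
    using decomposition_zero[OF gA15] dec[OF that] by simp
  fix H assume H: "submodule H R (reduced R A)" "\<And>i. grade (reduced R A) i \<subseteq> H"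
  show "carrier (reduced R A) \<subseteq> H"
  proof
    fix x assume x: "x \<in> carrier (reduced R A)"
    then obtain c where c: "decomposition A c x" using decomposition_ex[OF gA15] by auto
    \<comment> \<open>0 is adjoined so that the sum of the values of the splitting can be cut down
      to the index 0.\<close>
    let ?S = "{i. c i \<noteq> \<zero>\<^bsub>A\<^esub>} \<union> {0}"
    have S: "finite ?S" using c by (auto simp: decomposition_def)
    note cl = decomposition_closed[OF graded_moduleD[OF gA15] c]
    have nz: "splitting A (c i) = \<zero>\<^bsub>R\<^esub>" if "i \<noteq> 0" for i using splitting_grade[OF cl(1) that] .
    have sum: "x = finsum A c ?S" by (rule decomposition_finsum[OF graded_moduleD[OF gA15] c S]) auto
    have "splitting A x = finsum (ground R) (\<lambda>i. splitting A (c i)) ?S"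
      unfolding sum by (rule lin_finsum[OF mA15 mG15 splitting_linear]) (use cl in auto)
    also have "... = finsum (ground R) (\<lambda>i. splitting A (c i)) {0}"
    proof -
      interpret G: module R "ground R" by (rule mG15)
      show ?thesis by (rule G.M.finsum_subset[OF S]) (use nz splitting_closed[OF cl(2)] in auto)
    qed
    also have "... = splitting A (c 0)"
    proof -
      interpret G: module R "ground R" by (rule mG15)
      show ?thesis using splitting_closed[OF cl(2)] by (simp add: G.M.finsum_insert)
    qed
    finally have z: "splitting A (c i) = \<zero>\<^bsub>R\<^esub>" for i using x nz by (cases "i = 0") auto
    have ci: "c i \<in> grade (reduced R A) i" "c i \<in> carrier (reduced R A)" for i using z cl by auto
    have "x = finsum (reduced R A) c ?S" using sum finsum_reduced[of ?S c] ci(2) by simp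
    also have "... \<in> H" by (rule submodule_finsum[OF module_reduced H(1)]) (use ci(1) H(2) in blast)
    finally show "x \<in> H" .
  qed
qed

lemma koszul_reduced: "x \<in> carrier (reduced R A) \<Longrightarrow> koszul (reduced R A) e x = koszul A e x"
proof -
  assume x: "x \<in> carrier (reduced R A)"
  have "(\<lambda>x. x) \<in> graded_hom R (reduced R A) A 0" using reduced_incl by (auto simp: graded_hom_def)
  from koszul_commute[OF graded_module_reduced gA15 this x, of e] show ?thesis by simp
qed

lemma koszul_susp_reduced: "x \<in> carrier (reduced R A) \<Longrightarrow> koszul (susp (reduced R A)) e x = koszul (susp A) e x"
proof -
  assume x: "x \<in> carrier (reduced R A)"
  have "(\<lambda>x. x) \<in> graded_hom R (susp (reduced R A)) (susp A) 0" using reduced_incl by (auto simp: graded_hom_def)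
  from koszul_commute[OF graded_module_susp[OF graded_module_reduced] graded_module_susp[OF gA15] this, of x e] x
  show ?thesis by simp
qed

lemma unit_map_linear: "unit_map A \<in> lin R (ground R) A"
  by (rule lin_mapsI) (auto simp: unit_map_def unt_closed A.smult_l_distr A.smult_assoc1)

lemma reduction_linear: "reduction A \<in> lin R A (reduced R A)"
proof -
  have lin: "reduction A \<in> lin R A A"
    unfolding reduction_def
    by (intro lin_minus_map[OF mA15 mA15 lin_id[OF mA15]] lin_scalar_map[OF mA15 mA15 splitting_linear unt_closed])
  have "splitting A (reduction A x) = \<zero>\<^bsub>R\<^esub>" if x: "x \<in> carrier A" for x
  proof -
    have "splitting A (reduction A x) = splitting A x \<ominus>\<^bsub>ground R\<^esub> splitting A (splitting A x \<odot>\<^bsub>A\<^esub> unt A)"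
      unfolding reduction_def
      by (rule lin_minus[OF mA15 mG15 splitting_linear x]) (use splitting_closed[OF x] unt_closed in simp)
    also have "splitting A (splitting A x \<odot>\<^bsub>A\<^esub> unt A) = splitting A x"
      using lin_smult[OF splitting_linear splitting_closed[OF x] unt_closed] splitting_closed[OF x]
      by (simp add: splitting_unt)
    also have "splitting A x \<ominus>\<^bsub>ground R\<^esub> splitting A x = \<zero>\<^bsub>R\<^esub>"
      using a_inv_ground[OF A.R.is_cring] splitting_closed[OF x] by (simp add: a_minus_def A.R.r_neg)
    finally show ?thesis .
  qed
  then show ?thesis using lin by (auto simp: linear_maps_def Pi_def)
qed

lemma splitting_sum:
  assumes "b \<in> carrier (reduced R A)" "r \<in> carrier R"
  shows "splitting A (b \<oplus>\<^bsub>A\<^esub> r \<odot>\<^bsub>A\<^esub> unt A) = r" "reduction A (b \<oplus>\<^bsub>A\<^esub> r \<odot>\<^bsub>A\<^esub> unt A) = b"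
proof -
  have b: "b \<in> carrier A" "splitting A b = \<zero>\<^bsub>R\<^esub>" using assms(1) by auto
  have u: "r \<odot>\<^bsub>A\<^esub> unt A \<in> carrier A" using assms(2) unt_closed by simp
  show s: "splitting A (b \<oplus>\<^bsub>A\<^esub> r \<odot>\<^bsub>A\<^esub> unt A) = r"
    using lin_add[OF splitting_linear b(1) u] lin_smult[OF splitting_linear assms(2) unt_closed] b(2) assms(2)
    by (simp add: splitting_unt)
  show "reduction A (b \<oplus>\<^bsub>A\<^esub> r \<odot>\<^bsub>A\<^esub> unt A) = b"
    using b u by (simp add: reduction_def s a_minus_def A.M.a_assoc A.M.r_neg)
qed

lemma reduction_reduced: "b \<in> carrier (reduced R A) \<Longrightarrow> reduction A b = b"
  using unt_closed by (simp add: reduction_def a_minus_def)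

lemma reduction_unit_map:
  assumes "r \<in> carrier R"
  shows "reduction A (r \<odot>\<^bsub>A\<^esub> unt A) = \<zero>\<^bsub>A\<^esub>" "splitting A (r \<odot>\<^bsub>A\<^esub> unt A) = r"
  using splitting_sum[OF submodule_closed(2)[OF mA15 reduced_submodule] assms] assms unt_closed by simp_all

lemma reduction_unt: "reduction A (unt A) = \<zero>\<^bsub>A\<^esub>"
  using reduction_unit_map(1)[of "\<one>\<^bsub>R\<^esub>"] unt_closed by simp

text \<open>\<open>splitting\<close> and \<open>reduction\<close> recover the two summands. This is
  how one equation in the unital module becomes an equation of reduced elements and a scalar
  one.\<close>

lemma split_eq_zero:
  assumes "b \<in> carrier (reduced R A)" "r \<in> carrier R"
  shows "b \<oplus>\<^bsub>A\<^esub> r \<odot>\<^bsub>A\<^esub> unt A = \<zero>\<^bsub>A\<^esub> \<longleftrightarrow> b = \<zero>\<^bsub>A\<^esub> \<and> r = \<zero>\<^bsub>R\<^esub>"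
proof
  assume eq: "b \<oplus>\<^bsub>A\<^esub> r \<odot>\<^bsub>A\<^esub> unt A = \<zero>\<^bsub>A\<^esub>"
  have "\<zero>\<^bsub>A\<^esub> \<in> carrier (reduced R A)" "splitting A \<zero>\<^bsub>A\<^esub> = \<zero>\<^bsub>R\<^esub>"
    using submodule_closed(2)[OF mA15 reduced_submodule] by auto
  then show "b = \<zero>\<^bsub>A\<^esub> \<and> r = \<zero>\<^bsub>R\<^esub>"
    using splitting_sum[OF assms] eq reduction_reduced[of "\<zero>\<^bsub>A\<^esub>"] by simp
qed (use unt_closed in simp)

text \<open>Every x is \<open>reduction A x\<close> plus a multiple of the unit. These generators
  are the ones on which multilinear identities over \<open>A\<close> are tested.\<close>

lemma split_span:
  assumes H: "submodule H R A" and sub: "carrier (reduced R A) \<union> {unt A} \<subseteq> H"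
  shows "carrier A \<subseteq> H"
proof
  fix x assume x: "x \<in> carrier A"
  have r: "reduction A x \<in> carrier (reduced R A)" using lin_closed[OF reduction_linear x] .
  have "reduction A x \<oplus>\<^bsub>A\<^esub> splitting A x \<odot>\<^bsub>A\<^esub> unt A = x"
    using x splitting_closed[OF x] unt_closed by (simp add: reduction_def a_minus_def A.M.a_assoc A.M.l_neg)
  moreover have "reduction A x \<oplus>\<^bsub>A\<^esub> splitting A x \<odot>\<^bsub>A\<^esub> unt A \<in> H"
    using submodule_closed(3,4)[OF mA15 H] sub r splitting_closed[OF x] by blast
  ultimately show "x \<in> H" by simp
qed

lemma koszul_unt: "koszul A 1 (unt A) = unt A" "koszul (susp A) (-1) (unt A) = \<ominus>\<^bsub>A\<^esub> unt A"
  using koszul_homogeneous[OF gA15 unt_grade, of 1] koszul_susp[OF gA15 unt_closed] by simp_all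

lemma extend_cochain_ev:
  assumes xs: "xs \<noteq> []" "over A xs"
  shows "ev R (susp A) (extend_cochain R A f) xs = ev R (susp (reduced R A)) f (map (reduction A) xs)"
proof -
  note gV = graded_module_susp[OF gA15]
  note mV = graded_moduleD(1)[OF gV] and mW = module_susp[OF module_reduced]
  let ?F = "(0, 1, \<lambda>Y. reduction A (untensor R (susp A) Y)) :: ('k, 'a, 'a) factor"
  have "(\<lambda>Y. reduction A (untensor R (susp A) Y)) \<in> tlin R (susp A) 1 (susp (reduced R A))"
    using lin_comp[OF reduction_linear, of "untensor R (susp A)" "tpow R (susp A) 1"] untensor(1)[OF mV]
    by simp
  then have valid: "valid_factors R (susp A) (susp (reduced R A)) (replicate n ?F)" for n
    by (auto simp: valid_factors_def)
  have ar: "arity (replicate n ?F) = n" for n by (simp add: sum_list_replicate)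
  have s0: "sum_list (map fst (replicate n ?F)) = 0" for n by (induction n) auto
  have "apply_factors R (susp A) (replicate (length ys) ?F) ys = map (reduction A) ys" if "over A ys" for ys
    using that
  proof (induction ys)
    case (Cons y ys)
    have "koszul (susp A) 0 y = y" using koszul_even[OF gV, of 0 y] Cons.prems by simp
    then show ?case using Cons s0 untensor(2)[OF mV, of y] by (simp del: map_replicate)
  qed simp
  moreover have "tensor_maps R (susp A) (susp (reduced R A)) (replicate (length xs) ?F) (tensor R (susp A) xs) =
      tensor R (susp (reduced R A)) (apply_factors R (susp A) (replicate (length xs) ?F) xs)"
    by (rule tensor_maps_tensor[OF gV mW valid ar]) (use xs in simp)
  ultimately show ?thesis using xs(2) by (simp add: ev_def extend_cochain_def)
qed

lemma mu_su_linear: "mu_su R A 2 \<in> tlin R (susp A) 2 A"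
  and mu_su_tensor: "x \<in> carrier A \<Longrightarrow> y \<in> carrier A \<Longrightarrow> mu_su R A 2 (tensor R (susp A) [x, y]) =
    splitting A x \<odot>\<^bsub>A\<^esub> y \<oplus>\<^bsub>A\<^esub> splitting A y \<odot>\<^bsub>A\<^esub> koszul A 1 (reduction A x)"
proof -
  let ?b = "\<lambda>x y. splitting A x \<odot>\<^bsub>A\<^esub> y \<oplus>\<^bsub>A\<^esub> splitting A y \<odot>\<^bsub>A\<^esub> koszul A 1 (reduction A x)"
  note mV = module_susp[OF mA15]
  have kr: "(\<lambda>x. koszul A 1 (reduction A x)) \<in> lin R A A"
    using lin_comp[OF koszul_linear[OF gA15] lin_comp[OF reduced_incl reduction_linear]] by simp
  have b: "(\<lambda>x. ?b x y) \<in> lin R A A" "?b x \<in> lin R A A"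
    if "x \<in> carrier A" "y \<in> carrier A" for x y
    using that
    by (auto intro!: lin_add_map[OF mA15 mA15] lin_scalar_map[OF mA15 mA15 splitting_linear]
        lin_smult_map[OF mA15 mA15] lin_id[OF mA15] kr splitting_closed lin_closed[OF kr])
  have eq: "mu_su R A 2 = tensor_lift R A (\<lambda>xs. ?b (xs ! 0) (xs ! 1))" by (simp add: mu_su_def fun_eq_iff)
  show "mu_su R A 2 \<in> tlin R (susp A) 2 A"
    unfolding eq by (rule pair_lift_linear[OF mV mA15, of ?b]) (use b in auto)
  show "x \<in> carrier A \<Longrightarrow> y \<in> carrier A \<Longrightarrow> mu_su R A 2 (tensor R (susp A) [x, y]) = ?b x y"
    unfolding eq by (rule pair_lift_tensor[OF mV mA15, of ?b]) (use b in auto)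
qed

section \<open>Values of a strictly unital structure on words\<close>

context
  fixes \<mu> and h
  assumes \<mu>: "\<And>n. 1 \<le> n \<Longrightarrow> \<mu> n \<in> tlin R (susp (reduced R A)) n (reduced R A)"
    and h: "\<And>n. 1 \<le> n \<Longrightarrow> h n \<in> tlin R (susp (reduced R A)) n (ground R)"
begin
private lemma \<mu>h_ev:
  assumes "xs \<noteq> []" "over (reduced R A) xs"
  shows "ev R (susp (reduced R A)) \<mu> xs \<in> carrier (reduced R A)" "ev R (susp (reduced R A)) h xs \<in> carrier R"
    "\<zero>\<^bsub>A\<^esub> \<in> set xs \<Longrightarrow> ev R (susp (reduced R A)) \<mu> xs = \<zero>\<^bsub>A\<^esub>" "\<zero>\<^bsub>A\<^esub> \<in> set xs \<Longrightarrow> ev R (susp (reduced R A)) h xs = \<zero>\<^bsub>R\<^esub>"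
proof -
  have n: "1 \<le> length xs" using assms(1) by (simp add: Suc_le_eq)
  note gr = graded_module_reduced
  show "ev R (susp (reduced R A)) \<mu> xs \<in> carrier (reduced R A)" by (rule ev_closed[OF gr module_reduced, of \<mu> xs, OF \<mu>[OF n] assms(2)])
  show "ev R (susp (reduced R A)) h xs \<in> carrier R" using ev_closed[OF gr mG15, of h xs, OF h[OF n] assms(2)] by simp
  show "ev R (susp (reduced R A)) \<mu> xs = \<zero>\<^bsub>A\<^esub>" "ev R (susp (reduced R A)) h xs = \<zero>\<^bsub>R\<^esub>" if "\<zero>\<^bsub>A\<^esub> \<in> set xs"
    using multilinear_zero_entry[OF module_reduced module_reduced ev_multilinear[OF gr module_reduced, of \<mu> "length xs", OF \<mu>[OF n]] refl assms(2)]
      multilinear_zero_entry[OF module_reduced mG15 ev_multilinear[OF gr mG15, of h "length xs", OF h[OF n]] refl assms(2)] that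
    by simp_all
qed

lemma reduction_list: "over A xs \<Longrightarrow> over (reduced R A) (map (reduction A) xs)"
  using lin_closed[OF reduction_linear] by auto

lemma su_structure_ev:
  assumes xs: "xs \<noteq> []" "over A xs"
  shows "ev R (susp A) (su_structure R A \<mu> h) xs =
    ev R (susp (reduced R A)) \<mu> (map (reduction A) xs) \<oplus>\<^bsub>A\<^esub>
    ev R (susp (reduced R A)) h (map (reduction A) xs) \<odot>\<^bsub>A\<^esub> unt A \<oplus>\<^bsub>A\<^esub>
    (if length xs = 2 then splitting A (xs ! 0) \<odot>\<^bsub>A\<^esub> (xs ! 1) \<oplus>\<^bsub>A\<^esub>
       splitting A (xs ! 1) \<odot>\<^bsub>A\<^esub> koszul A 1 (reduction A (xs ! 0)) else \<zero>\<^bsub>A\<^esub>)"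
proof -
  have "ev R (susp A) (mu_su R A) xs = (if length xs = 2 then splitting A (xs ! 0) \<odot>\<^bsub>A\<^esub> (xs ! 1) \<oplus>\<^bsub>A\<^esub>
       splitting A (xs ! 1) \<odot>\<^bsub>A\<^esub> koszul A 1 (reduction A (xs ! 0)) else \<zero>\<^bsub>A\<^esub>)"
  proof (cases "length xs = 2")
    case True
    then obtain x y where "xs = [x, y]" by (auto simp: numeral_2_eq_2 length_Suc_conv)
    then show ?thesis using mu_su_tensor xs(2) by (simp add: ev_def numeral_2_eq_2)
  qed (simp add: ev_def mu_su_def)
  moreover have "ev R (susp A) (su_structure R A \<mu> h) xs =
      ev R (susp A) (extend_cochain R A \<mu>) xs \<oplus>\<^bsub>A\<^esub> ev R (susp A) (extend_cochain R A (unital_cochain A h)) xs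
      \<oplus>\<^bsub>A\<^esub> ev R (susp A) (mu_su R A) xs"
    by (simp add: ev_def su_structure_def cochain_add_def)
  ultimately show ?thesis
    using extend_cochain_ev[OF xs, of \<mu>] extend_cochain_ev[OF xs, of "unital_cochain A h"]
    by (simp add: ev_def unital_cochain_def unit_map_def)
qed

text \<open>The splitting vanishes on reduced letters, and with it the contribution of
  \<open>mu_su\<close>.\<close>

lemma su_structure_reduced:
  assumes xs: "xs \<noteq> []" "over (reduced R A) xs"
  shows "ev R (susp A) (su_structure R A \<mu> h) xs =
    ev R (susp (reduced R A)) \<mu> xs \<oplus>\<^bsub>A\<^esub> ev R (susp (reduced R A)) h xs \<odot>\<^bsub>A\<^esub> unt A"
proof -
  have sub: "over A xs" using xs(2) by auto
  have red: "map (reduction A) xs = xs" by (rule map_idI) (use xs(2) reduction_reduced in auto)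
  have "(if length xs = 2 then splitting A (xs ! 0) \<odot>\<^bsub>A\<^esub> (xs ! 1) \<oplus>\<^bsub>A\<^esub>
       splitting A (xs ! 1) \<odot>\<^bsub>A\<^esub> koszul A 1 (reduction A (xs ! 0)) else \<zero>\<^bsub>A\<^esub>) = \<zero>\<^bsub>A\<^esub>"
    using xs(2) koszul_closed[OF gA15] reduction_reduced
    by (auto simp: numeral_2_eq_2 length_Suc_conv)
  then show ?thesis
    unfolding su_structure_ev[OF xs(1) sub] red using \<mu>h_ev(1,2)[OF xs] unt_closed by simp
qed

text \<open>The unit has reduction zero, which kills the parts coming from \<mu> and h and leaves
  \<open>mu_su\<close>.\<close>

lemma su_structure_unt:
  assumes xs: "over A xs" "unt A \<in> set xs"
  shows "length xs \<noteq> 2 \<Longrightarrow> ev R (susp A) (su_structure R A \<mu> h) xs = \<zero>\<^bsub>A\<^esub>"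
    and "xs = [unt A, x] \<Longrightarrow> ev R (susp A) (su_structure R A \<mu> h) xs = x"
    and "xs = [x, unt A] \<Longrightarrow> ev R (susp A) (su_structure R A \<mu> h) xs = koszul A 1 x"
proof -
  have ne: "xs \<noteq> []" using xs(2) by auto
  have "\<zero>\<^bsub>A\<^esub> \<in> set (map (reduction A) xs)" using xs(2) reduction_unt by force
  then have z: "ev R (susp (reduced R A)) \<mu> (map (reduction A) xs) = \<zero>\<^bsub>A\<^esub>"
    "ev R (susp (reduced R A)) h (map (reduction A) xs) = \<zero>\<^bsub>R\<^esub>"
    using \<mu>h_ev(3,4)[of "map (reduction A) xs"] ne reduction_list[OF xs(1)] by auto
  note eq = su_structure_ev[OF ne xs(1), unfolded z]
  show "length xs \<noteq> 2 \<Longrightarrow> ev R (susp A) (su_structure R A \<mu> h) xs = \<zero>\<^bsub>A\<^esub>"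
    unfolding eq using unt_closed by simp
  show "ev R (susp A) (su_structure R A \<mu> h) xs = x" if x: "xs = [unt A, x]"
  proof -
    have "koszul A 1 \<zero>\<^bsub>A\<^esub> = \<zero>\<^bsub>A\<^esub>" by (rule lin_zero[OF mA15 mA15 koszul_linear[OF gA15]])
    then show ?thesis
      unfolding eq using x xs(1) unt_closed splitting_closed by (simp add: reduction_unt splitting_unt)
  qed
  show "ev R (susp A) (su_structure R A \<mu> h) xs = koszul A 1 x" if x: "xs = [x, unt A]"
  proof -
    have xc: "x \<in> carrier A" using x xs(1) by simp
    note k = koszul_linear[OF gA15, of 1] and s = splitting_closed[OF xc]
    \<comment> \<open>The multiple of the unit that \<open>reduction\<close> removes is given back
      by the first term of \<open>mu_su\<close>; the unit has degree 0, so no sign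
      intervenes.\<close>
    have "koszul A 1 (reduction A x) = koszul A 1 x \<ominus>\<^bsub>A\<^esub> splitting A x \<odot>\<^bsub>A\<^esub> unt A"
      unfolding reduction_def
      using lin_minus[OF mA15 mA15 k xc, of "splitting A x \<odot>\<^bsub>A\<^esub> unt A"] lin_smult[OF k s unt_closed] s unt_closed
      by (simp add: koszul_unt)
    then show ?thesis
      unfolding eq using x unt_closed s lin_closed[OF k xc]
      by (simp add: splitting_unt a_minus_def A.M.a_lcomm A.M.r_neg)
  qed
qed

end

end

section \<open>Unital cochains on reduced words\<close>

lemma (in abelian_monoid) finsum_add_cong:
  assumes "\<And>i. i \<in> S \<Longrightarrow> f i = x i \<oplus> y i" "\<And>i. i \<in> S \<Longrightarrow> x i \<in> carrier G" "\<And>i. i \<in> S \<Longrightarrow> y i \<in> carrier G"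
  shows "finsum G f S = finsum G x S \<oplus> finsum G y S"
proof -
  have "finsum G f S = (\<Oplus>i\<in>S. x i \<oplus> y i)" by (rule finsum_cong') (use assms in auto)
  then show ?thesis using assms(2,3) by (simp add: finsum_addf Pi_def)
qed

lemma finsum_unit:
  fixes A :: "('k, 'a) split_gmodule"
  assumes "split_element R A" "\<And>i. i \<in> S \<Longrightarrow> r i \<in> carrier R"
  shows "finsum A (\<lambda>i. r i \<odot>\<^bsub>A\<^esub> unt A) S = finsum (ground R) r S \<odot>\<^bsub>A\<^esub> unt A"
proof -
  have mA16: "module R A" using assms(1) by (auto simp: split_element_def dest: graded_moduleD)
  then have mG16: "module R (ground R)" by (intro module_ground) (simp add: module_def)
  show ?thesis using lin_finsum[OF mG16 mA16 unit_map_linear[OF assms(1)], of S r] assms(2) by (simp add: unit_map_def)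
qed

lemma CC_linear:
  assumes "f \<in> CC R A B d" "1 \<le> n"
  shows "f n \<in> tlin R (susp A) n B"
proof -
  have "f n \<in> graded_hom R (tpow R (susp A) n) (susp B) d" using assms by (simp add: CC_def)
  from graded_homD(1)[OF this] show ?thesis by simp
qed

lemma infixes_closed:
  assumes "(us, ys, vs) \<in> infixes xs" "set xs \<subseteq> S"
  shows "ys \<noteq> []" "set us \<subseteq> S" "set ys \<subseteq> S" "set vs \<subseteq> S"
  using assms by (auto simp: infixes_def)

text \<open>On reduced letters \<open>g_su\<close> vanishes and \<open>reduction\<close>, hence
  \<open>extend_cochain\<close>, changes nothing.\<close>

lemma su_element_ev:
  fixes A :: "('k, 'a) split_gmodule" and B :: "('k, 'b) split_gmodule"
  assumes A: "split_element R A" and B: "split_element R B" and xs: "xs \<noteq> []" "over (reduced R A) xs"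
    and g: "ev R (susp (reduced R A)) g xs \<in> carrier B" and a: "ev R (susp (reduced R A)) a xs \<in> carrier R"
  shows "ev R (susp A) (su_element R A B g a) xs =
    ev R (susp (reduced R A)) g xs \<oplus>\<^bsub>B\<^esub> ev R (susp (reduced R A)) a xs \<odot>\<^bsub>B\<^esub> unt B"
proof -
  have mB16: "module R B" using B by (auto simp: split_element_def dest: graded_moduleD)
  have mA16: "module R A" using A by (auto simp: split_element_def dest: graded_moduleD)
  interpret B: module R B by (rule mB16)
  have sub: "over A xs" using xs(2) by auto
  have red: "map (reduction A) xs = xs" by (rule map_idI) (use xs(2) reduction_reduced[OF A] in auto)
  have "ev R (susp A) (g_su R A B) xs = \<zero>\<^bsub>B\<^esub>"
  proof (cases "length xs = 1")
    case True
    then obtain x where x: "xs = [x]" by (auto simp: length_Suc_conv)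
    then show ?thesis
      using untensor(2)[OF module_susp[OF mA16], of x] xs(2) unt_closed[OF B]
      by (simp add: ev_def g_su_def unit_map_def)
  qed (simp add: ev_def g_su_def)
  moreover have "ev R (susp A) (su_element R A B g a) xs =
      ev R (susp A) (extend_cochain R A (cochain_add B g (unital_cochain B a))) xs \<oplus>\<^bsub>B\<^esub> ev R (susp A) (g_su R A B) xs"
    by (simp add: ev_def su_element_def cochain_add_def)
  ultimately show ?thesis
    using g a unt_closed[OF B]
    by (simp add: extend_cochain_ev[OF A xs(1) sub] red) (simp add: ev_def cochain_add_def unital_cochain_def unit_map_def)
qed

lemma append_Cons_eq_append:
  "ps @ x # qs = us @ ws \<longleftrightarrow>
    (\<exists>zs. us = ps @ x # zs \<and> qs = zs @ ws) \<or> (\<exists>zs. ps = us @ zs \<and> ws = zs @ x # qs)"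
proof (induction ps arbitrary: us)
  case Nil
  then show ?case by (cases us) auto
next
  case (Cons p ps)
  then show ?case by (cases us) auto
qed

text \<open>Locates the block of a segmentation that holds a marked letter: \<open>c\<close> and
  \<open>d\<close> are its neighbours inside the block, \<open>l\<close> and \<open>r\<close> the
  blocks around it.\<close>

lemma concat_eq_append_Cons:
  assumes "concat yss = ps @ x # qs"
  shows "\<exists>l c d r. yss = l @ (c @ x # d) # r \<and> ps = concat l @ c \<and> qs = d @ concat r"
  using assms
proof (induction yss arbitrary: ps)
  case (Cons ys yss)
  have "ps @ x # qs = ys @ concat yss" using Cons.prems by simp
  then consider d where "ys = ps @ x # d" "qs = d @ concat yss" | ps' where "ps = ys @ ps'" "concat yss = ps' @ x # qs"
    unfolding append_Cons_eq_append by metis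
  then show ?case
  proof cases
    case 1
    then have "ys # yss = [] @ (ps @ x # d) # yss \<and> ps = concat [] @ ps \<and> qs = d @ concat yss" by simp
    then show ?thesis by blast
  next
    case (2 ps')
    obtain l c d r where "yss = l @ (c @ x # d) # r" "ps' = concat l @ c" "qs = d @ concat r"
      using Cons.IH[OF 2(2)] by blast
    then have "ys # yss = (ys # l) @ (c @ x # d) # r \<and> ps = concat (ys # l) @ c \<and> qs = d @ concat r"
      using 2(1) by simp
    then show ?thesis by blast
  qed
qed simp

section \<open>Gerstenhaber and star products in the presence of units\<close>

context
  fixes R :: "'k ring" and A :: "('k, 'a) split_gmodule" and B :: "('k, 'b) split_gmodule"
  assumes A: "split_element R A" and B: "split_element R B"
begin
private abbreviation (input) "Ar16 \<equiv> reduced R A"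
private abbreviation (input) "Br16 \<equiv> reduced R B"
private abbreviation (input) "Vr16 \<equiv> susp (reduced R A)"
private abbreviation (input) "Wr \<equiv> susp (reduced R B)"

private lemma gA16: "graded_module R A" and gB16: "graded_module R B" using A B by (auto simp: split_element_def)
private lemmas mA16 = graded_moduleD(1)[OF gA16] and mB16 = graded_moduleD(1)[OF gB16]
  and gAr16 = graded_module_reduced[OF A] and mAr16 = module_reduced[OF A]
  and gBr16 = graded_module_reduced[OF B] and mBr16 = module_reduced[OF B]

interpretation A: module R A by (rule mA16)
interpretation B: module R B by (rule mB16)

private lemmas mG16 = module_ground[OF A.R.is_cring]

context
  fixes \<mu> h f
  assumes \<mu>: "\<And>n. 1 \<le> n \<Longrightarrow> \<mu> n \<in> tlin R Vr16 n Ar16"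
    and h: "\<And>n. 1 \<le> n \<Longrightarrow> h n \<in> tlin R Vr16 n (ground R)"
    and \<nu>: "\<And>n. 1 \<le> n \<Longrightarrow> su_structure R A \<mu> h n \<in> tlin R (susp A) n A"
    and f: "\<And>n. 1 \<le> n \<Longrightarrow> f n \<in> tlin R (susp A) n B"
begin
text \<open>The inner operation returns \<mu>(ys) + h(ys) 1. On the first summand \<open>f\<close>
  splits into \<open>p\<close> and \<open>q\<close>. On the second it is left unevaluated, because
  its value on a word with a unit depends on \<open>f\<close>, which is the structure itself in
  \<open>A_infinity_reduced\<close> and the morphism in \<open>morphism_reduced\<close>.\<close>

lemma gerst_reduced:
  assumes p: "\<And>n. 1 \<le> n \<Longrightarrow> p n \<in> tlin R Vr16 n Br16"
    and q: "\<And>n. 1 \<le> n \<Longrightarrow> q n \<in> tlin R Vr16 n (ground R)"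
    and f_ev: "\<And>xs. xs \<noteq> [] \<Longrightarrow> over Ar16 xs \<Longrightarrow> ev R (susp A) f xs =
      ev R Vr16 p xs \<oplus>\<^bsub>B\<^esub> ev R Vr16 q xs \<odot>\<^bsub>B\<^esub> unt B"
    and xs: "over Ar16 xs"
  shows "gerst R A B (-1) f (su_structure R A \<mu> h) (length xs) (tensor R (susp A) xs) =
    gerst R Ar16 Br16 (-1) p \<mu> (length xs) (tensor R Vr16 xs) \<oplus>\<^bsub>B\<^esub>
    gerst R Ar16 (ground R) (-1) q \<mu> (length xs) (tensor R Vr16 xs) \<odot>\<^bsub>B\<^esub> unt B \<oplus>\<^bsub>B\<^esub>
    finsum B (\<lambda>(us, ys, vs). ev R Vr16 h ys \<odot>\<^bsub>B\<^esub>
      ev R (susp A) f (map (koszul (susp A) (-1)) us @ unt A # vs)) (infixes xs)"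
proof -
  let ?K = "koszul (susp A) (-1)" and ?Kr = "koszul Vr16 (-1)"
  let ?f = "ev R (susp A) f" and ?\<nu> = "ev R (susp A) (su_structure R A \<mu> h)"
  let ?p = "ev R Vr16 p" and ?q = "ev R Vr16 q"
  let ?m = "ev R Vr16 \<mu>" and ?h = "ev R Vr16 h"
  have xsA: "over A xs" using xs by auto
  have cl: "?p zs \<in> carrier Br16" "?q zs \<in> carrier R" "?m zs \<in> carrier Ar16" "?h zs \<in> carrier R"
    if "zs \<noteq> []" "over Ar16 zs" for zs
    using ev_closed[OF gAr16 mBr16, of p zs] ev_closed[OF gAr16 mG16, of q zs] ev_closed[OF gAr16 mAr16, of \<mu> zs]
      ev_closed[OF gAr16 mG16, of h zs] p[of "length zs"] q[of "length zs"] \<mu>[of "length zs"] h[of "length zs"] that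
    by (auto simp: Suc_le_eq)
  have fcl: "?f zs \<in> carrier B" if "zs \<noteq> []" "over A zs" for zs
    using ev_closed[OF gA16 mB16, of f zs] f[of "length zs"] that by (auto simp: Suc_le_eq)
  have val: "?f (map ?K us @ ?\<nu> ys # vs) =
      (?p (map ?Kr us @ ?m ys # vs) \<oplus>\<^bsub>B\<^esub> ?q (map ?Kr us @ ?m ys # vs) \<odot>\<^bsub>B\<^esub> unt B) \<oplus>\<^bsub>B\<^esub>
      ?h ys \<odot>\<^bsub>B\<^esub> ?f (map ?K us @ unt A # vs)"
    "?p (map ?Kr us @ ?m ys # vs) \<in> carrier Br16" "?q (map ?Kr us @ ?m ys # vs) \<in> carrier R"
    "?h ys \<odot>\<^bsub>B\<^esub> ?f (map ?K us @ unt A # vs) \<in> carrier B"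
    if "(us, ys, vs) \<in> infixes xs" for us ys vs
  proof -
    note i = infixes_closed[OF that xs]
    have us: "map ?Kr us = map ?K us" using koszul_susp_reduced[OF A] i(2) by (intro map_cong) auto
    have K: "over Ar16 (map ?Kr us)"
      using koszul_closed[OF graded_module_susp[OF gAr16]] i(2) by (auto simp del: reduced_simps)
    note m = cl(3,4)[OF i(1,3)]
    have z: "over Ar16 (map ?Kr us @ ?m ys # vs)" using K m(1) i(4) by simp
    have KA: "over A (map ?K us)" "over A vs" using K i(4) unfolding us by auto
    show "?p (map ?Kr us @ ?m ys # vs) \<in> carrier Br16" "?q (map ?Kr us @ ?m ys # vs) \<in> carrier R"
      using cl(1,2)[OF _ z] by auto
    have fu: "?f (map ?K us @ unt A # vs) \<in> carrier B" using KA unt_closed[OF A] by (intro fcl) auto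
    then show "?h ys \<odot>\<^bsub>B\<^esub> ?f (map ?K us @ unt A # vs) \<in> carrier B" using m(2) by simp
    have slot: "(\<lambda>x. ?f (map ?K us @ x # vs)) \<in> lin R A B"
      by (rule multilinear_slot[OF ev_multilinear[OF gA16 mB16 f] _ KA]) auto
    have mc: "?m ys \<in> carrier A" "?h ys \<odot>\<^bsub>A\<^esub> unt A \<in> carrier A" using m unt_closed[OF A] by auto
    have su: "?\<nu> ys = ?m ys \<oplus>\<^bsub>A\<^esub> ?h ys \<odot>\<^bsub>A\<^esub> unt A"
      by (rule su_structure_reduced[OF A _ _ i(1,3)]) (rule \<mu> h, assumption)+
    have "?f (map ?K us @ ?\<nu> ys # vs) = ?f (map ?K us @ ?m ys # vs) \<oplus>\<^bsub>B\<^esub> ?h ys \<odot>\<^bsub>B\<^esub> ?f (map ?K us @ unt A # vs)"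
      unfolding su
      by (simp add: lin_add[OF slot mc] lin_smult[OF slot m(2) unt_closed[OF A]])
    then show "?f (map ?K us @ ?\<nu> ys # vs) =
      (?p (map ?Kr us @ ?m ys # vs) \<oplus>\<^bsub>B\<^esub> ?q (map ?Kr us @ ?m ys # vs) \<odot>\<^bsub>B\<^esub> unt B) \<oplus>\<^bsub>B\<^esub>
      ?h ys \<odot>\<^bsub>B\<^esub> ?f (map ?K us @ unt A # vs)"
      using f_ev[OF _ z] by (simp add: us)
  qed
  have qG: "gerst R Ar16 (ground R) (-1) q \<mu> (length xs) (tensor R Vr16 xs) =
      finsum (ground R) (\<lambda>(us, ys, vs). ?q (map ?Kr us @ ?m ys # vs)) (infixes xs)"
    by (rule gerst_tensor[OF gAr16 mG16 \<mu> q xs])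
  have pG: "gerst R Ar16 Br16 (-1) p \<mu> (length xs) (tensor R Vr16 xs) =
      finsum Br16 (\<lambda>(us, ys, vs). ?p (map ?Kr us @ ?m ys # vs)) (infixes xs)"
    by (rule gerst_tensor[OF gAr16 mBr16 \<mu> p xs])
  have "gerst R A B (-1) f (su_structure R A \<mu> h) (length xs) (tensor R (susp A) xs) =
      finsum B (\<lambda>(us, ys, vs). ?f (map ?K us @ ?\<nu> ys # vs)) (infixes xs)"
    by (rule gerst_tensor[OF gA16 mB16 \<nu> f xsA])
  also have "... = finsum B (\<lambda>(us, ys, vs). ?p (map ?Kr us @ ?m ys # vs) \<oplus>\<^bsub>B\<^esub> ?q (map ?Kr us @ ?m ys # vs) \<odot>\<^bsub>B\<^esub> unt B)
      (infixes xs) \<oplus>\<^bsub>B\<^esub> finsum B (\<lambda>(us, ys, vs). ?h ys \<odot>\<^bsub>B\<^esub> ?f (map ?K us @ unt A # vs)) (infixes xs)"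
    by (rule B.M.finsum_add_cong) (use val unt_closed[OF B] in auto)
  also have "finsum B (\<lambda>(us, ys, vs). ?p (map ?Kr us @ ?m ys # vs) \<oplus>\<^bsub>B\<^esub> ?q (map ?Kr us @ ?m ys # vs) \<odot>\<^bsub>B\<^esub> unt B)
      (infixes xs) = finsum B (\<lambda>(us, ys, vs). ?p (map ?Kr us @ ?m ys # vs)) (infixes xs) \<oplus>\<^bsub>B\<^esub>
      finsum B (\<lambda>t. (case t of (us, ys, vs) \<Rightarrow> ?q (map ?Kr us @ ?m ys # vs)) \<odot>\<^bsub>B\<^esub> unt B) (infixes xs)"
    by (rule B.M.finsum_add_cong) (use val unt_closed[OF B] in auto)
  also have "finsum B (\<lambda>t. (case t of (us, ys, vs) \<Rightarrow> ?q (map ?Kr us @ ?m ys # vs)) \<odot>\<^bsub>B\<^esub> unt B) (infixes xs) =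
      gerst R Ar16 (ground R) (-1) q \<mu> (length xs) (tensor R Vr16 xs) \<odot>\<^bsub>B\<^esub> unt B"
    unfolding qG by (rule finsum_unit[OF B]) (use val in auto)
  also have "finsum B (\<lambda>(us, ys, vs). ?p (map ?Kr us @ ?m ys # vs)) (infixes xs) =
      gerst R Ar16 Br16 (-1) p \<mu> (length xs) (tensor R Vr16 xs)"
    unfolding pG by (rule finsum_reduced[OF B, symmetric]) (use val in auto)
  finally show ?thesis .
qed

text \<open>The unit survives only if the inner operation consumes it together with one neighbour.
  The resulting value is the one in \<open>star_unt\<close>, so the morphism equation holds on words
  with a unit.\<close>

lemma gerst_unt:
  assumes fg: "\<And>n. 1 \<le> n \<Longrightarrow> f n \<in> graded_hom R (tpow R (susp A) n) (susp B) 0"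
    and f_unt: "\<And>xs. 2 \<le> length xs \<Longrightarrow> over A xs \<Longrightarrow> unt A \<in> set xs \<Longrightarrow> ev R (susp A) f xs = \<zero>\<^bsub>B\<^esub>"
    and xs: "over A ps" "over A qs"
  shows "gerst R A B (-1) f (su_structure R A \<mu> h) (length (ps @ unt A # qs)) (tensor R (susp A) (ps @ unt A # qs)) =
    (if ps = [] \<and> qs \<noteq> [] then ev R (susp A) f qs
     else if ps \<noteq> [] \<and> qs = [] then koszul B 1 (ev R (susp A) f ps) else \<zero>\<^bsub>B\<^esub>)"
proof -
  let ?K = "koszul (susp A) (-1)" and ?xs = "ps @ unt A # qs"
  let ?f = "ev R (susp A) f" and ?\<nu> = "ev R (susp A) (su_structure R A \<mu> h)"
  let ?t = "\<lambda>(us, ys, vs). ?f (map ?K us @ ?\<nu> ys # vs)"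
  note u = unt_closed[OF A]
  have K: "?K x \<in> carrier A" if "x \<in> carrier A" for x
    using koszul_closed[OF graded_module_susp[OF gA16], of x "-1"] that by simp
  have Ks: "over A (map ?K zs)" if "over A zs" for zs using K that by auto
  have slot: "(\<lambda>x. ?f (us @ x # vs)) \<in> lin R A B" if "over A us" "over A vs" for us vs
    by (rule multilinear_slot[OF ev_multilinear[OF gA16 mB16 f] _ that]) auto
  have \<nu>_cl: "?\<nu> ys \<in> carrier A" if "ys \<noteq> []" "over A ys" for ys
    by (rule ev_closed[OF gA16 mA16 _ that(2)], rule \<nu>) (use that(1) in "simp add: Suc_le_eq")
  note su = su_structure_unt[OF A, of \<mu> h]
  have xsA: "over A ?xs" using xs u by simp
  \<comment> \<open>The surviving infixes join the unit with its right or its left neighbour. If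
    both exist their terms are opposite, since \<open>koszul A 1\<close> on a letter is minus the
    sign taken in the suspension.\<close>
  let ?l = "if qs = [] then {} else {(ps, [unt A, hd qs], tl qs)}"
  let ?r = "if ps = [] then {} else {(butlast ps, [last ps, unt A], qs)}"
  have zero: "?t t = \<zero>\<^bsub>B\<^esub>" if t: "t \<in> infixes ?xs - (?l \<union> ?r)" for t
  proof -
    obtain us ys vs where t': "t = (us, ys, vs)" by (cases t)
    have i: "(us, ys, vs) \<in> infixes ?xs" using t t' by simp
    note c = infixes_closed[OF i xsA]
    have eq: "ps @ unt A # qs = us @ ys @ vs" using i by (simp add: infixes_def)
    \<comment> \<open>The unit lies in \<open>us\<close>, in \<open>vs\<close> or in
      \<open>ys\<close>. In the first two cases it reaches \<open>f\<close> next to the output of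
      the inner operation, so \<open>f\<close> has at least two arguments and vanishes.\<close>
    consider zs where "us = ps @ unt A # zs" | zs where "ps = us @ zs" "zs @ unt A # qs = ys @ vs"
      using eq[unfolded append_Cons_eq_append] by metis
    then have "?f (map ?K us @ ?\<nu> ys # vs) = \<zero>\<^bsub>B\<^esub>"
    proof cases
      case 1
      have "?K (unt A) = \<ominus>\<^bsub>A\<^esub> unt A" by (rule koszul_unt[OF A])
      have s: "over A (map ?K ps)" "over A (map ?K zs @ ?\<nu> ys # vs)"
        using Ks[OF xs(1)] Ks[of zs] c \<nu>_cl[OF c(1,3)] 1 by auto
      have "?f (map ?K ps @ unt A # (map ?K zs @ ?\<nu> ys # vs)) = \<zero>\<^bsub>B\<^esub>" by (rule f_unt) (use s u in auto)
      then show ?thesis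
        using lin_neg[OF mA16 mB16 slot[OF s] u] by (simp add: 1 koszul_unt(2)[OF A])
    next
      case (2 zs)
      consider ws where "vs = ws @ unt A # qs" | ws where "ys = zs @ unt A # ws" "qs = ws @ vs"
        using 2(2)[unfolded append_Cons_eq_append] by metis
      then show ?thesis
      proof cases
        case 1
        show ?thesis
          by (rule f_unt) (use 1 Ks[OF c(2)] c(4) \<nu>_cl[OF c(1,3)] in auto)
      next
        case (2 ws)
        \<comment> \<open>An infix of two letters that contains the marked unit is the one in
          \<open>?l\<close> or the one in \<open>?r\<close>, both excluded here.\<close>
        have "length ys \<noteq> 2"
        proof
          assume "length ys = 2"
          then have "(\<exists>z. zs = [z] \<and> ws = []) \<or> (\<exists>w. zs = [] \<and> ws = [w])"
            using 2(1) by (cases zs; cases ws) auto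
          then show False using t \<open>ps = us @ zs\<close> 2 t' by auto
        qed
        then have "?\<nu> ys = \<zero>\<^bsub>A\<^esub>" using su(1)[OF \<mu> h c(3)] 2(1) by simp
        then show ?thesis using lin_zero[OF mA16 mB16 slot[OF Ks[OF c(2)] c(4)]] by simp
      qed
    qed
    then show ?thesis by (simp add: t')
  qed
  have lin_l: "?t (ps, [unt A, hd qs], tl qs) = ?f (map ?K ps @ qs)" if "qs \<noteq> []"
    using su(2)[OF \<mu> h, of "[unt A, hd qs]" "hd qs"] that xs(2) u by (cases qs) auto
  have lin_r: "?t (butlast ps, [last ps, unt A], qs) = \<ominus>\<^bsub>B\<^esub> ?f (map ?K ps @ qs)" if ne: "ps \<noteq> []"
  proof -
    obtain bs b where ps: "ps = bs @ [b]" using ne by (cases ps rule: rev_cases) auto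
    have b: "b \<in> carrier A" "over A bs" using xs(1) ps by auto
    have "?\<nu> [b, unt A] = koszul A 1 b" using su(3)[OF \<mu> h, of "[b, unt A]" b] b u by simp
    also have "... = \<ominus>\<^bsub>A\<^esub> ?K b" using koszul_susp[OF gA16 b(1)] koszul_closed[OF gA16 b(1), of 1] by simp
    finally show ?thesis using lin_neg[OF mA16 mB16 slot[OF Ks[OF b(2)] xs(2)] K[OF b(1)]] by (simp add: ps)
  qed
  have cl: "?f (map ?K ps @ qs) \<in> carrier B" if "ps @ qs \<noteq> []"
  proof (rule ev_closed[OF gA16 mB16])
    show "f (length (map ?K ps @ qs)) \<in> tlin R (susp A) (length (map ?K ps @ qs)) B"
      by (rule f) (use that in "cases ps; cases qs; simp")
  qed (use Ks[OF xs(1)] xs(2) in simp)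
  \<comment> \<open>The sign operators on the letters become one on the value of \<open>f\<close>,
    with the minus from \<open>koszul_ev\<close>.\<close>
  have K1: "\<ominus>\<^bsub>B\<^esub> ?f (map ?K ps) = koszul B 1 (?f ps)" if "ps \<noteq> []"
  proof -
    have "?f ps \<in> carrier B" by (rule ev_closed[OF gA16 mB16, of f ps, OF _ xs(1)], rule f) (use that in "simp add: Suc_le_eq")
    then show ?thesis
      using koszul_ev[OF gA16 gB16 fg that xs(1)] koszul_closed[OF gB16, of "?f ps" 1] by simp
  qed
  have "gerst R A B (-1) f (su_structure R A \<mu> h) (length ?xs) (tensor R (susp A) ?xs) = finsum B ?t (infixes ?xs)"
    by (rule gerst_tensor[OF gA16 mB16 \<nu> f xsA])
  also have "... = finsum B ?t (?l \<union> ?r)"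
  proof (rule B.M.finsum_subset[OF finite_infixes _ zero])
    show "?l \<union> ?r \<subseteq> infixes ?xs" by (cases ps rule: rev_cases; cases qs) (auto simp: infixes_def)
    show "?t t \<in> carrier B" if "t \<in> ?l \<union> ?r" for t
      using that lin_l lin_r cl by (auto split: if_splits)
  qed
  also have "... = (if ps = [] \<and> qs \<noteq> [] then ?f qs else if ps \<noteq> [] \<and> qs = [] then koszul B 1 (?f ps) else \<zero>\<^bsub>B\<^esub>)"
  proof (cases "ps = []"; cases "qs = []")
    assume *: "ps \<noteq> []" "qs \<noteq> []"
    \<comment> \<open>Keeps the two infixes apart, whose last components are \<open>tl qs\<close>
      and \<open>qs\<close>.\<close>
    then have "tl qs \<noteq> qs" by (cases qs) auto
    then have "finsum B ?t (?l \<union> ?r) = ?f (map ?K ps @ qs) \<oplus>\<^bsub>B\<^esub> \<ominus>\<^bsub>B\<^esub> ?f (map ?K ps @ qs)"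
      using * lin_l[OF *(2)] lin_r[OF *(1)] cl by (simp add: B.M.finsum_insert B.M.a_comm)
    then show ?thesis using * cl by (simp add: B.M.r_neg)
  qed (use lin_l lin_r cl K1[symmetric] in "auto simp: B.M.finsum_insert")
  finally show ?thesis .
qed

end

context
  fixes \<mu> h f
  assumes \<mu>: "\<And>n. 1 \<le> n \<Longrightarrow> \<mu> n \<in> tlin R Wr n Br16"
    and h: "\<And>n. 1 \<le> n \<Longrightarrow> h n \<in> tlin R Wr n (ground R)"
    and \<nu>: "\<And>n. 1 \<le> n \<Longrightarrow> su_structure R B \<mu> h n \<in> tlin R (susp B) n B"
    and f: "\<And>n. 1 \<le> n \<Longrightarrow> f n \<in> tlin R (susp A) n B"
begin
text \<open>A unit that shares its block with other letters is killed by \<open>f\<close>. Alone in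
  its block it becomes the unit of \<open>B\<close>, and the structure of \<open>B\<close> vanishes
  on it unless there are exactly two blocks.\<close>

lemma star_unt:
  assumes f_unt: "\<And>xs. 2 \<le> length xs \<Longrightarrow> over A xs \<Longrightarrow> unt A \<in> set xs \<Longrightarrow> ev R (susp A) f xs = \<zero>\<^bsub>B\<^esub>"
    and f1: "ev R (susp A) f [unt A] = unt B"
    and xs: "over A ps" "over A qs"
  shows "star R A B B (su_structure R B \<mu> h) f (length (ps @ unt A # qs)) (tensor R (susp A) (ps @ unt A # qs)) =
    (if ps = [] \<and> qs \<noteq> [] then ev R (susp A) f qs
     else if ps \<noteq> [] \<and> qs = [] then koszul B 1 (ev R (susp A) f ps) else \<zero>\<^bsub>B\<^esub>)"
proof -
  let ?xs = "ps @ unt A # qs" and ?f = "ev R (susp A) f" and ?\<nu> = "ev R (susp B) (su_structure R B \<mu> h)"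
  let ?t = "\<lambda>yss. ?\<nu> (map ?f yss)"
  have xsA: "over A ?xs" using xs unt_closed[OF A] by simp
  note su = su_structure_unt[OF B, of \<mu> h]
  \<comment> \<open>Survivors need the unit at an end of the word, forming one of two
    blocks.\<close>
  let ?T = "(if ps = [] \<and> qs \<noteq> [] then {[[unt A], qs]} else {}) \<union> (if ps \<noteq> [] \<and> qs = [] then {[ps, [unt A]]} else {})"
  have mapf: "over B (map ?f yss)" if "yss \<in> segmentations ?xs" for yss
    by (rule map_ev_closed[OF gA16 mB16 _ that xsA]) (rule f)
  have zero: "?t yss = \<zero>\<^bsub>B\<^esub>" if yss: "yss \<in> segmentations ?xs - ?T" for yss
  proof -
    have seg: "yss \<in> segmentations ?xs" using yss by simp
    then obtain l c d r where e: "yss = l @ (c @ unt A # d) # r" "ps = concat l @ c" "qs = d @ concat r"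
      using concat_eq_append_Cons[of yss ps "unt A" qs] by (auto simp: segmentations_def)
    have ne: "[] \<notin> set yss" using seg by (simp add: segmentations_def)
    note m = mapf[OF seg]
    show ?thesis
    \<comment> \<open>The case of empty \<open>c\<close> and \<open>d\<close> is the one in which
      the unit is a block of its own.\<close>
    proof (cases "c = [] \<and> d = []")
      case True
      then have "unt B \<in> set (map ?f yss)" using e(1) f1 by force
      moreover have "length (map ?f yss) \<noteq> 2"
      proof
        assume "length (map ?f yss) = 2"
        then have "(\<exists>z. l = [z] \<and> r = []) \<or> (\<exists>z. l = [] \<and> r = [z])" using e(1) by (cases l; cases r) auto
        then show False using yss e True ne by auto
      qed
      ultimately show ?thesis using su(1)[OF \<mu> h m] by simp
    next
      case False
      have "?f (c @ unt A # d) = \<zero>\<^bsub>B\<^esub>"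
        by (rule f_unt) (use False e(2,3) xs unt_closed[OF A] in "cases c; auto simp: Suc_le_eq")+
      then have "\<zero>\<^bsub>B\<^esub> \<in> set (map ?f yss)" using e(1) by force
      moreover have "1 \<le> length (map ?f yss)" using e(1) by simp
      ultimately show ?thesis
        using multilinear_zero_entry[OF mB16 mB16 ev_multilinear[OF gB16 mB16, of "su_structure R B \<mu> h", OF \<nu>] refl m] by blast
    qed
  qed
  have fcl: "?f ys \<in> carrier B" if "ys \<noteq> []" "over A ys" for ys
    by (rule ev_closed[OF gA16 mB16, of f ys, OF _ that(2)], rule f) (use that in "simp add: Suc_le_eq")
  have val: "?t [[unt A], qs] = ?f qs" if "qs \<noteq> []"
    using su(2)[OF \<mu> h, of "[unt B, ?f qs]" "?f qs"] f1 fcl[OF that xs(2)] unt_closed[OF B] by simp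
  have val': "?t [ps, [unt A]] = koszul B 1 (?f ps)" if "ps \<noteq> []"
    using su(3)[OF \<mu> h, of "[?f ps, unt B]" "?f ps"] f1 fcl[OF that xs(1)] unt_closed[OF B] by simp
  have "star R A B B (su_structure R B \<mu> h) f (length ?xs) (tensor R (susp A) ?xs) = finsum B ?t (segmentations ?xs)"
    by (rule star_tensor[OF gA16 mB16, of f, OF f mB16 \<nu> xsA])
  also have "... = finsum B ?t ?T"
    by (rule B.M.finsum_subset[OF finite_segmentations _ zero])
      (use val val' fcl xs koszul_closed[OF gB16] in "auto simp: segmentations_def split: if_splits")
  also have "... = (if ps = [] \<and> qs \<noteq> [] then ?f qs else if ps \<noteq> [] \<and> qs = [] then koszul B 1 (?f ps) else \<zero>\<^bsub>B\<^esub>)"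
    using val val' fcl xs koszul_closed[OF gB16] by (auto simp: B.M.finsum_insert)
  finally show ?thesis .
qed

text \<open>On a block, \<open>f\<close> has reduction g and splitting a. So \<mu> and h see only g,
  and the values of a enter through \<open>mu_su\<close> alone. That takes two arguments, and
  segmentations into two blocks are cuts.\<close>

lemma star_reduced:
  assumes g: "\<And>n. 1 \<le> n \<Longrightarrow> g n \<in> tlin R Vr16 n Br16"
    and a: "\<And>n. 1 \<le> n \<Longrightarrow> a n \<in> tlin R Vr16 n (ground R)"
    and f_ev: "\<And>xs. xs \<noteq> [] \<Longrightarrow> over Ar16 xs \<Longrightarrow> ev R (susp A) f xs =
      ev R Vr16 g xs \<oplus>\<^bsub>B\<^esub> ev R Vr16 a xs \<odot>\<^bsub>B\<^esub> unt B"
    and xs: "over Ar16 xs"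
  shows "star R A B B (su_structure R B \<mu> h) f (length xs) (tensor R (susp A) xs) =
    star R Ar16 Br16 Br16 \<mu> g (length xs) (tensor R Vr16 xs) \<oplus>\<^bsub>B\<^esub>
    star R Ar16 Br16 (ground R) h g (length xs) (tensor R Vr16 xs) \<odot>\<^bsub>B\<^esub> unt B \<oplus>\<^bsub>B\<^esub>
    (finsum B (\<lambda>(us, vs). ev R Vr16 a us \<odot>\<^bsub>B\<^esub> ev R Vr16 g vs) (cuts xs) \<oplus>\<^bsub>B\<^esub>
     finsum (ground R) (\<lambda>(us, vs). ev R Vr16 a us \<otimes>\<^bsub>R\<^esub> ev R Vr16 a vs) (cuts xs) \<odot>\<^bsub>B\<^esub> unt B \<oplus>\<^bsub>B\<^esub>
     finsum B (\<lambda>(us, vs). ev R Vr16 a vs \<odot>\<^bsub>B\<^esub> koszul B 1 (ev R Vr16 g us)) (cuts xs))"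
proof -
  let ?f = "ev R (susp A) f" and ?\<nu> = "ev R (susp B) (su_structure R B \<mu> h)"
  let ?g = "ev R Vr16 g" and ?a = "ev R Vr16 a"
  let ?m = "ev R Wr \<mu>" and ?h = "ev R Wr h"
  note u = unt_closed[OF B]
  have xsA: "over A xs" using xs by auto
  have cl: "?g ys \<in> carrier Br16" "?a ys \<in> carrier R" "?g ys \<in> carrier B"
    if "ys \<noteq> []" "over Ar16 ys" for ys
    using ev_closed[OF gAr16 mBr16, of g ys] ev_closed[OF gAr16 mG16, of a ys] g[of "length ys"] a[of "length ys"] that
    by (auto simp: Suc_le_eq)
  \<comment> \<open>This is \<open>mu_su\<close> on f(us) and f(vs). The first term contains the
    second argument whole, including its unit part, which yields the product of the two values of
    a.\<close>
  let ?c = "\<lambda>us vs. ?a us \<odot>\<^bsub>B\<^esub> (?g vs \<oplus>\<^bsub>B\<^esub> ?a vs \<odot>\<^bsub>B\<^esub> unt B) \<oplus>\<^bsub>B\<^esub> ?a vs \<odot>\<^bsub>B\<^esub> koszul B 1 (?g us)"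
  let ?C = "\<lambda>yss. if length yss = 2 then ?c (yss ! 0) (yss ! 1) else \<zero>\<^bsub>B\<^esub>"
  have val: "?\<nu> (map ?f yss) = (?m (map ?g yss) \<oplus>\<^bsub>B\<^esub> ?h (map ?g yss) \<odot>\<^bsub>B\<^esub> unt B) \<oplus>\<^bsub>B\<^esub> ?C yss"
    "?m (map ?g yss) \<in> carrier Br16" "?h (map ?g yss) \<in> carrier R" "?C yss \<in> carrier B"
    if yss: "yss \<in> segmentations xs" for yss
  proof -
    have y: "ys \<noteq> []" "over Ar16 ys" if "ys \<in> set yss" for ys
    proof -
      show "ys \<noteq> []" using yss that by (auto simp: segmentations_def)
      have "set ys \<subseteq> set xs" using yss that by (auto simp: segmentations_def)
      then show "over Ar16 ys" using xs by blast
    qed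
    have fy: "?f ys = ?g ys \<oplus>\<^bsub>B\<^esub> ?a ys \<odot>\<^bsub>B\<^esub> unt B" "splitting B (?f ys) = ?a ys" "reduction B (?f ys) = ?g ys" "?f ys \<in> carrier B"
      if "ys \<in> set yss" for ys
      using f_ev[OF y[OF that]] splitting_sum[OF B cl(1,2)[OF y[OF that]]] cl(2,3)[OF y[OF that]] u by simp_all
    have red: "map (reduction B) (map ?f yss) = map ?g yss" using fy(3) by simp
    have ne: "yss \<noteq> []" using yss by (simp add: segmentations_def)
    have mg: "over Br16 (map ?g yss)" using cl(1) y by (auto simp del: reduced_simps)
    show "?m (map ?g yss) \<in> carrier Br16"
      by (rule ev_closed[OF gBr16 mBr16, of \<mu> "map ?g yss", OF _ mg], rule \<mu>) (use ne in "simp add: Suc_le_eq")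
    show "?h (map ?g yss) \<in> carrier R"
      using ev_closed[OF gBr16 mG16, of h "map ?g yss", OF _ mg] h[of "length yss"] ne by (simp add: Suc_le_eq)
    have C: "?C yss = (if length (map ?f yss) = 2 then splitting B (map ?f yss ! 0) \<odot>\<^bsub>B\<^esub> (map ?f yss ! 1) \<oplus>\<^bsub>B\<^esub>
        splitting B (map ?f yss ! 1) \<odot>\<^bsub>B\<^esub> koszul B 1 (reduction B (map ?f yss ! 0)) else \<zero>\<^bsub>B\<^esub>)"
      using fy by (auto simp: numeral_2_eq_2 length_Suc_conv)
    have "?\<nu> (map ?f yss) = ?m (map (reduction B) (map ?f yss)) \<oplus>\<^bsub>B\<^esub> ?h (map (reduction B) (map ?f yss)) \<odot>\<^bsub>B\<^esub> unt B \<oplus>\<^bsub>B\<^esub>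
      (if length (map ?f yss) = 2 then splitting B (map ?f yss ! 0) \<odot>\<^bsub>B\<^esub> (map ?f yss ! 1) \<oplus>\<^bsub>B\<^esub>
        splitting B (map ?f yss ! 1) \<odot>\<^bsub>B\<^esub> koszul B 1 (reduction B (map ?f yss ! 0)) else \<zero>\<^bsub>B\<^esub>)"
    proof -
      have "map ?f yss \<noteq> []" "over B (map ?f yss)" using ne fy(4) by auto
      from su_structure_ev[OF B \<mu> h this] show ?thesis .
    qed
    then show "?\<nu> (map ?f yss) = (?m (map ?g yss) \<oplus>\<^bsub>B\<^esub> ?h (map ?g yss) \<odot>\<^bsub>B\<^esub> unt B) \<oplus>\<^bsub>B\<^esub> ?C yss"
      unfolding red C .
    show "?C yss \<in> carrier B"
      using y cl u koszul_closed[OF gB16] by (auto simp: numeral_2_eq_2 length_Suc_conv simp del: reduced_simps)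
  qed
  have sub: "(\<lambda>(us, vs). [us, vs]) ` cuts xs \<subseteq> segmentations xs" by (auto simp: cuts_def segmentations_def)
  have "star R A B B (su_structure R B \<mu> h) f (length xs) (tensor R (susp A) xs) =
      finsum B (\<lambda>yss. ?\<nu> (map ?f yss)) (segmentations xs)"
    by (rule star_tensor[OF gA16 mB16, of f, OF f mB16 \<nu> xsA])
  also have "... = finsum B (\<lambda>yss. ?m (map ?g yss) \<oplus>\<^bsub>B\<^esub> ?h (map ?g yss) \<odot>\<^bsub>B\<^esub> unt B) (segmentations xs) \<oplus>\<^bsub>B\<^esub>
      finsum B ?C (segmentations xs)"
    by (rule B.M.finsum_add_cong) (use val u in auto)
  also have "finsum B (\<lambda>yss. ?m (map ?g yss) \<oplus>\<^bsub>B\<^esub> ?h (map ?g yss) \<odot>\<^bsub>B\<^esub> unt B) (segmentations xs) =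
      finsum B (\<lambda>yss. ?m (map ?g yss)) (segmentations xs) \<oplus>\<^bsub>B\<^esub>
      finsum B (\<lambda>yss. ?h (map ?g yss) \<odot>\<^bsub>B\<^esub> unt B) (segmentations xs)"
    by (rule B.M.finsum_add_cong) (use val u in auto)
  also have "finsum B (\<lambda>yss. ?m (map ?g yss)) (segmentations xs) =
      star R Ar16 Br16 Br16 \<mu> g (length xs) (tensor R Vr16 xs)"
    by (subst star_tensor[OF gAr16 mBr16, of g, OF g mBr16 \<mu> xs], assumption+)
      (rule finsum_reduced[OF B, symmetric], rule val(2))
  also have "finsum B (\<lambda>yss. ?h (map ?g yss) \<odot>\<^bsub>B\<^esub> unt B) (segmentations xs) =
      star R Ar16 Br16 (ground R) h g (length xs) (tensor R Vr16 xs) \<odot>\<^bsub>B\<^esub> unt B"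
    by (subst star_tensor[OF gAr16 mBr16, of g, OF g mG16 h xs], assumption+) (rule finsum_unit[OF B], rule val(3))
  also have "finsum B ?C (segmentations xs) = finsum B ?C ((\<lambda>(us, vs). [us, vs]) ` cuts xs)"
  proof (rule B.M.finsum_subset[OF finite_segmentations])
    show "(\<lambda>(us, vs). [us, vs]) ` cuts xs \<subseteq> segmentations xs" by (rule sub)
    then show "\<And>t. t \<in> (\<lambda>(us, vs). [us, vs]) ` cuts xs \<Longrightarrow> ?C t \<in> carrier B" using val(4) by blast
    show "?C t = \<zero>\<^bsub>B\<^esub>" if "t \<in> segmentations xs - (\<lambda>(us, vs). [us, vs]) ` cuts xs" for t
      using that by (auto simp: numeral_2_eq_2 length_Suc_conv cuts_def segmentations_def)
  qed
  also have "... = finsum B (\<lambda>(us, vs). ?c us vs) (cuts xs)"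
  proof (subst B.M.finsum_reindex)
    show "?C \<in> (\<lambda>(us, vs). [us, vs]) ` cuts xs \<rightarrow> carrier B"
      using val(4) sub by blast
  qed (auto simp: inj_on_def intro!: arg_cong2[where f = "finsum B"])
  also have "... = finsum B (\<lambda>(us, vs). ?a us \<odot>\<^bsub>B\<^esub> ?g vs) (cuts xs) \<oplus>\<^bsub>B\<^esub>
      finsum (ground R) (\<lambda>(us, vs). ?a us \<otimes>\<^bsub>R\<^esub> ?a vs) (cuts xs) \<odot>\<^bsub>B\<^esub> unt B \<oplus>\<^bsub>B\<^esub>
      finsum B (\<lambda>(us, vs). ?a vs \<odot>\<^bsub>B\<^esub> koszul B 1 (?g us)) (cuts xs)"
  proof -
    have c: "us \<noteq> []" "vs \<noteq> []" "over Ar16 us" "over Ar16 vs"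
      if "(us, vs) \<in> cuts xs" for us vs using cuts_closed[OF that xs] by auto
    note k = cl(2,3)[OF c(1,3)] cl(2,3)[OF c(2,4)] koszul_closed[OF gB16, of _ 1]
    have "finsum B (\<lambda>(us, vs). ?c us vs) (cuts xs) =
        finsum B (\<lambda>(us, vs). ?a us \<odot>\<^bsub>B\<^esub> ?g vs \<oplus>\<^bsub>B\<^esub> (?a us \<otimes>\<^bsub>R\<^esub> ?a vs) \<odot>\<^bsub>B\<^esub> unt B) (cuts xs) \<oplus>\<^bsub>B\<^esub>
        finsum B (\<lambda>(us, vs). ?a vs \<odot>\<^bsub>B\<^esub> koszul B 1 (?g us)) (cuts xs)"
      by (rule B.M.finsum_add_cong) (use k u in "auto simp: B.smult_r_distr B.smult_assoc1")
    also have "finsum B (\<lambda>(us, vs). ?a us \<odot>\<^bsub>B\<^esub> ?g vs \<oplus>\<^bsub>B\<^esub> (?a us \<otimes>\<^bsub>R\<^esub> ?a vs) \<odot>\<^bsub>B\<^esub> unt B) (cuts xs) =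
        finsum B (\<lambda>(us, vs). ?a us \<odot>\<^bsub>B\<^esub> ?g vs) (cuts xs) \<oplus>\<^bsub>B\<^esub>
        finsum B (\<lambda>t. (case t of (us, vs) \<Rightarrow> ?a us \<otimes>\<^bsub>R\<^esub> ?a vs) \<odot>\<^bsub>B\<^esub> unt B) (cuts xs)"
      by (rule B.M.finsum_add_cong) (use k u in auto)
    also have "finsum B (\<lambda>t. (case t of (us, vs) \<Rightarrow> ?a us \<otimes>\<^bsub>R\<^esub> ?a vs) \<odot>\<^bsub>B\<^esub> unt B) (cuts xs) =
        finsum (ground R) (\<lambda>(us, vs). ?a us \<otimes>\<^bsub>R\<^esub> ?a vs) (cuts xs) \<odot>\<^bsub>B\<^esub> unt B"
      by (rule finsum_unit[OF B]) (use k in auto)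
    finally show ?thesis .
  qed
  finally show ?thesis .
qed

end

end

text \<open>In \<open>gerst_reduced\<close>, with the structure also as outer operation, the sum
  with units collapses: an operation on a unit needs exactly one further letter, so h is applied to
  all letters but the last or all but the first. The minus of the latter is the shift between the
  sign rule in the suspension and the sign of \<open>mu_su\<close>.\<close>

lemma A_infinity_reduced:
  fixes A :: "('k, 'a) split_gmodule"
  assumes A: "split_element R A"
    and \<mu>: "\<And>n. 1 \<le> n \<Longrightarrow> \<mu> n \<in> tlin R (susp (reduced R A)) n (reduced R A)"
    and h: "\<And>n. 1 \<le> n \<Longrightarrow> h n \<in> tlin R (susp (reduced R A)) n (ground R)"
    and alg: "A_infinity_algebra R A (su_structure R A \<mu> h)"
    and xs: "xs \<noteq> []" "over (reduced R A) xs"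
  shows "gerst R (reduced R A) (reduced R A) (-1) \<mu> \<mu> (length xs) (tensor R (susp (reduced R A)) xs) =
      (if 2 \<le> length xs then ev R (susp (reduced R A)) h (tl xs) \<odot>\<^bsub>reduced R A\<^esub> hd xs
        \<ominus>\<^bsub>reduced R A\<^esub> ev R (susp (reduced R A)) h (butlast xs) \<odot>\<^bsub>reduced R A\<^esub> last xs else \<zero>\<^bsub>reduced R A\<^esub>)"
    and "gerst R (reduced R A) (ground R) (-1) h \<mu> (length xs) (tensor R (susp (reduced R A)) xs) = \<zero>\<^bsub>R\<^esub>"
proof -
  have gA16: "graded_module R A" using A by (simp add: split_element_def)
  note mA16 = graded_moduleD(1)[OF gA16]
  note gAr16 = graded_module_reduced[OF A] and mAr16 = module_reduced[OF A]
  interpret A: module R A by (rule mA16)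
  have mG16: "module R (ground R)" by (rule module_ground[OF A.R.is_cring])
  let ?\<nu> = "su_structure R A \<mu> h" and ?n = "ev R (susp A) (su_structure R A \<mu> h)"
  let ?h = "ev R (susp (reduced R A)) h" and ?K = "koszul (susp A) (-1)"
  note u = unt_closed[OF A]
  have xsA: "over A xs" using xs(2) by auto
  have \<nu>: "1 \<le> n \<Longrightarrow> ?\<nu> n \<in> tlin R (susp A) n A" for n
    using alg CC_linear[of ?\<nu> R A A "-1"] by (simp add: A_infinity_algebra_def)
  have n_ev: "ev R (susp A) ?\<nu> zs = ev R (susp (reduced R A)) \<mu> zs \<oplus>\<^bsub>A\<^esub> ?h zs \<odot>\<^bsub>A\<^esub> unt A"
    if "zs \<noteq> []" "over (reduced R A) zs" for zs
    by (rule su_structure_reduced[OF A _ _ that]) (rule \<mu> h, assumption)+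
  have hcl: "?h zs \<in> carrier R" if "zs \<noteq> []" "over (reduced R A) zs" for zs
    using ev_closed[OF gAr16 mG16, of h zs] h[of "length zs"] that by (auto simp: Suc_le_eq)
  have hr: "last xs \<in> carrier (reduced R A)" "hd xs \<in> carrier (reduced R A)"
    using last_in_set[OF xs(1)] hd_in_set[OF xs(1)] xs(2) by auto
  then have hl: "last xs \<in> carrier A" "hd xs \<in> carrier A" by auto
  have tb: "butlast xs \<noteq> []" "tl xs \<noteq> []" "?h (butlast xs) \<in> carrier R" "?h (tl xs) \<in> carrier R" if "2 \<le> length xs"
  proof -
    show ne: "butlast xs \<noteq> []" "tl xs \<noteq> []" using that by (cases xs; cases "tl xs"; simp)+
    show "?h (butlast xs) \<in> carrier R" "?h (tl xs) \<in> carrier R"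
      using hcl[OF ne(1)] hcl[OF ne(2)] xs(2) by (auto dest: in_set_butlastD list.set_sel(2)[OF xs(1)])
  qed
  interpret Ar16: module R "reduced R A" by (rule mAr16)
  let ?G = "gerst R (reduced R A) (reduced R A) (-1) \<mu> \<mu> (length xs) (tensor R (susp (reduced R A)) xs)"
  let ?H = "gerst R (reduced R A) (ground R) (-1) h \<mu> (length xs) (tensor R (susp (reduced R A)) xs)"
  let ?t = "\<lambda>(us, ys, vs). ?h ys \<odot>\<^bsub>A\<^esub> ?n (map ?K us @ unt A # vs)"
  let ?E = "if 2 \<le> length xs then ?h (butlast xs) \<odot>\<^bsub>A\<^esub> last xs \<ominus>\<^bsub>A\<^esub> ?h (tl xs) \<odot>\<^bsub>A\<^esub> hd xs else \<zero>\<^bsub>A\<^esub>"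
  have t: "tensor R (susp (reduced R A)) xs \<in> carrier (tpow R (susp (reduced R A)) (length xs))"
    by (rule tensor_closed[OF module_susp[OF mAr16]]) (use xs(2) in simp_all)
  have Gc: "?G \<in> carrier (reduced R A)"
    by (rule lin_closed[OF gerst_linear[OF gAr16 mAr16, of \<mu> \<mu>, OF \<mu> \<mu>] t])
  have Hc: "?H \<in> carrier R"
    using lin_closed[OF gerst_linear[OF gAr16 mG16, of \<mu> h, OF \<mu> h] t] by simp
  have su: "?n zs = \<zero>\<^bsub>A\<^esub>" if "length zs \<noteq> 2" "over A zs" "unt A \<in> set zs" for zs
    using su_structure_unt(1)[OF A \<mu> h that(2,3,1)] .
  have su_l: "?n [unt A, x] = x" and su_r: "?n [?K x, unt A] = \<ominus>\<^bsub>A\<^esub> x" if x: "x \<in> carrier A" for x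
  proof -
    show "?n [unt A, x] = x" using su_structure_unt(2)[OF A \<mu> h, of "[unt A, x]" x] u x by simp
    have k: "koszul A 1 x \<in> carrier A" by (rule koszul_closed[OF gA16 x])
    then have K: "?K x = \<ominus>\<^bsub>A\<^esub> koszul A 1 x" "?K x \<in> carrier A" using koszul_susp[OF gA16 x] by auto
    have "?n [?K x, unt A] = koszul A 1 (?K x)" using su_structure_unt(3)[OF A \<mu> h, of "[?K x, unt A]" "?K x"] u K(2) by simp
    also have "... = \<ominus>\<^bsub>A\<^esub> koszul A 1 (koszul A 1 x)" unfolding K(1) by (rule lin_neg[OF mA16 mA16 koszul_linear[OF gA16] k])
    finally show "?n [?K x, unt A] = \<ominus>\<^bsub>A\<^esub> x" using koszul_koszul[OF gA16 x] koszul_even[OF gA16 _ x, of 2] by simp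
  qed
  have "finsum A ?t (infixes xs) = ?E"
  proof (cases "2 \<le> length xs")
    case False
    then obtain x where x: "xs = [x]" using xs(1) by (cases xs; cases "tl xs") auto
    then have "infixes xs = {([], [x], [])}" by (auto simp: infixes_def append_eq_Cons_conv Cons_eq_append_conv)
    then show ?thesis using x su[of "[unt A]"] u hcl xs by (simp add: A.M.finsum_insert)
  next
    case True
    let ?T = "{([], butlast xs, [last xs]), ([hd xs], tl xs, [])}"
    note ne = tb(1,2)[OF True] xs(1) and hc = tb(3,4)[OF True]
    have tv: "?t ([], butlast xs, [last xs]) = ?h (butlast xs) \<odot>\<^bsub>A\<^esub> last xs"
      "?t ([hd xs], tl xs, []) = \<ominus>\<^bsub>A\<^esub> (?h (tl xs) \<odot>\<^bsub>A\<^esub> hd xs)"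
      using hl hc by (simp_all add: su_l su_r A.smult_r_minus)
    have "finsum A ?t (infixes xs) = finsum A ?t ?T"
    proof (rule A.M.finsum_subset[OF finite_infixes])
      show "?T \<subseteq> infixes xs" using ne by (auto simp: infixes_def)
      show "?t p \<in> carrier A" if "p \<in> ?T" for p using that tv hl hc by auto
      show "?t p = \<zero>\<^bsub>A\<^esub>" if p: "p \<in> infixes xs - ?T" for p
      proof -
        obtain us ys vs where p': "p = (us, ys, vs)" by (cases p)
        have i: "(us, ys, vs) \<in> infixes xs" using p p' by simp
        note c = infixes_closed[OF i xs(2)]
        \<comment> \<open>The outer operation sees the unit and the letters of \<open>us\<close> and
          \<open>vs\<close>. It vanishes unless these are one letter in all, and then
          \<open>p\<close> belongs to \<open>?T\<close>.\<close>
        have "length us + length vs \<noteq> 1"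
        proof
          assume "length us + length vs = 1"
          then have "(\<exists>x. us = [x] \<and> vs = []) \<or> (\<exists>x. us = [] \<and> vs = [x])" by (cases us; cases vs) auto
          then show False using p p' i by (auto simp: infixes_def)
        qed
        moreover have "over A (map ?K us @ unt A # vs)"
          using koszul_closed[OF graded_module_susp[OF gA16]] c(2,4) u by auto
        ultimately have "?n (map ?K us @ unt A # vs) = \<zero>\<^bsub>A\<^esub>" by (intro su) auto
        then show ?thesis using hcl[OF c(1,3)] by (simp add: p')
      qed
    qed
    also have "... = ?t ([], butlast xs, [last xs]) \<oplus>\<^bsub>A\<^esub> ?t ([hd xs], tl xs, [])"
      using tv hl hc by (simp add: A.M.finsum_insert)
    finally show ?thesis using True tv by (simp add: a_minus_def)
  qed
  moreover have "\<zero>\<^bsub>A\<^esub> = gerst R A A (-1) ?\<nu> ?\<nu> (length xs) (tensor R (susp A) xs)"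
  proof -
    have "tensor R (susp A) xs \<in> carrier (tpow R (susp A) (length xs))"
      by (rule tensor_closed[OF module_susp[OF mA16]]) (use xsA in simp_all)
    then show ?thesis using alg xs(1) by (simp add: A_infinity_algebra_def Suc_le_eq)
  qed
  moreover have "gerst R A A (-1) ?\<nu> ?\<nu> (length xs) (tensor R (susp A) xs) =
      ?G \<oplus>\<^bsub>A\<^esub> ?H \<odot>\<^bsub>A\<^esub> unt A \<oplus>\<^bsub>A\<^esub> finsum A ?t (infixes xs)"
    by (rule gerst_reduced[OF A A \<mu> h \<nu> \<nu> \<mu> h n_ev xs(2)])
  ultimately have eq: "?G \<oplus>\<^bsub>A\<^esub> ?H \<odot>\<^bsub>A\<^esub> unt A \<oplus>\<^bsub>A\<^esub> ?E = \<zero>\<^bsub>A\<^esub>" by simp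
  \<comment> \<open>The boundary terms are reduced, so they join the reduced part of the relation
    and the scalar part has to vanish by itself.\<close>
  have E: "?E \<in> carrier (reduced R A)"
  proof (cases "2 \<le> length xs")
    case True
    note hc = tb(3,4)[OF True]
    have s: "?h (tl xs) \<odot>\<^bsub>reduced R A\<^esub> hd xs \<in> carrier (reduced R A)" "?h (butlast xs) \<odot>\<^bsub>reduced R A\<^esub> last xs \<in> carrier (reduced R A)"
      using Ar16.smult_closed hc hr by blast+
    have "?E = ?h (butlast xs) \<odot>\<^bsub>reduced R A\<^esub> last xs \<ominus>\<^bsub>reduced R A\<^esub> ?h (tl xs) \<odot>\<^bsub>reduced R A\<^esub> hd xs"
      using True a_minus_reduced[OF A s(1)] by simp
    also have "... \<in> carrier (reduced R A)" using s by blast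
    finally show ?thesis .
  qed (use Ar16.M.zero_closed in simp)
  have GA: "?G \<in> carrier A" and EA: "?E \<in> carrier A" using Gc E by auto
  have GE: "?G \<oplus>\<^bsub>A\<^esub> ?E \<in> carrier (reduced R A)"
    using submodule_closed(3)[OF mA16 reduced_submodule[OF A] Gc E] .
  have "(?G \<oplus>\<^bsub>A\<^esub> ?E) \<oplus>\<^bsub>A\<^esub> ?H \<odot>\<^bsub>A\<^esub> unt A = \<zero>\<^bsub>A\<^esub>"
    using eq GA EA Hc u by (simp add: A.M.a_ac)
  then have *: "?G \<oplus>\<^bsub>A\<^esub> ?E = \<zero>\<^bsub>A\<^esub>" "?H = \<zero>\<^bsub>R\<^esub>" unfolding split_eq_zero[OF A GE Hc] by auto
  show "?H = \<zero>\<^bsub>R\<^esub>" by fact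
  have G: "?G = \<ominus>\<^bsub>A\<^esub> ?E" using A.M.minus_equality[OF *(1) EA GA] by simp
  show "?G = (if 2 \<le> length xs then ?h (tl xs) \<odot>\<^bsub>reduced R A\<^esub> hd xs
        \<ominus>\<^bsub>reduced R A\<^esub> ?h (butlast xs) \<odot>\<^bsub>reduced R A\<^esub> last xs else \<zero>\<^bsub>reduced R A\<^esub>)"
  proof (cases "2 \<le> length xs")
    case True
    note hc = tb(3,4)[OF True]
    have "?h (butlast xs) \<odot>\<^bsub>reduced R A\<^esub> last xs \<in> carrier (reduced R A)" using Ar16.smult_closed hc hr by blast
    from a_minus_reduced[OF A this, of "?h (tl xs) \<odot>\<^bsub>reduced R A\<^esub> hd xs"] show ?thesis
      using True G hc hl by (simp add: a_minus_def A.M.minus_add A.M.a_comm)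
  qed (use G in simp)
qed

section \<open>The comparison theorem\<close>

text \<open>Both factors have degree 0, so no Koszul sign arises between them, and the position p
  becomes a cut of the word.\<close>

lemma mu_su_cup:
  fixes B :: "('k, 'b) split_gmodule" and V :: "('k, 'a, 'x) gmodule_scheme"
  assumes B: "split_element R B" and V: "graded_module R V"
    and \<phi>: "\<And>n. 1 \<le> n \<Longrightarrow> \<phi> n \<in> tlin R V n B"
    and \<psi>: "\<And>n. 1 \<le> n \<Longrightarrow> \<psi> n \<in> tlin R V n B"
  shows "(\<lambda>X. \<Oplus>\<^bsub>B\<^esub> p \<in> {1..n - 1}. mu_su R B 2 (tensor_maps R V (susp B) [(0, p, \<phi> p), (0, n - p, \<psi> (n - p))] X))
      \<in> tlin R V n B"
    and "over V xs \<Longrightarrow> (\<Oplus>\<^bsub>B\<^esub> p \<in> {1..length xs - 1}. mu_su R B 2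
        (tensor_maps R V (susp B) [(0, p, \<phi> p), (0, length xs - p, \<psi> (length xs - p))] (tensor R V xs))) =
      finsum B (\<lambda>(us, vs). splitting B (ev R V \<phi> us) \<odot>\<^bsub>B\<^esub> ev R V \<psi> vs \<oplus>\<^bsub>B\<^esub>
        splitting B (ev R V \<psi> vs) \<odot>\<^bsub>B\<^esub> koszul B 1 (reduction B (ev R V \<phi> us))) (cuts xs)"
proof -
  have gB17: "graded_module R B" using B by (simp add: split_element_def)
  note mB17 = graded_moduleD(1)[OF gB17] and mV = graded_moduleD(1)[OF V]
  interpret B: module R B by (rule mB17)
  have valid: "valid_factors R V (susp B) [(0, p, \<phi> p), (0, n - p, \<psi> (n - p))]"
    "arity [(0, p, \<phi> p), (0, n - p, \<psi> (n - p))] = n" if "p \<in> {1..n - 1}" for n p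
  proof -
    have "1 \<le> p" "1 \<le> n - p" using that by auto
    then show "valid_factors R V (susp B) [(0, p, \<phi> p), (0, n - p, \<psi> (n - p))]"
      using \<phi>[of p] \<psi>[of "n - p"] by (simp add: valid_factors_def)
  qed (use that in auto)
  show "(\<lambda>X. \<Oplus>\<^bsub>B\<^esub> p \<in> {1..n - 1}. mu_su R B 2 (tensor_maps R V (susp B) [(0, p, \<phi> p), (0, n - p, \<psi> (n - p))] X))
      \<in> tlin R V n B"
    by (intro lin_finsum_map[OF module_tpow[OF mV] mB17]
        lin_comp[OF mu_su_linear[OF B] tensor_maps_linear[OF V module_susp[OF mB17]]] valid) simp_all
  assume xs: "over V xs"
  show "(\<Oplus>\<^bsub>B\<^esub> p \<in> {1..length xs - 1}. mu_su R B 2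
        (tensor_maps R V (susp B) [(0, p, \<phi> p), (0, length xs - p, \<psi> (length xs - p))] (tensor R V xs))) =
      finsum B (\<lambda>(us, vs). splitting B (ev R V \<phi> us) \<odot>\<^bsub>B\<^esub> ev R V \<psi> vs \<oplus>\<^bsub>B\<^esub>
        splitting B (ev R V \<psi> vs) \<odot>\<^bsub>B\<^esub> koszul B 1 (reduction B (ev R V \<phi> us))) (cuts xs)"
  proof (rule B.M.finsum_cuts)
    fix us vs assume uv: "(us, vs) \<in> cuts xs"
    note c = cuts_closed[OF uv xs]
    have eq: "xs = us @ vs" using uv by (simp add: cuts_def)
    have K: "map (koszul V 0) us = us" "map (koszul V 0) vs = vs"
      using koszul_even[OF V] c by (auto intro!: map_idI)
    have n: "1 \<le> length us" "1 \<le> length vs" using c by (simp_all add: Suc_le_eq)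
    have cl: "ev R V \<phi> us \<in> carrier B" "ev R V \<psi> vs \<in> carrier B"
      using lin_closed[OF \<phi>[OF n(1)] tensor_closed[OF mV refl c(3)]] lin_closed[OF \<psi>[OF n(2)] tensor_closed[OF mV refl c(4)]]
      by (auto simp: ev_def)
    have p: "length us \<in> {1..length xs - 1}" using n by (simp add: eq)
    have "tensor_maps R V (susp B) [(0, length us, \<phi> (length us)), (0, length xs - length us, \<psi> (length xs - length us))]
        (tensor R V xs) = tensor R (susp B) [ev R V \<phi> us, ev R V \<psi> vs]"
      using tensor_maps_tensor[OF V module_susp[OF mB17] valid[OF p] xs] K by (simp add: eq ev_def)
    then show "mu_su R B 2 (tensor_maps R V (susp B)
        [(0, length us, \<phi> (length us)), (0, length xs - length us, \<psi> (length xs - length us))] (tensor R V xs)) =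
      splitting B (ev R V \<phi> us) \<odot>\<^bsub>B\<^esub> ev R V \<psi> vs \<oplus>\<^bsub>B\<^esub>
        splitting B (ev R V \<psi> vs) \<odot>\<^bsub>B\<^esub> koszul B 1 (reduction B (ev R V \<phi> us))"
      using mu_su_tensor[OF B cl] by simp
    show "splitting B (ev R V \<phi> us) \<odot>\<^bsub>B\<^esub> ev R V \<psi> vs \<oplus>\<^bsub>B\<^esub>
        splitting B (ev R V \<psi> vs) \<odot>\<^bsub>B\<^esub> koszul B 1 (reduction B (ev R V \<phi> us)) \<in> carrier B"
      using cl splitting_closed[OF B] lin_closed[OF reduction_linear[OF B]] koszul_closed[OF gB17] by simp
  qed
qed

section \<open>The three conditions expressed on words with reduced letters\<close>

context
  fixes R :: "'k ring" and A :: "('k, 'a) split_gmodule" and B :: "('k, 'b) split_gmodule"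
    and \<mu>A hA \<mu>B hB g a
  assumes R: "cring R"
    and \<mu>A: "\<mu>A \<in> CC R (reduced R A) (reduced R A) (-1)" and hA: "hA \<in> CC R (reduced R A) (ground R) (-1)"
    and algA: "A_infinity_split_unit R A (su_structure R A \<mu>A hA)"
    and \<mu>B: "\<mu>B \<in> CC R (reduced R B) (reduced R B) (-1)" and hB: "hB \<in> CC R (reduced R B) (ground R) (-1)"
    and algB: "A_infinity_split_unit R B (su_structure R B \<mu>B hB)"
    and g: "g \<in> CC R (reduced R A) (reduced R B) 0" and a: "a \<in> CC R (reduced R A) (ground R) 0"
    and unital: "strictly_unital_element R A B (su_element R A B g a)"
begin
private abbreviation (input) "Ar17 \<equiv> reduced R A"
private abbreviation (input) "Br17 \<equiv> reduced R B"
private abbreviation (input) "Vr17 \<equiv> susp (reduced R A)"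
private abbreviation (input) "nA \<equiv> su_structure R A \<mu>A hA"
private abbreviation (input) "nB \<equiv> su_structure R B \<mu>B hB"
private abbreviation (input) "fu \<equiv> su_element R A B g a"

private lemma splitA: "split_element R A" and splitB: "split_element R B"
  and alg: "A_infinity_algebra R A nA" "A_infinity_algebra R B nB"
  and fCC: "fu \<in> CC R A B 0"
  using algA algB unital by (auto simp: A_infinity_split_unit_def strictly_unital_element_def)

private lemma gA17: "graded_module R A" and gB17: "graded_module R B" using splitA splitB by (auto simp: split_element_def)
private lemma mA17: "module R A" and mB17: "module R B" using gA17 gB17 by (auto dest: graded_moduleD)
private lemmas gAr17 = graded_module_reduced[OF splitA] and gBr17 = graded_module_reduced[OF splitB]
  and mAr17 = module_reduced[OF splitA] and mBr17 = module_reduced[OF splitB] and mG17 = module_ground[OF R]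

interpretation R: cring R by (rule R)
interpretation B: module R B by (rule mB17)
interpretation Br17: module R "reduced R B" by (rule mBr17)

private lemmas lins = CC_linear[OF \<mu>A] CC_linear[OF hA] CC_linear[OF \<mu>B] CC_linear[OF hB] CC_linear[OF g] CC_linear[OF a]

private lemma n_lin: "1 \<le> n \<Longrightarrow> nA n \<in> tlin R (susp A) n A"
  "1 \<le> n \<Longrightarrow> nB n \<in> tlin R (susp B) n B"
  using alg CC_linear by (auto simp: A_infinity_algebra_def)

private lemma ga_closed:
  assumes "us \<noteq> []" "over Ar17 us"
  shows "ev R Vr17 g us \<in> carrier Br17" "ev R Vr17 g us \<in> carrier B" "ev R Vr17 a us \<in> carrier R" "ev R Vr17 hA us \<in> carrier R"
proof -
  have n: "1 \<le> length us" using assms(1) by (simp add: Suc_le_eq)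
  show "ev R Vr17 g us \<in> carrier Br17" by (rule ev_closed[OF gAr17 mBr17, of g us, OF lins(5)[OF n] assms(2)])
  then show "ev R Vr17 g us \<in> carrier B" by simp
  show "ev R Vr17 a us \<in> carrier R" "ev R Vr17 hA us \<in> carrier R"
    using ev_closed[OF gAr17 mG17, of a us, OF lins(6)[OF n] assms(2)] ev_closed[OF gAr17 mG17, of hA us, OF lins(2)[OF n] assms(2)] by auto
qed

private lemma fu_ev: "xs \<noteq> [] \<Longrightarrow> over Ar17 xs \<Longrightarrow>
    ev R (susp A) fu xs = ev R Vr17 g xs \<oplus>\<^bsub>B\<^esub> ev R Vr17 a xs \<odot>\<^bsub>B\<^esub> unt B"
  using su_element_ev[OF splitA splitB] ga_closed by blast

private abbreviation (input) "P xs \<equiv> star R Ar17 Br17 Br17 \<mu>B g (length xs) (tensor R Vr17 xs)"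
private abbreviation (input) "P' xs \<equiv> gerst R Ar17 Br17 (-1) g \<mu>A (length xs) (tensor R Vr17 xs)"
private abbreviation (input) "Q17 xs \<equiv> star R Ar17 Br17 (ground R) hB g (length xs) (tensor R Vr17 xs)"
private abbreviation (input) "Q' xs \<equiv> gerst R Ar17 (ground R) (-1) a \<mu>A (length xs) (tensor R Vr17 xs)"
private abbreviation (input) "C1 xs \<equiv> finsum B (\<lambda>(us, vs). ev R Vr17 a vs \<odot>\<^bsub>B\<^esub> koszul B 1 (ev R Vr17 g us)) (cuts xs)"
private abbreviation (input) "C2 xs \<equiv> finsum B (\<lambda>(us, vs). ev R Vr17 a us \<odot>\<^bsub>B\<^esub> ev R Vr17 g vs) (cuts xs)"
private abbreviation (input) "C3 xs \<equiv> finsum (ground R) (\<lambda>(us, vs). ev R Vr17 a us \<otimes>\<^bsub>R\<^esub> ev R Vr17 a vs) (cuts xs)"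
text \<open>\<open>D1\<close> and \<open>D2\<close> are the left sides of the two equations on a
  word, the second one as a scalar in \<open>R\<close> rather than a multiple of the unit.\<close>

private abbreviation (input) "D1 xs \<equiv> P xs \<ominus>\<^bsub>B\<^esub> P' xs \<oplus>\<^bsub>B\<^esub> C1 xs \<oplus>\<^bsub>B\<^esub> C2 xs"
private abbreviation (input) "D2 xs \<equiv> Q17 xs \<ominus>\<^bsub>R\<^esub> Q' xs \<ominus>\<^bsub>R\<^esub> ev R Vr17 hA xs \<oplus>\<^bsub>R\<^esub> C3 xs"

private lemma stars_linear:
  shows "star R Ar17 Br17 Br17 \<mu>B g n \<in> tlin R Vr17 n Br17"
    and "gerst R Ar17 Br17 (-1) g \<mu>A n \<in> tlin R Vr17 n Br17"
    and "star R Ar17 Br17 (ground R) hB g n \<in> tlin R Vr17 n (ground R)"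
    and "gerst R Ar17 (ground R) (-1) a \<mu>A n \<in> tlin R Vr17 n (ground R)"
  by (rule star_linear[OF gAr17 mBr17, of g, OF lins(5) mBr17 lins(3)]
      gerst_linear[OF gAr17 mBr17, of \<mu>A g, OF lins(1,5)]
      star_linear[OF gAr17 mBr17, of g, OF lins(5) mG17 lins(4)]
      gerst_linear[OF gAr17 mG17, of \<mu>A a, OF lins(1,6)]; assumption)+

private lemma parts_closed:
  assumes xs: "xs \<noteq> []" "over Ar17 xs"
  shows "P xs \<in> carrier Br17" "P' xs \<in> carrier Br17" "Q17 xs \<in> carrier R" "Q' xs \<in> carrier R"
    "C1 xs \<in> carrier Br17" "C2 xs \<in> carrier Br17" "C3 xs \<in> carrier R"
    and "C1 xs = finsum Br17 (\<lambda>(us, vs). ev R Vr17 a vs \<odot>\<^bsub>Br17\<^esub> koszul Br17 1 (ev R Vr17 g us)) (cuts xs)"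
    and "C2 xs = finsum Br17 (\<lambda>(us, vs). ev R Vr17 a us \<odot>\<^bsub>Br17\<^esub> ev R Vr17 g vs) (cuts xs)"
proof -
  have t: "tensor R Vr17 xs \<in> carrier (tpow R Vr17 (length xs))"
    by (rule tensor_closed[OF module_susp[OF mAr17]]) (use xs in simp_all)
  show "P xs \<in> carrier Br17" "P' xs \<in> carrier Br17" "Q17 xs \<in> carrier R" "Q' xs \<in> carrier R"
    using lin_closed[OF stars_linear(1) t] lin_closed[OF stars_linear(2) t]
      lin_closed[OF stars_linear(3) t] lin_closed[OF stars_linear(4) t] by auto
  have c: "us \<noteq> []" "vs \<noteq> []" "over Ar17 us" "over Ar17 vs"
    if "(us, vs) \<in> cuts xs" for us vs using cuts_closed[OF that xs(2)] by auto
  have cl: "ev R Vr17 a vs \<odot>\<^bsub>Br17\<^esub> koszul Br17 1 (ev R Vr17 g us) \<in> carrier Br17" "ev R Vr17 a us \<odot>\<^bsub>Br17\<^esub> ev R Vr17 g vs \<in> carrier Br17"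
    "ev R Vr17 a us \<otimes>\<^bsub>R\<^esub> ev R Vr17 a vs \<in> carrier R"
    "koszul Br17 1 (ev R Vr17 g us) = koszul B 1 (ev R Vr17 g us)" if "(us, vs) \<in> cuts xs" for us vs
    using ga_closed[OF c(1,3)[OF that]] ga_closed[OF c(2,4)[OF that]] koszul_closed[OF gBr17, of "ev R Vr17 g us" 1]
      koszul_reduced[OF splitB, of "ev R Vr17 g us" 1] Br17.smult_closed by (blast intro: R.m_closed)+
  have "C1 xs = finsum B (\<lambda>(us, vs). ev R Vr17 a vs \<odot>\<^bsub>Br17\<^esub> koszul Br17 1 (ev R Vr17 g us)) (cuts xs)"
    by (rule B.M.finsum_cong2) (use cl in auto)
  also have "... = finsum Br17 (\<lambda>(us, vs). ev R Vr17 a vs \<odot>\<^bsub>Br17\<^esub> koszul Br17 1 (ev R Vr17 g us)) (cuts xs)"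
    by (rule finsum_reduced[OF splitB, symmetric]) (use cl in auto)
  finally show C1: "C1 xs = finsum Br17 (\<lambda>(us, vs). ev R Vr17 a vs \<odot>\<^bsub>Br17\<^esub> koszul Br17 1 (ev R Vr17 g us)) (cuts xs)" .
  have "C2 xs = finsum B (\<lambda>(us, vs). ev R Vr17 a us \<odot>\<^bsub>Br17\<^esub> ev R Vr17 g vs) (cuts xs)" by simp
  also have "... = finsum Br17 (\<lambda>(us, vs). ev R Vr17 a us \<odot>\<^bsub>Br17\<^esub> ev R Vr17 g vs) (cuts xs)"
    by (rule finsum_reduced[OF splitB, symmetric]) (use cl in auto)
  finally show C2: "C2 xs = finsum Br17 (\<lambda>(us, vs). ev R Vr17 a us \<odot>\<^bsub>Br17\<^esub> ev R Vr17 g vs) (cuts xs)" .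
  show "C1 xs \<in> carrier Br17" "C2 xs \<in> carrier Br17" unfolding C1 C2 by (rule Br17.M.finsum_closed; use cl in auto)+
  interpret G: module R "ground R" by (rule mG17)
  have "C3 xs \<in> carrier (ground R)" by (rule G.M.finsum_closed) (use cl in auto)
  then show "C3 xs \<in> carrier R" by simp
qed

text \<open>\<open>bar_morphism_differential\<close> lives in the record of the reduced module and
  the displayed equation in \<open>B\<close>; sums, differences and signs of the two agree on
  reduced elements.\<close>

private lemma D_reduced:
  assumes xs: "xs \<noteq> []" "over Ar17 xs"
  shows "D1 xs = P xs \<ominus>\<^bsub>Br17\<^esub> P' xs \<oplus>\<^bsub>Br17\<^esub>
      finsum Br17 (\<lambda>(us, vs). ev R Vr17 a vs \<odot>\<^bsub>Br17\<^esub> koszul Br17 1 (ev R Vr17 g us)) (cuts xs) \<oplus>\<^bsub>Br17\<^esub>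
      finsum Br17 (\<lambda>(us, vs). ev R Vr17 a us \<odot>\<^bsub>Br17\<^esub> ev R Vr17 g vs) (cuts xs)"
    and "D1 xs \<in> carrier Br17" "D2 xs \<in> carrier R"
proof -
  note c = parts_closed[OF xs]
  show eq: "D1 xs = P xs \<ominus>\<^bsub>Br17\<^esub> P' xs \<oplus>\<^bsub>Br17\<^esub>
      finsum Br17 (\<lambda>(us, vs). ev R Vr17 a vs \<odot>\<^bsub>Br17\<^esub> koszul Br17 1 (ev R Vr17 g us)) (cuts xs) \<oplus>\<^bsub>Br17\<^esub>
      finsum Br17 (\<lambda>(us, vs). ev R Vr17 a us \<odot>\<^bsub>Br17\<^esub> ev R Vr17 g vs) (cuts xs)"
    unfolding c(8,9)[symmetric] using a_minus_reduced[OF splitB c(2)] by simp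
  show "D1 xs \<in> carrier Br17" unfolding eq c(8,9)[symmetric] using c(1,2,5,6) by (intro Br17.M.a_closed Br17.M.minus_closed)
  show "D2 xs \<in> carrier R" using c(3,4,7) ga_closed(4)[OF xs] by (intro R.a_closed R.minus_closed)
qed

text \<open>The difference of the two sides is \<open>D1 xs\<close> plus \<open>D2 xs\<close> times
  the unit, with \<open>D1 xs\<close> reduced, so the summands vanish separately.\<close>

private lemma morphism_reduced:
  assumes xs: "xs \<noteq> []" "over Ar17 xs"
  shows "star R A B B nB fu (length xs) (tensor R (susp A) xs) =
      gerst R A B (-1) fu nA (length xs) (tensor R (susp A) xs) \<longleftrightarrow> D1 xs = \<zero>\<^bsub>B\<^esub> \<and> D2 xs = \<zero>\<^bsub>R\<^esub>"
proof -
  note c = parts_closed[OF xs] and h = ga_closed(4)[OF xs] and u = unt_closed[OF splitB]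
  have cB: "P xs \<in> carrier B" "P' xs \<in> carrier B" "C1 xs \<in> carrier B" "C2 xs \<in> carrier B" using c by auto
  let ?f = "ev R (susp A) fu" and ?K = "koszul (susp A) (-1)"
  let ?t = "\<lambda>(us, ys, vs). ev R Vr17 hA ys \<odot>\<^bsub>B\<^esub> ?f (map ?K us @ unt A # vs)"
  have f1: "?f [unt A] = unt B" using unital by (simp add: ev_def strictly_unital_element_def)
  \<comment> \<open>A strictly unital element kills the unit among several letters, so only the
    infix that is the whole word contributes, by leaving the unit alone.\<close>
  have "finsum B ?t (infixes xs) = finsum B ?t {([], xs, [])}"
  proof (rule B.M.finsum_subset[OF finite_infixes])
    show "{([], xs, [])} \<subseteq> infixes xs" using xs(1) by (simp add: infixes_def)
    show "?t p \<in> carrier B" if "p \<in> {([], xs, [])}" for p using that f1 h u by simp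
    show "?t p = \<zero>\<^bsub>B\<^esub>" if p: "p \<in> infixes xs - {([], xs, [])}" for p
    proof -
      obtain us ys vs where p': "p = (us, ys, vs)" by (cases p)
      have i: "(us, ys, vs) \<in> infixes xs" using p p' by simp
      note ic = infixes_closed[OF i xs(2)]
      let ?z = "map ?K us @ unt A # vs"
      have "us \<noteq> [] \<or> vs \<noteq> []" using p p' by (auto simp: infixes_def)
      then have "2 \<le> length ?z" by (cases us; cases vs) auto
      moreover have "over A ?z"
        using koszul_closed[OF graded_module_susp[OF gA17]] ic(2,4) unt_closed[OF splitA] by auto
      moreover have "unt A \<in> set ?z" by simp
      ultimately have "?f ?z = \<zero>\<^bsub>B\<^esub>" using unital unfolding ev_def strictly_unital_element_def by blast
      then show ?thesis using ga_closed(4)[OF ic(1,3)] by (simp add: p')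
    qed
  qed
  also have "... = ev R Vr17 hA xs \<odot>\<^bsub>B\<^esub> unt B" using f1 h u by (simp add: B.M.finsum_insert)
  finally have H: "finsum B ?t (infixes xs) = ev R Vr17 hA xs \<odot>\<^bsub>B\<^esub> unt B" .
  let ?s = "star R A B B nB fu (length xs) (tensor R (susp A) xs)"
  let ?g = "gerst R A B (-1) fu nA (length xs) (tensor R (susp A) xs)"
  have s: "?s = P xs \<oplus>\<^bsub>B\<^esub> Q17 xs \<odot>\<^bsub>B\<^esub> unt B \<oplus>\<^bsub>B\<^esub> (C2 xs \<oplus>\<^bsub>B\<^esub> C3 xs \<odot>\<^bsub>B\<^esub> unt B \<oplus>\<^bsub>B\<^esub> C1 xs)"
    by (rule star_reduced[OF splitA splitB lins(3,4) n_lin(2) CC_linear[OF fCC] lins(5,6) fu_ev xs(2)])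
  have g': "?g = P' xs \<oplus>\<^bsub>B\<^esub> Q' xs \<odot>\<^bsub>B\<^esub> unt B \<oplus>\<^bsub>B\<^esub> finsum B ?t (infixes xs)"
    by (rule gerst_reduced[OF splitA splitB lins(1,2) n_lin(1) CC_linear[OF fCC] lins(5,6) fu_ev xs(2)])
  have sg: "?s \<in> carrier B" "?g \<in> carrier B" unfolding s g' H using cB c(3,4,7) h u by auto
  have "?s \<ominus>\<^bsub>B\<^esub> ?g = D1 xs \<oplus>\<^bsub>B\<^esub> D2 xs \<odot>\<^bsub>B\<^esub> unt B"
    unfolding s g' H using cB c(3,4,7) h u
    by (simp add: a_minus_def B.smult_l_distr B.smult_l_minus B.M.minus_add B.M.a_ac)
  then show ?thesis using B.M.minus_eq_zero_iff[OF sg] split_eq_zero[OF splitB D_reduced(2,3)[OF xs]] by simp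
qed

lemma A_infinity_morphism_words:
  "A_infinity_morphism R A nA B nB fu \<longleftrightarrow>
    (\<forall>xs. xs \<noteq> [] \<longrightarrow> over Ar17 xs \<longrightarrow> D1 xs = \<zero>\<^bsub>B\<^esub> \<and> D2 xs = \<zero>\<^bsub>R\<^esub>)" (is "_ \<longleftrightarrow> ?D")
proof
  assume mor: "A_infinity_morphism R A nA B nB fu"
  show ?D
  proof (intro allI impI)
    fix xs assume xs: "xs \<noteq> []" "over Ar17 xs"
    have "tensor R (susp A) xs \<in> carrier (tpow R (susp A) (length xs))"
      by (rule tensor_closed[OF module_susp[OF mA17]]) (use xs in auto)
    then have "star R A B B nB fu (length xs) (tensor R (susp A) xs) =
      gerst R A B (-1) fu nA (length xs) (tensor R (susp A) xs)"
      using mor xs(1) by (simp add: A_infinity_morphism_def Suc_le_eq)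
    then show "D1 xs = \<zero>\<^bsub>B\<^esub> \<and> D2 xs = \<zero>\<^bsub>R\<^esub>" using morphism_reduced[OF xs] by blast
  qed
next
  assume D: ?D
  have fg: "fu n \<in> graded_hom R (tpow R (susp A) n) (susp B) 0" if "1 \<le> n" for n
    using fCC that by (simp add: CC_def)
  have f_unt: "ev R (susp A) fu xs = \<zero>\<^bsub>B\<^esub>" if "2 \<le> length xs" "over A xs" "unt A \<in> set xs" for xs
    using unital that unfolding ev_def strictly_unital_element_def by blast
  have f1: "ev R (susp A) fu [unt A] = unt B" using unital by (simp add: ev_def strictly_unital_element_def)
  have eq: "star R A B B nB fu n X = gerst R A B (-1) fu nA n X"
    if n: "1 \<le> n" and X: "X \<in> carrier (tpow R (susp A) n)" for n X
  proof -
    have sl: "star R A B B nB fu n \<in> tlin R (susp A) n B"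
      by (rule star_linear[OF gA17 mB17, of fu, OF CC_linear[OF fCC] mB17 n_lin(2)])
    have gl: "gerst R A B (-1) fu nA n \<in> tlin R (susp A) n B"
      by (rule gerst_linear[OF gA17 mB17, of nA fu, OF n_lin(1) CC_linear[OF fCC]])
    note tml = tensor_multilinear[OF module_susp[OF mA17], of n]
    have "star R A B B nB fu n (tensor R (susp A) xs) = gerst R A B (-1) fu nA n (tensor R (susp A) xs)"
      if xs: "length xs = n" "over (susp A) xs" for xs
    proof (rule multilinear_ext[OF module_susp[OF mA17] mB17 multilinear_comp[OF tml sl] multilinear_comp[OF tml gl] _ _ _ xs])
      \<comment> \<open>Entries may be taken reduced or equal to the unit; words without the unit
        are handled by \<open>morphism_reduced\<close>, the others by comparing
        \<open>star_unt\<close> with \<open>gerst_unt\<close>.\<close>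
      let ?S = "carrier Ar17 \<union> {unt A}"
      show "?S \<subseteq> carrier (susp A)" using unt_closed[OF splitA] by auto
      show "carrier (susp A) \<subseteq> H" if "submodule H R (susp A)" "?S \<subseteq> H" for H
      proof -
        have "submodule H R A" using submodule_preimage[OF mA17 module_susp[OF mA17], of "\<lambda>x. x" H] lin_id[OF mA17] that
            submodule_closed(1)[OF module_susp[OF mA17] that(1)] by (simp add: Collect_conj_eq Int_absorb1)
        from split_span[OF splitA this that(2)] show ?thesis by simp
      qed
      fix ys assume ys: "length ys = n" "set ys \<subseteq> ?S"
      have ne: "ys \<noteq> []" using ys n by auto
      show "star R A B B nB fu n (tensor R (susp A) ys) = gerst R A B (-1) fu nA n (tensor R (susp A) ys)"
      proof (cases "unt A \<in> set ys")
        case False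
        then have "over Ar17 ys" using ys(2) by blast
        from morphism_reduced[OF ne this] D[rule_format, OF ne this] show ?thesis unfolding ys(1) by blast
      next
        case True
        then obtain ps qs where e: "ys = ps @ unt A # qs" by (meson split_list)
        have "over A ys" using ys(2) unt_closed[OF splitA] by auto
        then have pq: "over A ps" "over A qs" using e by auto
        show ?thesis
          unfolding ys(1)[symmetric] e
          by (rule trans[OF star_unt[OF splitA splitB lins(3,4) n_lin(2) CC_linear[OF fCC] f_unt f1 pq]
                gerst_unt[OF splitA splitB lins(1,2) n_lin(1) CC_linear[OF fCC] fg f_unt pq, symmetric]])
      qed
    qed
    then show ?thesis by (rule tensor_ext[OF module_susp[OF mA17] mB17 sl gl _ X])
  qed
  show "A_infinity_morphism R A nA B nB fu"
    unfolding A_infinity_morphism_def using alg fCC eq by blast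
qed

lemma bar_morphism_words:
  "curved_dg_morphism R (bar R A \<mu>A hA) (bar R B \<mu>B hB) (Psi_inv R Ar17 Br17 g) (neg_desusp R Ar17 a) \<longleftrightarrow>
    (\<forall>xs. xs \<noteq> [] \<longrightarrow> over Ar17 xs \<longrightarrow> D1 xs = \<zero>\<^bsub>B\<^esub> \<and> D2 xs = \<zero>\<^bsub>R\<^esub>)" (is "_ \<longleftrightarrow> ?D")
proof -
  have hom: "\<And>n. 1 \<le> n \<Longrightarrow> \<mu>A n \<in> graded_hom R (tpow R Vr17 n) Vr17 (-1)"
    "\<And>n. 1 \<le> n \<Longrightarrow> hA n \<in> graded_hom R (tpow R Vr17 n) (susp (ground R)) (-1)"
    "\<And>n. 1 \<le> n \<Longrightarrow> \<mu>B n \<in> graded_hom R (tpow R (susp Br17) n) (susp Br17) (-1)"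
    "\<And>n. 1 \<le> n \<Longrightarrow> hB n \<in> graded_hom R (tpow R (susp Br17) n) (susp (ground R)) (-1)"
    "\<And>n. 1 \<le> n \<Longrightarrow> g n \<in> graded_hom R (tpow R Vr17 n) (susp Br17) 0"
    "\<And>n. 1 \<le> n \<Longrightarrow> a n \<in> graded_hom R (tpow R Vr17 n) (susp (ground R)) 0"
    using \<mu>A hA \<mu>B hB g a by (simp_all add: CC_def)
  have "curved_dg_coalgebra R (bar R A \<mu>A hA)"
    unfolding bar_def
    by (rule curved_dg_coalgebra_tco[OF R gAr17 hom(1,2) A_infinity_reduced[OF splitA lins(1,2) alg(1)]])
  moreover have "curved_dg_coalgebra R (bar R B \<mu>B hB)"
    unfolding bar_def
    by (rule curved_dg_coalgebra_tco[OF R gBr17 hom(3,4) A_infinity_reduced[OF splitB lins(3,4) alg(2)]])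
  moreover have "coalgebra_morphism R (Tco R Vr17) (tco_comult R Vr17)
      (Tco R (susp Br17)) (tco_comult R (susp Br17)) (Psi_inv R Ar17 Br17 g)"
    unfolding coalgebra_morphism_iff[OF graded_module_Tco[OF graded_module_susp[OF gAr17]]
        module_Tco[OF module_susp[OF mBr17]] tco_comult_linear[OF module_susp[OF mAr17]]]
    using Psi_inv_graded[OF gAr17 gBr17, of g] Psi_inv_comult[OF gAr17 gBr17, of g] hom(5) by blast
  moreover have "neg_desusp R Ar17 a \<in> graded_hom R (Tco R Vr17) (ground R) (-1)"
    using neg_desusp_graded[OF R gAr17, of a 0] hom(6) by simp
  ultimately have "curved_dg_morphism R (bar R A \<mu>A hA) (bar R B \<mu>B hB) (Psi_inv R Ar17 Br17 g) (neg_desusp R Ar17 a) \<longleftrightarrow>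
    (\<forall>t \<in> carrier (Tco R Vr17). Phi_inv R Br17 (-1) \<mu>B (Psi_inv R Ar17 Br17 g t) =
      Psi_inv R Ar17 Br17 g (Phi_inv R Ar17 (-1) \<mu>A t) \<oplus>\<^bsub>Tco R (susp Br17)\<^esub>
      Psi_inv R Ar17 Br17 g (ad R (Tco R Vr17) (tco_comult R Vr17) (-1) (neg_desusp R Ar17 a) t)) \<and>
    (\<forall>t \<in> carrier (Tco R Vr17). neg_desusp R Br17 hB (Psi_inv R Ar17 Br17 g t) \<ominus>\<^bsub>R\<^esub>
      square R (tco_comult R Vr17) (neg_desusp R Ar17 a) t =
      neg_desusp R Ar17 a (Phi_inv R Ar17 (-1) \<mu>A t) \<oplus>\<^bsub>R\<^esub> neg_desusp R Ar17 hA t)"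
    unfolding curved_dg_morphism_def by (simp add: bar_def)
  also have "... \<longleftrightarrow> ?D"
    by (subst bar_morphism_differential[OF R gAr17 gBr17 hom], assumption+,
        subst bar_morphism_curvature[OF R gAr17 gBr17 hom], assumption+) (use D_reduced(1) in auto)
  finally show ?thesis .
qed

text \<open>Linearity brings both equations to words. A reduced entry has splitting zero and a
  multiple of the unit has reduction zero, so in each of the three sums over p exactly one of the
  two terms of \<open>mu_su\<close> can be nonzero.\<close>

lemma equations_words:
  "(\<forall>n \<ge> 1. \<forall>X \<in> carrier (tpow R Vr17 n).
     star R Ar17 Br17 Br17 \<mu>B g n X \<ominus>\<^bsub>B\<^esub> gerst R Ar17 Br17 (-1) g \<mu>A n X
     \<oplus>\<^bsub>B\<^esub> (\<Oplus>\<^bsub>B\<^esub> p \<in> {1..n - 1}. mu_su R B 2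
         (tensor_maps R Vr17 (susp B) [(0, p, g p), (0, n - p, unital_cochain B a (n - p))] X))
     \<oplus>\<^bsub>B\<^esub> (\<Oplus>\<^bsub>B\<^esub> p \<in> {1..n - 1}. mu_su R B 2
         (tensor_maps R Vr17 (susp B) [(0, p, unital_cochain B a p), (0, n - p, g (n - p))] X)) = \<zero>\<^bsub>B\<^esub> \<and>
     unit_map B (star R Ar17 Br17 (ground R) hB g n X) \<ominus>\<^bsub>B\<^esub> unit_map B (gerst R Ar17 (ground R) (-1) a \<mu>A n X)
     \<ominus>\<^bsub>B\<^esub> unit_map B (hA n X)
     \<oplus>\<^bsub>B\<^esub> (\<Oplus>\<^bsub>B\<^esub> p \<in> {1..n - 1}. mu_su R B 2
         (tensor_maps R Vr17 (susp B) [(0, p, unital_cochain B a p), (0, n - p, unital_cochain B a (n - p))] X)) = \<zero>\<^bsub>B\<^esub>)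
   \<longleftrightarrow> (\<forall>xs. xs \<noteq> [] \<longrightarrow> over Ar17 xs \<longrightarrow> D1 xs = \<zero>\<^bsub>B\<^esub> \<and> D2 xs = \<zero>\<^bsub>R\<^esub>)"
  (is "(\<forall>n \<ge> 1. \<forall>X \<in> _. ?E n X = _ \<and> ?F n X = _) \<longleftrightarrow> ?D")
proof -
  note u = unt_closed[OF splitB]
  have gl: "1 \<le> n \<Longrightarrow> g n \<in> tlin R Vr17 n B" for n
    using lin_comp[OF reduced_incl[OF splitB] lins(5)] by simp
  have al: "1 \<le> n \<Longrightarrow> unital_cochain B a n \<in> tlin R Vr17 n B" for n
    using lin_comp[OF unit_map_linear[OF splitB] lins(6)] by (simp add: unital_cochain_def)
  note gV = graded_module_susp[OF gAr17] and mV = module_susp[OF mAr17]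
  note cup = mu_su_cup[OF splitB gV]
  have tp: "module R (tpow R Vr17 n)" for n by (rule module_tpow[OF mV])
  have E: "?E n \<in> tlin R Vr17 n B" for n
    by (intro lin_add_map[OF tp mB17] lin_minus_map[OF tp mB17] cup(1))
      (use gl al lin_comp[OF reduced_incl[OF splitB] stars_linear(1)] lin_comp[OF reduced_incl[OF splitB] stars_linear(2)] in auto)
  have F: "?F n \<in> tlin R Vr17 n B" if "1 \<le> n" for n
    by (intro lin_add_map[OF tp mB17] lin_minus_map[OF tp mB17] cup(1) lin_comp[OF unit_map_linear[OF splitB]]
        stars_linear lins(2) that al)
  have word: "?E (length xs) (tensor R Vr17 xs) = D1 xs" "?F (length xs) (tensor R Vr17 xs) = \<zero>\<^bsub>B\<^esub> \<oplus>\<^bsub>B\<^esub> D2 xs \<odot>\<^bsub>B\<^esub> unt B"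
    if xs: "xs \<noteq> []" "over Ar17 xs" for xs
  proof -
    have xs': "over Vr17 xs" using xs by simp
    note c = parts_closed[OF xs] and h = ga_closed(4)[OF xs]
    have aev: "ev R Vr17 (unital_cochain B a) us = ev R Vr17 a us \<odot>\<^bsub>B\<^esub> unt B" for us
      by (simp add: ev_def unital_cochain_def unit_map_def)
    have k: "us \<noteq> []" "vs \<noteq> []" "over Ar17 us" "over Ar17 vs"
      if "(us, vs) \<in> cuts xs" for us vs using cuts_closed[OF that xs(2)] by auto
    note v = ga_closed[OF k(1,3)] ga_closed[OF k(2,4)] koszul_closed[OF gB17, of _ 1]
    note red = reduction_reduced[OF splitB] reduction_unit_map[OF splitB]
    have k0: "koszul B 1 \<zero>\<^bsub>B\<^esub> = \<zero>\<^bsub>B\<^esub>" by (rule lin_zero[OF mB17 mB17 koszul_linear[OF gB17]])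
    have "(\<Oplus>\<^bsub>B\<^esub> p \<in> {1..length xs - 1}. mu_su R B 2 (tensor_maps R Vr17 (susp B)
        [(0, p, g p), (0, length xs - p, unital_cochain B a (length xs - p))] (tensor R Vr17 xs))) = C1 xs"
      by (subst cup(2)[of g "unital_cochain B a", OF gl al xs'], assumption+) (unfold aev, rule B.M.finsum_cong2; use v u red in auto)
    moreover have "(\<Oplus>\<^bsub>B\<^esub> p \<in> {1..length xs - 1}. mu_su R B 2 (tensor_maps R Vr17 (susp B)
        [(0, p, unital_cochain B a p), (0, length xs - p, g (length xs - p))] (tensor R Vr17 xs))) = C2 xs"
      by (subst cup(2)[of "unital_cochain B a" g, OF al gl xs'], assumption+) (unfold aev, rule B.M.finsum_cong2; use v u red k0 in auto)
    ultimately show "?E (length xs) (tensor R Vr17 xs) = D1 xs" by simp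
    have "(\<Oplus>\<^bsub>B\<^esub> p \<in> {1..length xs - 1}. mu_su R B 2 (tensor_maps R Vr17 (susp B)
        [(0, p, unital_cochain B a p), (0, length xs - p, unital_cochain B a (length xs - p))] (tensor R Vr17 xs))) =
        finsum B (\<lambda>(us, vs). (ev R Vr17 a us \<otimes>\<^bsub>R\<^esub> ev R Vr17 a vs) \<odot>\<^bsub>B\<^esub> unt B) (cuts xs)"
      by (subst cup(2)[of "unital_cochain B a" "unital_cochain B a", OF al al xs'], assumption+) (unfold aev, rule B.M.finsum_cong2; use v u red k0 in "auto simp: B.smult_assoc1")
    also have "... = C3 xs \<odot>\<^bsub>B\<^esub> unt B"
      using finsum_unit[OF splitB, of "cuts xs" "\<lambda>(us, vs). ev R Vr17 a us \<otimes>\<^bsub>R\<^esub> ev R Vr17 a vs"] v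
      by (auto simp: case_prod_unfold)
    finally show "?F (length xs) (tensor R Vr17 xs) = \<zero>\<^bsub>B\<^esub> \<oplus>\<^bsub>B\<^esub> D2 xs \<odot>\<^bsub>B\<^esub> unt B"
      using c(3,4,7) h u by (simp add: unit_map_def a_minus_def B.smult_l_distr B.smult_l_minus ev_def[symmetric])
  qed
  \<comment> \<open>The zero plays the reduced part in \<open>split_eq_zero\<close>: a multiple of
    the unit vanishes only together with its coefficient.\<close>
  have D: "D2 xs = \<zero>\<^bsub>R\<^esub> \<longleftrightarrow> \<zero>\<^bsub>B\<^esub> \<oplus>\<^bsub>B\<^esub> D2 xs \<odot>\<^bsub>B\<^esub> unt B = \<zero>\<^bsub>B\<^esub>" if "xs \<noteq> []" "over Ar17 xs" for xs
    using split_eq_zero[OF splitB Br17.M.zero_closed D_reduced(3)[OF that]] by simp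
  show ?thesis
  proof
    assume eqs: "\<forall>n \<ge> 1. \<forall>X \<in> carrier (tpow R Vr17 n). ?E n X = \<zero>\<^bsub>B\<^esub> \<and> ?F n X = \<zero>\<^bsub>B\<^esub>"
    show ?D
    proof (intro allI impI)
      fix xs assume xs: "xs \<noteq> []" "over Ar17 xs"
      have "1 \<le> length xs" "tensor R Vr17 xs \<in> carrier (tpow R Vr17 (length xs))"
        using xs by (auto intro!: tensor_closed[OF mV] simp: Suc_le_eq)
      then have "?E (length xs) (tensor R Vr17 xs) = \<zero>\<^bsub>B\<^esub> \<and> ?F (length xs) (tensor R Vr17 xs) = \<zero>\<^bsub>B\<^esub>" using eqs by blast
      then show "D1 xs = \<zero>\<^bsub>B\<^esub> \<and> D2 xs = \<zero>\<^bsub>R\<^esub>" unfolding word[OF xs] D[OF xs] .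
    qed
  next
    assume d: ?D
    show "\<forall>n \<ge> 1. \<forall>X \<in> carrier (tpow R Vr17 n). ?E n X = \<zero>\<^bsub>B\<^esub> \<and> ?F n X = \<zero>\<^bsub>B\<^esub>"
    proof (intro allI impI ballI)
      fix n X assume n: "1 \<le> n" and X: "X \<in> carrier (tpow R Vr17 n)"
      have w: "?E n (tensor R Vr17 xs) = \<zero>\<^bsub>B\<^esub>" "?F n (tensor R Vr17 xs) = \<zero>\<^bsub>B\<^esub>"
        if xs: "length xs = n" "over Vr17 xs" for xs
      proof -
        have x: "xs \<noteq> []" "over Ar17 xs" using xs n by auto
        then have D0: "D1 xs = \<zero>\<^bsub>B\<^esub>" "D2 xs = \<zero>\<^bsub>R\<^esub>" using d by blast+
        show "?E n (tensor R Vr17 xs) = \<zero>\<^bsub>B\<^esub>" "?F n (tensor R Vr17 xs) = \<zero>\<^bsub>B\<^esub>"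
          unfolding xs(1)[symmetric]
          by (rule trans[OF word(1)[OF x] D0(1)] trans[OF word(2)[OF x] iffD1[OF D[OF x] D0(2)]])+
      qed
      note z = lin_zero_map[OF tp mB17]
      have "?E n X = \<zero>\<^bsub>B\<^esub>" by (rule tensor_ext[OF mV mB17 E z w(1) X])
      moreover have "?F n X = \<zero>\<^bsub>B\<^esub>" by (rule tensor_ext[OF mV mB17 F[OF n] z w(2) X])
      ultimately show "?E n X = \<zero>\<^bsub>B\<^esub> \<and> ?F n X = \<zero>\<^bsub>B\<^esub>" by blast
    qed
  qed
qed

end

theorem corollary4p16:
  fixes R :: "'k ring"
    and A :: "('k, 'a) split_gmodule" and B :: "('k, 'b) split_gmodule"
    and \<mu>\<^sub>A :: "('k, 'a, 'a) cochain" and h\<^sub>A :: "('k, 'a, 'k) cochain"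
    and \<mu>\<^sub>B :: "('k, 'b, 'b) cochain" and h\<^sub>B :: "('k, 'b, 'k) cochain"
    and g :: "('k, 'a, 'b) cochain" and a :: "('k, 'a, 'k) cochain"
  assumes "cring R"
    and "\<mu>\<^sub>A \<in> CC R (reduced R A) (reduced R A) (-1)"
    and "h\<^sub>A \<in> CC R (reduced R A) (ground R) (-1)"
    and "A_infinity_split_unit R A (su_structure R A \<mu>\<^sub>A h\<^sub>A)"
    and "\<mu>\<^sub>B \<in> CC R (reduced R B) (reduced R B) (-1)"
    and "h\<^sub>B \<in> CC R (reduced R B) (ground R) (-1)"
    and "A_infinity_split_unit R B (su_structure R B \<mu>\<^sub>B h\<^sub>B)"
    and "g \<in> CC R (reduced R A) (reduced R B) 0"
    and "a \<in> CC R (reduced R A) (ground R) 0"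
    and "strictly_unital_element R A B (su_element R A B g a)"
  shows "(A_infinity_morphism R A (su_structure R A \<mu>\<^sub>A h\<^sub>A) B (su_structure R B \<mu>\<^sub>B h\<^sub>B)
            (su_element R A B g a)
          \<longleftrightarrow>
          curved_dg_morphism R (bar R A \<mu>\<^sub>A h\<^sub>A) (bar R B \<mu>\<^sub>B h\<^sub>B)
            (Psi_inv R (reduced R A) (reduced R B) g) (neg_desusp R (reduced R A) a))
       \<and> (curved_dg_morphism R (bar R A \<mu>\<^sub>A h\<^sub>A) (bar R B \<mu>\<^sub>B h\<^sub>B)
            (Psi_inv R (reduced R A) (reduced R B) g) (neg_desusp R (reduced R A) a)
          \<longleftrightarrow>
          (\<forall>n \<ge> 1. \<forall>X \<in> carrier (tensor_power R (susp (reduced R A)) n).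
             star R (reduced R A) (reduced R B) (reduced R B) \<mu>\<^sub>B g n X
             \<ominus>\<^bsub>B\<^esub> gerstenhaber R (reduced R A) (reduced R B) (-1) g \<mu>\<^sub>A n X
             \<oplus>\<^bsub>B\<^esub> (\<Oplus>\<^bsub>B\<^esub> p \<in> {1..n - 1}. mu_su R B 2
                 (tensor_maps R (susp (reduced R A)) (susp B)
                    [(0, p, g p), (0, n - p, unital_cochain B a (n - p))] X))
             \<oplus>\<^bsub>B\<^esub> (\<Oplus>\<^bsub>B\<^esub> p \<in> {1..n - 1}. mu_su R B 2
                 (tensor_maps R (susp (reduced R A)) (susp B)
                    [(0, p, unital_cochain B a p), (0, n - p, g (n - p))] X))
             = \<zero>\<^bsub>B\<^esub>
             \<and>
             unit_map B (star R (reduced R A) (reduced R B) (ground R) h\<^sub>B g n X)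
             \<ominus>\<^bsub>B\<^esub> unit_map B (gerstenhaber R (reduced R A) (ground R) (-1) a \<mu>\<^sub>A n X)
             \<ominus>\<^bsub>B\<^esub> unit_map B (h\<^sub>A n X)
             \<oplus>\<^bsub>B\<^esub> (\<Oplus>\<^bsub>B\<^esub> p \<in> {1..n - 1}. mu_su R B 2
                 (tensor_maps R (susp (reduced R A)) (susp B)
                    [(0, p, unital_cochain B a p), (0, n - p, unital_cochain B a (n - p))] X))
             = \<zero>\<^bsub>B\<^esub>))"
  using A_infinity_morphism_words[OF assms] bar_morphism_words[OF assms] equations_words[OF assms] by blast

end
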